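(* Let $\lambda_1:L_1\to Q_1$ and $\lambda_2:L_2\to Q_2$ be two line bundles with line product $L_1\overline{\times}L_2\to Q_1\underline{\times}Q_2$. Then there is a canonical diffeomorphic factor $$W:L_{J^1(L_1\overline{\times}L_2)}\to L_{J^1L_1}\overline{\times}L_{J^1L_2}$$ covering a diffeomorphism $w:J^1(L_1\overline{\times}L_2)\to J^1L_1\underline{\times}J^1L_2$. Furthermore, $W$ is an isomorphism of Jacobi manifolds, where the source carries the canonical Jacobi structure of the jet bundle $J^1(L_1\overline{\times}L_2)$ and the target carries the product Jacobi structure of the canonical Jacobi structures on $L_{J^1L_1}$ and $L_{J^1L_2}$.
   Context: A line bundle is a real vector bundle of rank 1. A factor $B:L_1\to L_2$ between line bundles over $M_1,M_2$ is a vector bundle morphism, covering a smooth map $\varphi:M_1\to M_2$, that is a linear isomorphism on each fibre; it is a diffeomorphic factor if $\varphi$ is a diffeomorphism. Sections pull back by $(B^*s)(x)=B_x^{-1}(s(\varphi(x)))$. Line product: for line bundles $L_i\to M_i$, the base product $M_1\underline{\times}M_2$ is the manifold of all linear isomorphisms $B_{x_1x_2}:(L_1)_{x_1}\to(L_2)_{x_2}$, $(x_1,x_2)\in M_1\times M_2$, with projections $p_i$ to $M_i$; the line product is $L_1\overline{\times}L_2:=p_1^*L_1\to M_1\underline{\times}M_2$, with projection factors $P_1(B_{x_1x_2},l)=l$ and $P_2(B_{x_1x_2},l)=B_{x_1x_2}(l)$ covering $p_1,p_2$. Der and jet bundles: for $L\to Q$, $D_xL$ is the space of $\mathbb{R}$-linear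 maps $a_x:\Gamma(L)\to L_x$ with $a_x(fs)=f(x)a_x(s)+\delta(a_x)[f]s(x)$ for some $\delta(a_x)\in T_xQ$; sections of $DL$ are derivations of $\Gamma(L)$ with the commutator bracket. $\pi:J^1L=(DL)^*\otimes L\to Q$ is the first jet bundle, and $L_{J^1L}:=\pi^*L\to J^1L$. A Jacobi structure on a line bundle is a Lie bracket on its sections that is a first-order differential operator in each argument; a Jacobi map is a factor whose pull-back on sections is a Lie algebra morphism. The canonical Jacobi structure on $L_{J^1L}$ (induced by the canonical contact structure on $J^1L$) is the unique one with $\{l_a,l_b\}=l_{[a,b]}$, $\{l_a,\pi^*s\}=\pi^*(a[s])$, $\{\pi^*s,\pi^*r\}=0$ for $a,b\in\Gamma(DL)$, $s,r\in\Gamma(L)$, where $l_a(\alpha_q)=\alpha_q(a(q))$. The product Jacobi structure on $L_1\overline{\times}L_2$ of Jacobi structures $\{\cdot,\cdot\}_i$ on $L_i$ is the unique Jacobi structure with $\{P_i^*s_i,P_i^*s_i'\}=P_i^*\{s_i,s_i'\}_i$ ($i=1,2$) and $\{P_1^*s_1,P_2^*s_2\}=0$ for all $s_i,s_i'\in\Gamma(L_i)$. *)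

theory Defs
  imports "HOL-Analysis.Analysis"
begin

text \<open>
  Conventions.  Manifolds are carrier sets with an explicit atlas; the model space is a
  finite-dimensional inner product space, so that dimension 0 is included and model spaces are
  closed under products.  The atlas need not be maximal: all notions below are independent of
  enlarging it by compatible charts.  A chart is a pair of its domain and its coordinate map.

  A function that is only meaningful on a set (sections, functionals on sections, linear maps
  between fibres, ...) is represented by the total function that vanishes outside that set, so
  that equality of such objects is equality of HOL functions.
\<close>

definition zero_off :: "'a set \<Rightarrow> ('a \<Rightarrow> 'b::zero) \<Rightarrow> bool" where
  "zero_off A f \<longleftrightarrow> (\<forall>x. x \<notin> A \<longrightarrow> f x = 0)"


section \<open>Smooth manifolds\<close>

primrec differentiable_upto ::
    "nat \<Rightarrow> 'a::real_normed_vector set \<Rightarrow> ('a \<Rightarrow> 'b::real_normed_vector) \<Rightarrow> bool" where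
  "differentiable_upto 0 S f \<longleftrightarrow> continuous_on S f"
| "differentiable_upto (Suc n) S f \<longleftrightarrow>
     (\<forall>x\<in>S. f differentiable (at x)) \<and>
     (\<forall>v. differentiable_upto n S (\<lambda>x. frechet_derivative f (at x) v))"

text \<open>Only used for open sets in finite-dimensional spaces, where it is the usual smoothness.\<close>

definition smooth_on :: "'a::real_normed_vector set \<Rightarrow> ('a \<Rightarrow> 'b::real_normed_vector) \<Rightarrow> bool" where
  "smooth_on S f \<longleftrightarrow> (\<forall>n. differentiable_upto n S f)"

record ('a, 'e) mfd =
  pts :: "'a set"
  atlas :: "('a set \<times> ('a \<Rightarrow> 'e)) set"

definition mfd_topology :: "('a, 'e::real_normed_vector) mfd \<Rightarrow> 'a topology" where
  "mfd_topology M =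
     topology (\<lambda>S. S \<subseteq> pts M \<and> (\<forall>(U, \<phi>)\<in>atlas M. open (\<phi> ` (S \<inter> U))))"

definition smooth_manifold :: "('a, 'e::real_inner) mfd \<Rightarrow> bool" where
  "smooth_manifold M \<longleftrightarrow>
     (\<exists>B::'e set. finite B \<and> span B = UNIV) \<and>
     (\<Union>(U, \<phi>)\<in>atlas M. U) = pts M \<and>
     (\<forall>(U, \<phi>)\<in>atlas M. inj_on \<phi> U \<and> open (\<phi> ` U)) \<and>
     (\<forall>(U, \<phi>)\<in>atlas M. \<forall>(V, \<psi>)\<in>atlas M.
        open (\<phi> ` (U \<inter> V)) \<and> smooth_on (\<phi> ` (U \<inter> V)) (\<psi> \<circ> the_inv_into U \<phi>)) \<and>
     Hausdorff_space (mfd_topology M) \<and>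
     second_countable (mfd_topology M)"

text \<open>The openness condition, for all charts of \<open>N\<close>, is continuity of \<open>f\<close>.\<close>

definition smooth_map ::
    "('a, 'e::real_inner) mfd \<Rightarrow> ('b, 'f::real_inner) mfd \<Rightarrow> ('a \<Rightarrow> 'b) \<Rightarrow> bool" where
  "smooth_map M N f \<longleftrightarrow>
     f ` pts M \<subseteq> pts N \<and>
     (\<forall>(U, \<phi>)\<in>atlas M. \<forall>(V, \<psi>)\<in>atlas N.
        open (\<phi> ` (U \<inter> f -` V)) \<and>
        smooth_on (\<phi> ` (U \<inter> f -` V)) (\<psi> \<circ> f \<circ> the_inv_into U \<phi>))"

definition diffeomorphism ::
    "('a, 'e::real_inner) mfd \<Rightarrow> ('b, 'f::real_inner) mfd \<Rightarrow> ('a \<Rightarrow> 'b) \<Rightarrow> bool" where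
  "diffeomorphism M N f \<longleftrightarrow>
     smooth_map M N f \<and>
     (\<exists>g. smooth_map N M g \<and> (\<forall>x\<in>pts M. g (f x) = x) \<and> (\<forall>y\<in>pts N. f (g y) = y))"

text \<open>Smoothness of a real function on an open subset \<open>A\<close> of \<open>M\<close>.\<close>

definition smooth_fun_on :: "('a, 'e::real_inner) mfd \<Rightarrow> 'a set \<Rightarrow> ('a \<Rightarrow> real) \<Rightarrow> bool" where
  "smooth_fun_on M A f \<longleftrightarrow>
     (\<forall>(U, \<phi>)\<in>atlas M. smooth_on (\<phi> ` (A \<inter> U)) (f \<circ> the_inv_into U \<phi>))"

definition smooth_funs :: "('a, 'e::real_inner) mfd \<Rightarrow> ('a \<Rightarrow> real) set" where
  "smooth_funs M = {f. zero_off (pts M) f \<and> smooth_fun_on M (pts M) f}"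

text \<open>Tangent vectors at \<open>x\<close> are the point derivations of the algebra of smooth functions.\<close>

definition tangent_space :: "('a, 'e::real_inner) mfd \<Rightarrow> 'a \<Rightarrow> (('a \<Rightarrow> real) \<Rightarrow> real) set" where
  "tangent_space M x =
     {X. zero_off (smooth_funs M) X \<and>
         (\<forall>f\<in>smooth_funs M. \<forall>g\<in>smooth_funs M. X (\<lambda>y. f y + g y) = X f + X g) \<and>
         (\<forall>c. \<forall>f\<in>smooth_funs M. X (\<lambda>y. c * f y) = c * X f) \<and>
         (\<forall>f\<in>smooth_funs M. \<forall>g\<in>smooth_funs M. X (\<lambda>y. f y * g y) = f x * X g + X f * g x)}"


section \<open>Line bundles, sections and factors\<close>

definition linear_iso_betw ::
    "'v::real_vector set \<Rightarrow> 'w::real_vector set \<Rightarrow> ('v \<Rightarrow> 'w) \<Rightarrow> bool" where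
  "linear_iso_betw V W f \<longleftrightarrow>
     bij_betw f V W \<and>
     (\<forall>u\<in>V. \<forall>v\<in>V. f (u + v) = f u + f v) \<and>
     (\<forall>c. \<forall>v\<in>V. f (c *\<^sub>R v) = c *\<^sub>R f v)"

text \<open>
  The fibre over \<open>x\<close> is a linear subspace \<open>fib L x\<close> of some real vector space, without any
  relation between the fibres over different points; points of the total space are pairs
  \<open>(x, v)\<close> with \<open>v\<close> in the fibre over \<open>x\<close>.  A local trivialisation \<open>(U, h)\<close> consists of
  an open set \<open>U\<close> and linear isomorphisms \<open>h x\<close> from the fibres over \<open>U\<close> to the reals; the
  trivialisations carry the smooth structure.
\<close>

record ('q, 'v, 'e) line_bundle =
  base :: "('q, 'e) mfd"
  fib :: "'q \<Rightarrow> 'v set"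
  trivs :: "('q set \<times> ('q \<Rightarrow> 'v \<Rightarrow> real)) set"

definition line_bundle :: "('q, 'v::real_vector, 'e::real_inner) line_bundle \<Rightarrow> bool" where
  "line_bundle L \<longleftrightarrow>
     smooth_manifold (base L) \<and>
     (\<forall>x\<in>pts (base L). subspace (fib L x) \<and> dim (fib L x) = 1) \<and>
     (\<Union>(U, h)\<in>trivs L. U) = pts (base L) \<and>
     (\<forall>(U, h)\<in>trivs L.
        openin (mfd_topology (base L)) U \<and> (\<forall>x\<in>U. linear_iso_betw (fib L x) UNIV (h x))) \<and>
     (\<forall>(U, h)\<in>trivs L. \<forall>(V, k)\<in>trivs L. \<exists>g.
        smooth_fun_on (base L) (U \<inter> V) g \<and>
        (\<forall>x\<in>U \<inter> V. \<forall>v\<in>fib L x. k x v = g x * h x v))"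

definition total_space ::
    "('q, 'v::real_vector, 'e::real_inner) line_bundle \<Rightarrow> ('q \<times> 'v, 'e \<times> real) mfd" where
  "total_space L =
     \<lparr> pts = Sigma (pts (base L)) (fib L),
       atlas = {(Sigma (A \<inter> U) (fib L), \<lambda>(x, v). (\<phi> x, h x v)) | A \<phi> U h.
                  (A, \<phi>) \<in> atlas (base L) \<and> (U, h) \<in> trivs L} \<rparr>"

definition sections :: "('q, 'v::real_vector, 'e::real_inner) line_bundle \<Rightarrow> ('q \<Rightarrow> 'v) set" where
  "sections L =
     {s. zero_off (pts (base L)) s \<and> smooth_map (base L) (total_space L) (\<lambda>x. (x, s x))}"

definition fibre_map :: "('p \<times> 'v \<Rightarrow> 'q \<times> 'w) \<Rightarrow> 'p \<Rightarrow> 'v \<Rightarrow> 'w" where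
  "fibre_map B x v = snd (B (x, v))"

text \<open>\<open>factor L L' \<phi> B\<close>: the map \<open>B\<close> of total spaces is a factor covering \<open>\<phi>\<close>.\<close>

definition factor ::
    "('p, 'v::real_vector, 'e::real_inner) line_bundle \<Rightarrow>
     ('q, 'w::real_vector, 'f::real_inner) line_bundle \<Rightarrow>
     ('p \<Rightarrow> 'q) \<Rightarrow> ('p \<times> 'v \<Rightarrow> 'q \<times> 'w) \<Rightarrow> bool" where
  "factor L L' \<phi> B \<longleftrightarrow>
     line_bundle L \<and> line_bundle L' \<and>
     smooth_map (base L) (base L') \<phi> \<and>
     smooth_map (total_space L) (total_space L') B \<and>
     (\<forall>x\<in>pts (base L). \<forall>v\<in>fib L x. fst (B (x, v)) = \<phi> x) \<and>
     (\<forall>x\<in>pts (base L). linear_iso_betw (fib L x) (fib L' (\<phi> x)) (fibre_map B x))"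

definition diffeomorphic_factor ::
    "('p, 'v::real_vector, 'e::real_inner) line_bundle \<Rightarrow>
     ('q, 'w::real_vector, 'f::real_inner) line_bundle \<Rightarrow>
     ('p \<Rightarrow> 'q) \<Rightarrow> ('p \<times> 'v \<Rightarrow> 'q \<times> 'w) \<Rightarrow> bool" where
  "diffeomorphic_factor L L' \<phi> B \<longleftrightarrow>
     factor L L' \<phi> B \<and> diffeomorphism (base L) (base L') \<phi>"

definition pull_section ::
    "('p, 'v::real_vector, 'e::real_inner) line_bundle \<Rightarrow> ('p \<Rightarrow> 'q) \<Rightarrow>
     ('p \<times> 'v \<Rightarrow> 'q \<times> 'w) \<Rightarrow> ('q \<Rightarrow> 'w) \<Rightarrow> 'p \<Rightarrow> 'v" where
  "pull_section L \<phi> B s =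
     (\<lambda>x. if x \<in> pts (base L) then the_inv_into (fib L x) (fibre_map B x) (s (\<phi> x)) else 0)"

text \<open>The pull-back bundle \<open>p\<^sup>*L\<close> over \<open>N\<close>, with its canonical factor to \<open>L\<close> covering \<open>p\<close>.\<close>

definition pullback_bundle ::
    "('n, 'f) mfd \<Rightarrow> ('n \<Rightarrow> 'q) \<Rightarrow> ('q, 'v, 'e) line_bundle \<Rightarrow> ('n, 'v, 'f) line_bundle" where
  "pullback_bundle N p L =
     \<lparr> base = N,
       fib = (\<lambda>y. fib L (p y)),
       trivs = (\<lambda>(U, h). ({y \<in> pts N. p y \<in> U}, \<lambda>y. h (p y))) ` trivs L \<rparr>"

definition pullback_factor :: "('n \<Rightarrow> 'q) \<Rightarrow> 'n \<times> 'v \<Rightarrow> 'q \<times> 'v" where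
  "pullback_factor p = (\<lambda>(y, v). (p y, v))"


section \<open>The line product\<close>

text \<open>
  A point \<open>(x\<^sub>1, x\<^sub>2, b)\<close> of the base product is a linear isomorphism \<open>b\<close> from the fibre over
  \<open>x\<^sub>1\<close> to the fibre over \<open>x\<^sub>2\<close>.  Its last coordinate in a chart is the \<open>1 \<times> 1\<close> matrix of
  \<open>b\<close> with respect to the frames \<open>(h\<^sub>i x\<^sub>i)\<^sup>-\<^sup>1(1)\<close> given by the trivialisations.
\<close>

definition base_product ::
    "('p, 'v::real_vector, 'e::real_inner) line_bundle \<Rightarrow>
     ('q, 'w::real_vector, 'f::real_inner) line_bundle \<Rightarrow>
     ('p \<times> 'q \<times> ('v \<Rightarrow> 'w), 'e \<times> 'f \<times> real) mfd" where
  "base_product L1 L2 =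
     \<lparr> pts = {(x1, x2, b). x1 \<in> pts (base L1) \<and> x2 \<in> pts (base L2) \<and>
                zero_off (fib L1 x1) b \<and> linear_iso_betw (fib L1 x1) (fib L2 x2) b},
       atlas = {({(x1, x2, b). x1 \<in> A1 \<inter> U1 \<and> x2 \<in> A2 \<inter> U2 \<and>
                   zero_off (fib L1 x1) b \<and> linear_iso_betw (fib L1 x1) (fib L2 x2) b},
                 \<lambda>(x1, x2, b). (\<phi>1 x1, \<phi>2 x2,
                   h2 x2 (b (the_inv_into (fib L1 x1) (h1 x1) 1)))) | A1 \<phi>1 U1 h1 A2 \<phi>2 U2 h2.
                  (A1, \<phi>1) \<in> atlas (base L1) \<and> (U1, h1) \<in> trivs L1 \<and>
                  (A2, \<phi>2) \<in> atlas (base L2) \<and> (U2, h2) \<in> trivs L2} \<rparr>"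

definition bp_proj1 :: "'p \<times> 'q \<times> ('v \<Rightarrow> 'w) \<Rightarrow> 'p" where
  "bp_proj1 = (\<lambda>(x1, x2, b). x1)"

definition bp_proj2 :: "'p \<times> 'q \<times> ('v \<Rightarrow> 'w) \<Rightarrow> 'q" where
  "bp_proj2 = (\<lambda>(x1, x2, b). x2)"

definition line_product ::
    "('p, 'v::real_vector, 'e::real_inner) line_bundle \<Rightarrow>
     ('q, 'w::real_vector, 'f::real_inner) line_bundle \<Rightarrow>
     ('p \<times> 'q \<times> ('v \<Rightarrow> 'w), 'v, 'e \<times> 'f \<times> real) line_bundle" where
  "line_product L1 L2 = pullback_bundle (base_product L1 L2) bp_proj1 L1"

definition proj_factor1 :: "('p \<times> 'q \<times> ('v \<Rightarrow> 'w)) \<times> 'v \<Rightarrow> 'p \<times> 'v" where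
  "proj_factor1 = (\<lambda>((x1, x2, b), l). (x1, l))"

definition proj_factor2 :: "('p \<times> 'q \<times> ('v \<Rightarrow> 'w)) \<times> 'v \<Rightarrow> 'q \<times> 'w" where
  "proj_factor2 = (\<lambda>((x1, x2, b), l). (x2, b l))"


section \<open>The der bundle and the first jet bundle\<close>

definition der_fibre ::
    "('q, 'v::real_vector, 'e::real_inner) line_bundle \<Rightarrow> 'q \<Rightarrow> (('q \<Rightarrow> 'v) \<Rightarrow> 'v) set" where
  "der_fibre L x =
     {a. zero_off (sections L) a \<and>
         (\<forall>s\<in>sections L. a s \<in> fib L x) \<and>
         (\<forall>s\<in>sections L. \<forall>r\<in>sections L. a (\<lambda>y. s y + r y) = a s + a r) \<and>
         (\<forall>c. \<forall>s\<in>sections L. a (\<lambda>y. c *\<^sub>R s y) = c *\<^sub>R a s) \<and>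
         (\<exists>\<delta>\<in>tangent_space (base L) x. \<forall>f\<in>smooth_funs (base L). \<forall>s\<in>sections L.
            a (\<lambda>y. f y *\<^sub>R s y) = f x *\<^sub>R a s + \<delta> f *\<^sub>R s x)}"

text \<open>
  Smooth sections of the der bundle, as derivations of the module of sections; the value at
  \<open>x\<close> of the section \<open>a\<close> is \<open>der_at a x\<close>.
\<close>

definition der_at :: "(('q \<Rightarrow> 'v) \<Rightarrow> ('q \<Rightarrow> 'v)) \<Rightarrow> 'q \<Rightarrow> ('q \<Rightarrow> 'v) \<Rightarrow> 'v" where
  "der_at a x = (\<lambda>s. a s x)"

definition derivations ::
    "('q, 'v::real_vector, 'e::real_inner) line_bundle \<Rightarrow> (('q \<Rightarrow> 'v) \<Rightarrow> ('q \<Rightarrow> 'v)) set" where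
  "derivations L =
     {a. (\<forall>s\<in>sections L. a s \<in> sections L) \<and>
         (\<forall>s. s \<notin> sections L \<longrightarrow> a s = (\<lambda>x. 0)) \<and>
         (\<forall>x\<in>pts (base L). der_at a x \<in> der_fibre L x)}"

definition commutator ::
    "(('q \<Rightarrow> 'v::real_vector) \<Rightarrow> ('q \<Rightarrow> 'v)) \<Rightarrow> (('q \<Rightarrow> 'v) \<Rightarrow> ('q \<Rightarrow> 'v)) \<Rightarrow>
     ('q \<Rightarrow> 'v) \<Rightarrow> ('q \<Rightarrow> 'v)" where
  "commutator a b = (\<lambda>s x. a (b s) x - b (a s) x)"

text \<open>The fibre of \<open>(DL)\<^sup>* \<otimes> L\<close> over \<open>x\<close>: linear maps from \<open>D\<^sub>xL\<close> to \<open>L\<^sub>x\<close>.\<close>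

definition jet_fibre ::
    "('q, 'v::real_vector, 'e::real_inner) line_bundle \<Rightarrow> 'q \<Rightarrow>
     ((('q \<Rightarrow> 'v) \<Rightarrow> 'v) \<Rightarrow> 'v) set" where
  "jet_fibre L x =
     {\<alpha>. zero_off (der_fibre L x) \<alpha> \<and>
         (\<forall>a\<in>der_fibre L x. \<alpha> a \<in> fib L x) \<and>
         (\<forall>a\<in>der_fibre L x. \<forall>b\<in>der_fibre L x. \<alpha> (\<lambda>s. a s + b s) = \<alpha> a + \<alpha> b) \<and>
         (\<forall>c. \<forall>a\<in>der_fibre L x. \<alpha> (\<lambda>s. c *\<^sub>R a s) = c *\<^sub>R \<alpha> a)}"

text \<open>
  A chart \<open>(A, \<phi>)\<close> and a trivialisation \<open>h\<close> give the linear isomorphism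
  \<open>(e, c) \<mapsto> (s \<mapsto> (h x)\<^sup>-\<^sup>1 (\<partial>\<^sub>e s\<^sub>h + c s\<^sub>h))\<close> from \<open>'e \<times> real\<close> to \<open>D\<^sub>xL\<close>, where \<open>s\<^sub>h\<close> is
  the coordinate representation of \<open>s\<close>: a local frame of the der bundle.
\<close>

definition der_frame ::
    "('q, 'v::real_vector, 'e::real_inner) line_bundle \<Rightarrow> 'q set \<Rightarrow> ('q \<Rightarrow> 'e) \<Rightarrow>
     ('q \<Rightarrow> 'v \<Rightarrow> real) \<Rightarrow> 'q \<Rightarrow> 'e \<times> real \<Rightarrow> ('q \<Rightarrow> 'v) \<Rightarrow> 'v" where
  "der_frame L A \<phi> h x = (\<lambda>(e, c) s.
     if s \<in> sections L
     then the_inv_into (fib L x) (h x)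
            (frechet_derivative ((\<lambda>y. h y (s y)) \<circ> the_inv_into A \<phi>) (at (\<phi> x)) e + c * h x (s x))
     else 0)"

text \<open>
  The smooth structure of the jet bundle is the one dual to these frames.  The covector
  \<open>e \<mapsto> h x (\<alpha> (der_frame L A \<phi> h x (e, 0)))\<close> on the model space is recorded by the vector
  representing it with respect to the inner product.
\<close>

definition jet_chart ::
    "('q, 'v::real_vector, 'e::real_inner) line_bundle \<Rightarrow> 'q set \<Rightarrow> ('q \<Rightarrow> 'e) \<Rightarrow>
     ('q \<Rightarrow> 'v \<Rightarrow> real) \<Rightarrow> 'q \<times> ((('q \<Rightarrow> 'v) \<Rightarrow> 'v) \<Rightarrow> 'v) \<Rightarrow> 'e \<times> 'e \<times> real" where
  "jet_chart L A \<phi> h = (\<lambda>(x, \<alpha>).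
     (\<phi> x,
      (THE g. \<forall>e. inner g e = h x (\<alpha> (der_frame L A \<phi> h x (e, 0)))),
      h x (\<alpha> (der_frame L A \<phi> h x (0, 1)))))"

definition jet_bundle ::
    "('q, 'v::real_vector, 'e::real_inner) line_bundle \<Rightarrow>
     ('q \<times> ((('q \<Rightarrow> 'v) \<Rightarrow> 'v) \<Rightarrow> 'v), 'e \<times> 'e \<times> real) mfd" where
  "jet_bundle L =
     \<lparr> pts = Sigma (pts (base L)) (jet_fibre L),
       atlas = {(Sigma (A \<inter> U) (jet_fibre L), jet_chart L A \<phi> h) | A \<phi> U h.
                  (A, \<phi>) \<in> atlas (base L) \<and> (U, h) \<in> trivs L} \<rparr>"

definition jet_line_bundle ::
    "('q, 'v::real_vector, 'e::real_inner) line_bundle \<Rightarrow>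
     ('q \<times> ((('q \<Rightarrow> 'v) \<Rightarrow> 'v) \<Rightarrow> 'v), 'v, 'e \<times> 'e \<times> real) line_bundle" where
  "jet_line_bundle L = pullback_bundle (jet_bundle L) fst L"

text \<open>The sections \<open>\<pi>\<^sup>*s\<close> and \<open>l\<^sub>a\<close> of the line bundle over the jet bundle.\<close>

definition basic_section ::
    "('q, 'v::real_vector, 'e::real_inner) line_bundle \<Rightarrow> ('q \<Rightarrow> 'v) \<Rightarrow>
     'q \<times> ((('q \<Rightarrow> 'v) \<Rightarrow> 'v) \<Rightarrow> 'v) \<Rightarrow> 'v" where
  "basic_section L s = pull_section (jet_line_bundle L) fst (pullback_factor fst) s"

definition linear_section ::
    "('q, 'v::real_vector, 'e::real_inner) line_bundle \<Rightarrow> (('q \<Rightarrow> 'v) \<Rightarrow> ('q \<Rightarrow> 'v)) \<Rightarrow>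
     'q \<times> ((('q \<Rightarrow> 'v) \<Rightarrow> 'v) \<Rightarrow> 'v) \<Rightarrow> 'v" where
  "linear_section L a = (\<lambda>(x, \<alpha>). if (x, \<alpha>) \<in> pts (jet_bundle L) then \<alpha> (der_at a x) else 0)"


section \<open>Jacobi structures\<close>

text \<open>
  Order at most one in the usual algebraic sense: \<open>[[\<Delta>, f], g] = 0\<close> for all smooth functions.
\<close>

definition first_order_operator ::
    "('q, 'v::real_vector, 'e::real_inner) line_bundle \<Rightarrow> (('q \<Rightarrow> 'v) \<Rightarrow> ('q \<Rightarrow> 'v)) \<Rightarrow> bool" where
  "first_order_operator L \<Delta> \<longleftrightarrow>
     (\<forall>s\<in>sections L. \<Delta> s \<in> sections L) \<and>
     (\<forall>s\<in>sections L. \<forall>r\<in>sections L. \<Delta> (\<lambda>y. s y + r y) = (\<lambda>y. \<Delta> s y + \<Delta> r y)) \<and>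
     (\<forall>c. \<forall>s\<in>sections L. \<Delta> (\<lambda>y. c *\<^sub>R s y) = (\<lambda>y. c *\<^sub>R \<Delta> s y)) \<and>
     (\<forall>f\<in>smooth_funs (base L). \<forall>g\<in>smooth_funs (base L). \<forall>s\<in>sections L. \<forall>x.
        \<Delta> (\<lambda>y. (f y * g y) *\<^sub>R s y) x - f x *\<^sub>R \<Delta> (\<lambda>y. g y *\<^sub>R s y) x
          - g x *\<^sub>R \<Delta> (\<lambda>y. f y *\<^sub>R s y) x + (f x * g x) *\<^sub>R \<Delta> s x = 0)"

text \<open>Bilinearity is part of \<open>first_order_operator\<close>.\<close>

definition jacobi_structure ::
    "('q, 'v::real_vector, 'e::real_inner) line_bundle \<Rightarrow>
     (('q \<Rightarrow> 'v) \<Rightarrow> ('q \<Rightarrow> 'v) \<Rightarrow> ('q \<Rightarrow> 'v)) \<Rightarrow> bool" where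
  "jacobi_structure L K \<longleftrightarrow>
     (\<forall>s\<in>sections L. first_order_operator L (\<lambda>r. K s r) \<and> first_order_operator L (\<lambda>r. K r s)) \<and>
     (\<forall>s\<in>sections L. K s s = (\<lambda>x. 0)) \<and>
     (\<forall>s\<in>sections L. \<forall>r\<in>sections L. \<forall>t\<in>sections L.
        (\<lambda>x. K s (K r t) x + K r (K t s) x + K t (K s r) x) = (\<lambda>x. 0))"

definition jacobi_map ::
    "('p, 'v::real_vector, 'e::real_inner) line_bundle \<Rightarrow>
     (('p \<Rightarrow> 'v) \<Rightarrow> ('p \<Rightarrow> 'v) \<Rightarrow> ('p \<Rightarrow> 'v)) \<Rightarrow>
     ('q, 'w::real_vector, 'f::real_inner) line_bundle \<Rightarrow>
     (('q \<Rightarrow> 'w) \<Rightarrow> ('q \<Rightarrow> 'w) \<Rightarrow> ('q \<Rightarrow> 'w)) \<Rightarrow>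
     ('p \<Rightarrow> 'q) \<Rightarrow> ('p \<times> 'v \<Rightarrow> 'q \<times> 'w) \<Rightarrow> bool" where
  "jacobi_map L K L' K' \<phi> B \<longleftrightarrow>
     jacobi_structure L K \<and> jacobi_structure L' K' \<and> factor L L' \<phi> B \<and>
     (\<forall>s\<in>sections L'. \<forall>r\<in>sections L'.
        pull_section L \<phi> B (K' s r) = K (pull_section L \<phi> B s) (pull_section L \<phi> B r))"

definition jacobi_isomorphism ::
    "('p, 'v::real_vector, 'e::real_inner) line_bundle \<Rightarrow>
     (('p \<Rightarrow> 'v) \<Rightarrow> ('p \<Rightarrow> 'v) \<Rightarrow> ('p \<Rightarrow> 'v)) \<Rightarrow>
     ('q, 'w::real_vector, 'f::real_inner) line_bundle \<Rightarrow>
     (('q \<Rightarrow> 'w) \<Rightarrow> ('q \<Rightarrow> 'w) \<Rightarrow> ('q \<Rightarrow> 'w)) \<Rightarrow>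
     ('p \<Rightarrow> 'q) \<Rightarrow> ('p \<times> 'v \<Rightarrow> 'q \<times> 'w) \<Rightarrow> bool" where
  "jacobi_isomorphism L K L' K' \<phi> B \<longleftrightarrow>
     jacobi_map L K L' K' \<phi> B \<and>
     (\<exists>\<psi> C. jacobi_map L' K' L K \<psi> C \<and>
        (\<forall>x\<in>pts (base L). \<psi> (\<phi> x) = x) \<and> (\<forall>y\<in>pts (base L'). \<phi> (\<psi> y) = y) \<and>
        (\<forall>z\<in>pts (total_space L). C (B z) = z) \<and> (\<forall>z\<in>pts (total_space L'). B (C z) = z))"

text \<open>\<open>K\<close> is the canonical Jacobi structure on the line bundle over the jet bundle of \<open>L\<close>.\<close>

definition canonical_jacobi ::
    "('q, 'v::real_vector, 'e::real_inner) line_bundle \<Rightarrow>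
     (('q \<times> ((('q \<Rightarrow> 'v) \<Rightarrow> 'v) \<Rightarrow> 'v) \<Rightarrow> 'v) \<Rightarrow> ('q \<times> ((('q \<Rightarrow> 'v) \<Rightarrow> 'v) \<Rightarrow> 'v) \<Rightarrow> 'v) \<Rightarrow>
      ('q \<times> ((('q \<Rightarrow> 'v) \<Rightarrow> 'v) \<Rightarrow> 'v) \<Rightarrow> 'v)) \<Rightarrow> bool" where
  "canonical_jacobi L K \<longleftrightarrow>
     jacobi_structure (jet_line_bundle L) K \<and>
     (\<forall>a\<in>derivations L. \<forall>b\<in>derivations L.
        K (linear_section L a) (linear_section L b) = linear_section L (commutator a b)) \<and>
     (\<forall>a\<in>derivations L. \<forall>s\<in>sections L.
        K (linear_section L a) (basic_section L s) = basic_section L (a s)) \<and>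
     (\<forall>s\<in>sections L. \<forall>r\<in>sections L. K (basic_section L s) (basic_section L r) = (\<lambda>z. 0))"

text \<open>\<open>K\<close> is the product Jacobi structure of \<open>K1\<close> and \<open>K2\<close>.\<close>

definition product_jacobi ::
    "('p, 'v::real_vector, 'e::real_inner) line_bundle \<Rightarrow>
     (('p \<Rightarrow> 'v) \<Rightarrow> ('p \<Rightarrow> 'v) \<Rightarrow> ('p \<Rightarrow> 'v)) \<Rightarrow>
     ('q, 'w::real_vector, 'f::real_inner) line_bundle \<Rightarrow>
     (('q \<Rightarrow> 'w) \<Rightarrow> ('q \<Rightarrow> 'w) \<Rightarrow> ('q \<Rightarrow> 'w)) \<Rightarrow>
     (('p \<times> 'q \<times> ('v \<Rightarrow> 'w) \<Rightarrow> 'v) \<Rightarrow> ('p \<times> 'q \<times> ('v \<Rightarrow> 'w) \<Rightarrow> 'v) \<Rightarrow>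
      ('p \<times> 'q \<times> ('v \<Rightarrow> 'w) \<Rightarrow> 'v)) \<Rightarrow> bool" where
  "product_jacobi L1 K1 L2 K2 K \<longleftrightarrow>
     (let pull1 = pull_section (line_product L1 L2) bp_proj1 proj_factor1;
          pull2 = pull_section (line_product L1 L2) bp_proj2 proj_factor2
      in jacobi_structure (line_product L1 L2) K \<and>
         (\<forall>s\<in>sections L1. \<forall>r\<in>sections L1. K (pull1 s) (pull1 r) = pull1 (K1 s r)) \<and>
         (\<forall>s\<in>sections L2. \<forall>r\<in>sections L2. K (pull2 s) (pull2 r) = pull2 (K2 s r)) \<and>
         (\<forall>s\<in>sections L1. \<forall>r\<in>sections L2. K (pull1 s) (pull2 r) = (\<lambda>z. 0)))"


section \<open>The canonical factor\<close>

text \<open>The der map of a factor: \<open>(D\<^sub>xB a)(s) = B\<^sub>x (a (B\<^sup>*s))\<close>.\<close>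

definition der_map ::
    "('p, 'v::real_vector, 'e::real_inner) line_bundle \<Rightarrow>
     ('q, 'w::real_vector, 'f::real_inner) line_bundle \<Rightarrow>
     ('p \<Rightarrow> 'q) \<Rightarrow> ('p \<times> 'v \<Rightarrow> 'q \<times> 'w) \<Rightarrow> 'p \<Rightarrow>
     (('p \<Rightarrow> 'v) \<Rightarrow> 'v) \<Rightarrow> (('q \<Rightarrow> 'w) \<Rightarrow> 'w)" where
  "der_map L L' \<phi> B x a =
     (\<lambda>s. if s \<in> sections L' then fibre_map B x (a (pull_section L \<phi> B s)) else 0)"

text \<open>
  Over a point \<open>z = (x\<^sub>1, x\<^sub>2, b)\<close> of the base product, \<open>a \<mapsto> (DP\<^sub>1 a, DP\<^sub>2 a)\<close> is an isomorphism
  from the der space at \<open>z\<close> of the line product onto the direct sum of the der spaces at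
  \<open>x\<^sub>1\<close> and \<open>x\<^sub>2\<close>; this is its inverse.
\<close>

definition der_pair ::
    "('p, 'v::real_vector, 'e::real_inner) line_bundle \<Rightarrow>
     ('q, 'w::real_vector, 'f::real_inner) line_bundle \<Rightarrow>
     'p \<times> 'q \<times> ('v \<Rightarrow> 'w) \<Rightarrow> (('p \<Rightarrow> 'v) \<Rightarrow> 'v) \<Rightarrow> (('q \<Rightarrow> 'w) \<Rightarrow> 'w) \<Rightarrow>
     (('p \<times> 'q \<times> ('v \<Rightarrow> 'w) \<Rightarrow> 'v) \<Rightarrow> 'v)" where
  "der_pair L1 L2 z a1 a2 =
     (THE a. a \<in> der_fibre (line_product L1 L2) z \<and>
        der_map (line_product L1 L2) L1 bp_proj1 proj_factor1 z a = a1 \<and>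
        der_map (line_product L1 L2) L2 bp_proj2 proj_factor2 z a = a2)"

text \<open>
  Splitting \<open>\<alpha>\<close> accordingly gives jets at \<open>x\<^sub>1\<close> and \<open>x\<^sub>2\<close>, the second one after identifying
  the fibre of the line product (that is, of \<open>L\<^sub>1\<close> at \<open>x\<^sub>1\<close>) with that of \<open>L\<^sub>2\<close> at \<open>x\<^sub>2\<close> by
  \<open>b\<close>.  The fibres of \<open>jet_line_bundle L\<^sub>i\<close> over these jets are the fibres of \<open>L\<^sub>i\<close> at
  \<open>x\<^sub>i\<close>, so \<open>b\<close> itself is the linear isomorphism required of a point of the base product.
\<close>

definition jet_product_map ::
    "('p, 'v::real_vector, 'e::real_inner) line_bundle \<Rightarrow>
     ('q, 'w::real_vector, 'f::real_inner) line_bundle \<Rightarrow>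
     ('p \<times> 'q \<times> ('v \<Rightarrow> 'w)) \<times> ((('p \<times> 'q \<times> ('v \<Rightarrow> 'w) \<Rightarrow> 'v) \<Rightarrow> 'v) \<Rightarrow> 'v) \<Rightarrow>
     ('p \<times> ((('p \<Rightarrow> 'v) \<Rightarrow> 'v) \<Rightarrow> 'v)) \<times> ('q \<times> ((('q \<Rightarrow> 'w) \<Rightarrow> 'w) \<Rightarrow> 'w)) \<times> ('v \<Rightarrow> 'w)" where
  "jet_product_map L1 L2 = (\<lambda>((x1, x2, b), \<alpha>).
     ((x1, \<lambda>a. if a \<in> der_fibre L1 x1
               then \<alpha> (der_pair L1 L2 (x1, x2, b) a (\<lambda>s. 0)) else 0),
      (x2, \<lambda>a. if a \<in> der_fibre L2 x2
               then b (\<alpha> (der_pair L1 L2 (x1, x2, b) (\<lambda>s. 0) a)) else 0),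
      b))"

definition jet_product_factor ::
    "('p, 'v::real_vector, 'e::real_inner) line_bundle \<Rightarrow>
     ('q, 'w::real_vector, 'f::real_inner) line_bundle \<Rightarrow>
     (('p \<times> 'q \<times> ('v \<Rightarrow> 'w)) \<times> ((('p \<times> 'q \<times> ('v \<Rightarrow> 'w) \<Rightarrow> 'v) \<Rightarrow> 'v) \<Rightarrow> 'v)) \<times> 'v \<Rightarrow>
     (('p \<times> ((('p \<Rightarrow> 'v) \<Rightarrow> 'v) \<Rightarrow> 'v)) \<times> ('q \<times> ((('q \<Rightarrow> 'w) \<Rightarrow> 'w) \<Rightarrow> 'w)) \<times> ('v \<Rightarrow> 'w)) \<times> 'v" where
  "jet_product_factor L1 L2 = (\<lambda>(z, l). (jet_product_map L1 L2 z, l))"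

end

theory Submission
  imports Defs
begin

text \<open>
  In a chart and a trivialisation, an element of the der bundle of the line product is a tuple
  \<open>((e1, e2, \<tau>), c)\<close>, and its images under the der maps of the two projection factors are
  \<open>(e1, c)\<close> and \<open>(e2, c - \<tau> / t)\<close>, where \<open>t \<noteq> 0\<close> is the coordinate of the fibre isomorphism.
  This splits the der spaces, and dually the jets; in charts the canonical map is an explicit
  invertible expression, so it is a diffeomorphism.  For the brackets, consider the difference of
  the two sides of the morphism property at a point, as a functional of one section.  It has order
  at most one, so by Hadamard's lemma it is an element of a der fibre; hence it vanishes as soon as
  it does so on the pull-backs of the linear and basic sections of the two jet line bundles, where
  both brackets are known: linear sections correspond to derivations, and a derivation of either
  factor lifts to the line product.
\<close>

section \<open>Finite-dimensional inner product spaces\<close>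

text \<open>The shift by \<open>\<tau> / t\<close> comes from the second projection factor. A
  section of \<open>L2\<close> with coordinate \<open>f\<close> pulls back to the coordinate
  \<open>f / t\<close>; differentiating \<open>1 / t\<close> in the direction \<open>\<tau>\<close>
  and multiplying by \<open>t\<close> again adds \<open>- \<tau> / t\<close> to the zeroth-order
  part.

  The brackets are prescribed only on linear and basic sections, and no formula is available for the
  others. What makes these values decisive is a pointwise fact: the 1-jets of such sections span all
  1-jets, and a bracket at a point sees only the 1-jets of its arguments. This is why the comparison
  is made at one point and in one argument at a time, antisymmetry exchanging the two.

  Two features of the setting cause most of the work. Elements of a der fibre are functionals on
  global sections, so locality has to be derived, with bump functions that rest on the Hausdorff
  property. And the model spaces are inner product spaces with a finite spanning set, in which
  compactness, a countable base, the chain rule and parameter integrals are all obtained by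
  expansion in an orthonormal basis.\<close>

definition findim :: "'e::real_vector itself \<Rightarrow> bool" where
  "findim _ \<longleftrightarrow> (\<exists>B::'e set. finite B \<and> span B = UNIV)"

text \<open>The expansion clause stands in for spanning, and it is the form in which bases are used
  later. \<open>B\<close> may be empty, which covers dimension 0.\<close>

definition onb :: "'e::real_inner set \<Rightarrow> bool" where
  "onb B \<longleftrightarrow> finite B \<and> (\<forall>x\<in>B. \<forall>y\<in>B. inner x y = (if x = y then 1 else 0)) \<and>
     (\<forall>x. (\<Sum>b\<in>B. inner x b *\<^sub>R b) = x)"

lemma gram_schmidt:
  fixes B :: "'e::real_inner set"
  assumes "finite B"
  shows "\<exists>C. finite C \<and> (\<forall>x\<in>C. \<forall>y\<in>C. inner x y = (if x = y then 1 else 0)) \<and> span B \<subseteq> span C"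
  using assms
proof induction
  case empty
  show ?case by (rule exI[of _ "{}"]) simp
next
  case (insert a B)
  then obtain C where C: "finite C" "\<And>x y. x\<in>C \<Longrightarrow> y\<in>C \<Longrightarrow> inner x y = (if x = y then 1 else 0)"
    "span B \<subseteq> span C" by blast
  define d where "d = a - (\<Sum>c\<in>C. inner a c *\<^sub>R c)"
  have sC: "(\<Sum>c\<in>C. inner a c *\<^sub>R c) \<in> span C"
    by (intro span_sum span_scale span_base)
  have orth: "inner d c = 0" if "c \<in> C" for c
  proof -
    have "(\<Sum>x\<in>C. inner a x * inner x c) = (\<Sum>x\<in>C. if x = c then inner a c else 0)"
      using C(2) that by (intro sum.cong) auto
    then show ?thesis
      using C(1) that by (simp add: d_def inner_diff_left inner_sum_left)
  qed
  show ?case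
  proof (cases "d = 0")
    case True
    then have "a \<in> span C" using sC d_def by simp
    moreover have "B \<subseteq> span C" using C(3) span_superset by blast
    ultimately have "span (insert a B) \<subseteq> span C"
      by (intro span_minimal) auto
    with C show ?thesis by blast
  next
    case False
    define u where "u = d /\<^sub>R norm d"
    have u1: "inner u u = 1"
      using False by (simp add: u_def dot_square_norm power2_eq_square)
    have u2: "inner u c = 0" "inner c u = 0" if "c \<in> C" for c
      using orth[OF that] by (auto simp: u_def inner_commute)
    have "d = norm d *\<^sub>R u" using False by (simp add: u_def)
    then have "d \<in> span (insert u C)"
      by (metis insertI1 span_base span_scale)
    moreover have "(\<Sum>c\<in>C. inner a c *\<^sub>R c) \<in> span (insert u C)"
      using sC span_mono[of C "insert u C"] by blast
    ultimately have "a \<in> span (insert u C)"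
      unfolding d_def by (metis diff_add_cancel span_add)
    moreover have "B \<subseteq> span (insert u C)"
      using C(3) span_superset span_mono[of C "insert u C"] by blast
    ultimately have "span (insert a B) \<subseteq> span (insert u C)"
      by (intro span_minimal) auto
    moreover have "u \<notin> C" using u1 u2 by force
    ultimately show ?thesis
      using C u1 u2 by (intro exI[of _ "insert u C"]) (auto simp: u2)
  qed
qed

lemma findim_onb:
  assumes "findim TYPE('e::real_inner)"
  obtains B :: "'e::real_inner set" where "onb B"
proof -
  obtain B0 :: "'e set" where B0: "finite B0" "span B0 = UNIV"
    using assms unfolding findim_def by blast
  obtain C where C: "finite C" "\<forall>x\<in>C. \<forall>y\<in>C. inner x y = (if x = y then 1 else 0)"
    "span B0 \<subseteq> span C" using gram_schmidt[OF B0(1)] by blast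
  have "(\<Sum>b\<in>C. inner x b *\<^sub>R b) = x" for x
  proof -
    have "x \<in> span C" using C B0 by auto
    then show ?thesis
    proof (induction rule: span_induct_alt)
      case base then show ?case by simp
    next
      case (step c x y)
      have "(\<Sum>b\<in>C. inner x b *\<^sub>R b) = (\<Sum>b\<in>C. if b = x then x else 0)"
        using C(2) step(1) by (intro sum.cong) auto
      also have "\<dots> = x" using C(1) step(1) by simp
      finally show ?case using step(2)
        by (simp add: inner_add_left scaleR_add_left sum.distrib flip: scaleR_scaleR scaleR_sum_right)
    qed
  qed
  then show ?thesis using that C unfolding onb_def by blast
qed

lemma onb_expand: "onb B \<Longrightarrow> (\<Sum>b\<in>B. inner x b *\<^sub>R b) = x"
  and onb_finite: "onb B \<Longrightarrow> finite B"
  and onb_inner: "onb B \<Longrightarrow> b \<in> B \<Longrightarrow> c \<in> B \<Longrightarrow> inner b c = (if b = c then 1 else 0)"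
  by (auto simp: onb_def)

lemma linear_onb:
  fixes f :: "'e::real_inner \<Rightarrow> 'b::real_vector"
  assumes "onb B" "linear f"
  shows "f x = (\<Sum>b\<in>B. inner x b *\<^sub>R f b)"
proof -
  have "f x = f (\<Sum>b\<in>B. inner x b *\<^sub>R b)" using onb_expand[OF assms(1)] by simp
  also have "\<dots> = (\<Sum>b\<in>B. inner x b *\<^sub>R f b)"
    using assms(2) by (simp add: linear_sum linear_cmul)
  finally show ?thesis .
qed

text \<open>In an orthonormal basis \<open>f\<close> is a finite sum of coordinate functionals times
  fixed vectors.\<close>

lemma linear_findim_bounded:
  fixes f :: "'e::real_inner \<Rightarrow> 'b::real_normed_vector"
  assumes "findim TYPE('e)" "linear f"
  shows "bounded_linear f"
proof -
  obtain B :: "'e set" where B: "onb B" using findim_onb assms(1) by blast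
  have "f = (\<lambda>x. \<Sum>b\<in>B. inner x b *\<^sub>R f b)" by (rule ext) (rule linear_onb[OF B assms(2)])
  moreover have "bounded_linear (\<lambda>x. \<Sum>b\<in>B. inner x b *\<^sub>R f b)"
    by (intro bounded_linear_sum bounded_linear_compose[OF bounded_linear_scaleR_left]
          bounded_linear_inner_left)
  ultimately show ?thesis by metis
qed

lemma findim_real: "findim TYPE(real)"
proof -
  have "x \<in> span {1}" for x :: real
    using span_scale[OF span_base, of "1::real" "{1}" x] by simp
  then show ?thesis unfolding findim_def by (intro exI[of _ "{1}"]) auto
qed

lemma findim_prod:
  assumes "findim TYPE('a::real_vector)" "findim TYPE('b::real_vector)"
  shows "findim TYPE('a::real_vector \<times> 'b::real_vector)"
proof -
  obtain A :: "'a set" and B :: "'b set"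
    where AB: "finite A" "span A = UNIV" "finite B" "span B = UNIV"
    using assms unfolding findim_def by blast
  let ?C = "(\<lambda>a. (a, 0::'b)) ` A \<union> (\<lambda>b. (0::'a, b)) ` B"
  have l1: "linear (\<lambda>a. (a, 0::'b))" and l2: "linear (\<lambda>b. (0::'a, b))"
    by (auto intro!: linearI)
  have "(a, b) \<in> span ?C" for a b
  proof -
    have "(a, 0) \<in> span ((\<lambda>a. (a, 0::'b)) ` A)"
      using linear_span_image[OF l1, of A] AB by auto
    moreover have "(0, b) \<in> span ((\<lambda>b. (0::'a, b)) ` B)"
      using linear_span_image[OF l2, of B] AB by auto
    ultimately have "(a, 0) + (0, b) \<in> span ?C"
      by (meson span_add span_mono subsetD sup_ge1 sup_ge2)
    then show ?thesis by simp
  qed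
  then show ?thesis unfolding findim_def using AB by (intro exI[of _ ?C]) auto
qed

text \<open>Cauchy-Schwarz bounds the coefficients of every point of the ball by
  \<open>norm p + \<bar>r\<bar>\<close>. Combinations with coefficients in a bounded closed interval
  form a finite sum of compact segments, and the ball is a closed part of it.\<close>

lemma findim_compact_cball:
  fixes p :: "'e::real_inner"
  assumes "findim TYPE('e)"
  shows "compact (cball p r)"
proof -
  obtain B :: "'e set" where B: "onb B" using findim_onb assms by blast
  define M where "M = norm p + \<bar>r\<bar>"
  have *: "compact {\<Sum>b\<in>A. c b *\<^sub>R b | c. \<forall>b\<in>A. \<bar>c b\<bar> \<le> M}" if "finite A" for A :: "'e set"
    using that
  proof induction
    case (insert a A)
    have "{\<Sum>b\<in>insert a A. c b *\<^sub>R b | c. \<forall>b\<in>insert a A. \<bar>c b\<bar> \<le> M} =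
       {x + y | x y. x \<in> (\<lambda>t. t *\<^sub>R a) ` {-M..M} \<and> y \<in> {\<Sum>b\<in>A. c b *\<^sub>R b | c. \<forall>b\<in>A. \<bar>c b\<bar> \<le> M}}"
      (is "?L = ?R")
    proof
      show "?L \<subseteq> ?R" using insert(1,2)
        by (auto simp: abs_le_iff) (smt (verit, ccfv_SIG) atLeastAtMost_iff imageI)
      show "?R \<subseteq> ?L"
      proof
        fix z assume "z \<in> ?R"
        then obtain t c where tc: "t \<in> {-M..M}" "\<forall>b\<in>A. \<bar>c b\<bar> \<le> M" "z = t *\<^sub>R a + (\<Sum>b\<in>A. c b *\<^sub>R b)"
          by blast
        have "(\<Sum>b\<in>A. (c(a:=t)) b *\<^sub>R b) = (\<Sum>b\<in>A. c b *\<^sub>R b)"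
          using insert(2) by (intro sum.cong) auto
        then have "z = (\<Sum>b\<in>insert a A. (c(a:=t)) b *\<^sub>R b)" "\<forall>b\<in>insert a A. \<bar>(c(a:=t)) b\<bar> \<le> M"
          using insert(1,2) tc by auto
        then show "z \<in> ?L" by blast
      qed
    qed
    moreover have "compact ((\<lambda>t. t *\<^sub>R a) ` {-M..M})"
      by (intro compact_continuous_image continuous_intros compact_Icc)
    ultimately show ?case using compact_sums[OF _ insert(3)] by simp
  qed auto
  have "cball p r \<subseteq> {\<Sum>b\<in>B. c b *\<^sub>R b | c. \<forall>b\<in>B. \<bar>c b\<bar> \<le> M}"
  proof
    fix x assume "x \<in> cball p r"
    then have nx: "norm x \<le> M"
      unfolding M_def using norm_triangle_ineq2[of x p] by (simp add: dist_norm norm_minus_commute)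
    have "\<bar>inner x b\<bar> \<le> M" if "b \<in> B" for b
    proof -
      have "norm b = 1" using onb_inner[OF B that that] by (simp add: norm_eq_sqrt_inner)
      then show ?thesis using Cauchy_Schwarz_ineq2[of x b] nx by simp
    qed
    moreover have "x = (\<Sum>b\<in>B. inner x b *\<^sub>R b)" using onb_expand[OF B] by simp
    ultimately show "x \<in> {\<Sum>b\<in>B. c b *\<^sub>R b | c. \<forall>b\<in>B. \<bar>c b\<bar> \<le> M}" by blast
  qed
  then show ?thesis
    using compact_Int_closed[OF *[OF onb_finite[OF B]] closed_cball[of p r]] by (simp add: Int_absorb1)
qed

text \<open>Rational combinations of an orthonormal basis are dense, so the balls of radius
  \<open>1 / Suc n\<close> around them form a base.\<close>

lemma findim_countable_base:
  assumes "findim TYPE('e::real_inner)"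
  obtains \<B> :: "'e::real_inner set set" where "countable \<B>" "\<And>U. U \<in> \<B> \<Longrightarrow> open U"
    "\<And>T x. open T \<Longrightarrow> x \<in> T \<Longrightarrow> \<exists>U\<in>\<B>. x \<in> U \<and> U \<subseteq> T"
proof -
  obtain B :: "'e set" where B: "onb B" using findim_onb assms by blast
  \<comment> \<open>Extensional coefficient functions make the index set a product over the finite
    set \<open>B\<close> of countable sets, hence countable.\<close>
  define D where "D = (\<lambda>q. \<Sum>b\<in>B. q b *\<^sub>R b) ` (B \<rightarrow>\<^sub>E \<rat>)"
  have cD: "countable D"
    unfolding D_def using onb_finite[OF B] countable_rat by (intro countable_image countable_PiE) auto
  let ?\<B> = "(\<lambda>(d, n). ball d (1 / Suc n)) ` (D \<times> (UNIV::nat set))"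
  have dense: "\<exists>d\<in>D. dist x d < \<epsilon>" if "\<epsilon> > 0" for x :: 'e and \<epsilon>
  proof -
    \<comment> \<open>The summand 1 keeps the quotient meaningful for an empty basis and the total
      of \<open>card B\<close> errors strictly below \<open>\<epsilon>\<close>.\<close>
    define \<eta> where "\<eta> = \<epsilon> / (1 + card B)"
    have \<eta>: "\<eta> > 0" using that by (simp add: \<eta>_def add_pos_nonneg)
    have "\<exists>q. q \<in> \<rat> \<and> \<bar>inner x b - q\<bar> < \<eta>" for b
    proof -
      obtain q where "q \<in> \<rat>" "inner x b - \<eta> < q" "q < inner x b"
        using Rats_dense_in_real[of "inner x b - \<eta>" "inner x b"] \<eta> by auto
      then show ?thesis by (intro exI[of _ q]) auto
    qed
    then obtain q where q: "\<And>b. q b \<in> \<rat>" "\<And>b. \<bar>inner x b - q b\<bar> < \<eta>" by metis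
    let ?d = "\<Sum>b\<in>B. q b *\<^sub>R b"
    have "?d = (\<Sum>b\<in>B. (restrict q B) b *\<^sub>R b)" by (intro sum.cong) auto
    then have "?d \<in> D" unfolding D_def using q(1) by (intro image_eqI[of _ _ "restrict q B"]) auto
    have "x - ?d = (\<Sum>b\<in>B. (inner x b - q b) *\<^sub>R b)"
      using onb_expand[OF B, of x] by (simp add: scaleR_diff_left sum_subtractf)
    then have "norm (x - ?d) \<le> (\<Sum>b\<in>B. norm ((inner x b - q b) *\<^sub>R b))"
      by (metis norm_sum)
    also have "\<dots> \<le> (\<Sum>b\<in>B. \<eta>)"
    proof (intro sum_mono)
      fix b assume b: "b \<in> B"
      have "norm b = 1" using onb_inner[OF B b b] by (simp add: norm_eq_sqrt_inner)
      then show "norm ((inner x b - q b) *\<^sub>R b) \<le> \<eta>" using q(2)[of b] by simp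
    qed
    also have "\<dots> < \<epsilon>" using that by (simp add: \<eta>_def field_simps)
    finally show ?thesis using \<open>?d \<in> D\<close> by (auto simp: dist_norm)
  qed
  show ?thesis
  proof (rule that[of ?\<B>])
    show "countable ?\<B>" using cD by auto
    show "\<And>U. U \<in> ?\<B> \<Longrightarrow> open U" by auto
    fix T and x :: 'e assume "open T" "x \<in> T"
    then obtain \<epsilon> where e: "\<epsilon> > 0" "ball x \<epsilon> \<subseteq> T" by (meson open_contains_ball)
    then obtain n where n: "1 / Suc n < \<epsilon> / 2" using nat_approx_posE[of "\<epsilon>/2"] by auto
    obtain d where d: "d \<in> D" "dist x d < 1 / Suc n" using dense[of "1 / Suc n"] by auto
    have "ball d (1 / Suc n) \<subseteq> ball x \<epsilon>"
    proof
      fix y assume "y \<in> ball d (1 / Suc n)"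
      then have "dist x y < \<epsilon>" using d n dist_triangle[of x y d] by auto
      then show "y \<in> ball x \<epsilon>" by simp
    qed
    moreover have "x \<in> ball d (1 / Suc n)" using d by (simp add: dist_commute)
    moreover have "ball d (1 / Suc n) \<in> ?\<B>" using d(1) by (intro image_eqI[of _ _ "(d, n)"]) auto
    ultimately show "\<exists>U\<in>?\<B>. x \<in> U \<and> U \<subseteq> T" using e(2) by (metis subset_trans)
  qed
qed


section \<open>Calculus of smooth functions\<close>

lemma differentiable_upto_cong:
  assumes "open S" "\<And>x. x \<in> S \<Longrightarrow> f x = g x" "differentiable_upto n S f"
  shows "differentiable_upto n S g"
  using assms(2,3)
proof (induction n arbitrary: f g)
  case 0
  then show ?case by (simp cong: continuous_on_cong)
next
  case (Suc n)
  have D: "(g has_derivative frechet_derivative f (at x)) (at x)" if "x \<in> S" for x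
    using has_derivative_transform_within_open[OF _ assms(1) that Suc.prems(1)] Suc.prems(2) that
    by (simp add: frechet_derivative_works)
  then have "frechet_derivative g (at x) = frechet_derivative f (at x)" if "x \<in> S" for x
    using that by (metis frechet_derivative_at)
  then have "differentiable_upto n S (\<lambda>x. frechet_derivative g (at x) v)" for v
    using Suc.IH[of "\<lambda>x. frechet_derivative f (at x) v" "\<lambda>x. frechet_derivative g (at x) v"] Suc.prems(2) by simp
  moreover have "g differentiable at x" if "x \<in> S" for x
    using D[OF that] differentiable_def by blast
  ultimately show ?case by simp
qed

lemma differentiable_upto_subset:
  "differentiable_upto n S f \<Longrightarrow> T \<subseteq> S \<Longrightarrow> differentiable_upto n T f"
  by (induction n arbitrary: f) (auto intro: continuous_on_subset)

text \<open>All derivatives are full derivatives \<open>at x\<close>, hence local; only the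
  continuity at order 0 has to be passed from the neighbourhoods to \<open>S\<close>.\<close>

lemma differentiable_upto_local:
  assumes "\<And>x. x \<in> S \<Longrightarrow> \<exists>T. open T \<and> x \<in> T \<and> differentiable_upto n T f"
  shows "differentiable_upto n S f"
  using assms
proof (induction n arbitrary: f)
  case 0
  have "isCont f x" if "x \<in> S" for x
    using 0[OF that] by (auto simp: continuous_on_eq_continuous_at)
  then show ?case by (simp add: continuous_at_imp_continuous_on)
next
  case (Suc n)
  have "f differentiable (at x)" if "x \<in> S" for x using Suc.prems[OF that] by auto
  moreover have "differentiable_upto n S (\<lambda>x. frechet_derivative f (at x) v)" for v
    using Suc.prems by (intro Suc.IH) fastforce
  ultimately show ?case by simp
qed

lemma differentiable_upto_Suc_imp:
  "differentiable_upto (Suc n) S f \<Longrightarrow> differentiable_upto n S f"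
proof (induction n arbitrary: f)
  case 0
  then show ?case
    by (auto intro!: continuous_at_imp_continuous_on differentiable_imp_continuous_within)
next
  case (Suc n)
  have "differentiable_upto n S (\<lambda>x. frechet_derivative f (at x) v)" for v
    by (intro Suc.IH) (use Suc.prems in simp)
  moreover have "\<forall>x\<in>S. f differentiable at x" using Suc.prems by simp
  ultimately show ?case by simp
qed

lemma differentiable_upto_has_derivative:
  "differentiable_upto (Suc n) S f \<Longrightarrow> x \<in> S \<Longrightarrow> (f has_derivative frechet_derivative f (at x)) (at x)"
  by (simp add: frechet_derivative_works)

text \<open>Admits any explicit formula for the derivative in place of
  \<open>frechet_derivative\<close>. The closure properties below run their inductions through
  it.\<close>

lemma differentiable_upto_SucI:
  assumes "open S" "\<And>x. x \<in> S \<Longrightarrow> (f has_derivative f' x) (at x)"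
    "\<And>v. differentiable_upto n S (\<lambda>x. f' x v)"
  shows "differentiable_upto (Suc n) S f"
proof -
  have "f' x = frechet_derivative f (at x)" if "x \<in> S" for x
    using frechet_derivative_at assms(2) that by blast
  then have "differentiable_upto n S (\<lambda>x. frechet_derivative f (at x) v)" for v
    using differentiable_upto_cong[OF assms(1) _ assms(3)[of v]] by simp
  moreover have "f differentiable at x" if "x \<in> S" for x
    using assms(2)[OF that] differentiable_def by blast
  ultimately show ?thesis by simp
qed

lemma differentiable_upto_const: "differentiable_upto n S (\<lambda>x. c)"
  by (induction n arbitrary: c) (auto simp: frechet_derivative_const)

lemma differentiable_upto_bounded_linear:
  assumes "bounded_linear L" "open S" "differentiable_upto n S f"
  shows "differentiable_upto n S (\<lambda>x. L (f x))"
  using assms(3)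
proof (induction n arbitrary: f)
  case 0
  then show ?case using assms(1) by (simp add: bounded_linear.continuous_on)
next
  case (Suc n)
  show ?case
    by (rule differentiable_upto_SucI[OF assms(2) bounded_linear.has_derivative[OF assms(1)
          differentiable_upto_has_derivative[OF Suc.prems]]])
      (use Suc in auto)
qed

lemma differentiable_upto_id: "open S \<Longrightarrow> differentiable_upto n S (\<lambda>x. x)"
proof (cases n)
  case (Suc m)
  assume "open S"
  then show ?thesis unfolding Suc
    by (rule differentiable_upto_SucI) (auto intro: has_derivative_ident differentiable_upto_const)
qed auto

lemma differentiable_upto_add:
  assumes "open S" "differentiable_upto n S f" "differentiable_upto n S g"
  shows "differentiable_upto n S (\<lambda>x. f x + g x)"
  using assms(2,3)
proof (induction n arbitrary: f g)
  case 0 then show ?case by (auto intro: continuous_intros)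
next
  case (Suc n)
  show ?case
    by (rule differentiable_upto_SucI[OF assms(1) has_derivative_add[OF
          differentiable_upto_has_derivative[OF Suc.prems(1)] differentiable_upto_has_derivative[OF Suc.prems(2)]]])
      (use Suc in auto)
qed

text \<open>The product rule expresses the derivative by the same bilinear operation applied to
  \<open>f\<close>, \<open>g\<close> and their derivatives, all of the lower order, so the induction
  closes for arbitrary pairs of functions.\<close>

lemma differentiable_upto_bilinear:
  assumes "bounded_bilinear pr" "open S" "differentiable_upto n S f" "differentiable_upto n S g"
  shows "differentiable_upto n S (\<lambda>x. pr (f x) (g x))"
  using assms(3,4)
proof (induction n arbitrary: f g)
  case 0 then show ?case using bounded_bilinear.continuous_on[OF assms(1)] by auto
next
  case (Suc n)
  note lower = Suc.prems[THEN differentiable_upto_Suc_imp]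
  show ?case
    by (rule differentiable_upto_SucI[OF assms(2) bounded_bilinear.FDERIV[OF assms(1)
          differentiable_upto_has_derivative[OF Suc.prems(1)] differentiable_upto_has_derivative[OF Suc.prems(2)]]])
      (use Suc lower in \<open>auto intro!: differentiable_upto_add[OF assms(2)] Suc.IH\<close>)
qed

lemma differentiable_upto_sum:
  assumes "open S" "\<And>i. i \<in> I \<Longrightarrow> differentiable_upto n S (f i)"
  shows "differentiable_upto n S (\<lambda>x. \<Sum>i\<in>I. f i x)"
  using assms(2)
  by (induction I rule: infinite_finite_induct)
     (auto intro!: differentiable_upto_const differentiable_upto_add assms(1))

text \<open>Expanding the derivative of \<open>f\<close> in an orthonormal basis turns the chain
  rule into a finite sum of scalar coefficients times partial derivatives of \<open>g\<close>. The
  induction hypothesis applies to these partial derivatives, and operator-valued maps never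
  occur.\<close>

lemma differentiable_upto_compose:
  fixes f :: "'a::real_normed_vector \<Rightarrow> 'b::real_inner"
  assumes fd: "findim TYPE('b)" and "open S" "open T" "f ` S \<subseteq> T"
    "differentiable_upto n S f" "differentiable_upto n T g"
  shows "differentiable_upto n S (\<lambda>x. g (f x))"
proof -
  obtain B :: "'b set" where B: "onb B" using findim_onb fd by blast
  show ?thesis
    using assms(5,6)
  proof (induction n arbitrary: g)
    case 0
    then show ?case using assms(4) by (auto intro: continuous_on_compose2)
  next
    case (Suc n)
    note lower = Suc.prems[THEN differentiable_upto_Suc_imp]
    have gd: "(g has_derivative frechet_derivative g (at (f x))) (at (f x))" if "x \<in> S" for x
      using differentiable_upto_has_derivative[OF Suc.prems(2)] assms(4) that by blast
    have D: "((\<lambda>x. g (f x)) has_derivative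
        (\<lambda>v. \<Sum>b\<in>B. inner (frechet_derivative f (at x) v) b *\<^sub>R frechet_derivative g (at (f x)) b)) (at x)"
      if "x \<in> S" for x
    proof -
      have "linear (frechet_derivative g (at (f x)))"
        using gd[OF that] has_derivative_linear by blast
      then show ?thesis
        using has_derivative_compose[OF differentiable_upto_has_derivative[OF Suc.prems(1) that] gd[OF that]]
        by (simp flip: linear_onb[OF B])
    qed
    show ?case
    proof (rule differentiable_upto_SucI[OF assms(2) D])
      fix v
      show "differentiable_upto n S (\<lambda>x. \<Sum>b\<in>B. inner (frechet_derivative f (at x) v) b *\<^sub>R
              frechet_derivative g (at (f x)) b)"
        using Suc.prems lower
        by (intro differentiable_upto_sum assms(2) differentiable_upto_bilinear[OF bounded_bilinear_scaleR]
            differentiable_upto_bounded_linear[OF bounded_linear_inner_left] Suc.IH) auto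
    qed
  qed
qed

lemma smooth_on_cong:
  "open S \<Longrightarrow> (\<And>x. x \<in> S \<Longrightarrow> f x = g x) \<Longrightarrow> smooth_on S f \<Longrightarrow> smooth_on S g"
  unfolding smooth_on_def using differentiable_upto_cong by blast

lemma smooth_on_subset: "smooth_on S f \<Longrightarrow> T \<subseteq> S \<Longrightarrow> smooth_on T f"
  unfolding smooth_on_def using differentiable_upto_subset by blast

lemma smooth_on_local:
  fixes S :: "'a::real_normed_vector set"
  shows "(\<And>x. x \<in> S \<Longrightarrow> \<exists>T. open T \<and> x \<in> T \<and> smooth_on T f) \<Longrightarrow> smooth_on S f"
  unfolding smooth_on_def by (meson differentiable_upto_local)

lemma smooth_on_continuous: "smooth_on S f \<Longrightarrow> continuous_on S f"
  unfolding smooth_on_def by (metis differentiable_upto.simps(1))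

lemma smooth_on_has_derivative:
  "smooth_on S f \<Longrightarrow> x \<in> S \<Longrightarrow> (f has_derivative frechet_derivative f (at x)) (at x)"
  unfolding smooth_on_def using differentiable_upto_has_derivative by blast

lemma smooth_on_derivative: "smooth_on S f \<Longrightarrow> smooth_on S (\<lambda>x. frechet_derivative f (at x) v)"
  unfolding smooth_on_def using differentiable_upto.simps(2) by blast

lemma smooth_on_bilinear:
  "bounded_bilinear pr \<Longrightarrow> open S \<Longrightarrow> smooth_on S f \<Longrightarrow> smooth_on S g \<Longrightarrow>
    smooth_on S (\<lambda>x. pr (f x) (g x))"
  unfolding smooth_on_def using differentiable_upto_bilinear by blast

lemma smooth_on_bounded_linear:
  "bounded_linear L \<Longrightarrow> open S \<Longrightarrow> smooth_on S f \<Longrightarrow> smooth_on S (\<lambda>x. L (f x))"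
  unfolding smooth_on_def using differentiable_upto_bounded_linear by blast

lemma smooth_on_compose:
  fixes f :: "'a::real_normed_vector \<Rightarrow> 'b::real_inner"
  shows "smooth_on T g \<Longrightarrow> smooth_on S f \<Longrightarrow> findim TYPE('b) \<Longrightarrow> open S \<Longrightarrow> open T \<Longrightarrow> f ` S \<subseteq> T \<Longrightarrow>
    smooth_on S (\<lambda>x. g (f x))"
  unfolding smooth_on_def using differentiable_upto_compose by blast

lemma smooth_on_const: "smooth_on S (\<lambda>x. c)"
  unfolding smooth_on_def using differentiable_upto_const by blast

lemma smooth_on_id: "open S \<Longrightarrow> smooth_on S (\<lambda>x. x)"
  unfolding smooth_on_def using differentiable_upto_id by blast

lemma smooth_on_add:
  "open S \<Longrightarrow> smooth_on S f \<Longrightarrow> smooth_on S g \<Longrightarrow> smooth_on S (\<lambda>x. f x + g x)"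
  unfolding smooth_on_def using differentiable_upto_add by blast

lemma smooth_on_sum:
  "open S \<Longrightarrow> (\<And>i. i \<in> I \<Longrightarrow> smooth_on S (f i)) \<Longrightarrow> smooth_on S (\<lambda>x. \<Sum>i\<in>I. f i x)"
  unfolding smooth_on_def by (simp add: differentiable_upto_sum)

lemma smooth_on_fst: "open S \<Longrightarrow> smooth_on S f \<Longrightarrow> smooth_on S (\<lambda>x. fst (f x))"
  by (rule smooth_on_bounded_linear[OF bounded_linear_fst])

lemma smooth_on_snd: "open S \<Longrightarrow> smooth_on S f \<Longrightarrow> smooth_on S (\<lambda>x. snd (f x))"
  by (rule smooth_on_bounded_linear[OF bounded_linear_snd])

lemma smooth_on_Pair:
  fixes f :: "'a::real_normed_vector \<Rightarrow> 'b::real_normed_vector"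
    and g :: "'a \<Rightarrow> 'c::real_normed_vector"
  assumes "open S" "smooth_on S f" "smooth_on S g"
  shows "smooth_on S (\<lambda>x. (f x, g x))"
proof -
  have "bounded_linear (\<lambda>x::'b. (x, 0::'c))" "bounded_linear (\<lambda>x::'c. (0::'b, x))"
    by (auto intro!: bounded_linear_Pair bounded_linear_ident bounded_linear_zero)
  then have "smooth_on S (\<lambda>x. (f x, 0) + (0, g x))"
    using assms by (intro smooth_on_add) (auto intro: smooth_on_bounded_linear)
  then show ?thesis by simp
qed

lemma smooth_on_scaleR:
  "open S \<Longrightarrow> smooth_on S f \<Longrightarrow> smooth_on S g \<Longrightarrow> smooth_on S (\<lambda>x. f x *\<^sub>R g x)"
  by (rule smooth_on_bilinear[OF bounded_bilinear_scaleR])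

lemma smooth_on_mult:
  fixes f g :: "'a::real_normed_vector \<Rightarrow> real"
  shows "open S \<Longrightarrow> smooth_on S f \<Longrightarrow> smooth_on S g \<Longrightarrow> smooth_on S (\<lambda>x. f x * g x)"
  by (rule smooth_on_bilinear[OF bounded_bilinear_mult])

lemma smooth_on_inner:
  "open S \<Longrightarrow> smooth_on S f \<Longrightarrow> smooth_on S g \<Longrightarrow> smooth_on S (\<lambda>x. inner (f x) (g x))"
  by (rule smooth_on_bilinear[OF bounded_bilinear_inner])

lemma smooth_on_uminus: "open S \<Longrightarrow> smooth_on S f \<Longrightarrow> smooth_on S (\<lambda>x. - f x)"
  by (rule smooth_on_bounded_linear[OF bounded_linear_minus[OF bounded_linear_ident]])

lemma smooth_on_diff:
  "open S \<Longrightarrow> smooth_on S f \<Longrightarrow> smooth_on S g \<Longrightarrow> smooth_on S (\<lambda>x. f x - g x)"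
  using smooth_on_add[of S f "\<lambda>x. - g x"] smooth_on_uminus[of S g] by simp

text \<open>The derivative of \<open>inverse\<close> is again a product of copies of
  \<open>inverse\<close>, so the induction feeds on itself.\<close>

lemma smooth_on_inverse_real: "smooth_on (- {0::real}) inverse"
proof -
  have "differentiable_upto n (- {0::real}) inverse" for n
  proof (induction n)
    case 0
    show ?case by (auto intro!: continuous_intros)
  next
    case (Suc n)
    have D: "(inverse has_derivative (\<lambda>v. (inverse x * inverse x) * - v)) (at x)"
      if "x \<in> - {0}" for x :: real
      using has_derivative_inverse'[of x UNIV] that by (simp add: mult_ac)
    show ?case
      by (intro differentiable_upto_SucI[OF _ D] differentiable_upto_bilinear[OF bounded_bilinear_mult]
          differentiable_upto_const Suc) auto
  qed
  then show ?thesis by (simp add: smooth_on_def)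
qed

lemma smooth_on_inverse:
  fixes f :: "'a::real_normed_vector \<Rightarrow> real"
  shows "open S \<Longrightarrow> smooth_on S f \<Longrightarrow> (\<And>x. x \<in> S \<Longrightarrow> f x \<noteq> 0) \<Longrightarrow> smooth_on S (\<lambda>x. inverse (f x))"
  by (rule smooth_on_compose[OF smooth_on_inverse_real _ findim_real]) auto

lemma smooth_on_divide:
  fixes f g :: "'a::real_normed_vector \<Rightarrow> real"
  shows "open S \<Longrightarrow> smooth_on S f \<Longrightarrow> smooth_on S g \<Longrightarrow> (\<And>x. x \<in> S \<Longrightarrow> g x \<noteq> 0) \<Longrightarrow>
    smooth_on S (\<lambda>x. f x / g x)"
  using smooth_on_mult[of S f "\<lambda>x. inverse (g x)"] smooth_on_inverse[of S g]
  by (simp add: divide_inverse)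

lemmas smooth_intros = smooth_on_const smooth_on_id smooth_on_add smooth_on_sum smooth_on_fst
  smooth_on_snd smooth_on_Pair smooth_on_scaleR smooth_on_mult smooth_on_inner smooth_on_uminus
  smooth_on_diff smooth_on_divide


section \<open>A smooth bump function and Hadamard's lemma\<close>

text \<open>The function \<open>exp (- 1 / t)\<close> extended by zero, together with its multiples
  by powers of \<open>1 / t\<close>: the linear span of the family is closed under
  differentiation.\<close>

definition exp_flat :: "nat \<Rightarrow> real \<Rightarrow> real" where
  "exp_flat k t = (if t > 0 then exp (- inverse t) * inverse t ^ k else 0)"

text \<open>The substitution of \<open>1 / t\<close> for the variable turns the limit from the right
  into the decay of \<open>x ^ k / exp x\<close> at infinity.\<close>

lemma exp_flat_tendsto_0: "(exp_flat k \<longlongrightarrow> 0) (at 0)"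
proof -
  have "((\<lambda>x::real. x ^ k / exp x) \<longlongrightarrow> 0) at_top" by (rule tendsto_power_div_exp_0)
  then have "((\<lambda>t. inverse t ^ k / exp (inverse t)) \<longlongrightarrow> 0) (at_right (0::real))"
    using filterlim_compose filterlim_inverse_at_top_right by blast
  moreover have "\<forall>\<^sub>F t in at_right 0. inverse t ^ k / exp (inverse t) = exp_flat k t"
    unfolding eventually_at_right_field
    by (intro exI[of _ 1]) (auto simp: exp_flat_def exp_minus field_simps)
  ultimately have "(exp_flat k \<longlongrightarrow> 0) (at_right 0)" by (rule Lim_transform_eventually)
  moreover have "(exp_flat k \<longlongrightarrow> 0) (at_left 0)"
    by (rule Lim_transform_eventually[OF tendsto_const])
       (auto simp: eventually_at_left_field exp_flat_def intro!: exI[of _ "-1"])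
  ultimately show ?thesis using filterlim_split_at by blast
qed

lemma exp_flat_has_derivative:
  "(exp_flat k has_real_derivative exp_flat (k + 2) t - real k * exp_flat (k + 1) t) (at t)"
proof -
  consider "t > 0" | "t < 0" | "t = 0" by linarith
  then show ?thesis
  proof cases
    case 1
    have "((\<lambda>t. exp (- inverse t) * inverse t ^ k) has_real_derivative
        exp_flat (k + 2) t - real k * exp_flat (k + 1) t) (at t)"
    proof (cases k)
      case 0
      then show ?thesis using 1
        by (auto intro!: derivative_eq_intros simp: exp_flat_def power2_eq_square field_simps)
    next
      case (Suc j)
      have "((\<lambda>t. inverse t) has_real_derivative - (inverse t ^ Suc (Suc 0))) (at t)"
        using DERIV_inverse[of t] 1 by simp
      note I = this DERIV_fun_exp[OF DERIV_minus[OF this]] DERIV_power_Suc[OF this, of j]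
      show ?thesis
        by (rule DERIV_cong[OF DERIV_mult[OF I(2) I(3)[folded Suc]]])
           (use 1 in \<open>simp add: exp_flat_def Suc algebra_simps\<close>)
    qed
    then show ?thesis
      by (rule has_field_derivative_transform_within_open[of _ _ _ "{0<..}"])
         (use 1 in \<open>auto simp: exp_flat_def\<close>)
  next
    case 2
    have "((\<lambda>t. 0) has_real_derivative exp_flat (k + 2) t - real k * exp_flat (k + 1) t) (at t)"
      using 2 by (simp add: exp_flat_def)
    then show ?thesis
      by (rule has_field_derivative_transform_within_open[of _ _ _ "{..<0}"])
         (use 2 in \<open>auto simp: exp_flat_def\<close>)
  next
    case 3
    \<comment> \<open>The difference quotient at 0 is itself a member of the family, with the
      exponent raised by one, so differentiability there is the limit already proved.\<close>
    have "(exp_flat k h - exp_flat k 0) / h = exp_flat (k + 1) h" for h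
      by (simp add: exp_flat_def field_simps)
    then have "((\<lambda>h. (exp_flat k (0 + h) - exp_flat k 0) / h) \<longlongrightarrow> 0) (at 0)"
      using exp_flat_tendsto_0[of "k + 1"] by simp
    then show ?thesis using 3 by (simp add: DERIV_def exp_flat_def)
  qed
qed

lemma smooth_on_exp_flat: "smooth_on UNIV (exp_flat k)"
proof -
  have "differentiable_upto n UNIV (exp_flat k)" for n
  proof (induction n arbitrary: k)
    case 0
    show ?case
      unfolding differentiable_upto.simps
      by (intro continuous_at_imp_continuous_on ballI DERIV_isCont[OF exp_flat_has_derivative])
  next
    case (Suc n)
    have D: "(exp_flat k has_derivative
        (\<lambda>v. v *\<^sub>R exp_flat (k + 2) t + (- real k * v) *\<^sub>R exp_flat (k + 1) t)) (at t)" for t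
    proof -
      have "(*) (exp_flat (k + 2) t - real k * exp_flat (k + 1) t) =
          (\<lambda>v. v *\<^sub>R exp_flat (k + 2) t + (- real k * v) *\<^sub>R exp_flat (k + 1) t)"
        by (auto simp: algebra_simps)
      then show ?thesis
        using exp_flat_has_derivative[of k t] unfolding has_field_derivative_def by metis
    qed
    show ?case
      by (rule differentiable_upto_SucI[OF open_UNIV D])
         (intro differentiable_upto_add differentiable_upto_bounded_linear[OF bounded_linear_scaleR_right]
            Suc open_UNIV)
  qed
  then show ?thesis by (simp add: smooth_on_def)
qed

text \<open>The squared distance is used because, unlike the distance, it is smooth at
  \<open>p\<close>. Dividing by \<open>exp_flat 0 (r\<^sup>2)\<close> normalises the value at
  \<open>p\<close> to 1.\<close>

lemma smooth_bump:
  fixes p :: "'e::real_inner"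
  assumes "r > 0"
  obtains \<beta> :: "'e \<Rightarrow> real" where "smooth_on UNIV \<beta>" "\<beta> p = 1" "\<And>y. y \<notin> cball p r \<Longrightarrow> \<beta> y = 0"
proof -
  define \<beta> where "\<beta> y = exp_flat 0 (r\<^sup>2 - inner (y - p) (y - p)) / exp_flat 0 (r\<^sup>2)" for y
  have "smooth_on UNIV \<beta>"
    unfolding \<beta>_def using assms
    by (intro smooth_intros smooth_on_compose[OF smooth_on_exp_flat _ findim_real])
       (auto simp: exp_flat_def)
  moreover have "\<beta> p = 1" using assms by (simp add: \<beta>_def exp_flat_def)
  moreover have "\<beta> y = 0" if "y \<notin> cball p r" for y
  proof -
    have "r < norm (y - p)" using that by (simp add: dist_norm norm_minus_commute)
    then have "r\<^sup>2 \<le> (norm (y - p))\<^sup>2" using assms by (intro power_mono) auto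
    then show ?thesis by (simp add: \<beta>_def exp_flat_def dot_square_norm)
  qed
  ultimately show ?thesis using that by blast
qed

text \<open>A Lebesgue number for the cover of \<open>K\<close> by preimages of balls of half the
  tolerance. The point \<open>y\<close> may leave \<open>K\<close>, which perturbing a segment of
  integration requires.\<close>

lemma uniformly_continuous_near_compact:
  fixes f :: "'a::metric_space \<Rightarrow> 'b::metric_space"
  assumes "continuous_on S f" "open S" "compact K" "K \<subseteq> S" "\<epsilon> > 0"
  obtains \<delta> where "\<delta> > 0" "\<And>x y. x \<in> K \<Longrightarrow> dist x y < \<delta> \<Longrightarrow> y \<in> S \<and> dist (f y) (f x) < \<epsilon>"
proof -
  define G where "G z = S \<inter> f -` ball (f z) (\<epsilon>/2)" for z
  have "open (G z)" for z
    unfolding G_def using assms(1,2) by (intro continuous_open_preimage) auto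
  moreover have "K \<subseteq> \<Union>(G ` K)" using assms(4,5) by (auto simp: G_def)
  ultimately obtain \<delta> where d: "\<delta> > 0" "\<And>x. x \<in> K \<Longrightarrow> \<exists>U\<in>G ` K. ball x \<delta> \<subseteq> U"
    using Heine_Borel_lemma[OF assms(3), of "G ` K"] by (metis (no_types, lifting) imageE)
  show ?thesis
  proof (rule that[OF d(1)])
    fix x y assume xy: "x \<in> K" "dist x y < \<delta>"
    then obtain z where z: "ball x \<delta> \<subseteq> G z" using d(2) by blast
    then have "x \<in> G z" "y \<in> G z" using xy d(1) by auto
    then have "y \<in> S" "dist (f y) (f z) < \<epsilon> / 2" "dist (f x) (f z) < \<epsilon> / 2"
      unfolding G_def by (auto simp: dist_commute)
    then show "y \<in> S \<and> dist (f y) (f x) < \<epsilon>"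
      using dist_triangle_half_l by blast
  qed
qed

text \<open>Differentiating in \<open>y\<close> brings out a factor \<open>t\<close> under the
  integral, so the family has to be indexed by the power of \<open>t\<close> for an induction on the
  order. Hadamard's lemma uses \<open>m = 0\<close>.\<close>

definition ray_integral :: "'e::real_inner \<Rightarrow> nat \<Rightarrow> ('e \<Rightarrow> real) \<Rightarrow> 'e \<Rightarrow> real" where
  "ray_integral p m h y = integral {0..1} (\<lambda>t. t ^ m * h (p + t *\<^sub>R (y - p)))"

lemma ray_in_ball:
  fixes y p :: "'e::real_inner"
  assumes "y \<in> ball p \<rho>" "t \<in> {0..1}"
  shows "p + t *\<^sub>R (y - p) \<in> ball p \<rho>"
proof -
  have "norm (t *\<^sub>R (y - p)) \<le> norm (y - p)"
    using assms(2) by (simp add: mult_left_le_one_le)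
  then show ?thesis using assms(1) by (simp add: dist_norm norm_minus_commute)
qed

lemma ray_integrable:
  fixes y p :: "'e::real_inner"
  assumes "continuous_on (ball p \<rho>) h" "y \<in> ball p \<rho>"
  shows "(\<lambda>t. t ^ m * h (p + t *\<^sub>R (y - p))) integrable_on {0..1}"
proof (rule integrable_continuous_real)
  have "continuous_on {0..1} (\<lambda>t. h (p + t *\<^sub>R (y - p)))"
  proof (rule continuous_on_compose2[OF assms(1)])
    show "continuous_on {0..1} (\<lambda>t. p + t *\<^sub>R (y - p))" by (intro continuous_intros)
  qed (use ray_in_ball[OF assms(2)] in auto)
  then show "continuous_on {0..1} (\<lambda>t. t ^ m * h (p + t *\<^sub>R (y - p)))"
    by (intro continuous_intros)
qed

text \<open>
  Differentiation under the integral sign.  The library's Leibniz rule asks for a Banach space of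
  parameters, which a bare \<^class>\<open>real_inner\<close> type is not.
\<close>

lemma ray_integral_has_derivative:
  fixes p :: "'e::real_inner"
  assumes fd: "findim TYPE('e)" and h: "smooth_on (ball p \<rho>) h" and y: "y \<in> ball p \<rho>"
  shows "(ray_integral p m h has_derivative
    (\<lambda>v. ray_integral p (Suc m) (\<lambda>z. frechet_derivative h (at z) v) y)) (at y)"
proof -
  obtain B :: "'e set" where B: "onb B" using findim_onb fd by blast
  let ?D = "\<lambda>z v. frechet_derivative h (at z) v"
  have lin: "linear (?D z)" if "z \<in> ball p \<rho>" for z
    using smooth_on_has_derivative[OF h that] has_derivative_linear by blast
  have cD: "continuous_on (ball p \<rho>) (\<lambda>z. ?D z v)" for v
    using smooth_on_continuous[OF smooth_on_derivative[OF h]] .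
  have intD: "(\<lambda>t. t ^ k * ?D (p + t *\<^sub>R (x - p)) v) integrable_on {0..1}"
    if "x \<in> ball p \<rho>" for x k v
    by (rule ray_integrable[OF cD that])
  have "linear (\<lambda>v. ray_integral p (Suc m) (\<lambda>z. ?D z v) y)"
  proof (rule linearI)
    fix u v
    have "ray_integral p (Suc m) (\<lambda>z. ?D z (u + v)) y = integral {0..1}
      (\<lambda>t. t ^ Suc m * ?D (p + t *\<^sub>R (y - p)) u + t ^ Suc m * ?D (p + t *\<^sub>R (y - p)) v)"
      unfolding ray_integral_def
      by (intro integral_cong) (use lin[OF ray_in_ball[OF y]] in \<open>simp add: linear_add algebra_simps\<close>)
    then show "ray_integral p (Suc m) (\<lambda>z. ?D z (u + v)) y =
        ray_integral p (Suc m) (\<lambda>z. ?D z u) y + ray_integral p (Suc m) (\<lambda>z. ?D z v) y"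
      using intD[OF y, of "Suc m"] by (simp add: ray_integral_def integral_add)
  next
    fix c :: real and v
    have "ray_integral p (Suc m) (\<lambda>z. ?D z (c *\<^sub>R v)) y = integral {0..1}
      (\<lambda>t. c * (t ^ Suc m * ?D (p + t *\<^sub>R (y - p)) v))"
      unfolding ray_integral_def
      by (intro integral_cong) (use lin[OF ray_in_ball[OF y]] in \<open>simp add: linear_cmul algebra_simps\<close>)
    then show "ray_integral p (Suc m) (\<lambda>z. ?D z (c *\<^sub>R v)) y =
        c *\<^sub>R ray_integral p (Suc m) (\<lambda>z. ?D z v) y"
      by (simp add: ray_integral_def)
  qed
  then have bl: "bounded_linear (\<lambda>v. ray_integral p (Suc m) (\<lambda>z. ?D z v) y)"
    by (rule linear_findim_bounded[OF fd])
  \<comment> \<open>The segment of integration; the estimates that follow must be uniform along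
    it.\<close>
  define K where "K = (\<lambda>t. p + t *\<^sub>R (y - p)) ` {0..1}"
  have K: "compact K" "K \<subseteq> ball p \<rho>"
    unfolding K_def using ray_in_ball[OF y]
    by (auto intro!: compact_continuous_image continuous_intros)
  have "\<exists>d>0. \<forall>x. norm (x - y) < d \<longrightarrow> norm (ray_integral p m h x - ray_integral p m h y -
      ray_integral p (Suc m) (\<lambda>z. ?D z (x - y)) y) \<le> \<epsilon> * norm (x - y)" if "\<epsilon> > 0" for \<epsilon>
  proof -
    define \<eta> where "\<eta> = \<epsilon> / (1 + card B)"
    have \<eta>: "\<eta> > 0" "card B * \<eta> \<le> \<epsilon>" using that by (auto simp: \<eta>_def add_pos_nonneg field_simps)
    have "\<exists>\<delta>>0. \<forall>b\<in>A. \<forall>z\<in>K. \<forall>u. dist z u < \<delta> \<longrightarrow> u \<in> ball p \<rho> \<and> \<bar>?D u b - ?D z b\<bar> < \<eta>"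
      if "finite A" for A
      using that
    proof induction
      case empty then show ?case by (auto intro: exI[of _ 1])
    next
      case (insert a A)
      then obtain \<delta>1 where 1: "\<delta>1 > 0"
        "\<forall>b\<in>A. \<forall>z\<in>K. \<forall>u. dist z u < \<delta>1 \<longrightarrow> u \<in> ball p \<rho> \<and> \<bar>?D u b - ?D z b\<bar> < \<eta>" by blast
      obtain \<delta>2 where 2: "\<delta>2 > 0"
        "\<And>z u. z \<in> K \<Longrightarrow> dist z u < \<delta>2 \<Longrightarrow> u \<in> ball p \<rho> \<and> dist (?D u a) (?D z a) < \<eta>"
        by (rule uniformly_continuous_near_compact[OF cD[of a] open_ball K \<eta>(1)]) auto
      show ?case
        by (rule exI[of _ "min \<delta>1 \<delta>2"]) (use 1 2 in \<open>auto simp: dist_real_def\<close>)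
    qed
    from this[OF onb_finite[OF B]] obtain \<delta>0 where d0: "\<delta>0 > 0"
      "\<And>b z u. b \<in> B \<Longrightarrow> z \<in> K \<Longrightarrow> dist z u < \<delta>0 \<Longrightarrow> \<bar>?D u b - ?D z b\<bar> < \<eta>" by blast
    \<comment> \<open>The direction 0 serves to keep a neighbourhood of the segment inside the ball.
      The bound over \<open>B\<close> alone gives no such neighbourhood when \<open>B\<close> is
      empty.\<close>
    obtain \<delta>1 where d1: "\<delta>1 > 0" "\<And>z u. z \<in> K \<Longrightarrow> dist z u < \<delta>1 \<Longrightarrow> u \<in> ball p \<rho>"
      by (rule uniformly_continuous_near_compact[OF cD[of 0] open_ball K zero_less_one]) auto
    define \<delta> where "\<delta> = min \<delta>0 \<delta>1"
    have d: "\<delta> > 0" "\<And>z u. z \<in> K \<Longrightarrow> dist z u < \<delta> \<Longrightarrow> u \<in> ball p \<rho>"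
      "\<And>b z u. b \<in> B \<Longrightarrow> z \<in> K \<Longrightarrow> dist z u < \<delta> \<Longrightarrow> \<bar>?D u b - ?D z b\<bar> < \<eta>"
      using d0 d1 by (auto simp: \<delta>_def)
    \<comment> \<open>The mean value inequality for \<open>h\<close> minus its linearisation at
      \<open>z\<close>. Near \<open>z\<close> the derivative of this difference is small on each
      basis vector, and Cauchy-Schwarz makes it at most \<open>\<epsilon>\<close> in operator
      norm.\<close>
    have pt: "\<bar>h (z + u) - h z - ?D z u\<bar> \<le> \<epsilon> * norm u" if z: "z \<in> K" and u: "norm u < \<delta>" for z u
    proof -
      let ?f = "\<lambda>w. h w - ?D z w"
      have zb: "z \<in> ball p \<rho>" using K z by auto
      have bz: "bounded_linear (?D z)" using linear_findim_bounded[OF fd lin[OF zb]] .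
      have "norm (?f (z + u) - ?f z) \<le> \<epsilon> * norm (z + u - z)"
      proof (rule differentiable_bound[of "ball z \<delta>" ?f "\<lambda>w v. ?D w v - ?D z v"])
        fix w assume w: "w \<in> ball z \<delta>"
        then have wb: "w \<in> ball p \<rho>" using d(2)[OF z] by simp
        show "(?f has_derivative (\<lambda>v. ?D w v - ?D z v)) (at w within ball z \<delta>)"
          by (intro has_derivative_diff has_derivative_at_withinI[OF smooth_on_has_derivative[OF h wb]]
              bounded_linear_imp_has_derivative[OF bz])
        show "onorm (\<lambda>v. ?D w v - ?D z v) \<le> \<epsilon>"
        proof (rule onorm_bound)
          show "0 \<le> \<epsilon>" using \<open>\<epsilon> > 0\<close> by simp
          fix v
          have "?D w v - ?D z v = (\<Sum>b\<in>B. inner v b * (?D w b - ?D z b))"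
            using linear_onb[OF B lin[OF wb], of v] linear_onb[OF B lin[OF zb], of v]
            by (simp add: sum_subtractf algebra_simps)
          then have "norm (?D w v - ?D z v) \<le> (\<Sum>b\<in>B. \<bar>inner v b * (?D w b - ?D z b)\<bar>)"
            by (simp add: sum_abs)
          also have "\<dots> \<le> (\<Sum>b\<in>B. norm v * \<eta>)"
          proof (rule sum_mono)
            fix b assume b: "b \<in> B"
            have "norm b = 1" using onb_inner[OF B b b] by (simp add: norm_eq_sqrt_inner)
            then have "\<bar>inner v b\<bar> \<le> norm v" using Cauchy_Schwarz_ineq2[of v b] by simp
            moreover have "\<bar>?D w b - ?D z b\<bar> \<le> \<eta>" using d(3)[OF b z, of w] w by simp
            ultimately show "\<bar>inner v b * (?D w b - ?D z b)\<bar> \<le> norm v * \<eta>"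
              unfolding abs_mult by (intro mult_mono) auto
          qed
          also have "\<dots> = (card B * \<eta>) * norm v" by simp
          also have "\<dots> \<le> \<epsilon> * norm v" using \<eta>(2) by (intro mult_right_mono) auto
          finally show "norm (?D w v - ?D z v) \<le> \<epsilon> * norm v" .
        qed
      qed (use u d(1) in \<open>auto simp: dist_norm\<close>)
      then show ?thesis
        using linear_add[OF lin[OF zb], of z u] by (simp add: algebra_simps)
    qed
    show ?thesis
    proof (intro exI conjI allI impI)
      \<comment> \<open>The second bound keeps \<open>x\<close> in the ball on which
        \<open>h\<close> is smooth.\<close>
      show "min \<delta> (\<rho> - dist p y) > 0" using d(1) y by simp
      fix x assume x: "norm (x - y) < min \<delta> (\<rho> - dist p y)"
      have "dist x y < \<rho> - dist p y" using x by (simp add: dist_norm)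
      then have xb: "x \<in> ball p \<rho>"
        using dist_triangle[of p x y] by (simp add: dist_commute)
      let ?F = "\<lambda>t. t ^ m * h (p + t *\<^sub>R (x - p)) - t ^ m * h (p + t *\<^sub>R (y - p)) -
        t ^ Suc m * ?D (p + t *\<^sub>R (y - p)) (x - y)"
      note ch = smooth_on_continuous[OF h]
      have iF: "?F integrable_on {0..1}"
        by (intro integrable_diff ray_integrable[OF ch xb] ray_integrable[OF ch y] intD[OF y])
      have "ray_integral p m h x - ray_integral p m h y - ray_integral p (Suc m) (\<lambda>z. ?D z (x - y)) y
          = integral {0..1} ?F"
        unfolding ray_integral_def
        by (simp add: integral_diff integrable_diff ray_integrable[OF ch xb] ray_integrable[OF ch y]
            intD[OF y] del: power_Suc)
      also have "norm \<dots> \<le> integral {0..1} (\<lambda>t::real. \<epsilon> * norm (x - y))"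
      proof (rule integral_norm_bound_integral[OF iF])
        fix t :: real assume t: "t \<in> {0..1}"
        let ?z = "p + t *\<^sub>R (y - p)"
        have zK: "?z \<in> K" using t by (auto simp: K_def)
        have le: "norm (t *\<^sub>R (x - y)) \<le> norm (x - y)" using t by (simp add: mult_left_le_one_le)
        have "p + t *\<^sub>R (x - p) = ?z + t *\<^sub>R (x - y)" by (simp add: algebra_simps)
        \<comment> \<open>Linearity moves one factor \<open>t\<close> into the direction. What
          remains is \<open>t ^ m\<close> times the Taylor remainder of \<open>h\<close> for the
          increment \<open>t *\<^sub>R (x - y)\<close>, to which \<open>pt\<close> applies.\<close>
        then have "?F t = t ^ m * (h (?z + t *\<^sub>R (x - y)) - h ?z - ?D ?z (t *\<^sub>R (x - y)))"
          using linear_cmul[OF lin[OF ray_in_ball[OF y t]], of t "x - y"] by (simp add: algebra_simps)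
        also have "norm \<dots> \<le> 1 * (\<epsilon> * norm (t *\<^sub>R (x - y)))"
          unfolding norm_mult using pt[OF zK, of "t *\<^sub>R (x - y)"] x le t
          by (intro mult_mono) (auto simp: power_le_one)
        also have "\<dots> \<le> \<epsilon> * norm (x - y)" using le \<open>\<epsilon> > 0\<close> by simp
        finally show "norm (?F t) \<le> \<epsilon> * norm (x - y)" .
      qed auto
      finally show "norm (ray_integral p m h x - ray_integral p m h y -
        ray_integral p (Suc m) (\<lambda>z. ?D z (x - y)) y) \<le> \<epsilon> * norm (x - y)" by simp
    qed
  qed
  then show ?thesis using bl unfolding has_derivative_at_alt by blast
qed

lemma smooth_on_ray_integral:
  fixes p :: "'e::real_inner"
  assumes fd: "findim TYPE('e)" and h: "smooth_on (ball p \<rho>) h"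
  shows "smooth_on (ball p \<rho>) (ray_integral p m h)"
proof -
  have "differentiable_upto n (ball p \<rho>) (ray_integral p m h)" for n
    using h
  proof (induction n arbitrary: m h)
    case 0
    then show ?case
      using ray_integral_has_derivative[OF fd]
      by (auto intro!: continuous_at_imp_continuous_on has_derivative_continuous)
  next
    case (Suc n)
    show ?case
      by (rule differentiable_upto_SucI[OF open_ball ray_integral_has_derivative[OF fd Suc.prems]])
         (auto intro!: Suc.IH smooth_on_derivative Suc.prems)
  qed
  then show ?thesis by (simp add: smooth_on_def)
qed

text \<open>Integrate the derivative of \<open>h\<close> along the ray from \<open>p\<close> to
  \<open>y\<close> and expand the direction \<open>y - p\<close> in the basis. The coefficients are
  ray integrals of partial derivatives, smooth by the preceding lemma; at \<open>p\<close> the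
  integrand is constant, which gives their value there.\<close>

lemma hadamard:
  fixes p :: "'e::real_inner"
  assumes B: "onb B" and fd: "findim TYPE('e)" and h: "smooth_on (ball p \<rho>) h"
  obtains g :: "'e \<Rightarrow> 'e \<Rightarrow> real"
  where "\<And>b. smooth_on (ball p \<rho>) (g b)"
    "\<And>b. \<rho> > 0 \<Longrightarrow> g b p = frechet_derivative h (at p) b"
    "\<And>y. y \<in> ball p \<rho> \<Longrightarrow> h y = h p + (\<Sum>b\<in>B. inner (y - p) b * g b y)"
proof -
  let ?D = "\<lambda>z v. frechet_derivative h (at z) v"
  let ?g = "\<lambda>b. ray_integral p 0 (\<lambda>z. ?D z b)"
  have sm: "smooth_on (ball p \<rho>) (\<lambda>z. ?D z b)" for b by (rule smooth_on_derivative[OF h])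
  show ?thesis
  proof (rule that[of ?g])
    show "smooth_on (ball p \<rho>) (?g b)" for b by (rule smooth_on_ray_integral[OF fd sm])
    show "?g b p = ?D p b" for b by (simp add: ray_integral_def)
    fix y assume y: "y \<in> ball p \<rho>"
    have "((\<lambda>t. ?D (p + t *\<^sub>R (y - p)) (y - p)) has_integral
        h (p + 1 *\<^sub>R (y - p)) - h (p + 0 *\<^sub>R (y - p))) {0..1}"
    proof (rule fundamental_theorem_of_calculus)
      fix t :: real assume t: "t \<in> {0..1}"
      have 1: "((\<lambda>t. p + t *\<^sub>R (y - p)) has_derivative (\<lambda>s. s *\<^sub>R (y - p))) (at t within {0..1})"
        by (auto intro!: derivative_eq_intros)
      note D = smooth_on_has_derivative[OF h ray_in_ball[OF y t]]
      show "((\<lambda>t. h (p + t *\<^sub>R (y - p))) has_vector_derivative ?D (p + t *\<^sub>R (y - p)) (y - p))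
          (at t within {0..1})"
        unfolding has_vector_derivative_def
        using has_derivative_compose[OF 1 D] has_derivative_linear[OF D] by (simp add: linear_cmul)
    qed simp
    then have "h y - h p = integral {0..1} (\<lambda>t. ?D (p + t *\<^sub>R (y - p)) (y - p))"
      by (simp add: integral_unique)
    also have "\<dots> = integral {0..1} (\<lambda>t. \<Sum>b\<in>B. inner (y - p) b * ?D (p + t *\<^sub>R (y - p)) b)"
      using linear_onb[OF B has_derivative_linear[OF smooth_on_has_derivative[OF h ray_in_ball[OF y]]]]
      by (intro integral_cong) auto
    also have "\<dots> = (\<Sum>b\<in>B. inner (y - p) b * ?g b y)"
    proof -
      have "(\<lambda>t. ?D (p + t *\<^sub>R (y - p)) b) integrable_on {0..1}" for b
        using ray_integrable[OF smooth_on_continuous[OF sm] y, of 0] by simp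
      then show ?thesis
        by (subst integral_sum) (auto simp: ray_integral_def onb_finite[OF B] intro: integrable_on_mult_right)
    qed
    finally show "h y = h p + (\<Sum>b\<in>B. inner (y - p) b * ?g b y)" by simp
  qed
qed


section \<open>Smooth functions on manifolds\<close>

text \<open>A smooth manifold, except that it need not be Hausdorff or second countable.\<close>

definition premanifold :: "('a, 'e::real_inner) mfd \<Rightarrow> bool" where
  "premanifold M \<longleftrightarrow> findim TYPE('e) \<and>
     (\<Union>(U, \<phi>)\<in>atlas M. U) = pts M \<and>
     (\<forall>(U, \<phi>)\<in>atlas M. inj_on \<phi> U \<and> open (\<phi> ` U)) \<and>
     (\<forall>(U, \<phi>)\<in>atlas M. \<forall>(V, \<psi>)\<in>atlas M.
        open (\<phi> ` (U \<inter> V)) \<and> smooth_on (\<phi> ` (U \<inter> V)) (\<psi> \<circ> the_inv_into U \<phi>))"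

lemma smooth_manifold_iff:
  "smooth_manifold M \<longleftrightarrow>
    premanifold M \<and> Hausdorff_space (mfd_topology M) \<and> second_countable (mfd_topology M)"
  unfolding smooth_manifold_def premanifold_def findim_def by blast

context
  fixes M :: "('a, 'e::real_inner) mfd"
  assumes M: "premanifold M"
begin

lemma premanifold_findim: "findim TYPE('e)"
  using M unfolding premanifold_def by blast

lemma chart_cover: "p \<in> pts M \<Longrightarrow> \<exists>U \<phi>. (U, \<phi>) \<in> atlas M \<and> p \<in> U"
  using M unfolding premanifold_def by blast

lemma chart_subset: "(U, \<phi>) \<in> atlas M \<Longrightarrow> U \<subseteq> pts M"
  using M unfolding premanifold_def by blast

lemma chart_inj: "(U, \<phi>) \<in> atlas M \<Longrightarrow> inj_on \<phi> U"
  and chart_open_image: "(U, \<phi>) \<in> atlas M \<Longrightarrow> open (\<phi> ` U)"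
  using M unfolding premanifold_def by auto

lemma chart_open_Int: "(U, \<phi>) \<in> atlas M \<Longrightarrow> (V, \<psi>) \<in> atlas M \<Longrightarrow> open (\<phi> ` (U \<inter> V))"
  and chart_transition: "(U, \<phi>) \<in> atlas M \<Longrightarrow> (V, \<psi>) \<in> atlas M \<Longrightarrow>
    smooth_on (\<phi> ` (U \<inter> V)) (\<psi> \<circ> the_inv_into U \<phi>)"
  using M unfolding premanifold_def by fast+

lemma chart_inv: "(U, \<phi>) \<in> atlas M \<Longrightarrow> x \<in> U \<Longrightarrow> the_inv_into U \<phi> (\<phi> x) = x"
  using chart_inj by (simp add: the_inv_into_f_f)

text \<open>\<open>mfd_topology\<close> applies \<open>topology\<close> to a predicate, whose open
  sets are known only after the predicate is shown to be stable under intersections and unions.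
  Intersections use injectivity of the charts.\<close>

lemma openin_mfd:
  "openin (mfd_topology M) S \<longleftrightarrow> S \<subseteq> pts M \<and> (\<forall>(U, \<phi>)\<in>atlas M. open (\<phi> ` (S \<inter> U)))"
proof -
  have "istopology (\<lambda>S. S \<subseteq> pts M \<and> (\<forall>(U, \<phi>)\<in>atlas M. open (\<phi> ` (S \<inter> U))))"
    unfolding istopology_def
  proof (intro conjI allI impI)
    fix S T
    assume S: "S \<subseteq> pts M \<and> (\<forall>(U, \<phi>)\<in>atlas M. open (\<phi> ` (S \<inter> U)))"
      and T: "T \<subseteq> pts M \<and> (\<forall>(U, \<phi>)\<in>atlas M. open (\<phi> ` (T \<inter> U)))"
    have "open (\<phi> ` (S \<inter> T \<inter> U))" if u: "(U, \<phi>) \<in> atlas M" for U \<phi>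
    proof -
      have "\<phi> ` (S \<inter> T \<inter> U) = \<phi> ` (S \<inter> U) \<inter> \<phi> ` (T \<inter> U)"
        using inj_on_image_Int[OF chart_inj[OF u], of "S \<inter> U" "T \<inter> U"] by (simp add: Int_ac)
      then show ?thesis using S T u by fastforce
    qed
    then show "\<forall>(U, \<phi>)\<in>atlas M. open (\<phi> ` (S \<inter> T \<inter> U))" by blast
    show "S \<inter> T \<subseteq> pts M" using S by blast
  next
    fix K assume K: "\<forall>S\<in>K. S \<subseteq> pts M \<and> (\<forall>(U, \<phi>)\<in>atlas M. open (\<phi> ` (S \<inter> U)))"
    then show "\<Union>K \<subseteq> pts M" by blast
    have "open (\<phi> ` (\<Union>K \<inter> U))" if u: "(U, \<phi>) \<in> atlas M" for U \<phi>
    proof -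
      have "\<phi> ` (\<Union>K \<inter> U) = (\<Union>S\<in>K. \<phi> ` (S \<inter> U))" by blast
      then show ?thesis using K u by (auto intro!: open_UN)
    qed
    then show "\<forall>(U, \<phi>)\<in>atlas M. open (\<phi> ` (\<Union>K \<inter> U))" by blast
  qed
  then show ?thesis unfolding mfd_topology_def by (simp add: topology_inverse')
qed

lemma openin_chart: "(U, \<phi>) \<in> atlas M \<Longrightarrow> openin (mfd_topology M) U"
  unfolding openin_mfd using chart_subset chart_open_Int by (auto simp: Int_commute)

lemma openin_pts: "openin (mfd_topology M) (pts M)"
  unfolding openin_mfd using chart_subset chart_open_image by (auto simp: Int_absorb1)

lemma topspace_mfd: "topspace (mfd_topology M) = pts M"
  using openin_pts openin_mfd by (meson openin_subset openin_topspace subset_antisym)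

lemma openin_mfd_subset: "openin (mfd_topology M) S \<Longrightarrow> S \<subseteq> pts M"
  using openin_mfd by blast

lemma open_chart_image: "openin (mfd_topology M) S \<Longrightarrow> (U, \<phi>) \<in> atlas M \<Longrightarrow> S \<subseteq> U \<Longrightarrow> open (\<phi> ` S)"
  unfolding openin_mfd by (fastforce simp: Int_absorb2)

lemma openin_chart_preimage:
  assumes "(U, \<phi>) \<in> atlas M" "open T"
  shows "openin (mfd_topology M) {x \<in> U. \<phi> x \<in> T}"
  unfolding openin_mfd
proof safe
  fix V \<psi> assume V: "(V, \<psi>) \<in> atlas M"
  have eq: "\<psi> ` ({x \<in> U. \<phi> x \<in> T} \<inter> V) = \<psi> ` (V \<inter> U) \<inter> (\<phi> \<circ> the_inv_into V \<psi>) -` T"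
    using chart_inv[OF V] by auto
  show "open (\<psi> ` ({x \<in> U. \<phi> x \<in> T} \<inter> V))"
    unfolding eq
    by (rule continuous_open_preimage[OF smooth_on_continuous[OF chart_transition[OF V assms(1)]]
          chart_open_Int[OF V assms(1)] assms(2)])
qed (use chart_subset assms(1) in blast)

end

text \<open>Smoothness of the germ at \<open>p\<close>, read in some chart. In this form it accepts
  any normed codomain, and closure rules can be composed without keeping track of domains.\<close>

definition sm_at :: "('a, 'e::real_inner) mfd \<Rightarrow> ('a \<Rightarrow> 'b::real_normed_vector) \<Rightarrow> 'a \<Rightarrow> bool" where
  "sm_at M f p \<longleftrightarrow> (\<exists>U \<phi> S. (U, \<phi>) \<in> atlas M \<and> openin (mfd_topology M) S \<and> p \<in> S \<and> S \<subseteq> U \<and>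
     smooth_on (\<phi> ` S) (f \<circ> the_inv_into U \<phi>))"

context
  fixes M :: "('a, 'e::real_inner) mfd"
  assumes M: "premanifold M"
begin

text \<open>Independence of the chart: on the overlap the two coordinate expressions differ by a
  smooth transition map.\<close>

lemma sm_at_chartE:
  assumes f: "sm_at M f p" and U: "(U, \<phi>) \<in> atlas M" "p \<in> U"
  obtains S where "openin (mfd_topology M) S" "p \<in> S" "S \<subseteq> U" "open (\<phi> ` S)"
    "smooth_on (\<phi> ` S) (f \<circ> the_inv_into U \<phi>)"
proof -
  obtain V \<psi> S where V: "(V, \<psi>) \<in> atlas M" "openin (mfd_topology M) S" "p \<in> S" "S \<subseteq> V"
    "smooth_on (\<psi> ` S) (f \<circ> the_inv_into V \<psi>)" using f unfolding sm_at_def by blast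
  let ?S = "S \<inter> U"
  have S: "openin (mfd_topology M) ?S" using V(2) openin_chart[OF M U(1)] by blast
  have o: "open (\<phi> ` ?S)" by (rule open_chart_image[OF M S U(1)]) blast
  have "smooth_on (\<phi> ` ?S) (\<lambda>y. (f \<circ> the_inv_into V \<psi>) ((\<psi> \<circ> the_inv_into U \<phi>) y))"
  proof (rule smooth_on_compose[OF V(5) _ premanifold_findim[OF M] o open_chart_image[OF M V(2,1,4)]])
    show "smooth_on (\<phi> ` ?S) (\<psi> \<circ> the_inv_into U \<phi>)"
      by (rule smooth_on_subset[OF chart_transition[OF M U(1) V(1)]]) (use V(4) in blast)
    show "(\<psi> \<circ> the_inv_into U \<phi>) ` \<phi> ` ?S \<subseteq> \<psi> ` S"
      using chart_inv[OF M U(1)] by auto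
  qed
  then have "smooth_on (\<phi> ` ?S) (f \<circ> the_inv_into U \<phi>)"
    by (rule smooth_on_cong[OF o, rotated])
       (use chart_inv[OF M U(1)] chart_inv[OF M V(1)] V(4) in auto)
  with S o U(2) V(3) that show ?thesis by blast
qed

lemma sm_at_cong:
  assumes f: "sm_at M f p" and W: "openin (mfd_topology M) W" "p \<in> W" "\<And>x. x \<in> W \<Longrightarrow> f x = g x"
  shows "sm_at M g p"
proof -
  obtain V \<psi> S where V: "(V, \<psi>) \<in> atlas M" "openin (mfd_topology M) S" "p \<in> S" "S \<subseteq> V"
    "smooth_on (\<psi> ` S) (f \<circ> the_inv_into V \<psi>)" using f unfolding sm_at_def by blast
  have S: "openin (mfd_topology M) (S \<inter> W)" using V(2) W(1) by blast
  have o: "open (\<psi> ` (S \<inter> W))" by (rule open_chart_image[OF M S V(1)]) (use V(4) in blast)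
  have "smooth_on (\<psi> ` (S \<inter> W)) (f \<circ> the_inv_into V \<psi>)"
    by (rule smooth_on_subset[OF V(5)]) blast
  then have "smooth_on (\<psi> ` (S \<inter> W)) (g \<circ> the_inv_into V \<psi>)"
    by (rule smooth_on_cong[OF o, rotated]) (use chart_inv[OF M V(1)] V(4) W(3) in auto)
  then show ?thesis unfolding sm_at_def using S V W(2) by blast
qed

lemma sm_at_const: "p \<in> pts M \<Longrightarrow> sm_at M (\<lambda>x. c) p"
  using chart_cover[OF M, of p] openin_chart[OF M] smooth_on_const[of _ c]
  unfolding sm_at_def by (fastforce simp: o_def)

lemma sm_at_chart:
  assumes "(U, \<phi>) \<in> atlas M" "p \<in> U"
  shows "sm_at M \<phi> p"
proof -
  have "smooth_on (\<phi> ` U) (\<phi> \<circ> the_inv_into U \<phi>)"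
    by (rule smooth_on_cong[OF chart_open_image[OF M assms(1)] _ smooth_on_id[OF chart_open_image[OF M assms(1)]]])
       (use chart_inv[OF M assms(1)] in auto)
  then show ?thesis unfolding sm_at_def using assms openin_chart[OF M assms(1)] by blast
qed

lemma sm_at_pts: "sm_at M f p \<Longrightarrow> p \<in> pts M"
  unfolding sm_at_def using openin_mfd_subset[OF M] by blast

lemma sm_at_preimage:
  assumes f: "sm_at M f p" and T: "open T" "f p \<in> T"
  obtains S where "openin (mfd_topology M) S" "p \<in> S" "\<And>x. x \<in> S \<Longrightarrow> f x \<in> T"
proof -
  obtain U \<phi> where U: "(U, \<phi>) \<in> atlas M" "p \<in> U" using chart_cover[OF M sm_at_pts[OF f]] by blast
  obtain S where S: "openin (mfd_topology M) S" "p \<in> S" "S \<subseteq> U" "open (\<phi> ` S)"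
    "smooth_on (\<phi> ` S) (f \<circ> the_inv_into U \<phi>)" using sm_at_chartE[OF f U] by blast
  let ?T = "\<phi> ` S \<inter> (f \<circ> the_inv_into U \<phi>) -` T"
  have "open ?T" by (rule continuous_open_preimage[OF smooth_on_continuous[OF S(5)] S(4) T(1)])
  then have "openin (mfd_topology M) {x \<in> U. \<phi> x \<in> ?T}"
    by (rule openin_chart_preimage[OF M U(1)])
  moreover have "p \<in> {x \<in> U. \<phi> x \<in> ?T}" using U S(2) T(2) chart_inv[OF M U(1)] by auto
  moreover have "f x \<in> T" if "x \<in> {x \<in> U. \<phi> x \<in> ?T}" for x
  proof -
    have "x \<in> U" "(f \<circ> the_inv_into U \<phi>) (\<phi> x) \<in> T" using that by blast+
    then show ?thesis using chart_inv[OF M U(1)] by simp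
  qed
  ultimately show ?thesis using that by blast
qed

lemma sm_at_compose:
  fixes f :: "'a \<Rightarrow> 'b::real_inner"
  assumes F: "smooth_on T F" and f: "sm_at M f p" and "findim TYPE('b)" "open T" "f p \<in> T"
  shows "sm_at M (\<lambda>x. F (f x)) p"
proof -
  obtain U \<phi> where U: "(U, \<phi>) \<in> atlas M" "p \<in> U" using chart_cover[OF M sm_at_pts[OF f]] by blast
  obtain S where S: "openin (mfd_topology M) S" "p \<in> S" "S \<subseteq> U" "open (\<phi> ` S)"
    "smooth_on (\<phi> ` S) (f \<circ> the_inv_into U \<phi>)" using sm_at_chartE[OF f U] by blast
  obtain S2 where S2: "openin (mfd_topology M) S2" "p \<in> S2" "\<And>x. x \<in> S2 \<Longrightarrow> f x \<in> T"
    using sm_at_preimage[OF f assms(4,5)] by blast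
  have o: "open (\<phi> ` (S \<inter> S2))"
    by (rule open_chart_image[OF M _ U(1)]) (use S S2 in auto)
  have "smooth_on (\<phi> ` (S \<inter> S2)) (\<lambda>y. F ((f \<circ> the_inv_into U \<phi>) y))"
    by (rule smooth_on_compose[OF F smooth_on_subset[OF S(5)] assms(3) o assms(4)])
       (use chart_inv[OF M U(1)] S(3) S2(3) in auto)
  then show ?thesis unfolding sm_at_def using U S S2
    by (intro exI[of _ U] exI[of _ \<phi>] exI[of _ "S \<inter> S2"]) (auto simp: o_def)
qed

text \<open>Both functions are read in one chart on the intersection of their neighbourhoods. Any
  operation that preserves smoothness on open sets thereby passes to the manifold; the rules below
  are instances.\<close>

lemma sm_at_lift2:
  assumes f: "sm_at M f p" and g: "sm_at M g p"
    and op: "\<And>S f g. open S \<Longrightarrow> smooth_on S f \<Longrightarrow> smooth_on S g \<Longrightarrow> smooth_on (S::'e set) (\<lambda>x. F (f x) (g x))"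
  shows "sm_at M (\<lambda>x. F (f x) (g x)) p"
proof -
  obtain U \<phi> where U: "(U, \<phi>) \<in> atlas M" "p \<in> U" using chart_cover[OF M sm_at_pts[OF f]] by blast
  obtain S where S: "openin (mfd_topology M) S" "p \<in> S" "S \<subseteq> U" "open (\<phi> ` S)"
    "smooth_on (\<phi> ` S) (f \<circ> the_inv_into U \<phi>)" using sm_at_chartE[OF f U] by blast
  obtain S2 where S2: "openin (mfd_topology M) S2" "p \<in> S2" "S2 \<subseteq> U" "open (\<phi> ` S2)"
    "smooth_on (\<phi> ` S2) (g \<circ> the_inv_into U \<phi>)" using sm_at_chartE[OF g U] by blast
  have o: "open (\<phi> ` (S \<inter> S2))"
    by (rule open_chart_image[OF M _ U(1)]) (use S S2 in auto)
  have "smooth_on (\<phi> ` (S \<inter> S2)) (\<lambda>y. F ((f \<circ> the_inv_into U \<phi>) y) ((g \<circ> the_inv_into U \<phi>) y))"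
    by (rule op[OF o smooth_on_subset[OF S(5)] smooth_on_subset[OF S2(5)]]) auto
  then show ?thesis unfolding sm_at_def using U S S2
    by (intro exI[of _ U] exI[of _ \<phi>] exI[of _ "S \<inter> S2"]) (auto simp: o_def)
qed

lemma sm_at_Pair: "sm_at M f p \<Longrightarrow> sm_at M g p \<Longrightarrow> sm_at M (\<lambda>x. (f x, g x)) p"
  by (rule sm_at_lift2[where F = Pair]) (auto intro: smooth_on_Pair)

lemma sm_at_add: "sm_at M f p \<Longrightarrow> sm_at M g p \<Longrightarrow> sm_at M (\<lambda>x. f x + g x) p"
  by (rule sm_at_lift2[where F = "(+)"]) (auto intro: smooth_on_add)

lemma sm_at_diff: "sm_at M f p \<Longrightarrow> sm_at M g p \<Longrightarrow> sm_at M (\<lambda>x. f x - g x) p"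
  by (rule sm_at_lift2[where F = "(-)"]) (auto intro: smooth_on_diff)

lemma sm_at_scaleR: "sm_at M f p \<Longrightarrow> sm_at M g p \<Longrightarrow> sm_at M (\<lambda>x. f x *\<^sub>R g x) p"
  by (rule sm_at_lift2[where F = scaleR]) (auto intro: smooth_on_scaleR)

lemma sm_at_mult:
  fixes f g :: "'a \<Rightarrow> real"
  shows "sm_at M f p \<Longrightarrow> sm_at M g p \<Longrightarrow> sm_at M (\<lambda>x. f x * g x) p"
  by (rule sm_at_lift2[where F = "(*)"]) (auto intro: smooth_on_mult)

lemma sm_at_inner: "sm_at M f p \<Longrightarrow> sm_at M g p \<Longrightarrow> sm_at M (\<lambda>x. inner (f x) (g x)) p"
  by (rule sm_at_lift2[where F = inner]) (auto intro: smooth_on_inner)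

lemma sm_at_lift1:
  assumes f: "sm_at M f p"
    and op: "\<And>S f. open S \<Longrightarrow> smooth_on S f \<Longrightarrow> smooth_on (S::'e set) (\<lambda>x. F (f x))"
  shows "sm_at M (\<lambda>x. F (f x)) p"
  using sm_at_lift2[OF f f, of "\<lambda>x y. F x"] op by blast

lemma sm_at_fst: "sm_at M f p \<Longrightarrow> sm_at M (\<lambda>x. fst (f x)) p"
  by (rule sm_at_lift1[where F = fst]) (auto intro: smooth_on_fst)

lemma sm_at_snd: "sm_at M f p \<Longrightarrow> sm_at M (\<lambda>x. snd (f x)) p"
  by (rule sm_at_lift1[where F = snd]) (auto intro: smooth_on_snd)

lemma sm_at_uminus: "sm_at M f p \<Longrightarrow> sm_at M (\<lambda>x. - f x) p"
  by (rule sm_at_lift1[where F = uminus]) (auto intro: smooth_on_uminus)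

lemma sm_at_divide:
  fixes f g :: "'a \<Rightarrow> real"
  assumes "sm_at M f p" "sm_at M g p" "g p \<noteq> 0"
  shows "sm_at M (\<lambda>x. f x / g x) p"
  using sm_at_mult[OF assms(1) sm_at_compose[OF smooth_on_inverse_real assms(2) findim_real]] assms(3)
  by (simp add: divide_inverse open_Compl)

lemma sm_at_sum: "p \<in> pts M \<Longrightarrow> (\<And>i. i \<in> I \<Longrightarrow> sm_at M (f i) p) \<Longrightarrow> sm_at M (\<lambda>x. \<Sum>i\<in>I. f i x) p"
  by (induction I rule: infinite_finite_induct) (auto intro: sm_at_const sm_at_add)

lemmas sm_at_intros = sm_at_const sm_at_Pair sm_at_add sm_at_diff sm_at_scaleR sm_at_mult
  sm_at_inner sm_at_fst sm_at_snd sm_at_uminus sm_at_divide sm_at_sum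

lemma sm_at_derivative:
  assumes f: "sm_at M f p" and U: "(U, \<phi>) \<in> atlas M" "p \<in> U"
  shows "sm_at M (\<lambda>x. frechet_derivative (f \<circ> the_inv_into U \<phi>) (at (\<phi> x)) v) p"
proof -
  obtain S where S: "openin (mfd_topology M) S" "p \<in> S" "S \<subseteq> U" "open (\<phi> ` S)"
    "smooth_on (\<phi> ` S) (f \<circ> the_inv_into U \<phi>)" using sm_at_chartE[OF f U] by blast
  have "smooth_on (\<phi> ` S) ((\<lambda>x. frechet_derivative (f \<circ> the_inv_into U \<phi>) (at (\<phi> x)) v) \<circ> the_inv_into U \<phi>)"
    by (rule smooth_on_cong[OF S(4) _ smooth_on_derivative[OF S(5), of v]])
       (use S(3) chart_inv[OF M U(1)] in auto)
  then show ?thesis unfolding sm_at_def using U S by blast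
qed

lemma sm_at_has_derivative:
  assumes f: "sm_at M f p" and U: "(U, \<phi>) \<in> atlas M" "p \<in> U"
  shows "((f \<circ> the_inv_into U \<phi>) has_derivative frechet_derivative (f \<circ> the_inv_into U \<phi>) (at (\<phi> p))) (at (\<phi> p))"
  using sm_at_chartE[OF f U] smooth_on_has_derivative by (metis imageI)

lemma smooth_on_chart_iff:
  assumes U: "(U, \<phi>) \<in> atlas M" and S: "openin (mfd_topology M) S" "S \<subseteq> U"
  shows "smooth_on (\<phi> ` S) (f \<circ> the_inv_into U \<phi>) \<longleftrightarrow> (\<forall>p\<in>S. sm_at M f p)"
proof
  assume "smooth_on (\<phi> ` S) (f \<circ> the_inv_into U \<phi>)"
  then show "\<forall>p\<in>S. sm_at M f p" unfolding sm_at_def using U S by blast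
next
  assume sm: "\<forall>p\<in>S. sm_at M f p"
  show "smooth_on (\<phi> ` S) (f \<circ> the_inv_into U \<phi>)"
  proof (rule smooth_on_local)
    fix y assume "y \<in> \<phi> ` S"
    then obtain p where p: "p \<in> S" "y = \<phi> p" by blast
    show "\<exists>T. open T \<and> y \<in> T \<and> smooth_on T (f \<circ> the_inv_into U \<phi>)"
      using sm_at_chartE[OF bspec[OF sm p(1)] U] p S(2) by (metis imageI subsetD)
  qed
qed

lemma smooth_fun_on_iff:
  assumes A: "openin (mfd_topology M) A"
  shows "smooth_fun_on M A f \<longleftrightarrow> (\<forall>p\<in>A. sm_at M f p)"
proof -
  have *: "smooth_on (\<phi> ` (A \<inter> U)) (f \<circ> the_inv_into U \<phi>) \<longleftrightarrow> (\<forall>p\<in>A \<inter> U. sm_at M f p)"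
    if u: "(U, \<phi>) \<in> atlas M" for U \<phi>
    by (rule smooth_on_chart_iff[OF u]) (use A openin_chart[OF M u] in auto)
  have "smooth_fun_on M A f \<longleftrightarrow> (\<forall>(U, \<phi>)\<in>atlas M. \<forall>p\<in>A \<inter> U. sm_at M f p)"
    unfolding smooth_fun_on_def using * by fast
  also have "\<dots> \<longleftrightarrow> (\<forall>p\<in>A. sm_at M f p)"
    using chart_cover[OF M] openin_mfd_subset[OF M A] by fast
  finally show ?thesis .
qed

lemma smooth_funs_iff: "f \<in> smooth_funs M \<longleftrightarrow> zero_off (pts M) f \<and> (\<forall>p\<in>pts M. sm_at M f p)"
  unfolding smooth_funs_def using smooth_fun_on_iff[OF openin_pts[OF M]] by simp

text \<open>Two points of one chart domain are separated inside the chart image, so separation has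
  to be supplied only for points without a common chart. For the bundles below it will come from the
  base.\<close>

lemma premanifold_HausdorffI:
  assumes "\<And>p q. p \<in> pts M \<Longrightarrow> q \<in> pts M \<Longrightarrow> p \<noteq> q \<Longrightarrow> (\<exists>U \<phi>. (U, \<phi>) \<in> atlas M \<and> p \<in> U \<and> q \<in> U) \<or>
    (\<exists>S T. openin (mfd_topology M) S \<and> openin (mfd_topology M) T \<and> p \<in> S \<and> q \<in> T \<and> S \<inter> T = {})"
  shows "Hausdorff_space (mfd_topology M)"
  unfolding Hausdorff_space_def topspace_mfd[OF M]
proof (intro allI impI)
  fix p q assume pq: "p \<in> pts M \<and> q \<in> pts M \<and> p \<noteq> q"
  show "\<exists>S T. openin (mfd_topology M) S \<and> openin (mfd_topology M) T \<and> p \<in> S \<and> q \<in> T \<and> disjnt S T"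
  proof (cases "\<exists>U \<phi>. (U, \<phi>) \<in> atlas M \<and> p \<in> U \<and> q \<in> U")
    case False then show ?thesis using assms pq by (metis disjnt_def)
  next
    case True
    then obtain U \<phi> where U: "(U, \<phi>) \<in> atlas M" "p \<in> U" "q \<in> U" by blast
    have "\<phi> p \<noteq> \<phi> q" using U pq chart_inj[OF M U(1)] by (meson inj_on_contraD)
    then obtain S T where ST: "open S" "open T" "\<phi> p \<in> S" "\<phi> q \<in> T" "S \<inter> T = {}"
      using hausdorff[of "\<phi> p" "\<phi> q"] by auto
    show ?thesis
      by (rule exI[of _ "{x \<in> U. \<phi> x \<in> S}"], rule exI[of _ "{x \<in> U. \<phi> x \<in> T}"])
         (use openin_chart_preimage[OF M U(1)] ST U in \<open>auto simp: disjnt_def\<close>)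
  qed
qed

text \<open>Chart preimages of a countable base of the model space, taken over countably many
  charts, form a base.\<close>

lemma premanifold_second_countableI:
  assumes "countable C" "C \<subseteq> atlas M" "(\<Union>(U, \<phi>)\<in>C. U) = pts M"
  shows "second_countable (mfd_topology M)"
proof -
  obtain \<B> :: "'e set set" where B: "countable \<B>" "\<And>U. U \<in> \<B> \<Longrightarrow> open U"
    "\<And>T x. open T \<Longrightarrow> x \<in> T \<Longrightarrow> \<exists>U\<in>\<B>. x \<in> U \<and> U \<subseteq> T"
    using findim_countable_base[OF premanifold_findim[OF M]] by blast
  let ?\<B> = "(\<lambda>((U, \<phi>), T). {x \<in> U. \<phi> x \<in> T}) ` (C \<times> \<B>)"
  show ?thesis unfolding second_countable_def
  proof (intro exI[of _ ?\<B>] conjI ballI allI impI)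
    show "countable ?\<B>" using assms(1) B(1) by auto
    show "openin (mfd_topology M) V" if "V \<in> ?\<B>" for V
      using that openin_chart_preimage[OF M] B(2) assms(2) by auto
    fix S x assume S: "openin (mfd_topology M) S \<and> x \<in> S"
    then have "x \<in> pts M" using openin_mfd_subset[OF M] by blast
    then obtain U \<phi> where U: "(U, \<phi>) \<in> C" "x \<in> U" using assms(3) by blast
    then have Ua: "(U, \<phi>) \<in> atlas M" using assms(2) by blast
    have "open (\<phi> ` (S \<inter> U))"
      by (rule open_chart_image[OF M _ Ua]) (use S openin_chart[OF M Ua] in auto)
    then obtain T where T: "T \<in> \<B>" "\<phi> x \<in> T" "T \<subseteq> \<phi> ` (S \<inter> U)" using B(3)[of _ "\<phi> x"] S U by blast
    have "{x \<in> U. \<phi> x \<in> T} \<subseteq> S"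
      using T(3) chart_inj[OF M Ua] by (auto simp: inj_on_def)
    moreover have "{x \<in> U. \<phi> x \<in> T} \<in> ?\<B>" using U T by (intro image_eqI[of _ _ "((U, \<phi>), T)"]) auto
    moreover have "x \<in> {x \<in> U. \<phi> x \<in> T}" using U T by blast
    ultimately show "\<exists>V\<in>?\<B>. x \<in> V \<and> V \<subseteq> S" by (intro bexI[of _ "{x \<in> U. \<phi> x \<in> T}"] conjI)
  qed
qed

end

section \<open>Smooth maps between manifolds\<close>

lemma smooth_mapI:
  assumes M: "premanifold M" and N: "premanifold N"
    and f: "\<And>p. p \<in> pts M \<Longrightarrow> f p \<in> pts N"
    and loc: "\<And>p. p \<in> pts M \<Longrightarrow> \<exists>V \<psi> S. (V, \<psi>) \<in> atlas N \<and> openin (mfd_topology M) S \<and> p \<in> S \<and>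
      f ` S \<subseteq> V \<and> sm_at M (\<lambda>x. \<psi> (f x)) p"
  shows "smooth_map M N f"
proof -
  \<comment> \<open>The hypothesis offers one chart at the image point, but
    \<open>smooth_map\<close> speaks of all. The overlap of the two chart domains is open in the
    coordinates of the first, so a neighbourhood of \<open>p\<close> lands in it, and injectivity of
    the first chart turns this into membership in the second domain.\<close>
  have *: "(\<exists>S. openin (mfd_topology M) S \<and> p \<in> S \<and> f ` S \<subseteq> V) \<and> sm_at M (\<lambda>x. \<psi> (f x)) p"
    if p: "p \<in> pts M" and V: "(V, \<psi>) \<in> atlas N" "f p \<in> V" for p V \<psi>
  proof -
    obtain V' \<psi>' S where V': "(V', \<psi>') \<in> atlas N" "openin (mfd_topology M) S" "p \<in> S"
      "f ` S \<subseteq> V'" "sm_at M (\<lambda>x. \<psi>' (f x)) p" using loc[OF p] by blast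
    have "\<psi>' (f p) \<in> \<psi>' ` (V' \<inter> V)" using V' V by auto
    then obtain S' where S': "openin (mfd_topology M) S'" "p \<in> S'" "\<And>x. x \<in> S' \<Longrightarrow> \<psi>' (f x) \<in> \<psi>' ` (V' \<inter> V)"
      using sm_at_preimage[OF M V'(5) chart_open_Int[OF N V'(1) V(1)]] by blast
    have fV: "f x \<in> V" if "x \<in> S \<inter> S'" for x
    proof -
      obtain y where y: "y \<in> V' \<inter> V" "\<psi>' (f x) = \<psi>' y" using S'(3) \<open>x \<in> S \<inter> S'\<close> by blast
      moreover have "f x \<in> V'" using V'(4) \<open>x \<in> S \<inter> S'\<close> by blast
      ultimately have "f x = y" using chart_inj[OF N V'(1)] by (meson IntD1 inj_onD)
      then show ?thesis using y by blast
    qed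
    have o: "openin (mfd_topology M) (S \<inter> S')" using V' S' by blast
    have "sm_at M (\<lambda>x. (\<psi> \<circ> the_inv_into V' \<psi>') (\<psi>' (f x))) p"
      by (rule sm_at_compose[OF M chart_transition[OF N V'(1) V(1)] V'(5) premanifold_findim[OF N]
            chart_open_Int[OF N V'(1) V(1)]]) fact
    then have "sm_at M (\<lambda>x. \<psi> (f x)) p"
      by (rule sm_at_cong[OF M _ V'(2,3)]) (use V'(4) chart_inv[OF N V'(1)] in auto)
    then show ?thesis using o V' S' fV by blast
  qed
  show ?thesis unfolding smooth_map_def
  proof (intro conjI)
    show "f ` pts M \<subseteq> pts N" using f by blast
    show "\<forall>(U, \<phi>)\<in>atlas M. \<forall>(V, \<psi>)\<in>atlas N. open (\<phi> ` (U \<inter> f -` V)) \<and>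
        smooth_on (\<phi> ` (U \<inter> f -` V)) (\<psi> \<circ> f \<circ> the_inv_into U \<phi>)"
    proof clarify
      fix U \<phi> V \<psi> assume U: "(U, \<phi>) \<in> atlas M" and V: "(V, \<psi>) \<in> atlas N"
      have o: "openin (mfd_topology M) (U \<inter> f -` V)"
      proof (subst openin_subopen, intro ballI)
        fix p assume p: "p \<in> U \<inter> f -` V"
        then have "p \<in> pts M" using chart_subset[OF M U] by blast
        then obtain S where "openin (mfd_topology M) S" "p \<in> S" "f ` S \<subseteq> V"
          using *[OF _ V] p by blast
        then show "\<exists>T. openin (mfd_topology M) T \<and> p \<in> T \<and> T \<subseteq> U \<inter> f -` V"
          using openin_chart[OF M U] p by (intro exI[of _ "S \<inter> U"]) auto
      qed
      have "\<forall>p\<in>U \<inter> f -` V. sm_at M (\<lambda>x. \<psi> (f x)) p"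
        using *[OF _ V] chart_subset[OF M U] by blast
      then have "smooth_on (\<phi> ` (U \<inter> f -` V)) ((\<lambda>x. \<psi> (f x)) \<circ> the_inv_into U \<phi>)"
        using smooth_on_chart_iff[OF M U o] by blast
      then show "open (\<phi> ` (U \<inter> f -` V)) \<and> smooth_on (\<phi> ` (U \<inter> f -` V)) (\<psi> \<circ> f \<circ> the_inv_into U \<phi>)"
        using open_chart_image[OF M o U] by (simp add: o_def)
    qed
  qed
qed

context
  fixes M :: "('a, 'e::real_inner) mfd" and N :: "('b, 'f::real_inner) mfd" and f
  assumes M: "premanifold M" and N: "premanifold N" and f: "smooth_map M N f"
begin

lemma smooth_map_pts: "p \<in> pts M \<Longrightarrow> f p \<in> pts N"
  using f unfolding smooth_map_def by blast

lemma smooth_map_chart: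
  assumes p: "p \<in> pts M" and V: "(V, \<psi>) \<in> atlas N" "f p \<in> V"
  obtains S where "openin (mfd_topology M) S" "p \<in> S" "f ` S \<subseteq> V" "sm_at M (\<lambda>x. \<psi> (f x)) p"
proof -
  obtain U \<phi> where U: "(U, \<phi>) \<in> atlas M" "p \<in> U" using chart_cover[OF M p] by blast
  have o: "open (\<phi> ` (U \<inter> f -` V))" and s: "smooth_on (\<phi> ` (U \<inter> f -` V)) (\<psi> \<circ> f \<circ> the_inv_into U \<phi>)"
    using f U V unfolding smooth_map_def by fast+
  have eq: "{x \<in> U. \<phi> x \<in> \<phi> ` (U \<inter> f -` V)} = U \<inter> f -` V"
    using chart_inj[OF M U(1)] by (auto simp: inj_on_def)
  have S: "openin (mfd_topology M) (U \<inter> f -` V)"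
    using openin_chart_preimage[OF M U(1) o] unfolding eq .
  have "\<forall>p\<in>U \<inter> f -` V. sm_at M (\<lambda>x. \<psi> (f x)) p"
    using smooth_on_chart_iff[OF M U(1) S, of "\<lambda>x. \<psi> (f x)"] s by (simp add: o_def)
  with S that U V show ?thesis by blast
qed

lemma smooth_map_openin_preimage:
  assumes W: "openin (mfd_topology N) W"
  shows "openin (mfd_topology M) {x \<in> pts M. f x \<in> W}"
proof (subst openin_subopen, intro ballI)
  fix p assume p: "p \<in> {x \<in> pts M. f x \<in> W}"
  then obtain V \<psi> where V: "(V, \<psi>) \<in> atlas N" "f p \<in> V" using chart_cover[OF N] smooth_map_pts by blast
  obtain S where S: "openin (mfd_topology M) S" "p \<in> S" "f ` S \<subseteq> V" "sm_at M (\<lambda>x. \<psi> (f x)) p"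
    using smooth_map_chart[OF _ V] p by blast
  have o: "open (\<psi> ` (W \<inter> V))"
    by (rule open_chart_image[OF N _ V(1)]) (use W openin_chart[OF N V(1)] in auto)
  obtain S' where S': "openin (mfd_topology M) S'" "p \<in> S'" "\<And>x. x \<in> S' \<Longrightarrow> \<psi> (f x) \<in> \<psi> ` (W \<inter> V)"
    using sm_at_preimage[OF M S(4) o] p V by blast
  have "f x \<in> W" if "x \<in> S \<inter> S'" for x
  proof -
    have "\<psi> (f x) \<in> \<psi> ` (W \<inter> V)" "f x \<in> V" using S S' that by auto
    then show ?thesis using chart_inj[OF N V(1)] by (auto simp: inj_on_def)
  qed
  then show "\<exists>T. openin (mfd_topology M) T \<and> p \<in> T \<and> T \<subseteq> {x \<in> pts M. f x \<in> W}"
    using S S' openin_mfd_subset[OF M S(1)] by (intro exI[of _ "S \<inter> S'"]) auto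
qed

lemma sm_at_pullback:
  assumes p: "p \<in> pts M" and g: "sm_at N g (f p)"
  shows "sm_at M (\<lambda>x. g (f x)) p"
proof -
  obtain V \<psi> where V: "(V, \<psi>) \<in> atlas N" "f p \<in> V" using chart_cover[OF N smooth_map_pts[OF p]] by blast
  obtain T where T: "openin (mfd_topology N) T" "f p \<in> T" "T \<subseteq> V" "open (\<psi> ` T)"
    "smooth_on (\<psi> ` T) (g \<circ> the_inv_into V \<psi>)" using sm_at_chartE[OF N g V] by blast
  obtain S where S: "openin (mfd_topology M) S" "p \<in> S" "f ` S \<subseteq> V" "sm_at M (\<lambda>x. \<psi> (f x)) p"
    using smooth_map_chart[OF p V] by blast
  have "sm_at M (\<lambda>x. (g \<circ> the_inv_into V \<psi>) (\<psi> (f x))) p"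
    by (rule sm_at_compose[OF M T(5) S(4) premanifold_findim[OF N] T(4)]) (use T in blast)
  then show ?thesis
    by (rule sm_at_cong[OF M _ S(1,2)]) (use S(3) chart_inv[OF N V(1)] in auto)
qed

end

text \<open>A second countable space is Lindelof. This selects countably many trivialising chart
  domains of the base, from which countable atlases of the jet bundle and of the base product are
  built.\<close>

lemma smooth_manifold_countable_subcover:
  assumes M: "smooth_manifold M" and I: "\<And>i. i \<in> I \<Longrightarrow> openin (mfd_topology M) (X i)" "(\<Union>i\<in>I. X i) = pts M"
  obtains J where "countable J" "J \<subseteq> I" "(\<Union>i\<in>J. X i) = pts M"
proof -
  have "Lindelof_space (mfd_topology M)"
    using M second_countable_imp_Lindelof_space unfolding smooth_manifold_iff by blast
  moreover have "topspace (mfd_topology M) = pts M"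
    using M topspace_mfd unfolding smooth_manifold_iff by blast
  moreover have "\<forall>V\<in>X ` I. openin (mfd_topology M) V" "\<Union>(X ` I) = pts M" using I by auto
  ultimately obtain \<V> where "countable \<V>" "\<V> \<subseteq> X ` I" "\<Union>\<V> = pts M"
    unfolding Lindelof_space_def by metis
  then show ?thesis using that by (metis countable_subset_image)
qed

text \<open>The Hausdorff property enters here: the chart preimage of a closed ball is compact,
  therefore closed in the whole manifold, and the extension by zero is smooth across its boundary.
  The closed set \<open>C\<close> is part of the result because its complement is an open set on
  which products with the function vanish.\<close>

lemma bump_function:
  fixes M :: "('a, 'e::real_inner) mfd"
  assumes SM: "smooth_manifold M" and S: "openin (mfd_topology M) S" "p \<in> S"
  obtains \<theta> C where "\<theta> \<in> smooth_funs M" "\<theta> p = 1" "closedin (mfd_topology M) C" "C \<subseteq> S"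
    "\<And>x. x \<notin> C \<Longrightarrow> \<theta> x = 0"
proof -
  have M: "premanifold M" and H: "Hausdorff_space (mfd_topology M)" using SM smooth_manifold_iff by blast+
  have "p \<in> pts M" using S openin_mfd_subset[OF M] by blast
  then obtain U \<phi> where U: "(U, \<phi>) \<in> atlas M" "p \<in> U" using chart_cover[OF M] by blast
  have "open (\<phi> ` (S \<inter> U))"
    by (rule open_chart_image[OF M _ U(1)]) (use S openin_chart[OF M U(1)] in auto)
  then obtain r where r: "r > 0" "cball (\<phi> p) r \<subseteq> \<phi> ` (S \<inter> U)"
    unfolding open_contains_cball using S(2) U(2) by blast
  obtain \<beta> :: "'e \<Rightarrow> real" where b: "smooth_on UNIV \<beta>" "\<beta> (\<phi> p) = 1" "\<And>y. y \<notin> cball (\<phi> p) r \<Longrightarrow> \<beta> y = 0"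
    using smooth_bump[OF r(1)] by blast
  define C where "C = the_inv_into U \<phi> ` cball (\<phi> p) r"
  define \<theta> where "\<theta> x = (if x \<in> U then \<beta> (\<phi> x) else 0)" for x
  have inv: "the_inv_into U \<phi> y \<in> S \<inter> U" "\<phi> (the_inv_into U \<phi> y) = y" if "y \<in> cball (\<phi> p) r" for y
    using r(2) that chart_inv[OF M U(1)] by auto
  have CS: "C \<subseteq> S \<inter> U" unfolding C_def using inv by blast
  have th0: "\<theta> x = 0" if "x \<notin> C" for x
    unfolding \<theta>_def using b(3) that chart_inv[OF M U(1)] by (metis C_def imageI)
  have "compactin (mfd_topology M) C"
    unfolding compactin_def topspace_mfd[OF M]
  proof (intro conjI allI impI)
    show "C \<subseteq> pts M" using CS chart_subset[OF M U(1)] by blast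
    fix \<U> assume \<U>: "Ball \<U> (openin (mfd_topology M)) \<and> C \<subseteq> \<Union>\<U>"
    have "open (\<phi> ` (W \<inter> U))" if "W \<in> \<U>" for W
      by (rule open_chart_image[OF M _ U(1)]) (use \<U> that openin_chart[OF M U(1)] in auto)
    moreover have "cball (\<phi> p) r \<subseteq> (\<Union>W\<in>\<U>. \<phi> ` (W \<inter> U))"
    proof
      fix y assume y: "y \<in> cball (\<phi> p) r"
      then have "the_inv_into U \<phi> y \<in> C" by (simp add: C_def)
      then obtain W where "W \<in> \<U>" "the_inv_into U \<phi> y \<in> W" using \<U> by blast
      then show "y \<in> (\<Union>W\<in>\<U>. \<phi> ` (W \<inter> U))" using inv[OF y] by (metis IntD2 IntI UN_I image_eqI)
    qed
    ultimately obtain \<F> where F: "\<F> \<subseteq> \<U>" "finite \<F>" "cball (\<phi> p) r \<subseteq> (\<Union>W\<in>\<F>. \<phi> ` (W \<inter> U))"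
      by (rule compactE_image[OF findim_compact_cball[OF premanifold_findim[OF M], of "\<phi> p" r]])
    have "C \<subseteq> \<Union>\<F>"
    proof
      fix x assume "x \<in> C"
      then have "x \<in> U" "\<phi> x \<in> cball (\<phi> p) r" using CS inv by (auto simp: C_def)
      then obtain W where "W \<in> \<F>" "\<phi> x \<in> \<phi> ` (W \<inter> U)" using F(3) by blast
      then show "x \<in> \<Union>\<F>" using chart_inj[OF M U(1)] \<open>x \<in> U\<close> by (auto simp: inj_on_def)
    qed
    then show "\<exists>\<F>. finite \<F> \<and> \<F> \<subseteq> \<U> \<and> C \<subseteq> \<Union>\<F>" using F by blast
  qed
  then have clo: "closedin (mfd_topology M) C" using compactin_imp_closedin[OF H] by blast
  have "sm_at M \<theta> q" if q: "q \<in> pts M" for q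
  proof (cases "q \<in> U")
    case True
    have "sm_at M (\<lambda>x. \<beta> (\<phi> x)) q"
      by (rule sm_at_compose[OF M b(1) sm_at_chart[OF M U(1) True] premanifold_findim[OF M]]) auto
    then show ?thesis
      by (rule sm_at_cong[OF M _ openin_chart[OF M U(1)] True]) (simp add: \<theta>_def)
  next
    case False
    have "openin (mfd_topology M) (pts M - C)"
      using clo topspace_mfd[OF M] by (metis closedin_def)
    then show ?thesis
      by (rule sm_at_cong[OF M sm_at_const[OF M q]]) (use q False CS th0 in auto)
  qed
  then have "\<theta> \<in> smooth_funs M"
    unfolding smooth_funs_iff[OF M] zero_off_def \<theta>_def using chart_subset[OF M U(1)] by auto
  moreover have "\<theta> p = 1" using U b by (simp add: \<theta>_def)
  ultimately show ?thesis using that clo CS th0 by blast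
qed

lemma sm_at_extend:
  assumes M: "premanifold M" and \<theta>: "\<theta> \<in> smooth_funs M" and C: "closedin (mfd_topology M) C"
    "C \<subseteq> S" "\<And>x. x \<notin> C \<Longrightarrow> \<theta> x = 0" and S: "openin (mfd_topology M) S"
    and f: "\<And>x. x \<in> S \<Longrightarrow> sm_at M f x" and p: "p \<in> pts M"
  shows "sm_at M (\<lambda>x. if x \<in> S then \<theta> x *\<^sub>R f x else 0) p"
proof (cases "p \<in> S")
  case True
  then have "sm_at M (\<lambda>x. \<theta> x *\<^sub>R f x) p"
    using \<theta> p f smooth_funs_iff[OF M] sm_at_scaleR[OF M] by blast
  then show ?thesis by (rule sm_at_cong[OF M _ S True]) simp
next
  case False
  have "openin (mfd_topology M) (pts M - C)" using C(1) topspace_mfd[OF M] by (metis closedin_def)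
  then show ?thesis
    by (rule sm_at_cong[OF M sm_at_const[OF M p]]) (use p False C in auto)
qed


section \<open>Derivatives in a chart\<close>

definition chart_deriv ::
    "'a set \<Rightarrow> ('a \<Rightarrow> 'e::real_inner) \<Rightarrow> ('a \<Rightarrow> 'b::real_normed_vector) \<Rightarrow> 'a \<Rightarrow> 'e \<Rightarrow> 'b" where
  "chart_deriv A \<phi> f x e = frechet_derivative (f \<circ> the_inv_into A \<phi>) (at (\<phi> x)) e"

context
  fixes M :: "('a, 'e::real_inner) mfd" and A \<phi> x
  assumes M: "premanifold M" and A: "(A, \<phi>) \<in> atlas M" and x: "x \<in> A"
begin

lemma chart_deriv_has: "sm_at M f x \<Longrightarrow> ((f \<circ> the_inv_into A \<phi>) has_derivative chart_deriv A \<phi> f x) (at (\<phi> x))"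
  using sm_at_has_derivative[OF M _ A x] by (simp add: chart_deriv_def[abs_def])

lemma chart_deriv_unique: "((f \<circ> the_inv_into A \<phi>) has_derivative D) (at (\<phi> x)) \<Longrightarrow> chart_deriv A \<phi> f x = D"
  unfolding chart_deriv_def[abs_def] using frechet_derivative_at by metis

lemma sm_at_chart_deriv: "sm_at M f x \<Longrightarrow> sm_at M (\<lambda>y. chart_deriv A \<phi> f y v) x"
  unfolding chart_deriv_def using sm_at_derivative[OF M _ A x] .

lemma chart_deriv_linear: "sm_at M f x \<Longrightarrow> linear (chart_deriv A \<phi> f x)"
  using chart_deriv_has has_derivative_linear by blast

lemma chart_deriv_const: "chart_deriv A \<phi> (\<lambda>y. c) x e = 0"
  using chart_deriv_unique[of "\<lambda>y. c" "\<lambda>e. 0"] by (simp add: o_def)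

lemma chart_deriv_add:
  "sm_at M f x \<Longrightarrow> sm_at M g x \<Longrightarrow>
    chart_deriv A \<phi> (\<lambda>y. f y + g y) x e = chart_deriv A \<phi> f x e + chart_deriv A \<phi> g x e"
  using chart_deriv_unique[of "\<lambda>y. f y + g y"] has_derivative_add[OF chart_deriv_has[of f] chart_deriv_has[of g]]
  by (simp add: o_def)

lemma chart_deriv_bilinear:
  assumes "bounded_bilinear pr" "sm_at M f x" "sm_at M g x"
  shows "chart_deriv A \<phi> (\<lambda>y. pr (f y) (g y)) x e =
    pr (f x) (chart_deriv A \<phi> g x e) + pr (chart_deriv A \<phi> f x e) (g x)"
  using chart_deriv_unique[of "\<lambda>y. pr (f y) (g y)"]
    bounded_bilinear.FDERIV[OF assms(1) chart_deriv_has[OF assms(2)] chart_deriv_has[OF assms(3)]]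
    chart_inv[OF M A x]
  by (simp add: o_def)

lemma chart_deriv_mult:
  fixes f g :: "'a \<Rightarrow> real"
  shows "sm_at M f x \<Longrightarrow> sm_at M g x \<Longrightarrow>
    chart_deriv A \<phi> (\<lambda>y. f y * g y) x e = f x * chart_deriv A \<phi> g x e + chart_deriv A \<phi> f x e * g x"
  by (rule chart_deriv_bilinear[OF bounded_bilinear_mult])

lemma chart_deriv_cmult:
  fixes f :: "'a \<Rightarrow> real"
  shows "sm_at M f x \<Longrightarrow> chart_deriv A \<phi> (\<lambda>y. c * f y) x e = c * chart_deriv A \<phi> f x e"
  using chart_deriv_mult[OF sm_at_const[OF M, of x c], of f] chart_deriv_const[of c]
    subsetD[OF chart_subset[OF M A] x] by simp

lemma chart_deriv_sum:
  assumes "finite I" "\<And>i. i \<in> I \<Longrightarrow> sm_at M (f i) x"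
  shows "chart_deriv A \<phi> (\<lambda>y. \<Sum>i\<in>I. f i y) x e = (\<Sum>i\<in>I. chart_deriv A \<phi> (f i) x e)"
  using assms
proof (induction I)
  case empty
  then show ?case using chart_deriv_const[of 0] by simp
next
  case (insert i I)
  have "x \<in> pts M" using chart_subset[OF M A] x by blast
  then show ?case using insert by (simp add: chart_deriv_add sm_at_sum[OF M])
qed

lemma chart_deriv_cong:
  assumes "openin (mfd_topology M) W" "x \<in> W" "\<And>y. y \<in> W \<Longrightarrow> f y = g y" "sm_at M f x"
  shows "chart_deriv A \<phi> f x = chart_deriv A \<phi> g x"
proof -
  have o: "open (\<phi> ` (W \<inter> A))"
    by (rule open_chart_image[OF M _ A]) (use openin_chart[OF M A] assms(1) in auto)
  have "((g \<circ> the_inv_into A \<phi>) has_derivative chart_deriv A \<phi> f x) (at (\<phi> x))"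
    by (rule has_derivative_transform_within_open[OF chart_deriv_has[OF assms(4)] o])
       (use x assms(2,3) chart_inv[OF M A] in auto)
  then show ?thesis using chart_deriv_unique by metis
qed

lemma chart_deriv_chart: "chart_deriv A \<phi> \<phi> x e = e"
proof -
  have "((\<phi> \<circ> the_inv_into A \<phi>) has_derivative (\<lambda>e. e)) (at (\<phi> x))"
    by (rule has_derivative_transform_within_open[OF has_derivative_ident chart_open_image[OF M A]])
       (use x chart_inv[OF M A] in auto)
  then show ?thesis using chart_deriv_unique by metis
qed

lemma chart_deriv_compose:
  assumes "sm_at M u x" "(F has_derivative D) (at (u x))"
  shows "chart_deriv A \<phi> (\<lambda>y. F (u y)) x e = D (chart_deriv A \<phi> u x e)"
proof -
  have "((\<lambda>y. F ((u \<circ> the_inv_into A \<phi>) y)) has_derivative (\<lambda>e. D (chart_deriv A \<phi> u x e))) (at (\<phi> x))"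
    by (rule has_derivative_compose[OF chart_deriv_has[OF assms(1)]])
       (use assms(2) chart_inv[OF M A x] in simp)
  then show ?thesis using chart_deriv_unique[of "\<lambda>y. F (u y)"] by (simp add: o_def)
qed

lemma chart_deriv_bounded_linear:
  assumes "bounded_linear F" "sm_at M u x"
  shows "chart_deriv A \<phi> (\<lambda>y. F (u y)) x e = F (chart_deriv A \<phi> u x e)"
  using chart_deriv_compose[OF assms(2) bounded_linear_imp_has_derivative[OF assms(1)]] .

end

text \<open>\<open>chart_deriv A' \<phi>' \<phi> x\<close> is the Jacobian of the change of charts;
  the identity is the chain rule for the coordinate expression of \<open>f\<close> composed with
  \<open>\<phi>\<close>.\<close>

lemma chart_deriv_change:
  assumes M: "premanifold M" and A: "(A, \<phi>) \<in> atlas M" "x \<in> A" and A': "(A', \<phi>') \<in> atlas M" "x \<in> A'"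
    and f: "sm_at M f x"
  shows "chart_deriv A' \<phi>' f x e = chart_deriv A \<phi> f x (chart_deriv A' \<phi>' \<phi> x e)"
proof -
  have "chart_deriv A' \<phi>' (\<lambda>y. (f \<circ> the_inv_into A \<phi>) (\<phi> y)) x e =
      chart_deriv A \<phi> f x (chart_deriv A' \<phi>' \<phi> x e)"
    by (rule chart_deriv_compose[OF M A' sm_at_chart[OF M A] chart_deriv_has[OF M A f]])
  moreover have "chart_deriv A' \<phi>' f x = chart_deriv A' \<phi>' (\<lambda>y. (f \<circ> the_inv_into A \<phi>) (\<phi> y)) x"
    by (rule chart_deriv_cong[OF M A' openin_chart[OF M A(1)] A(2) _ f]) (simp add: chart_inv[OF M A(1)])
  ultimately show ?thesis by simp
qed


section \<open>Sections of line bundles\<close>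

lemma linear_iso_betwD:
  assumes "linear_iso_betw V W f"
  shows "bij_betw f V W" "u \<in> V \<Longrightarrow> v \<in> V \<Longrightarrow> f (u + v) = f u + f v" "v \<in> V \<Longrightarrow> f (c *\<^sub>R v) = c *\<^sub>R f v"
    "v \<in> V \<Longrightarrow> f v \<in> W" "inj_on f V"
  using assms unfolding linear_iso_betw_def by (auto simp: bij_betw_def)

lemma linear_iso_betw_inv:
  assumes "linear_iso_betw V W f" "subspace V"
  shows "w \<in> W \<Longrightarrow> the_inv_into V f w \<in> V" "w \<in> W \<Longrightarrow> f (the_inv_into V f w) = w"
    "v \<in> V \<Longrightarrow> the_inv_into V f (f v) = v"
    "w \<in> W \<Longrightarrow> w' \<in> W \<Longrightarrow> the_inv_into V f (w + w') = the_inv_into V f w + the_inv_into V f w'"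
    "w \<in> W \<Longrightarrow> the_inv_into V f (c *\<^sub>R w) = c *\<^sub>R the_inv_into V f w"
proof -
  note f = linear_iso_betwD[OF assms(1)]
  note inv = the_inv_into_f_f[OF f(5)]
  show i: "w \<in> W \<Longrightarrow> the_inv_into V f w \<in> V" for w
    using f(1) by (metis bij_betw_def order_refl the_inv_into_into)
  show fi: "w \<in> W \<Longrightarrow> f (the_inv_into V f w) = w" for w
    using f(1) by (metis bij_betw_def f_the_inv_into_f)
  show "v \<in> V \<Longrightarrow> the_inv_into V f (f v) = v" using inv .
  show "w \<in> W \<Longrightarrow> w' \<in> W \<Longrightarrow> the_inv_into V f (w + w') = the_inv_into V f w + the_inv_into V f w'"
    using inv[of "the_inv_into V f w + the_inv_into V f w'"] i fi f(2) subspace_add[OF assms(2)] by metis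
  show "w \<in> W \<Longrightarrow> the_inv_into V f (c *\<^sub>R w) = c *\<^sub>R the_inv_into V f w"
    using inv[of "c *\<^sub>R the_inv_into V f w"] i fi f(3) subspace_scale[OF assms(2)] by metis
qed

text \<open>Transition maps may be given by any explicit \<open>E\<close> relating the two charts,
  so that chart inverses need not be computed. The case of a chart and itself yields the openness of
  its image.\<close>

lemma premanifoldI:
  fixes M :: "('a, 'e::real_inner) mfd"
  assumes "findim TYPE('e::real_inner)" "(\<Union>(U, \<phi>)\<in>atlas M. U) = pts M"
    "\<And>U \<phi>. (U, \<phi>) \<in> atlas M \<Longrightarrow> inj_on \<phi> U"
    "\<And>U \<phi> V \<psi>. (U, \<phi>) \<in> atlas M \<Longrightarrow> (V, \<psi>) \<in> atlas M \<Longrightarrow>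
       open (\<phi> ` (U \<inter> V)) \<and> (\<exists>E. smooth_on (\<phi> ` (U \<inter> V)) E \<and> (\<forall>x\<in>U \<inter> V. \<psi> x = E (\<phi> x)))"
  shows "premanifold M"
  unfolding premanifold_def
proof (intro conjI)
  show "\<forall>(U, \<phi>)\<in>atlas M. inj_on \<phi> U \<and> open (\<phi> ` U)"
    using assms(3,4) by (metis (no_types, lifting) Int_absorb case_prodI2)
  show "\<forall>(U, \<phi>)\<in>atlas M. \<forall>(V, \<psi>)\<in>atlas M. open (\<phi> ` (U \<inter> V)) \<and>
      smooth_on (\<phi> ` (U \<inter> V)) (\<psi> \<circ> the_inv_into U \<phi>)"
  proof clarify
    fix U \<phi> V \<psi> assume U: "(U, \<phi>) \<in> atlas M" and V: "(V, \<psi>) \<in> atlas M"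
    obtain E where E: "open (\<phi> ` (U \<inter> V))" "smooth_on (\<phi> ` (U \<inter> V)) E" "\<forall>x\<in>U \<inter> V. \<psi> x = E (\<phi> x)"
      using assms(4)[OF U V] by blast
    have "smooth_on (\<phi> ` (U \<inter> V)) (\<psi> \<circ> the_inv_into U \<phi>)"
      by (rule smooth_on_cong[OF E(1) _ E(2)]) (use E(3) assms(3)[OF U] in \<open>auto simp: the_inv_into_f_f\<close>)
    then show "open (\<phi> ` (U \<inter> V)) \<and> smooth_on (\<phi> ` (U \<inter> V)) (\<psi> \<circ> the_inv_into U \<phi>)"
      using E(1) by blast
  qed
qed (use assms in auto)

section \<open>Trivialisations, the total space and global sections\<close>

context
  fixes L :: "('q, 'v::real_vector, 'e::real_inner) line_bundle"
  assumes L: "line_bundle L"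
begin

lemma base_manifold: "smooth_manifold (base L)"
  using L unfolding line_bundle_def by blast

lemma base_premanifold: "premanifold (base L)"
  using base_manifold smooth_manifold_iff by blast

lemma fib_subspace: "x \<in> pts (base L) \<Longrightarrow> subspace (fib L x)"
  using L unfolding line_bundle_def by blast

lemma triv_cover: "x \<in> pts (base L) \<Longrightarrow> \<exists>U h. (U, h) \<in> trivs L \<and> x \<in> U"
  using L unfolding line_bundle_def by blast

lemma triv_subset: "(U, h) \<in> trivs L \<Longrightarrow> U \<subseteq> pts (base L)"
  using L unfolding line_bundle_def by blast

lemma triv_openin: "(U, h) \<in> trivs L \<Longrightarrow> openin (mfd_topology (base L)) U"
  using L unfolding line_bundle_def by blast

lemma triv_iso: "(U, h) \<in> trivs L \<Longrightarrow> x \<in> U \<Longrightarrow> linear_iso_betw (fib L x) UNIV (h x)"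
  using L unfolding line_bundle_def by blast

text \<open>A zero of the transition function would make the isomorphism \<open>k x\<close> vanish
  identically, against its surjectivity onto the reals.\<close>

lemma triv_change:
  assumes "(U, h) \<in> trivs L" "(V, k) \<in> trivs L"
  shows "\<exists>g. \<forall>x\<in>U \<inter> V. sm_at (base L) g x \<and> g x \<noteq> 0 \<and> (\<forall>v\<in>fib L x. k x v = g x * h x v)"
proof -
  obtain g where g: "smooth_fun_on (base L) (U \<inter> V) g"
    "\<forall>x\<in>U \<inter> V. \<forall>v\<in>fib L x. k x v = g x * h x v"
    using L assms unfolding line_bundle_def by fast
  have "openin (mfd_topology (base L)) (U \<inter> V)" using triv_openin assms by blast
  then have "\<forall>x\<in>U \<inter> V. sm_at (base L) g x" using g(1) smooth_fun_on_iff[OF base_premanifold] by blast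
  moreover have "g x \<noteq> 0" if x: "x \<in> U \<inter> V" for x
  proof
    assume "g x = 0"
    then have "k x v = 0" if "v \<in> fib L x" for v using g(2) x that by auto
    moreover have "bij_betw (k x) (fib L x) UNIV"
      using linear_iso_betwD(1)[OF triv_iso[OF assms(2)]] x by blast
    ultimately have "(1::real) \<in> {0}" unfolding bij_betw_def by fastforce
    then show False by simp
  qed
  ultimately show ?thesis using g(2) by (intro exI[of _ g]) auto
qed

lemma triv_add: "(U, h) \<in> trivs L \<Longrightarrow> x \<in> U \<Longrightarrow> u \<in> fib L x \<Longrightarrow> v \<in> fib L x \<Longrightarrow> h x (u + v) = h x u + h x v"
  and triv_scale: "(U, h) \<in> trivs L \<Longrightarrow> x \<in> U \<Longrightarrow> v \<in> fib L x \<Longrightarrow> h x (c *\<^sub>R v) = c * h x v"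
  using linear_iso_betwD[OF triv_iso] by auto

lemma triv_zero: "(U, h) \<in> trivs L \<Longrightarrow> x \<in> U \<Longrightarrow> h x 0 = 0"
  using triv_scale[of U h x 0 0] triv_subset fib_subspace subspace_0 by fastforce

lemma triv_inv:
  assumes "(U, h) \<in> trivs L" "x \<in> U"
  shows "the_inv_into (fib L x) (h x) r \<in> fib L x" "h x (the_inv_into (fib L x) (h x) r) = r"
    "v \<in> fib L x \<Longrightarrow> the_inv_into (fib L x) (h x) (h x v) = v"
    "the_inv_into (fib L x) (h x) (r + r') = the_inv_into (fib L x) (h x) r + the_inv_into (fib L x) (h x) r'"
    "the_inv_into (fib L x) (h x) (c * r) = c *\<^sub>R the_inv_into (fib L x) (h x) r"
proof -
  have "subspace (fib L x)" using assms triv_subset fib_subspace by blast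
  note inv = linear_iso_betw_inv[OF triv_iso[OF assms] this]
  show "the_inv_into (fib L x) (h x) r \<in> fib L x" "h x (the_inv_into (fib L x) (h x) r) = r"
    "v \<in> fib L x \<Longrightarrow> the_inv_into (fib L x) (h x) (h x v) = v"
    "the_inv_into (fib L x) (h x) (r + r') = the_inv_into (fib L x) (h x) r + the_inv_into (fib L x) (h x) r'"
    "the_inv_into (fib L x) (h x) (c * r) = c *\<^sub>R the_inv_into (fib L x) (h x) r"
    using inv by auto
qed

lemma triv_eqI: "(U, h) \<in> trivs L \<Longrightarrow> x \<in> U \<Longrightarrow> u \<in> fib L x \<Longrightarrow> v \<in> fib L x \<Longrightarrow> h x u = h x v \<Longrightarrow> u = v"
  using linear_iso_betwD(5)[OF triv_iso] by (meson inj_onD)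

lemma total_chart_image:
  assumes "(U, h) \<in> trivs L" "W \<subseteq> U"
  shows "(\<lambda>(x, v). (\<phi> x, h x v)) ` Sigma W (fib L) = \<phi> ` W \<times> UNIV"
proof safe
  fix x r assume x: "x \<in> W"
  then have "(x, the_inv_into (fib L x) (h x) r) \<in> Sigma W (fib L)"
    using triv_inv(1)[OF assms(1)] assms(2) by blast
  moreover have "(\<phi> x, r) = (\<lambda>(x, v). (\<phi> x, h x v)) (x, the_inv_into (fib L x) (h x) r)"
    using triv_inv(2)[OF assms(1)] assms(2) x by auto
  ultimately show "(\<phi> x, r) \<in> (\<lambda>(x, v). (\<phi> x, h x v)) ` Sigma W (fib L)" by (rule image_eqI[rotated])
qed auto

lemma premanifold_total_space: "premanifold (total_space L)"
proof (rule premanifoldI)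
  note M = base_premanifold
  show "findim TYPE('e \<times> real)" using findim_prod[OF premanifold_findim[OF M] findim_real] .
  show "(\<Union>(U, \<phi>)\<in>atlas (total_space L). U) = pts (total_space L)"
  proof
    show "(\<Union>(U, \<phi>)\<in>atlas (total_space L). U) \<subseteq> pts (total_space L)"
      using triv_subset unfolding total_space_def by fastforce
    show "pts (total_space L) \<subseteq> (\<Union>(U, \<phi>)\<in>atlas (total_space L). U)"
    proof
      fix z assume "z \<in> pts (total_space L)"
      then obtain x v where z: "z = (x, v)" "x \<in> pts (base L)" "v \<in> fib L x"
        by (auto simp: total_space_def)
      obtain A \<phi> where A: "(A, \<phi>) \<in> atlas (base L)" "x \<in> A" using chart_cover[OF M z(2)] by blast
      obtain U h where U: "(U, h) \<in> trivs L" "x \<in> U" using triv_cover[OF z(2)] by blast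
      have "(Sigma (A \<inter> U) (fib L), \<lambda>(x, v). (\<phi> x, h x v)) \<in> atlas (total_space L)"
        using A U unfolding total_space_def by auto
      moreover have "z \<in> Sigma (A \<inter> U) (fib L)" using z A U by auto
      ultimately show "z \<in> (\<Union>(U, \<phi>)\<in>atlas (total_space L). U)" by blast
    qed
  qed
  fix D \<Phi> assume "(D, \<Phi>) \<in> atlas (total_space L)"
  then obtain A \<phi> U h where c: "D = Sigma (A \<inter> U) (fib L)" "\<Phi> = (\<lambda>(x, v). (\<phi> x, h x v))"
    "(A, \<phi>) \<in> atlas (base L)" "(U, h) \<in> trivs L" unfolding total_space_def by auto
  show "inj_on \<Phi> D"
    unfolding c(1,2) using chart_inj[OF M c(3)] linear_iso_betwD(5)[OF triv_iso[OF c(4)]]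
    by (auto simp: inj_on_def)
  fix D' \<Phi>' assume "(D', \<Phi>') \<in> atlas (total_space L)"
  then obtain A' \<phi>' U' h' where c': "D' = Sigma (A' \<inter> U') (fib L)" "\<Phi>' = (\<lambda>(x, v). (\<phi>' x, h' x v))"
    "(A', \<phi>') \<in> atlas (base L)" "(U', h') \<in> trivs L" unfolding total_space_def by auto
  obtain g where "\<forall>x\<in>U \<inter> U'. sm_at (base L) g x \<and> g x \<noteq> 0 \<and> (\<forall>v\<in>fib L x. h' x v = g x * h x v)"
    using triv_change[OF c(4) c'(4)] by blast
  then have g: "\<And>x. x \<in> U \<inter> U' \<Longrightarrow> sm_at (base L) g x"
    "\<And>x v. x \<in> U \<inter> U' \<Longrightarrow> v \<in> fib L x \<Longrightarrow> h' x v = g x * h x v" by blast+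
  define W where "W = A \<inter> U \<inter> (A' \<inter> U')"
  have DD: "D \<inter> D' = Sigma W (fib L)" unfolding c c' W_def by blast
  have im: "\<Phi> ` (D \<inter> D') = \<phi> ` W \<times> UNIV"
    unfolding DD c(2) by (rule total_chart_image[OF c(4)]) (auto simp: W_def)
  have oW: "openin (mfd_topology (base L)) W"
    unfolding W_def using openin_chart[OF M] triv_openin c c' by blast
  have o: "open (\<phi> ` W)" by (rule open_chart_image[OF M oW c(3)]) (auto simp: W_def)
  have o2: "open (\<phi> ` W \<times> (UNIV :: real set))" using o by (simp add: open_Times)
  have gs: "smooth_on (\<phi> ` W) (g \<circ> the_inv_into A \<phi>)"
    using smooth_on_chart_iff[OF M c(3) oW] g(1) by (auto simp: W_def)
  have fs: "smooth_on (\<phi> ` W) (\<phi>' \<circ> the_inv_into A \<phi>)"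
    by (rule smooth_on_subset[OF chart_transition[OF M c(3) c'(3)]]) (auto simp: W_def)
  \<comment> \<open>Base coordinates change by the chart transition, the fibre coordinate by
    multiplication with the transition function \<open>g\<close>.\<close>
  define E where "E = (\<lambda>z. ((\<phi>' \<circ> the_inv_into A \<phi>) (fst z), (g \<circ> the_inv_into A \<phi>) (fst z) * (snd z :: real)))"
  have "smooth_on (\<phi> ` W \<times> UNIV) E"
    unfolding E_def
    by (intro smooth_intros o2 smooth_on_compose[OF fs _ premanifold_findim[OF M] o2 o]
          smooth_on_compose[OF gs _ premanifold_findim[OF M] o2 o]) auto
  moreover have "\<forall>z\<in>D \<inter> D'. \<Phi>' z = E (\<Phi> z)"
    unfolding DD c(2) c'(2) E_def using g(2) chart_inv[OF M c(3)] by (auto simp: W_def)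
  ultimately show "open (\<Phi> ` (D \<inter> D')) \<and> (\<exists>E. smooth_on (\<Phi> ` (D \<inter> D')) E \<and> (\<forall>x\<in>D \<inter> D'. \<Phi>' x = E (\<Phi> x)))"
    unfolding im using o2 by blast
qed

lemma sm_at_triv_change:
  assumes "(U, h) \<in> trivs L" "(V, k) \<in> trivs L" "x \<in> U" "x \<in> V"
    "\<And>y. y \<in> pts (base L) \<Longrightarrow> s y \<in> fib L y" "sm_at (base L) (\<lambda>y. h y (s y)) x"
  shows "sm_at (base L) (\<lambda>y. k y (s y)) x"
proof -
  obtain g where "\<forall>x\<in>U \<inter> V. sm_at (base L) g x \<and> g x \<noteq> 0 \<and> (\<forall>v\<in>fib L x. k x v = g x * h x v)"
    using triv_change[OF assms(1,2)] by blast
  then have g: "\<And>x. x \<in> U \<inter> V \<Longrightarrow> sm_at (base L) g x"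
    "\<And>x v. x \<in> U \<inter> V \<Longrightarrow> v \<in> fib L x \<Longrightarrow> k x v = g x * h x v" by blast+
  have "sm_at (base L) (\<lambda>y. g y * h y (s y)) x"
    using sm_at_mult[OF base_premanifold g(1) assms(6)] assms(3,4) by blast
  moreover have "openin (mfd_topology (base L)) (U \<inter> V)" using assms(1,2) triv_openin by blast
  ultimately show ?thesis
    by (rule sm_at_cong[OF base_premanifold])
       (use assms(3,4,5) g(2) triv_subset[OF assms(1)] in auto)
qed

text \<open>The base component of \<open>x \<mapsto> (x, s x)\<close> is the identity, so smoothness
  into the total space is carried by the fibre coordinates alone.\<close>

lemma sections_iff:
  "s \<in> sections L \<longleftrightarrow> zero_off (pts (base L)) s \<and> (\<forall>x\<in>pts (base L). s x \<in> fib L x) \<and>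
    (\<forall>U h x. (U, h) \<in> trivs L \<longrightarrow> x \<in> U \<longrightarrow> sm_at (base L) (\<lambda>y. h y (s y)) x)"
proof -
  note M = base_premanifold and N = premanifold_total_space
  let ?f = "\<lambda>x. (x, s x)"
  have ch: "(Sigma (A \<inter> U) (fib L), \<lambda>(x, v). (\<phi> x, h x v)) \<in> atlas (total_space L)"
    if "(A, \<phi>) \<in> atlas (base L)" "(U, h) \<in> trivs L" for A \<phi> U h
    unfolding total_space_def using that by auto
  have "smooth_map (base L) (total_space L) ?f \<longleftrightarrow> (\<forall>x\<in>pts (base L). s x \<in> fib L x) \<and>
    (\<forall>U h x. (U, h) \<in> trivs L \<longrightarrow> x \<in> U \<longrightarrow> sm_at (base L) (\<lambda>y. h y (s y)) x)" (is "?l \<longleftrightarrow> ?r")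
  proof
    assume l: ?l
    have sf: "\<forall>x\<in>pts (base L). s x \<in> fib L x"
      using smooth_map_pts[OF M N l] by (simp add: total_space_def)
    moreover have "sm_at (base L) (\<lambda>y. h y (s y)) x" if U: "(U, h) \<in> trivs L" "x \<in> U" for U h x
    proof -
      have x: "x \<in> pts (base L)" using U triv_subset by blast
      then obtain A \<phi> where A: "(A, \<phi>) \<in> atlas (base L)" "x \<in> A" using chart_cover[OF M] by blast
      have "(x, s x) \<in> Sigma (A \<inter> U) (fib L)" using A U sf x by blast
      from smooth_map_chart[OF M N l x ch[OF A(1) U(1)] this] obtain S
        where "sm_at (base L) (\<lambda>x. (\<lambda>(x, v). (\<phi> x, h x v)) (x, s x)) x" by blast
      from sm_at_snd[OF M this] show ?thesis by simp
    qed
    ultimately show ?r by blast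
  next
    assume r: ?r
    show ?l
    proof (rule smooth_mapI[OF M N])
      fix p assume p: "p \<in> pts (base L)"
      show "(p, s p) \<in> pts (total_space L)" using r p by (simp add: total_space_def)
      obtain A \<phi> where A: "(A, \<phi>) \<in> atlas (base L)" "p \<in> A" using chart_cover[OF M p] by blast
      obtain U h where U: "(U, h) \<in> trivs L" "p \<in> U" using triv_cover[OF p] by blast
      have "openin (mfd_topology (base L)) (A \<inter> U)" using A U openin_chart[OF M] triv_openin by blast
      moreover have "?f ` (A \<inter> U) \<subseteq> Sigma (A \<inter> U) (fib L)" using r triv_subset[OF U(1)] by blast
      moreover have "sm_at (base L) (\<lambda>x. (\<lambda>(x, v). (\<phi> x, h x v)) (?f x)) p"
        using sm_at_Pair[OF M sm_at_chart[OF M A], of "\<lambda>y. h y (s y)"] r U by auto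
      ultimately show "\<exists>V \<psi> S. (V, \<psi>) \<in> atlas (total_space L) \<and> openin (mfd_topology (base L)) S \<and> p \<in> S \<and>
          ?f ` S \<subseteq> V \<and> sm_at (base L) (\<lambda>x. \<psi> (?f x)) p"
        using ch[OF A(1) U(1)] A(2) U(2) by blast
    qed
  qed
  then show ?thesis unfolding sections_def by blast
qed

lemma section_in_fib: "s \<in> sections L \<Longrightarrow> x \<in> pts (base L) \<Longrightarrow> s x \<in> fib L x"
  and section_off: "s \<in> sections L \<Longrightarrow> x \<notin> pts (base L) \<Longrightarrow> s x = 0"
  and sm_at_section: "s \<in> sections L \<Longrightarrow> (U, h) \<in> trivs L \<Longrightarrow> x \<in> U \<Longrightarrow> sm_at (base L) (\<lambda>y. h y (s y)) x"
  by (simp_all add: sections_iff zero_off_def)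

lemma sectionsI:
  assumes "\<And>x. x \<notin> pts (base L) \<Longrightarrow> s x = 0" "\<And>x. x \<in> pts (base L) \<Longrightarrow> s x \<in> fib L x"
    "\<And>x. x \<in> pts (base L) \<Longrightarrow> \<exists>U h. (U, h) \<in> trivs L \<and> x \<in> U \<and> sm_at (base L) (\<lambda>y. h y (s y)) x"
  shows "s \<in> sections L"
  unfolding sections_iff zero_off_def
proof (intro conjI ballI allI impI)
  fix U h x assume U: "(U, h) \<in> trivs L" "x \<in> U"
  then have "x \<in> pts (base L)" using triv_subset by blast
  then obtain V k where "(V, k) \<in> trivs L" "x \<in> V" "sm_at (base L) (\<lambda>y. k y (s y)) x"
    using assms(3) by blast
  then show "sm_at (base L) (\<lambda>y. h y (s y)) x"
    using sm_at_triv_change[of V k U h x s] U assms(2) by blast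
qed (use assms in auto)

lemma section_add:
  assumes "s \<in> sections L" "r \<in> sections L"
  shows "(\<lambda>x. s x + r x) \<in> sections L"
proof (rule sectionsI)
  fix x assume x: "x \<in> pts (base L)"
  show "s x + r x \<in> fib L x" using assms section_in_fib x fib_subspace subspace_add by blast
  obtain U h where U: "(U, h) \<in> trivs L" "x \<in> U" using triv_cover[OF x] by blast
  have "sm_at (base L) (\<lambda>y. h y (s y) + h y (r y)) x"
    using sm_at_add[OF base_premanifold] sm_at_section U assms by blast
  then have "sm_at (base L) (\<lambda>y. h y (s y + r y)) x"
    by (rule sm_at_cong[OF base_premanifold _ triv_openin[OF U(1)] U(2)])
       (use triv_add[OF U(1)] triv_subset[OF U(1)] section_in_fib assms in auto)
  then show "\<exists>U h. (U, h) \<in> trivs L \<and> x \<in> U \<and> sm_at (base L) (\<lambda>y. h y (s y + r y)) x" using U by blast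
qed (use section_off[OF assms(1)] section_off[OF assms(2)] in auto)

lemma section_mult:
  assumes "\<And>x. x \<in> pts (base L) \<Longrightarrow> sm_at (base L) f x" "s \<in> sections L"
  shows "(\<lambda>x. f x *\<^sub>R s x) \<in> sections L"
proof (rule sectionsI)
  fix x assume x: "x \<in> pts (base L)"
  show "f x *\<^sub>R s x \<in> fib L x" using assms section_in_fib x fib_subspace subspace_scale by blast
  obtain U h where U: "(U, h) \<in> trivs L" "x \<in> U" using triv_cover[OF x] by blast
  have "sm_at (base L) (\<lambda>y. f y * h y (s y)) x"
    using sm_at_mult[OF base_premanifold] assms sm_at_section U x by blast
  then have "sm_at (base L) (\<lambda>y. h y (f y *\<^sub>R s y)) x"
    by (rule sm_at_cong[OF base_premanifold _ triv_openin[OF U(1)] U(2)])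
       (use triv_scale[OF U(1)] triv_subset[OF U(1)] section_in_fib assms in auto)
  then show "\<exists>U h. (U, h) \<in> trivs L \<and> x \<in> U \<and> sm_at (base L) (\<lambda>y. h y (f y *\<^sub>R s y)) x" using U by blast
qed (use section_off[OF assms(2)] in auto)

lemma section_fun_mult: "f \<in> smooth_funs (base L) \<Longrightarrow> s \<in> sections L \<Longrightarrow> (\<lambda>x. f x *\<^sub>R s x) \<in> sections L"
  using section_mult smooth_funs_iff[OF base_premanifold] by blast

lemma section_scale: "s \<in> sections L \<Longrightarrow> (\<lambda>x. c *\<^sub>R s x) \<in> sections L"
  using section_mult[of "\<lambda>x. c"] sm_at_const[OF base_premanifold] by blast

lemma section_zero: "(\<lambda>x. 0) \<in> sections L"
proof (rule sectionsI)
  fix x assume x: "x \<in> pts (base L)"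
  show "0 \<in> fib L x" using subspace_0 fib_subspace x by blast
  obtain U h where U: "(U, h) \<in> trivs L" "x \<in> U" using triv_cover[OF x] by blast
  have "sm_at (base L) (\<lambda>y. h y 0) x"
    by (rule sm_at_cong[OF base_premanifold sm_at_const[OF base_premanifold x, of 0] triv_openin[OF U(1)] U(2)])
       (simp add: triv_zero[OF U(1)])
  then show "\<exists>U h. (U, h) \<in> trivs L \<and> x \<in> U \<and> sm_at (base L) (\<lambda>y. h y 0) x" using U by blast
qed auto

lemma section_sum:
  "(\<And>i. i \<in> I \<Longrightarrow> s i \<in> sections L) \<Longrightarrow> (\<lambda>x. \<Sum>i\<in>I. s i x) \<in> sections L"
  by (induction I rule: infinite_finite_induct) (auto intro: section_zero section_add)

text \<open>Multiplies the local frame section with coordinate 1 by a function and a cut-off. This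
  produces the global sections with prescribed behaviour at a point on which functionals are
  tested.\<close>

lemma section_extend:
  assumes \<theta>: "\<theta> \<in> smooth_funs (base L)" and C: "closedin (mfd_topology (base L)) C"
    "C \<subseteq> S" "\<And>x. x \<notin> C \<Longrightarrow> \<theta> x = 0" and S: "openin (mfd_topology (base L)) S" "S \<subseteq> U" and U: "(U, h) \<in> trivs L"
    and f: "\<And>x. x \<in> S \<Longrightarrow> sm_at (base L) f x"
  shows "(\<lambda>x. if x \<in> S then (\<theta> x * f x) *\<^sub>R the_inv_into (fib L x) (h x) 1 else 0) \<in> sections L" (is "?s \<in> _")
proof (rule sectionsI)
  have Sp: "S \<subseteq> pts (base L)" using S U triv_subset by blast
  then show "?s x = 0" if "x \<notin> pts (base L)" for x using that by auto
  fix x assume x: "x \<in> pts (base L)"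
  show f: "?s x \<in> fib L x"
    using triv_inv(1)[OF U] S(2) fib_subspace[OF x] x by (auto intro: subspace_scale subspace_0)
  show "\<exists>V k. (V, k) \<in> trivs L \<and> x \<in> V \<and> sm_at (base L) (\<lambda>y. k y (?s y)) x"
  proof (cases "x \<in> S")
    case True
    have "sm_at (base L) (\<lambda>y. if y \<in> S then \<theta> y *\<^sub>R f y else 0) x"
      by (rule sm_at_extend[OF base_premanifold \<theta> C S(1) assms(8) x])
    then have "sm_at (base L) (\<lambda>y. h y (?s y)) x"
      by (rule sm_at_cong[OF base_premanifold _ S(1) True])
         (use S(2) triv_scale[OF U] triv_inv[OF U] in auto)
    then show ?thesis using True S(2) U by blast
  next
    case False
    \<comment> \<open>Outside \<open>S\<close> the trivialisation \<open>h\<close> may be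
      meaningless; any other one works, because the section is zero on the complement of
      \<open>C\<close>.\<close>
    obtain V k where V: "(V, k) \<in> trivs L" "x \<in> V" using triv_cover[OF x] by blast
    have "openin (mfd_topology (base L)) (pts (base L) - C)"
      using C(1) topspace_mfd[OF base_premanifold] by (metis closedin_def)
    then have "openin (mfd_topology (base L)) ((pts (base L) - C) \<inter> V)" using triv_openin[OF V(1)] by blast
    then have "sm_at (base L) (\<lambda>y. k y (?s y)) x"
      by (rule sm_at_cong[OF base_premanifold sm_at_const[OF base_premanifold x, of 0]])
         (use False x V C triv_zero[OF V(1)] in auto)
    then show ?thesis using V by blast
  qed
qed

end


section \<open>The fibres of the der bundle\<close>

text \<open>
  \<open>order_one_at L x \<Lambda>\<close> is a pointwise form of being a differential operator of order at most one.
  It characterises the elements of the der fibre, because by Hadamard's lemma every section with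
  vanishing 1-jet at \<open>x\<close> is a sum of products \<open>f g s\<close> with \<open>f x = g x = 0\<close>.
\<close>

definition order_one_at ::
    "('q, 'v::real_vector, 'e::real_inner) line_bundle \<Rightarrow> 'q \<Rightarrow> (('q \<Rightarrow> 'v) \<Rightarrow> 'v) \<Rightarrow> bool" where
  "order_one_at L x \<Lambda> \<longleftrightarrow>
     (\<forall>s\<in>sections L. \<Lambda> s \<in> fib L x) \<and>
     (\<forall>s\<in>sections L. \<forall>r\<in>sections L. \<Lambda> (\<lambda>y. s y + r y) = \<Lambda> s + \<Lambda> r) \<and>
     (\<forall>c. \<forall>s\<in>sections L. \<Lambda> (\<lambda>y. c *\<^sub>R s y) = c *\<^sub>R \<Lambda> s) \<and>
     (\<forall>f\<in>smooth_funs (base L). \<forall>g\<in>smooth_funs (base L). \<forall>s\<in>sections L.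
        f x = 0 \<longrightarrow> g x = 0 \<longrightarrow> \<Lambda> (\<lambda>y. (f y * g y) *\<^sub>R s y) = 0)"

lemma smooth_funs_add: "premanifold M \<Longrightarrow> f \<in> smooth_funs M \<Longrightarrow> g \<in> smooth_funs M \<Longrightarrow> (\<lambda>x. f x + g x) \<in> smooth_funs M"
  and smooth_funs_mult: "premanifold M \<Longrightarrow> f \<in> smooth_funs M \<Longrightarrow> g \<in> smooth_funs M \<Longrightarrow> (\<lambda>x. f x * g x) \<in> smooth_funs M"
  and smooth_funs_scale: "premanifold M \<Longrightarrow> f \<in> smooth_funs M \<Longrightarrow> (\<lambda>x. c * f x) \<in> smooth_funs M"
  by (auto simp: smooth_funs_iff zero_off_def intro: sm_at_add sm_at_mult sm_at_const)

context
  fixes L :: "('q, 'v::real_vector, 'e::real_inner) line_bundle" and x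
    and \<Lambda> :: "('q \<Rightarrow> 'v) \<Rightarrow> 'v"
  assumes L: "line_bundle L" and O: "order_one_at L x \<Lambda>" and xp: "x \<in> pts (base L)"
begin

lemma order_one_fib: "s \<in> sections L \<Longrightarrow> \<Lambda> s \<in> fib L x"
  and order_one_add: "s \<in> sections L \<Longrightarrow> r \<in> sections L \<Longrightarrow> \<Lambda> (\<lambda>y. s y + r y) = \<Lambda> s + \<Lambda> r"
  and order_one_scale: "s \<in> sections L \<Longrightarrow> \<Lambda> (\<lambda>y. c *\<^sub>R s y) = c *\<^sub>R \<Lambda> s"
  and order_one_prod: "f \<in> smooth_funs (base L) \<Longrightarrow> g \<in> smooth_funs (base L) \<Longrightarrow> s \<in> sections L \<Longrightarrow>
    f x = 0 \<Longrightarrow> g x = 0 \<Longrightarrow> \<Lambda> (\<lambda>y. (f y * g y) *\<^sub>R s y) = 0"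
  using O unfolding order_one_at_def by blast+

lemma order_one_zero: "\<Lambda> (\<lambda>y. 0) = 0"
  using order_one_scale[OF section_zero[OF L], of 0] by simp

lemma order_one_sum:
  "(\<And>i. i \<in> I \<Longrightarrow> s i \<in> sections L) \<Longrightarrow> \<Lambda> (\<lambda>y. \<Sum>i\<in>I. s i y) = (\<Sum>i\<in>I. \<Lambda> (s i))"
proof (induction I rule: infinite_finite_induct)
  case (insert i I)
  then show ?case using order_one_add[OF _ section_sum[OF L, of I s]] by simp
qed (simp_all add: order_one_zero)

context
  fixes A \<phi> U h
  assumes A: "(A, \<phi>) \<in> atlas (base L)" "x \<in> A" and U: "(U, h) \<in> trivs L" "x \<in> U"
begin

text \<open>Near \<open>x\<close> Hadamard's lemma writes the coordinate of \<open>r\<close> as a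
  sum of products of two functions that both vanish at \<open>x\<close>. Since
  \<open>\<Lambda>\<close> accepts only global sections, this local identity has to be made global
  by cut-offs before the order condition can be applied to it.\<close>

lemma order_one_vanish:
  assumes r: "r \<in> sections L" "h x (r x) = 0" "\<And>e. chart_deriv A \<phi> (\<lambda>y. h y (r y)) x e = 0"
  shows "\<Lambda> r = 0"
proof -
  note M = base_premanifold[OF L]
  note fd = premanifold_findim[OF M]
  obtain B :: "'e set" where B: "onb B" using findim_onb[OF fd] by blast
  have rs: "sm_at (base L) (\<lambda>y. h y (r y)) x" using sm_at_section[OF L r(1) U] .
  obtain S0 where S0: "openin (mfd_topology (base L)) S0" "x \<in> S0" "S0 \<subseteq> A" "open (\<phi> ` S0)"
    "smooth_on (\<phi> ` S0) ((\<lambda>y. h y (r y)) \<circ> the_inv_into A \<phi>)"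
    using sm_at_chartE[OF M rs A] by blast
  have o1: "open (\<phi> ` (S0 \<inter> U))"
    by (rule open_chart_image[OF M _ A(1)]) (use S0 triv_openin[OF L U(1)] in auto)
  then obtain \<rho> where rho: "\<rho> > 0" "ball (\<phi> x) \<rho> \<subseteq> \<phi> ` (S0 \<inter> U)"
    unfolding open_contains_ball using S0(2) U(2) by blast
  define F where "F = (\<lambda>y. h y (r y)) \<circ> the_inv_into A \<phi>"
  have sF: "smooth_on (ball (\<phi> x) \<rho>) F"
    unfolding F_def by (rule smooth_on_subset[OF S0(5)]) (use rho in auto)
  obtain g :: "'e \<Rightarrow> 'e \<Rightarrow> real" where g: "\<And>b. smooth_on (ball (\<phi> x) \<rho>) (g b)"
    "\<And>b. \<rho> > 0 \<Longrightarrow> g b (\<phi> x) = frechet_derivative F (at (\<phi> x)) b"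
    "\<And>y. y \<in> ball (\<phi> x) \<rho> \<Longrightarrow> F y = F (\<phi> x) + (\<Sum>b\<in>B. inner (y - \<phi> x) b * g b y)"
    by (rule hadamard[OF B fd sF]) (rule that)
  define S where "S = {y \<in> A. \<phi> y \<in> ball (\<phi> x) \<rho>}"
  have SU: "S \<subseteq> U"
  proof
    fix y assume y: "y \<in> S"
    then have "\<phi> y \<in> \<phi> ` (S0 \<inter> U)" using rho(2) unfolding S_def by blast
    then obtain y' where "y' \<in> S0" "y' \<in> U" "\<phi> y = \<phi> y'" by blast
    moreover have "y = y'"
      by (rule inj_onD[OF chart_inj[OF M A(1)]]) (use y S0(3) calculation in \<open>auto simp: S_def\<close>)
    ultimately show "y \<in> U" by simp
  qed
  have S: "openin (mfd_topology (base L)) S" "x \<in> S" "S \<subseteq> A"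
    unfolding S_def using openin_chart_preimage[OF M A(1) open_ball] A(2) rho(1) by auto
  obtain \<theta> C where \<theta>: "\<theta> \<in> smooth_funs (base L)" "\<theta> x = 1" "closedin (mfd_topology (base L)) C" "C \<subseteq> S"
    "\<And>y. y \<notin> C \<Longrightarrow> \<theta> y = 0" using bump_function[OF base_manifold[OF L] S(1,2)] by blast
  have smg: "sm_at (base L) (\<lambda>y. g b (\<phi> y)) y" if "y \<in> S" for b y
    by (rule sm_at_compose[OF M g(1) sm_at_chart[OF M A(1)] fd]) (use that S in \<open>auto simp: S_def\<close>)
  have sml: "sm_at (base L) (\<lambda>y. inner (\<phi> y - \<phi> x) b) y" if "y \<in> S" for b y
    using that S(3) chart_subset[OF M A(1)]
    by (intro sm_at_intros[OF M] sm_at_chart[OF M A(1)]) auto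
  have off: "\<theta> y *\<^sub>R u = 0" if "y \<notin> S" for y and u :: real using \<theta>(4,5) that by auto
  define P where "P b y = (if y \<in> S then \<theta> y *\<^sub>R inner (\<phi> y - \<phi> x) b else 0)" for b y
  define G where "G b y = (if y \<in> S then \<theta> y *\<^sub>R g b (\<phi> y) else 0)" for b y
  have P: "P b \<in> smooth_funs (base L)" and G: "G b \<in> smooth_funs (base L)" for b
    unfolding smooth_funs_iff[OF M] P_def G_def zero_off_def
    using sm_at_extend[OF M \<theta>(1,3,4,5) S(1), of "\<lambda>y. inner (\<phi> y - \<phi> x) b"] sml
      sm_at_extend[OF M \<theta>(1,3,4,5) S(1), of "\<lambda>y. g b (\<phi> y)"] smg openin_mfd_subset[OF M S(1)] by auto
  \<comment> \<open>\<open>P b\<close> vanishes at \<open>x\<close> as a coordinate difference.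
    \<open>G b\<close> vanishes there because its value is a first derivative of the coordinate of
    \<open>r\<close>, zero by hypothesis.\<close>
  have Px: "P b x = 0" and Gx: "G b x = 0" for b
    using r(3)[of b] rho(1) g(2)[of b] unfolding P_def G_def F_def chart_deriv_def by auto
  \<comment> \<open>With \<open>t = \<theta> ^ 3\<close> the identity
    \<open>(1 - t)^2 + t * (2 - t) = 1\<close> splits \<open>r\<close> globally. The first term
    gives the factor \<open>u * u\<close> with \<open>u = 1 - t\<close> vanishing at
    \<open>x\<close>. In the second term \<open>P\<close>, \<open>G\<close> and
    \<open>\<sigma>\<close> carry one factor \<open>\<theta>\<close> each, and the remaining
    \<open>2 - t\<close> is put into \<open>\<sigma>\<close>.\<close>
  define \<sigma> where "\<sigma> y = (if y \<in> S then (\<theta> y * (2 - \<theta> y * (\<theta> y * \<theta> y))) *\<^sub>R the_inv_into (fib L y) (h y) 1 else 0)" for y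
  have \<sigma>: "\<sigma> \<in> sections L"
    unfolding \<sigma>_def
  proof (rule section_extend[OF L \<theta>(1,3,4,5) S(1) SU U(1)])
    fix y assume "y \<in> S"
    then have "y \<in> pts (base L)" "sm_at (base L) \<theta> y"
      using \<theta>(1) smooth_funs_iff[OF M] openin_mfd_subset[OF M S(1)] by blast+
    then show "sm_at (base L) (\<lambda>y. 2 - \<theta> y * (\<theta> y * \<theta> y)) y" by (intro sm_at_intros[OF M])
  qed
  define u where "u y = (if y \<in> pts (base L) then 1 - \<theta> y * (\<theta> y * \<theta> y) else 0)" for y
  have u: "u \<in> smooth_funs (base L)"
    unfolding smooth_funs_iff[OF M]
  proof (intro conjI ballI)
    show "zero_off (pts (base L)) u" by (simp add: u_def zero_off_def)
    fix p assume p: "p \<in> pts (base L)"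
    have "sm_at (base L) (\<lambda>y. 1 - \<theta> y * (\<theta> y * \<theta> y)) p"
      using p \<theta>(1) smooth_funs_iff[OF M] by (intro sm_at_intros[OF M]) auto
    then show "sm_at (base L) u p"
      by (rule sm_at_cong[OF M _ openin_pts[OF M] p]) (simp add: u_def)
  qed
  have ux: "u x = 0" using \<theta>(2) xp by (simp add: u_def)
  have split: "r = (\<lambda>y. (u y * u y) *\<^sub>R r y + (\<Sum>b\<in>B. (P b y * G b y) *\<^sub>R \<sigma> y))"
  proof
    fix y
    show "r y = (u y * u y) *\<^sub>R r y + (\<Sum>b\<in>B. (P b y * G b y) *\<^sub>R \<sigma> y)"
    proof (cases "y \<in> S")
      case True
      have yp: "y \<in> pts (base L)" using True openin_mfd_subset[OF M S(1)] by blast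
      have yU: "y \<in> U" using True SU by blast
      have hy: "h y (r y) = (\<Sum>b\<in>B. inner (\<phi> y - \<phi> x) b * g b (\<phi> y))"
        using g(3)[of "\<phi> y"] True r(2) chart_inv[OF M A(1)] A(2) by (simp add: F_def S_def)
      let ?t = "\<theta> y * (\<theta> y * \<theta> y)"
      have "(\<Sum>b\<in>B. P b y * G b y) = (\<theta> y * \<theta> y) * (\<Sum>b\<in>B. inner (\<phi> y - \<phi> x) b * g b (\<phi> y))"
        using True by (simp add: P_def G_def sum_distrib_left mult_ac)
      then have "(\<Sum>b\<in>B. (P b y * G b y) *\<^sub>R \<sigma> y) =
          ((\<Sum>b\<in>B. inner (\<phi> y - \<phi> x) b * g b (\<phi> y)) * (?t * (2 - ?t))) *\<^sub>R the_inv_into (fib L y) (h y) 1"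
        unfolding scaleR_sum_left[symmetric] using True by (simp add: \<sigma>_def mult_ac)
      also have "\<dots> = (?t * (2 - ?t)) *\<^sub>R (h y (r y) *\<^sub>R the_inv_into (fib L y) (h y) 1)"
        by (simp add: hy mult_ac)
      also have "h y (r y) *\<^sub>R the_inv_into (fib L y) (h y) 1 = r y"
        using triv_inv(5)[OF L U(1) yU, of "h y (r y)" 1] triv_inv(3)[OF L U(1) yU]
          section_in_fib[OF L r(1) yp] by simp
      finally have "(u y * u y) *\<^sub>R r y + (\<Sum>b\<in>B. (P b y * G b y) *\<^sub>R \<sigma> y) =
          (u y * u y + ?t * (2 - ?t)) *\<^sub>R r y" by (simp add: scaleR_add_left)
      also have "u y * u y + ?t * (2 - ?t) = 1" using yp by (simp add: u_def algebra_simps)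
      finally show ?thesis by simp
    next
      case False
      then have "\<theta> y = 0" using \<theta>(4,5) by blast
      then have "u y *\<^sub>R r y = r y"
        using section_off[OF L r(1), of y] by (auto simp: u_def)
      then have "(u y * u y) *\<^sub>R r y = r y" by (metis scaleR_scaleR)
      then show ?thesis using False by (simp add: P_def)
    qed
  qed
  have "\<Lambda> r = \<Lambda> (\<lambda>y. (u y * u y) *\<^sub>R r y) + (\<Sum>b\<in>B. \<Lambda> (\<lambda>y. (P b y * G b y) *\<^sub>R \<sigma> y))"
    using P G u r(1) \<sigma>
    by (subst split, subst order_one_add, (intro section_sum[OF L] section_fun_mult[OF L]
        smooth_funs_mult[OF M]; simp)+)
      (subst order_one_sum, auto intro!: section_fun_mult[OF L] smooth_funs_mult[OF M])
  also have "\<dots> = 0"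
    using order_one_prod[OF u u r(1) ux ux] order_one_prod[OF P G \<sigma> Px Gx] by simp
  finally show ?thesis .
qed

end
end

section \<open>Frames of the der bundle\<close>

context
  fixes L :: "('q, 'v::real_vector, 'e::real_inner) line_bundle" and x A \<phi> U h
  assumes L: "line_bundle L"
    and A: "(A, \<phi>) \<in> atlas (base L)" "x \<in> A" and U: "(U, h) \<in> trivs L" "x \<in> U"
begin

text \<open>Cut-offs of the frame section and of its multiples by linear coordinate functions. Their
  1-jets span those at \<open>x\<close>; the derivative of \<open>\<sigma>\<close> is left free and
  is compensated where it matters.\<close>

lemma test_sections:
  obtains \<sigma> Y where "\<sigma> \<in> sections L" "h x (\<sigma> x) = 1" "\<And>b::'e. Y b \<in> sections L" "\<And>b. h x (Y b x) = 0"
    "\<And>b e. chart_deriv A \<phi> (\<lambda>y. h y (Y b y)) x e = inner e b"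
proof -
  note M = base_premanifold[OF L]
  let ?S = "A \<inter> U"
  have S: "openin (mfd_topology (base L)) ?S" "x \<in> ?S"
    using A U openin_chart[OF M] triv_openin[OF L] by auto
  obtain \<theta> C where \<theta>: "\<theta> \<in> smooth_funs (base L)" "\<theta> x = 1" "closedin (mfd_topology (base L)) C" "C \<subseteq> ?S"
    "\<And>y. y \<notin> C \<Longrightarrow> \<theta> y = 0" using bump_function[OF base_manifold[OF L] S] by blast
  have th: "sm_at (base L) \<theta> x" using \<theta>(1) S openin_mfd_subset[OF M] smooth_funs_iff[OF M] by blast
  define \<sigma> where "\<sigma> f y = (if y \<in> ?S then (\<theta> y * f y) *\<^sub>R the_inv_into (fib L y) (h y) 1 else 0)" for f y
  have \<sigma>: "\<sigma> f \<in> sections L" if "\<And>y. y \<in> ?S \<Longrightarrow> sm_at (base L) f y" for f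
    unfolding \<sigma>_def by (rule section_extend[OF L \<theta>(1,3,4,5) S(1) _ U(1)]) (use that in auto)
  have h\<sigma>: "h y (\<sigma> f y) = \<theta> y * f y" if "y \<in> ?S" for f y
    using that triv_scale[OF L U(1)] triv_inv[OF L U(1)] by (simp add: \<sigma>_def)
  have Sp: "?S \<subseteq> pts (base L)" using openin_mfd_subset[OF M S(1)] .
  let ?l = "\<lambda>b y. inner (\<phi> y - \<phi> x) b"
  have sml: "sm_at (base L) (?l b) y" if "y \<in> ?S" for b y
    using that Sp by (intro sm_at_intros[OF M] sm_at_chart[OF M A(1)]) auto
  show ?thesis
  proof (rule that[of "\<sigma> (\<lambda>y. 1)" "\<lambda>b. \<sigma> (?l b)"])
    show "\<sigma> (\<lambda>y. 1) \<in> sections L" using \<sigma> sm_at_const[OF M] Sp by blast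
    show "h x (\<sigma> (\<lambda>y. 1) x) = 1" using h\<sigma>[OF S(2)] \<theta>(2) by simp
    fix b
    show "\<sigma> (?l b) \<in> sections L" using \<sigma> sml by blast
    show "h x (\<sigma> (?l b) x) = 0" using h\<sigma>[OF S(2)] by simp
    fix e
    have "chart_deriv A \<phi> (\<lambda>y. \<theta> y * ?l b y) x = chart_deriv A \<phi> (\<lambda>y. h y (\<sigma> (?l b) y)) x"
      by (rule chart_deriv_cong[OF M A S]) (use h\<sigma> sm_at_mult[OF M th sml[OF S(2)]] in auto)
    moreover have "chart_deriv A \<phi> (\<lambda>y. \<theta> y * ?l b y) x e = chart_deriv A \<phi> (?l b) x e"
      using chart_deriv_mult[OF M A th sml[OF S(2), of b], of e] \<theta>(2) by simp
    moreover have "chart_deriv A \<phi> (?l b) x e = inner e b"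
    proof -
      have "((\<lambda>v. inner (v - \<phi> x) b) has_derivative (\<lambda>e. inner e b)) (at (\<phi> x))"
        by (auto intro!: derivative_eq_intros)
      from chart_deriv_compose[OF M A sm_at_chart[OF M A] this] show ?thesis
        by (simp add: chart_deriv_chart[OF M A])
    qed
    ultimately show "chart_deriv A \<phi> (\<lambda>y. h y (\<sigma> (?l b) y)) x e = inner e b" by simp
  qed
qed

lemma chart_point: "x \<in> pts (base L)"
  using A chart_subset[OF base_premanifold[OF L]] by blast

lemma der_frame_apply:
  assumes "s \<in> sections L"
  shows "der_frame L A \<phi> h x (e, c) s =
    the_inv_into (fib L x) (h x) (chart_deriv A \<phi> (\<lambda>y. h y (s y)) x e + c * h x (s x))"
  using assms by (simp add: der_frame_def chart_deriv_def)

lemma der_frame_triv: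
  assumes "s \<in> sections L"
  shows "h x (der_frame L A \<phi> h x (e, c) s) = chart_deriv A \<phi> (\<lambda>y. h y (s y)) x e + c * h x (s x)"
  using triv_inv(2)[OF L U] by (simp add: der_frame_apply[OF assms])

lemma der_frame_fib: "s \<in> sections L \<Longrightarrow> der_frame L A \<phi> h x ec s \<in> fib L x"
  using triv_inv(1)[OF L U] by (cases ec) (simp add: der_frame_apply)

lemma der_frame_off: "s \<notin> sections L \<Longrightarrow> der_frame L A \<phi> h x ec s = 0"
  by (cases ec) (simp add: der_frame_def)

lemma der_frame_eqI:
  assumes "zero_off (sections L) a" "\<And>s. s \<in> sections L \<Longrightarrow> a s \<in> fib L x"
    "\<And>s. s \<in> sections L \<Longrightarrow> h x (a s) = chart_deriv A \<phi> (\<lambda>y. h y (s y)) x e + c * h x (s x)"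
  shows "a = der_frame L A \<phi> h x (e, c)"
proof
  fix s show "a s = der_frame L A \<phi> h x (e, c) s"
  proof (cases "s \<in> sections L")
    case True
    then show ?thesis
      by (intro triv_eqI[OF L U]) (use assms der_frame_fib der_frame_triv in auto)
  next
    case False then show ?thesis using assms(1) der_frame_off by (simp add: zero_off_def)
  qed
qed

lemma der_frame_add: "(\<lambda>s. der_frame L A \<phi> h x (e, c) s + der_frame L A \<phi> h x (e', c') s) =
    der_frame L A \<phi> h x (e + e', c + c')"
proof (rule der_frame_eqI)
  fix s assume s: "s \<in> sections L"
  have "linear (chart_deriv A \<phi> (\<lambda>y. h y (s y)) x)"
    by (rule chart_deriv_linear[OF base_premanifold[OF L] A sm_at_section[OF L s U]])
  then show "h x (der_frame L A \<phi> h x (e, c) s + der_frame L A \<phi> h x (e', c') s) =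
      chart_deriv A \<phi> (\<lambda>y. h y (s y)) x (e + e') + (c + c') * h x (s x)"
    using triv_add[OF L U der_frame_fib[OF s] der_frame_fib[OF s]] der_frame_triv[OF s]
    by (simp add: linear_add algebra_simps)
qed (use der_frame_fib der_frame_off fib_subspace[OF L chart_point] in
  \<open>auto simp: zero_off_def intro: subspace_add\<close>)

lemma der_frame_scale: "(\<lambda>s. k *\<^sub>R der_frame L A \<phi> h x (e, c) s) = der_frame L A \<phi> h x (k *\<^sub>R e, k * c)"
proof (rule der_frame_eqI)
  fix s assume s: "s \<in> sections L"
  have "linear (chart_deriv A \<phi> (\<lambda>y. h y (s y)) x)"
    by (rule chart_deriv_linear[OF base_premanifold[OF L] A sm_at_section[OF L s U]])
  then show "h x (k *\<^sub>R der_frame L A \<phi> h x (e, c) s) =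
      chart_deriv A \<phi> (\<lambda>y. h y (s y)) x (k *\<^sub>R e) + k * c * h x (s x)"
    using triv_scale[OF L U der_frame_fib[OF s]] der_frame_triv[OF s]
    by (simp add: linear_cmul algebra_simps)
qed (use der_frame_fib der_frame_off fib_subspace[OF L chart_point] in
  \<open>auto simp: zero_off_def intro: subspace_scale\<close>)

lemma der_frame_zero: "der_frame L A \<phi> h x (0, 0) = (\<lambda>s. 0)"
  using der_frame_scale[of 0 0 0] by simp

lemma der_frame_inj:
  assumes "der_frame L A \<phi> h x (e, c) = der_frame L A \<phi> h x (e', c')"
  shows "e = e'" "c = c'"
proof -
  obtain \<sigma> Y where t: "\<sigma> \<in> sections L" "h x (\<sigma> x) = 1" "\<And>b::'e. Y b \<in> sections L" "\<And>b. h x (Y b x) = 0"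
    "\<And>b e. chart_deriv A \<phi> (\<lambda>y. h y (Y b y)) x e = inner e b" using test_sections by blast
  have "inner e b = inner e' b" for b
    using der_frame_triv[OF t(3), of e c b] der_frame_triv[OF t(3), of e' c' b] assms t(4,5) by simp
  then show "e = e'" by (metis inner_commute vector_eq_ldot)
  then show "c = c'"
  proof -
    assume "e = e'"
    moreover have "h x (der_frame L A \<phi> h x (e, c) \<sigma>) = h x (der_frame L A \<phi> h x (e', c') \<sigma>)"
      using assms by simp
    ultimately show ?thesis unfolding der_frame_triv[OF t(1)] t(2) by simp
  qed
qed

text \<open>The symbol is the derivative of functions in the direction \<open>e\<close>, and the
  Leibniz rule is the product rule for coordinate expressions.\<close>

lemma der_frame_der_fibre: "der_frame L A \<phi> h x ec \<in> der_fibre L x"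
proof (cases ec)
  case (Pair e c)
  note M = base_premanifold[OF L]
  have fs: "sm_at (base L) f x" if "f \<in> smooth_funs (base L)" for f
    using that chart_point smooth_funs_iff[OF M] by blast
  define \<delta> where "\<delta> f = (if f \<in> smooth_funs (base L) then chart_deriv A \<phi> f x e else 0)" for f
  have "\<delta> \<in> tangent_space (base L) x"
    unfolding tangent_space_def \<delta>_def zero_off_def
    by (auto simp: smooth_funs_add[OF M] smooth_funs_mult[OF M] smooth_funs_scale[OF M] fs
        chart_deriv_add[OF M A] chart_deriv_mult[OF M A] chart_deriv_cmult[OF M A])
  moreover have "der_frame L A \<phi> h x (e, c) (\<lambda>y. f y *\<^sub>R s y) =
      f x *\<^sub>R der_frame L A \<phi> h x (e, c) s + \<delta> f *\<^sub>R s x"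
    if f: "f \<in> smooth_funs (base L)" and s: "s \<in> sections L" for f s
  proof (rule triv_eqI[OF L U])
    have sx: "s x \<in> fib L x" using section_in_fib[OF L s chart_point] .
    note sub = fib_subspace[OF L chart_point]
    show "f x *\<^sub>R der_frame L A \<phi> h x (e, c) s + \<delta> f *\<^sub>R s x \<in> fib L x"
      using sub sx der_frame_fib[OF s] by (intro subspace_add subspace_scale)
    have "chart_deriv A \<phi> (\<lambda>y. f y * h y (s y)) x = chart_deriv A \<phi> (\<lambda>y. h y (f y *\<^sub>R s y)) x"
      by (rule chart_deriv_cong[OF M A triv_openin[OF L U(1)] U(2)])
         (use triv_scale[OF L U(1)] triv_subset[OF L U(1)] section_in_fib[OF L s] fs[OF f]
            sm_at_section[OF L s U] sm_at_mult[OF M] in auto)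
    then show "h x (der_frame L A \<phi> h x (e, c) (\<lambda>y. f y *\<^sub>R s y)) =
        h x (f x *\<^sub>R der_frame L A \<phi> h x (e, c) s + \<delta> f *\<^sub>R s x)"
      using triv_add[OF L U subspace_scale[OF sub der_frame_fib[OF s]] subspace_scale[OF sub sx]]
        triv_scale[OF L U der_frame_fib[OF s]] triv_scale[OF L U sx] f
        chart_deriv_mult[OF M A fs[OF f] sm_at_section[OF L s U], of e]
        der_frame_triv[OF s] der_frame_triv[OF section_fun_mult[OF L f s]]
      by (simp add: \<delta>_def algebra_simps)
  qed (use der_frame_fib section_fun_mult[OF L f s] in auto)
  moreover have "der_frame L A \<phi> h x (e, c) (\<lambda>y. s y + r y) =
      der_frame L A \<phi> h x (e, c) s + der_frame L A \<phi> h x (e, c) r"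
    if s: "s \<in> sections L" and r: "r \<in> sections L" for s r
  proof (rule triv_eqI[OF L U])
    have "chart_deriv A \<phi> (\<lambda>y. h y (s y) + h y (r y)) x = chart_deriv A \<phi> (\<lambda>y. h y (s y + r y)) x"
      by (rule chart_deriv_cong[OF M A triv_openin[OF L U(1)] U(2)])
         (use triv_add[OF L U(1)] triv_subset[OF L U(1)] section_in_fib[OF L] s r
            sm_at_section[OF L s U] sm_at_section[OF L r U] sm_at_add[OF M] in auto)
    then show "h x (der_frame L A \<phi> h x (e, c) (\<lambda>y. s y + r y)) =
      h x (der_frame L A \<phi> h x (e, c) s + der_frame L A \<phi> h x (e, c) r)"
      using triv_add[OF L U der_frame_fib[OF s] der_frame_fib[OF r]]
        triv_add[OF L U section_in_fib[OF L s chart_point] section_in_fib[OF L r chart_point]]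
        chart_deriv_add[OF M A sm_at_section[OF L s U] sm_at_section[OF L r U], of e]
        der_frame_triv[OF s] der_frame_triv[OF r] der_frame_triv[OF section_add[OF L s r]]
      by (simp add: distrib_left)
  qed (use der_frame_fib section_add[OF L s r] s r fib_subspace[OF L chart_point] in \<open>auto intro: subspace_add\<close>)
  moreover have "der_frame L A \<phi> h x (e, c) (\<lambda>y. k *\<^sub>R s y) = k *\<^sub>R der_frame L A \<phi> h x (e, c) s"
    if s: "s \<in> sections L" for s k
  proof (rule triv_eqI[OF L U])
    have "chart_deriv A \<phi> (\<lambda>y. k * h y (s y)) x = chart_deriv A \<phi> (\<lambda>y. h y (k *\<^sub>R s y)) x"
      by (rule chart_deriv_cong[OF M A triv_openin[OF L U(1)] U(2)])
         (use triv_scale[OF L U(1)] triv_subset[OF L U(1)] section_in_fib[OF L s]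
            sm_at_mult[OF M sm_at_const[OF M chart_point] sm_at_section[OF L s U]] in auto)
    then show "h x (der_frame L A \<phi> h x (e, c) (\<lambda>y. k *\<^sub>R s y)) = h x (k *\<^sub>R der_frame L A \<phi> h x (e, c) s)"
      using triv_scale[OF L U der_frame_fib[OF s]]
        triv_scale[OF L U section_in_fib[OF L s chart_point]]
        chart_deriv_cmult[OF M A sm_at_section[OF L s U], of k e]
        der_frame_triv[OF s] der_frame_triv[OF section_scale[OF L s]]
      by (simp add: algebra_simps)
  qed (use der_frame_fib section_scale[OF L s] s fib_subspace[OF L chart_point] in \<open>auto intro: subspace_scale\<close>)
  ultimately show ?thesis
    unfolding Pair der_fibre_def using der_frame_fib der_frame_off by (auto simp: zero_off_def)
qed

text \<open>Subtracting from \<open>s\<close> the combination of test sections with the same 1-jet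
  leaves a section killed by \<open>\<Lambda>\<close>. So \<open>\<Lambda>\<close> is determined by
  its values on the test sections, and these values dictate \<open>e\<close> and
  \<open>c\<close>.\<close>

lemma order_one_der_frame:
  assumes O: "order_one_at L x \<Lambda>"
  shows "\<exists>e c. \<forall>s\<in>sections L. \<Lambda> s = der_frame L A \<phi> h x (e, c) s"
proof -
  note M = base_premanifold[OF L] and xp = chart_point
  note sub = fib_subspace[OF L xp]
  obtain B :: "'e set" where B: "onb B" using findim_onb[OF premanifold_findim[OF M]] by blast
  obtain \<sigma> Y where t: "\<sigma> \<in> sections L" "h x (\<sigma> x) = 1" "\<And>b::'e. Y b \<in> sections L" "\<And>b. h x (Y b x) = 0"
    "\<And>b e. chart_deriv A \<phi> (\<lambda>y. h y (Y b y)) x e = inner e b" using test_sections by blast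
  let ?D = "\<lambda>s. chart_deriv A \<phi> (\<lambda>y. h y (s y)) x"
  define e where "e = (\<Sum>b\<in>B. h x (\<Lambda> (Y b)) *\<^sub>R b)"
  \<comment> \<open>The value of the frame element on \<open>\<sigma>\<close> is \<open>c\<close>
    plus the derivative of \<open>\<sigma>\<close> along \<open>e\<close>; the latter is not
    prescribed and has to be subtracted.\<close>
  define c where "c = h x (\<Lambda> \<sigma>) - ?D \<sigma> e"
  have eb: "inner e b = h x (\<Lambda> (Y b))" if "b \<in> B" for b
  proof -
    have "inner e b = (\<Sum>b'\<in>B. if b' = b then h x (\<Lambda> (Y b)) else 0)"
      unfolding e_def inner_sum_left using onb_inner[OF B] that by (intro sum.cong) auto
    then show ?thesis using that onb_finite[OF B] by simp
  qed
  have "\<Lambda> s = der_frame L A \<phi> h x (e, c) s" if s: "s \<in> sections L" for s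
  proof (rule triv_eqI[OF L U order_one_fib[OF L O xp s] der_frame_fib[OF s]])
    \<comment> \<open>The part of the derivative of \<open>s\<close> along \<open>b\<close> that
      remains once \<open>h x (s x)\<close> times \<open>\<sigma>\<close> has been removed; it is to
      be matched by the test section \<open>Y b\<close>.\<close>
    define k where "k b = ?D s b - h x (s x) * ?D \<sigma> b" for b
    define r where "r y = s y + ((- h x (s x)) *\<^sub>R \<sigma> y + (\<Sum>b\<in>B. (- k b) *\<^sub>R Y b y))" for y
    have sec: "(\<lambda>y. (- h x (s x)) *\<^sub>R \<sigma> y) \<in> sections L" "\<And>b. (\<lambda>y. (- k b) *\<^sub>R Y b y) \<in> sections L"
      "(\<lambda>y. \<Sum>b\<in>B. (- k b) *\<^sub>R Y b y) \<in> sections L"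
      "(\<lambda>y. (- h x (s x)) *\<^sub>R \<sigma> y + (\<Sum>b\<in>B. (- k b) *\<^sub>R Y b y)) \<in> sections L"
      using t(1,3) by (intro section_add[OF L] section_sum[OF L] section_scale[OF L]; simp)+
    have r: "r \<in> sections L" unfolding r_def by (rule section_add[OF L s sec(4)])
    have hsum: "h y (\<Sum>b\<in>I. (- k b) *\<^sub>R Y b y) = (\<Sum>b\<in>I. (- k b) * h y (Y b y))"
      if "y \<in> U" "finite I" for y I
      using that(2)
    proof induction
      case empty then show ?case using triv_zero[OF L U(1) that(1)] by simp
    next
      case (insert i I)
      have y: "y \<in> pts (base L)" using triv_subset[OF L U(1)] that by blast
      have "(\<Sum>b\<in>I. (- k b) *\<^sub>R Y b y) \<in> fib L y"
        using section_in_fib[OF L t(3) y] fib_subspace[OF L y] by (intro subspace_sum subspace_scale)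
      then show ?case using insert section_in_fib[OF L t(3) y] fib_subspace[OF L y]
        triv_add[OF L U(1) that(1), of "(- k i) *\<^sub>R Y i y"] triv_scale[OF L U(1) that(1), of "Y i y" "- k i"]
        subspace_scale[of "fib L y" "Y i y" "- k i"]
        by (simp del: scaleR_minus_left)
    qed
    have hr: "h y (r y) = h y (s y) + ((- h x (s x)) * h y (\<sigma> y) + (\<Sum>b\<in>B. (- k b) * h y (Y b y)))"
      if yU: "y \<in> U" for y
    proof -
      have y: "y \<in> pts (base L)" using triv_subset[OF L U(1)] yU by blast
      note f = section_in_fib[OF L _ y]
      show ?thesis
        unfolding r_def
        using triv_add[OF L U(1) yU f[OF s] f[OF sec(4)]] triv_add[OF L U(1) yU f[OF sec(1)] f[OF sec(3)]]
          triv_scale[OF L U(1) yU f[OF t(1)], of "- h x (s x)"] hsum[OF yU onb_finite[OF B]]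
        by simp
    qed
    have sm: "sm_at (base L) (\<lambda>y. h y (s y)) x" "sm_at (base L) (\<lambda>y. h y (\<sigma> y)) x"
      "\<And>b. sm_at (base L) (\<lambda>y. h y (Y b y)) x"
      using sm_at_section[OF L _ U] s t by blast+
    have "?D r e' = 0" for e'
    proof -
      have sm2: "sm_at (base L) (\<lambda>y. (- h x (s x)) * h y (\<sigma> y)) x" "\<And>b. sm_at (base L) (\<lambda>y. (- k b) * h y (Y b y)) x"
        using sm sm_at_mult[OF M sm_at_const[OF M xp]] by blast+
      note sm3 = sm_at_sum[OF M xp, of B, OF sm2(2)]
      have "?D r e' = chart_deriv A \<phi> (\<lambda>y. h y (s y) + ((- h x (s x)) * h y (\<sigma> y) + (\<Sum>b\<in>B. (- k b) * h y (Y b y)))) x e'"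
        using chart_deriv_cong[OF M A triv_openin[OF L U(1)] U(2) hr sm_at_section[OF L r U]] by simp
      also have "\<dots> = ?D s e' + ((- h x (s x)) * ?D \<sigma> e' + (\<Sum>b\<in>B. (- k b) * ?D (Y b) e'))"
        unfolding chart_deriv_add[OF M A sm(1) sm_at_add[OF M sm2(1) sm3]] chart_deriv_add[OF M A sm2(1) sm3]
          chart_deriv_sum[OF M A onb_finite[OF B] sm2(2)] chart_deriv_cmult[OF M A sm(2)]
          chart_deriv_cmult[OF M A sm(3)] ..
      also have "(\<Sum>b\<in>B. (- k b) * ?D (Y b) e') = - (?D s e' - h x (s x) * ?D \<sigma> e')"
        using linear_onb[OF B chart_deriv_linear[OF M A sm(1)], of e']
          linear_onb[OF B chart_deriv_linear[OF M A sm(2)], of e']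
        by (simp add: t(5) k_def algebra_simps sum_subtractf sum_distrib_left sum_negf)
      finally show ?thesis by simp
    qed
    moreover have "h x (r x) = 0" using hr[OF U(2)] t(2,4) by simp
    ultimately have "\<Lambda> r = 0" using order_one_vanish[OF L O xp A U r] by blast
    moreover have "\<Lambda> r = \<Lambda> s + ((- h x (s x)) *\<^sub>R \<Lambda> \<sigma> + (\<Sum>b\<in>B. (- k b) *\<^sub>R \<Lambda> (Y b)))"
    proof -
      have "\<Lambda> (\<lambda>y. \<Sum>b\<in>B. (- k b) *\<^sub>R Y b y) = (\<Sum>b\<in>B. \<Lambda> (\<lambda>y. (- k b) *\<^sub>R Y b y))"
        by (rule order_one_sum[OF L O xp sec(2)])
      then show ?thesis
        unfolding r_def order_one_add[OF L O xp s sec(4)] order_one_add[OF L O xp sec(1) sec(3)]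
          order_one_scale[OF L O xp t(1)] order_one_scale[OF L O xp t(3)] by (rule arg_cong)
    qed
    ultimately have "\<Lambda> s - (h x (s x) *\<^sub>R \<Lambda> \<sigma> + (\<Sum>b\<in>B. k b *\<^sub>R \<Lambda> (Y b))) = 0"
      by (simp add: sum_negf algebra_simps)
    then have Ls: "\<Lambda> s = h x (s x) *\<^sub>R \<Lambda> \<sigma> + (\<Sum>b\<in>B. k b *\<^sub>R \<Lambda> (Y b))" by simp
    have hs2: "h x (\<Sum>b\<in>I. k b *\<^sub>R \<Lambda> (Y b)) = (\<Sum>b\<in>I. k b * h x (\<Lambda> (Y b)))" if "finite I" for I
      using that
    proof induction
      case empty then show ?case using triv_zero[OF L U] by simp
    next
      case (insert i I)
      note f = order_one_fib[OF L O xp t(3)]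
      have "(\<Sum>b\<in>I. k b *\<^sub>R \<Lambda> (Y b)) \<in> fib L x"
        using f sub by (intro subspace_sum subspace_scale)
      then show ?case using insert triv_add[OF L U subspace_scale[OF sub f]] triv_scale[OF L U f] by simp
    qed
    have "(\<Sum>b\<in>B. k b *\<^sub>R \<Lambda> (Y b)) \<in> fib L x"
      using order_one_fib[OF L O xp t(3)] sub by (intro subspace_sum subspace_scale)
    then have "h x (\<Lambda> s) = h x (s x) * h x (\<Lambda> \<sigma>) + (\<Sum>b\<in>B. k b * h x (\<Lambda> (Y b)))"
      unfolding Ls using hs2[OF onb_finite[OF B]] order_one_fib[OF L O xp t(1)]
        triv_add[OF L U subspace_scale[OF sub order_one_fib[OF L O xp t(1)]]] triv_scale[OF L U] by simp
    also have "(\<Sum>b\<in>B. k b * h x (\<Lambda> (Y b))) = (\<Sum>b\<in>B. inner e b * k b)"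
      using eb by (intro sum.cong) (auto simp: mult.commute)
    also have "\<dots> = ?D s e - h x (s x) * ?D \<sigma> e"
      using linear_onb[OF B chart_deriv_linear[OF M A sm(1)], of e]
        linear_onb[OF B chart_deriv_linear[OF M A sm(2)], of e]
      by (simp add: k_def algebra_simps sum_subtractf sum_distrib_left)
    finally show "h x (\<Lambda> s) = h x (der_frame L A \<phi> h x (e, c) s)"
      unfolding der_frame_triv[OF s] by (simp add: c_def algebra_simps)
  qed
  then show ?thesis by blast
qed

lemma der_fibre_order_one: "a \<in> der_fibre L x \<Longrightarrow> order_one_at L x a"
proof -
  assume a: "a \<in> der_fibre L x"
  have "a (\<lambda>y. (f y * g y) *\<^sub>R s y) = 0"
    if f: "f \<in> smooth_funs (base L)" and g: "g \<in> smooth_funs (base L)" and s: "s \<in> sections L" "f x = 0" "g x = 0" for f g s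
  proof -
    obtain \<delta> where d: "\<forall>f\<in>smooth_funs (base L). \<forall>s\<in>sections L. a (\<lambda>y. f y *\<^sub>R s y) = f x *\<^sub>R a s + \<delta> f *\<^sub>R s x"
      using a unfolding der_fibre_def by blast
    have "a (\<lambda>y. f y *\<^sub>R (g y *\<^sub>R s y)) = f x *\<^sub>R a (\<lambda>y. g y *\<^sub>R s y) + \<delta> f *\<^sub>R (g x *\<^sub>R s x)"
      by (rule bspec[OF bspec[OF d f] section_fun_mult[OF L g s(1)]])
    then show ?thesis using s(2,3) by simp
  qed
  then show ?thesis using a unfolding der_fibre_def order_one_at_def by blast
qed

lemma der_fibreI:
  assumes "zero_off (sections L) a" "order_one_at L x a"
  shows "a \<in> der_fibre L x"
proof -
  obtain e c where "\<forall>s\<in>sections L. a s = der_frame L A \<phi> h x (e, c) s"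
    using order_one_der_frame[OF assms(2)] by blast
  then have "a = der_frame L A \<phi> h x (e, c)"
    using assms(1) der_frame_off unfolding zero_off_def by (metis ext)
  then show ?thesis using der_frame_der_fibre by simp
qed

lemma der_fibreE:
  assumes "a \<in> der_fibre L x"
  obtains e c where "a = der_frame L A \<phi> h x (e, c)"
proof -
  obtain e c where "\<forall>s\<in>sections L. a s = der_frame L A \<phi> h x (e, c) s"
    using order_one_der_frame[OF der_fibre_order_one[OF assms]] by blast
  moreover have "zero_off (sections L) a" using assms unfolding der_fibre_def by blast
  ultimately have "a = der_frame L A \<phi> h x (e, c)"
    using der_frame_off unfolding zero_off_def by (metis ext)
  then show ?thesis using that by blast
qed

end

text \<open>Trades the existence of a symbol for the order condition. Pulled-back functionals,
  commutators and differences of brackets satisfy the latter directly, whereas their symbols would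
  have to be constructed.\<close>

lemma der_fibre_iff:
  assumes L: "line_bundle L" and x: "x \<in> pts (base L)"
  shows "a \<in> der_fibre L x \<longleftrightarrow> zero_off (sections L) a \<and> order_one_at L x a"
proof -
  obtain A \<phi> where A: "(A, \<phi>) \<in> atlas (base L)" "x \<in> A" using chart_cover[OF base_premanifold[OF L] x] by blast
  obtain U h where U: "(U, h) \<in> trivs L" "x \<in> U" using triv_cover[OF L x] by blast
  show ?thesis
  proof
    assume a: "a \<in> der_fibre L x"
    then have "zero_off (sections L) a" unfolding der_fibre_def by blast
    then show "zero_off (sections L) a \<and> order_one_at L x a" using der_fibre_order_one[OF L A U a] by blast
  qed (use der_fibreI[OF L A U] in blast)
qed


section \<open>Pull-back bundles and the jet bundle\<close>

lemma line_bundle_pullback: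
  assumes L: "line_bundle L" and N: "smooth_manifold N" and p: "smooth_map N (base L) p"
  shows "line_bundle (pullback_bundle N p L)"
proof -
  note M = base_premanifold[OF L]
  have Np: "premanifold N" using N smooth_manifold_iff by blast
  note pts = smooth_map_pts[OF Np M p]
  have "\<exists>g. smooth_fun_on N ({y \<in> pts N. p y \<in> U} \<inter> {y \<in> pts N. p y \<in> V}) g \<and>
      (\<forall>y\<in>{y \<in> pts N. p y \<in> U} \<inter> {y \<in> pts N. p y \<in> V}. \<forall>v\<in>fib L (p y). k (p y) v = g y * h (p y) v)"
    if U: "(U, h) \<in> trivs L" and V: "(V, k) \<in> trivs L" for U h V k
  proof -
    obtain g where g: "\<forall>x\<in>U \<inter> V. sm_at (base L) g x \<and> g x \<noteq> 0 \<and> (\<forall>v\<in>fib L x. k x v = g x * h x v)"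
      using triv_change[OF L U V] by blast
    have "openin (mfd_topology N) ({y \<in> pts N. p y \<in> U} \<inter> {y \<in> pts N. p y \<in> V})"
      using smooth_map_openin_preimage[OF Np M p] triv_openin[OF L] U V by blast
    moreover have "\<forall>y\<in>{y \<in> pts N. p y \<in> U} \<inter> {y \<in> pts N. p y \<in> V}. sm_at N (\<lambda>y. g (p y)) y"
      using g sm_at_pullback[OF Np M p] by blast
    ultimately show ?thesis using g smooth_fun_on_iff[OF Np] by (intro exI[of _ "\<lambda>y. g (p y)"]) auto
  qed
  note change = this
  show ?thesis
    unfolding line_bundle_def
  proof (intro conjI)
    show "smooth_manifold (base (pullback_bundle N p L))" using N by (simp add: pullback_bundle_def)
    show "\<forall>x\<in>pts (base (pullback_bundle N p L)). subspace (fib (pullback_bundle N p L) x) \<and>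
        dim (fib (pullback_bundle N p L) x) = 1"
      using L pts unfolding pullback_bundle_def line_bundle_def by auto
    show "(\<Union>(U, h)\<in>trivs (pullback_bundle N p L). U) = pts (base (pullback_bundle N p L))"
      using triv_cover[OF L pts] unfolding pullback_bundle_def by fastforce
    show "\<forall>(U, h)\<in>trivs (pullback_bundle N p L). openin (mfd_topology (base (pullback_bundle N p L))) U \<and>
        (\<forall>x\<in>U. linear_iso_betw (fib (pullback_bundle N p L) x) UNIV (h x))"
      using triv_iso[OF L] smooth_map_openin_preimage[OF Np M p triv_openin[OF L]]
      unfolding pullback_bundle_def by auto
    show "\<forall>(U, h)\<in>trivs (pullback_bundle N p L). \<forall>(V, k)\<in>trivs (pullback_bundle N p L). \<exists>g.
        smooth_fun_on (base (pullback_bundle N p L)) (U \<inter> V) g \<and>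
        (\<forall>x\<in>U \<inter> V. \<forall>v\<in>fib (pullback_bundle N p L) x. k x v = g x * h x v)"
      using change unfolding pullback_bundle_def by (auto simp: split_beta)
  qed
qed

section \<open>Coordinates of jets in a der frame\<close>

context
  fixes L :: "('q, 'v::real_vector, 'e::real_inner) line_bundle" and x A \<phi> U h
  assumes L: "line_bundle L"
    and A: "(A, \<phi>) \<in> atlas (base L)" "x \<in> A" and U: "(U, h) \<in> trivs L" "x \<in> U"
begin

lemma jet_chart_eq:
  assumes "\<And>e c. h x (\<alpha> (der_frame L A \<phi> h x (e, c))) = inner g e + \<gamma> * c"
  shows "jet_chart L A \<phi> h (x, \<alpha>) = (\<phi> x, g, \<gamma>)"
proof -
  have "(THE g'. \<forall>e. inner g' e = h x (\<alpha> (der_frame L A \<phi> h x (e, 0)))) = g"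
    using assms by (intro the_equality) (auto simp: vector_eq_rdot)
  then show ?thesis using assms by (simp add: jet_chart_def)
qed

text \<open>The linear form on the model space is represented by the vector whose basis coefficients
  are its values on the basis. Hence the definite description in \<open>jet_chart\<close> denotes
  the intended vector.\<close>

lemma jet_frame_apply:
  assumes \<alpha>: "\<alpha> \<in> jet_fibre L x"
  obtains g \<gamma> where "jet_chart L A \<phi> h (x, \<alpha>) = (\<phi> x, g, \<gamma>)"
    "\<And>e c. h x (\<alpha> (der_frame L A \<phi> h x (e, c))) = inner g e + \<gamma> * c"
proof -
  let ?d = "der_frame L A \<phi> h x"
  note dd = der_frame_der_fibre[OF L A U]
  have fibd: "\<alpha> (?d ec) \<in> fib L x" for ec using \<alpha> dd unfolding jet_fibre_def by blast
  have add: "\<alpha> (?d (e + e', c + c')) = \<alpha> (?d (e, c)) + \<alpha> (?d (e', c'))" for e e' c c'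
    using \<alpha> dd unfolding jet_fibre_def by (simp flip: der_frame_add[OF L A U])
  have scale: "\<alpha> (?d (k *\<^sub>R e, k * c)) = k *\<^sub>R \<alpha> (?d (e, c))" for e c k
    using \<alpha> dd unfolding jet_fibre_def by (simp flip: der_frame_scale[OF L A U])
  obtain B :: "'e set" where B: "onb B" using findim_onb premanifold_findim[OF base_premanifold[OF L]] by blast
  define g where "g = (\<Sum>b\<in>B. h x (\<alpha> (?d (b, 0))) *\<^sub>R b)"
  have "linear (\<lambda>e. h x (\<alpha> (?d (e, 0))))"
    using add[of _ _ 0 0] scale[of _ _ 0] triv_add[OF L U fibd fibd] triv_scale[OF L U fibd]
    by (intro linearI) auto
  then have ge: "h x (\<alpha> (?d (e, 0))) = inner g e" for e
    by (subst linear_onb[OF B]) (simp_all add: g_def inner_sum_left inner_commute[of e] mult.commute)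
  have "h x (\<alpha> (?d (e, c))) = inner g e + h x (\<alpha> (?d (0, 1))) * c" for e c
    using add[of e 0 0 c] scale[of c 0 1] triv_add[OF L U fibd fibd, of "(e, 0)" "(0, c)"]
      triv_scale[OF L U fibd, of c "(0, 1)"] ge by simp
  then show ?thesis using that jet_chart_eq by blast
qed

lemma jet_eqI:
  assumes "\<alpha> \<in> jet_fibre L x" "\<beta> \<in> jet_fibre L x"
    "\<And>e c. h x (\<alpha> (der_frame L A \<phi> h x (e, c))) = h x (\<beta> (der_frame L A \<phi> h x (e, c)))"
  shows "\<alpha> = \<beta>"
proof
  fix a show "\<alpha> a = \<beta> a"
  proof (cases "a \<in> der_fibre L x")
    case True
    obtain e c where a: "a = der_frame L A \<phi> h x (e, c)" by (rule der_fibreE[OF L A U True])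
    have "\<alpha> a \<in> fib L x" "\<beta> a \<in> fib L x" using assms(1,2) True unfolding jet_fibre_def by blast+
    then show ?thesis using triv_eqI[OF L U] assms(3) a by blast
  next
    case False
    then show ?thesis using assms(1,2) unfolding jet_fibre_def zero_off_def by simp
  qed
qed

lemma jet_chart_inj:
  assumes "\<alpha> \<in> jet_fibre L x" "\<beta> \<in> jet_fibre L x" "jet_chart L A \<phi> h (x, \<alpha>) = jet_chart L A \<phi> h (x, \<beta>)"
  shows "\<alpha> = \<beta>"
proof -
  obtain g \<gamma> where 1: "jet_chart L A \<phi> h (x, \<alpha>) = (\<phi> x, g, \<gamma>)"
    "\<And>e c. h x (\<alpha> (der_frame L A \<phi> h x (e, c))) = inner g e + \<gamma> * c" using jet_frame_apply[OF assms(1)] by blast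
  obtain g' \<gamma>' where 2: "jet_chart L A \<phi> h (x, \<beta>) = (\<phi> x, g', \<gamma>')"
    "\<And>e c. h x (\<beta> (der_frame L A \<phi> h x (e, c))) = inner g' e + \<gamma>' * c" using jet_frame_apply[OF assms(2)] by blast
  show ?thesis by (rule jet_eqI[OF assms(1,2)]) (use 1 2 assms(3) in simp)
qed

lemma jet_of_coords:
  obtains \<alpha> where "\<alpha> \<in> jet_fibre L x" "\<And>e c. h x (\<alpha> (der_frame L A \<phi> h x (e, c))) = inner g e + \<gamma> * c"
proof -
  let ?d = "der_frame L A \<phi> h x" and ?i = "the_inv_into (fib L x) (h x)"
  note inv = triv_inv[OF L U]
  \<comment> \<open>A choice of frame coordinates, which \<open>der_frame_inj\<close> makes unique
    for elements of the form \<open>?d (e, c)\<close>.\<close>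
  define ec where "ec a = (SOME ec. a = ?d ec)" for a
  have ecd: "ec (?d (e, c)) = (e, c)" for e c
  proof -
    have "?d (e, c) = ?d (ec (?d (e, c)))" unfolding ec_def by (rule someI) (rule refl)
    then show ?thesis using der_frame_inj[OF L A U] by (metis prod.exhaust)
  qed
  define \<alpha> where "\<alpha> a = (if a \<in> der_fibre L x then ?i (inner g (fst (ec a)) + \<gamma> * snd (ec a)) else 0)" for a
  have \<alpha>d: "\<alpha> (?d (e, c)) = ?i (inner g e + \<gamma> * c)" for e c
    using der_frame_der_fibre[OF L A U] by (simp add: \<alpha>_def ecd)
  have "\<alpha> \<in> jet_fibre L x"
    unfolding jet_fibre_def mem_Collect_eq
  proof (intro conjI ballI allI)
    show "zero_off (der_fibre L x) \<alpha>" by (simp add: zero_off_def \<alpha>_def)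
    fix a assume a: "a \<in> der_fibre L x"
    then show "\<alpha> a \<in> fib L x" by (simp add: \<alpha>_def inv(1))
    obtain e c where ae: "a = ?d (e, c)" by (rule der_fibreE[OF L A U a])
    show "\<alpha> (\<lambda>s. k *\<^sub>R a s) = k *\<^sub>R \<alpha> a" for k
      unfolding ae der_frame_scale[OF L A U] \<alpha>d by (simp add: algebra_simps flip: inv(5))
    fix b assume b: "b \<in> der_fibre L x"
    obtain e' c' where be: "b = ?d (e', c')" by (rule der_fibreE[OF L A U b])
    show "\<alpha> (\<lambda>s. a s + b s) = \<alpha> a + \<alpha> b"
      unfolding ae be der_frame_add[OF L A U] \<alpha>d by (simp add: algebra_simps flip: inv(4))
  qed
  then show ?thesis using that \<alpha>d inv(2) by simp
qed

text \<open>Replacing \<open>h\<close> by \<open>q * h\<close> adds the logarithmic derivative of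
  \<open>q\<close> to the zeroth-order part, since the derivative of \<open>q * f\<close> divided by
  \<open>q\<close> is that of \<open>f\<close> plus \<open>f\<close> times that of \<open>q\<close>
  over \<open>q\<close>.\<close>

lemma der_frame_change:
  assumes A': "(A', \<phi>') \<in> atlas (base L)" "x \<in> A'" and U': "(U', h') \<in> trivs L" "x \<in> U'"
    and q: "\<And>y. y \<in> U \<inter> U' \<Longrightarrow> sm_at (base L) q y" "\<And>y. y \<in> U \<inter> U' \<Longrightarrow> q y \<noteq> 0"
      "\<And>y v. y \<in> U \<inter> U' \<Longrightarrow> v \<in> fib L y \<Longrightarrow> h' y v = q y * h y v"
  shows "der_frame L A' \<phi>' h' x (e, c) =
    der_frame L A \<phi> h x (chart_deriv A' \<phi>' \<phi> x e, c + chart_deriv A' \<phi>' q x e / q x)"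
proof (rule der_frame_eqI[OF L A U])
  note M = base_premanifold[OF L]
  have x: "x \<in> U \<inter> U'" using U U' by blast
  show "zero_off (sections L) (der_frame L A' \<phi>' h' x (e, c))"
    using der_frame_off[OF L A' U'] by (simp add: zero_off_def)
  fix s assume s: "s \<in> sections L"
  show f: "der_frame L A' \<phi>' h' x (e, c) s \<in> fib L x" by (rule der_frame_fib[OF L A' U' s])
  note sm = sm_at_section[OF L s U]
  have "chart_deriv A' \<phi>' (\<lambda>y. q y * h y (s y)) x = chart_deriv A' \<phi>' (\<lambda>y. h' y (s y)) x"
    by (rule chart_deriv_cong[OF M A' _ x])
       (use triv_openin[OF L U(1)] triv_openin[OF L U'(1)] q(3) triv_subset[OF L U(1)] section_in_fib[OF L s]
          sm_at_mult[OF M q(1)[OF x] sm] in auto)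
  then have "q x * h x (der_frame L A' \<phi>' h' x (e, c) s) =
      q x * chart_deriv A \<phi> (\<lambda>y. h y (s y)) x (chart_deriv A' \<phi>' \<phi> x e) +
      chart_deriv A' \<phi>' q x e * h x (s x) + c * (q x * h x (s x))"
    using der_frame_triv[OF L A' U' s, of e c] q(3)[OF x f] q(3)[OF x section_in_fib[OF L s]]
      chart_deriv_mult[OF M A' q(1)[OF x] sm, of e] chart_deriv_change[OF M A A' sm, of e]
      triv_subset[OF L U(1)] U(2) by auto
  then show "h x (der_frame L A' \<phi>' h' x (e, c) s) =
      chart_deriv A \<phi> (\<lambda>y. h y (s y)) x (chart_deriv A' \<phi>' \<phi> x e) +
      (c + chart_deriv A' \<phi>' q x e / q x) * h x (s x)"
    using q(2)[OF x] by (simp add: field_simps)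
qed

end

section \<open>The jet bundle as a smooth manifold\<close>

context
  fixes L :: "('q, 'v::real_vector, 'e::real_inner) line_bundle"
  assumes L: "line_bundle L"
begin

lemma jet_chart_image:
  assumes A: "(A, \<phi>) \<in> atlas (base L)" and U: "(U, h) \<in> trivs L" and W: "W \<subseteq> A \<inter> U"
  shows "jet_chart L A \<phi> h ` Sigma W (jet_fibre L) = \<phi> ` W \<times> UNIV"
proof
  show "jet_chart L A \<phi> h ` Sigma W (jet_fibre L) \<subseteq> \<phi> ` W \<times> UNIV" by (auto simp: jet_chart_def)
  show "\<phi> ` W \<times> UNIV \<subseteq> jet_chart L A \<phi> h ` Sigma W (jet_fibre L)"
  proof
    fix y assume "y \<in> \<phi> ` W \<times> (UNIV :: ('e \<times> real) set)"
    then obtain x g \<gamma> where y: "y = (\<phi> x, g, \<gamma>)" "x \<in> W" by (cases y) auto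
    have xA: "x \<in> A" "x \<in> U" using W y(2) by auto
    obtain \<alpha> where \<alpha>: "\<alpha> \<in> jet_fibre L x" "\<And>e c. h x (\<alpha> (der_frame L A \<phi> h x (e, c))) = inner g e + \<gamma> * c"
      using jet_of_coords[OF L A xA(1) U xA(2)] by metis
    have "y = jet_chart L A \<phi> h (x, \<alpha>)"
      using jet_chart_eq[OF L A xA(1) U xA(2) \<alpha>(2)] y(1) by simp
    then show "y \<in> jet_chart L A \<phi> h ` Sigma W (jet_fibre L)" using \<alpha>(1) y(2) by blast
  qed
qed

lemma jet_atlasI: "(A, \<phi>) \<in> atlas (base L) \<Longrightarrow> (U, h) \<in> trivs L \<Longrightarrow>
    (Sigma (A \<inter> U) (jet_fibre L), jet_chart L A \<phi> h) \<in> atlas (jet_bundle L)"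
  unfolding jet_bundle_def by auto

lemma jet_chart_inj_on:
  assumes A: "(A, \<phi>) \<in> atlas (base L)" and U: "(U, h) \<in> trivs L"
  shows "inj_on (jet_chart L A \<phi> h) (Sigma (A \<inter> U) (jet_fibre L))"
proof (rule inj_onI)
  fix z z' assume "z \<in> Sigma (A \<inter> U) (jet_fibre L)" "z' \<in> Sigma (A \<inter> U) (jet_fibre L)"
    and eq: "jet_chart L A \<phi> h z = jet_chart L A \<phi> h z'"
  then obtain x \<alpha> y \<beta> where z: "z = (x, \<alpha>)" "z' = (y, \<beta>)" "x \<in> A" "x \<in> U" "y \<in> A" "y \<in> U"
    "\<alpha> \<in> jet_fibre L x" "\<beta> \<in> jet_fibre L y" by auto
  have "\<phi> x = \<phi> y" using eq by (simp add: z jet_chart_def)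
  then have "x = y" using chart_inj[OF base_premanifold[OF L] A] z by (meson inj_onD)
  then show "z = z'" using jet_chart_inj[OF L A z(3) U z(4)] eq z by auto
qed

lemma jet_atlas_cover:
  assumes "z \<in> pts (jet_bundle L)"
  obtains A \<phi> U h where "(A, \<phi>) \<in> atlas (base L)" "fst z \<in> A" "(U, h) \<in> trivs L" "fst z \<in> U"
    "z \<in> Sigma (A \<inter> U) (jet_fibre L)"
proof -
  have x: "fst z \<in> pts (base L)" "snd z \<in> jet_fibre L (fst z)" using assms by (auto simp: jet_bundle_def)
  obtain A \<phi> where A: "(A, \<phi>) \<in> atlas (base L)" "fst z \<in> A" using chart_cover[OF base_premanifold[OF L] x(1)] by blast
  obtain U h where U: "(U, h) \<in> trivs L" "fst z \<in> U" using triv_cover[OF L x(1)] by blast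
  have "z \<in> Sigma (A \<inter> U) (jet_fibre L)" using x A U by (cases z) auto
  then show ?thesis using that A U by blast
qed

lemma premanifold_jet_bundle: "premanifold (jet_bundle L)"
proof (rule premanifoldI)
  note M = base_premanifold[OF L]
  note fd = premanifold_findim[OF M]
  obtain B :: "'e set" where B: "onb B" using findim_onb[OF fd] by blast
  show fd3: "findim TYPE('e \<times> 'e \<times> real)" using findim_prod[OF fd findim_prod[OF fd findim_real]] .
  show "(\<Union>(U, \<phi>)\<in>atlas (jet_bundle L). U) = pts (jet_bundle L)"
  proof
    show "(\<Union>(U, \<phi>)\<in>atlas (jet_bundle L). U) \<subseteq> pts (jet_bundle L)"
      using triv_subset[OF L] unfolding jet_bundle_def by fastforce
    show "pts (jet_bundle L) \<subseteq> (\<Union>(U, \<phi>)\<in>atlas (jet_bundle L). U)"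
      by (rule subsetI, erule jet_atlas_cover) (use jet_atlasI in blast)
  qed
  fix D \<Phi> assume "(D, \<Phi>) \<in> atlas (jet_bundle L)"
  then obtain A \<phi> U h where c: "D = Sigma (A \<inter> U) (jet_fibre L)" "\<Phi> = jet_chart L A \<phi> h"
    "(A, \<phi>) \<in> atlas (base L)" "(U, h) \<in> trivs L" unfolding jet_bundle_def by auto
  show "inj_on \<Phi> D" unfolding c(1,2) by (rule jet_chart_inj_on[OF c(3,4)])
  fix D' \<Phi>' assume "(D', \<Phi>') \<in> atlas (jet_bundle L)"
  then obtain A' \<phi>' U' h' where c': "D' = Sigma (A' \<inter> U') (jet_fibre L)" "\<Phi>' = jet_chart L A' \<phi>' h'"
    "(A', \<phi>') \<in> atlas (base L)" "(U', h') \<in> trivs L" unfolding jet_bundle_def by auto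
  obtain q where "\<forall>x\<in>U \<inter> U'. sm_at (base L) q x \<and> q x \<noteq> 0 \<and> (\<forall>v\<in>fib L x. h' x v = q x * h x v)"
    using triv_change[OF L c(4) c'(4)] by blast
  then have q: "\<And>x. x \<in> U \<inter> U' \<Longrightarrow> sm_at (base L) q x" "\<And>x. x \<in> U \<inter> U' \<Longrightarrow> q x \<noteq> 0"
    "\<And>x v. x \<in> U \<inter> U' \<Longrightarrow> v \<in> fib L x \<Longrightarrow> h' x v = q x * h x v" by blast+
  define W where "W = A \<inter> U \<inter> (A' \<inter> U')"
  have DD: "D \<inter> D' = Sigma W (jet_fibre L)" unfolding c c' W_def by blast
  have im: "\<Phi> ` (D \<inter> D') = \<phi> ` W \<times> UNIV"
    unfolding DD c(2) by (rule jet_chart_image[OF c(3,4)]) (auto simp: W_def)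
  have oW: "openin (mfd_topology (base L)) W"
    unfolding W_def using openin_chart[OF M] triv_openin[OF L] c c' by blast
  have o: "open (\<phi> ` W)" by (rule open_chart_image[OF M oW c(3)]) (auto simp: W_def)
  have o2: "open (\<phi> ` W \<times> (UNIV :: ('e \<times> real) set))" using o by (simp add: open_Times)
  have *: "smooth_on (\<phi> ` W \<times> (UNIV :: ('e \<times> real) set)) (\<lambda>z. (f \<circ> the_inv_into A \<phi>) (fst z))"
    if "\<And>x. x \<in> W \<Longrightarrow> sm_at (base L) f x" for f :: "'q \<Rightarrow> 'w::real_normed_vector"
  proof -
    have "smooth_on (\<phi> ` W) (f \<circ> the_inv_into A \<phi>)"
      using smooth_on_chart_iff[OF M c(3) oW, of f] that by (auto simp: W_def)
    then show ?thesis
      by (rule smooth_on_compose[OF _ _ fd o2 o]) (use o2 in \<open>auto intro: smooth_intros\<close>)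
  qed
  let ?i = "the_inv_into A \<phi>"
  \<comment> \<open>The dual of \<open>der_frame_change\<close>: applying a jet to the changed frame
    gives \<open>q * (inner g (J e) + \<gamma> * (c + dq e / q))\<close>, where \<open>J\<close> is
    the Jacobian of the charts and \<open>dq\<close> the derivative of \<open>q\<close>. The new
    covector is recovered from its values on the basis \<open>B\<close>, and \<open>\<gamma>\<close>
    is multiplied by \<open>q\<close>.\<close>
  define E where "E = (\<lambda>z. ((\<phi>' \<circ> ?i) (fst z),
    (\<Sum>b\<in>B. ((q \<circ> ?i) (fst z) * inner (fst (snd z)) (((\<lambda>x. chart_deriv A' \<phi>' \<phi> x b) \<circ> ?i) (fst z)) +
       snd (snd z) * ((\<lambda>x. chart_deriv A' \<phi>' q x b) \<circ> ?i) (fst z)) *\<^sub>R b),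
    (q \<circ> ?i) (fst z) * snd (snd z)))"
  have "smooth_on (\<phi> ` W \<times> UNIV) E"
    unfolding E_def
    by (intro smooth_on_Pair smooth_on_sum smooth_on_scaleR smooth_on_add smooth_on_mult smooth_on_inner
          smooth_on_const smooth_on_fst smooth_on_snd smooth_on_id o2 *
          sm_at_chart[OF M c'(3)] q(1) sm_at_chart_deriv[OF M c'(3)] sm_at_chart[OF M c(3)])
       (auto simp: W_def)
  moreover have "\<forall>z\<in>D \<inter> D'. \<Phi>' z = E (\<Phi> z)"
  proof
    fix z assume "z \<in> D \<inter> D'"
    then obtain x \<alpha> where z: "z = (x, \<alpha>)" "x \<in> W" "\<alpha> \<in> jet_fibre L x" unfolding DD by blast
    then have x: "x \<in> A" "x \<in> U" "x \<in> A'" "x \<in> U'" by (auto simp: W_def)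
    obtain g \<gamma> where g: "jet_chart L A \<phi> h (x, \<alpha>) = (\<phi> x, g, \<gamma>)"
      "\<And>e c. h x (\<alpha> (der_frame L A \<phi> h x (e, c))) = inner g e + \<gamma> * c"
      using jet_frame_apply[OF L c(3) x(1) c(4) x(2) z(3)] by blast
    let ?g = "\<Sum>b\<in>B. (q x * inner g (chart_deriv A' \<phi>' \<phi> x b) + \<gamma> * chart_deriv A' \<phi>' q x b) *\<^sub>R b"
    have xU: "x \<in> U \<inter> U'" using x by blast
    have "jet_chart L A' \<phi>' h' (x, \<alpha>) = (\<phi>' x, ?g, q x * \<gamma>)"
    proof (rule jet_chart_eq[OF L c'(3) x(3) c'(4) x(4)])
      fix e c0
      have "der_frame L A' \<phi>' h' x (e, c0) \<in> der_fibre L x"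
        by (rule der_frame_der_fibre[OF L c'(3) x(3) c'(4) x(4)])
      then have "\<alpha> (der_frame L A' \<phi>' h' x (e, c0)) \<in> fib L x" using z(3) unfolding jet_fibre_def by blast
      then have "h' x (\<alpha> (der_frame L A' \<phi>' h' x (e, c0))) =
          q x * h x (\<alpha> (der_frame L A' \<phi>' h' x (e, c0)))" by (rule q(3)[OF xU])
      also have "\<dots> = q x * (inner g (chart_deriv A' \<phi>' \<phi> x e) + \<gamma> * (c0 + chart_deriv A' \<phi>' q x e / q x))"
        using der_frame_change[OF L c(3) x(1) c(4) x(2) c'(3) x(3) c'(4) x(4) q(1,2,3)] g(2) by simp
      also have "\<dots> = (q x * inner g (chart_deriv A' \<phi>' \<phi> x e) + \<gamma> * chart_deriv A' \<phi>' q x e) + q x * \<gamma> * c0"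
        using q(2)[OF xU] by (simp add: field_simps)
      also have "q x * inner g (chart_deriv A' \<phi>' \<phi> x e) + \<gamma> * chart_deriv A' \<phi>' q x e = inner ?g e"
      proof -
        have l1: "linear (chart_deriv A' \<phi>' \<phi> x)" "linear (chart_deriv A' \<phi>' q x)"
          using chart_deriv_linear[OF M c'(3) x(3)] sm_at_chart[OF M c(3) x(1)] q(1)[OF xU] by blast+
        have "linear (\<lambda>e. q x * inner g (chart_deriv A' \<phi>' \<phi> x e) + \<gamma> * chart_deriv A' \<phi>' q x e)"
          by (rule linearI) (simp_all add: linear_add[OF l1(1)] linear_add[OF l1(2)] linear_cmul[OF l1(1)]
              linear_cmul[OF l1(2)] inner_add_right algebra_simps)
        from linear_onb[OF B this, of e] show ?thesis
          by (simp add: inner_sum_left inner_commute[of e] mult.commute)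
      qed
      finally show "h' x (\<alpha> (der_frame L A' \<phi>' h' x (e, c0))) = inner ?g e + q x * \<gamma> * c0" .
    qed
    then show "\<Phi>' z = E (\<Phi> z)"
      unfolding c(2) c'(2) z(1) g(1) E_def using chart_inv[OF M c(3) x(1)] by simp
  qed
  ultimately show "open (\<Phi> ` (D \<inter> D')) \<and> (\<exists>E. smooth_on (\<Phi> ` (D \<inter> D')) E \<and> (\<forall>x\<in>D \<inter> D'. \<Phi>' x = E (\<Phi> x)))"
    unfolding im using o2 by blast
qed

lemma smooth_map_jet_proj: "smooth_map (jet_bundle L) (base L) fst"
proof (rule smooth_mapI[OF premanifold_jet_bundle base_premanifold[OF L]])
  fix z assume z: "z \<in> pts (jet_bundle L)"
  then show "fst z \<in> pts (base L)" by (auto simp: jet_bundle_def)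
  note M = base_premanifold[OF L] and J = premanifold_jet_bundle
  obtain A \<phi> U h where c: "(A, \<phi>) \<in> atlas (base L)" "fst z \<in> A" "(U, h) \<in> trivs L" "fst z \<in> U"
    "z \<in> Sigma (A \<inter> U) (jet_fibre L)" by (rule jet_atlas_cover[OF z])
  note ja = jet_atlasI[OF c(1,3)]
  have "sm_at (jet_bundle L) (\<lambda>z. fst (jet_chart L A \<phi> h z)) z"
    by (rule sm_at_fst[OF J sm_at_chart[OF J ja c(5)]])
  then have "sm_at (jet_bundle L) (\<lambda>z. \<phi> (fst z)) z" by (simp add: jet_chart_def split_beta)
  then show "\<exists>V \<psi> S. (V, \<psi>) \<in> atlas (base L) \<and> openin (mfd_topology (jet_bundle L)) S \<and> z \<in> S \<and>
      fst ` S \<subseteq> V \<and> sm_at (jet_bundle L) (\<lambda>x. \<psi> (fst x)) z"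
    using c openin_chart[OF J ja] by fastforce
qed

text \<open>Two jets over the same point lie in a common chart domain, and jets over different
  points are separated by preimages of open sets of the base. A countable cover of the base by
  trivialising chart domains gives a countable atlas.\<close>

lemma smooth_manifold_jet_bundle: "smooth_manifold (jet_bundle L)"
  unfolding smooth_manifold_iff
proof (intro conjI)
  note M = base_premanifold[OF L] and J = premanifold_jet_bundle
  show "premanifold (jet_bundle L)" by (rule J)
  show "Hausdorff_space (mfd_topology (jet_bundle L))"
  proof (rule premanifold_HausdorffI[OF J])
    fix z z' assume z: "z \<in> pts (jet_bundle L)" "z' \<in> pts (jet_bundle L)" "z \<noteq> z'"
    show "(\<exists>U \<phi>. (U, \<phi>) \<in> atlas (jet_bundle L) \<and> z \<in> U \<and> z' \<in> U) \<or>
      (\<exists>S T. openin (mfd_topology (jet_bundle L)) S \<and> openin (mfd_topology (jet_bundle L)) T \<and> z \<in> S \<and> z' \<in> T \<and> S \<inter> T = {})"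
    proof (cases "fst z = fst z'")
      case True
      obtain A \<phi> U h where c: "(A, \<phi>) \<in> atlas (base L)" "fst z \<in> A" "(U, h) \<in> trivs L" "fst z \<in> U"
        "z \<in> Sigma (A \<inter> U) (jet_fibre L)" by (rule jet_atlas_cover[OF z(1)])
      moreover have "z' \<in> Sigma (A \<inter> U) (jet_fibre L)" using True c z(2) by (auto simp: jet_bundle_def)
      ultimately show ?thesis using jet_atlasI by blast
    next
      case False
      have "fst z \<in> pts (base L)" "fst z' \<in> pts (base L)" using z by (auto simp: jet_bundle_def)
      then obtain S T where ST: "openin (mfd_topology (base L)) S" "openin (mfd_topology (base L)) T"
        "fst z \<in> S" "fst z' \<in> T" "disjnt S T"
        using base_manifold[OF L] False unfolding smooth_manifold_iff Hausdorff_space_def topspace_mfd[OF M] by blast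
      note pre = smooth_map_openin_preimage[OF J M smooth_map_jet_proj]
      have "{y \<in> pts (jet_bundle L). fst y \<in> S} \<inter> {y \<in> pts (jet_bundle L). fst y \<in> T} = {}"
        using ST(5) by (auto simp: disjnt_iff)
      then show ?thesis using pre[OF ST(1)] pre[OF ST(2)] ST(3,4) z by blast
    qed
  qed
  let ?I = "{((A, \<phi>), (U, h)). (A, \<phi>) \<in> atlas (base L) \<and> (U, h) \<in> trivs L}"
  let ?X = "\<lambda>((A, \<phi>), (U, h)). A \<inter> U"
  have e: "(\<Union>i\<in>?I. ?X i) = pts (base L)"
  proof
    show "(\<Union>i\<in>?I. ?X i) \<subseteq> pts (base L)" using triv_subset[OF L] by auto
    show "pts (base L) \<subseteq> (\<Union>i\<in>?I. ?X i)"
    proof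
      fix x assume x: "x \<in> pts (base L)"
      obtain A \<phi> where A: "(A, \<phi>) \<in> atlas (base L)" "x \<in> A" using chart_cover[OF M x] by blast
      obtain U h where U: "(U, h) \<in> trivs L" "x \<in> U" using triv_cover[OF L x] by blast
      show "x \<in> (\<Union>i\<in>?I. ?X i)" using A U by (intro UN_I[of "((A, \<phi>), (U, h))"]) auto
    qed
  qed
  have o: "openin (mfd_topology (base L)) (?X i)" if "i \<in> ?I" for i
    using that openin_chart[OF M] triv_openin[OF L] by auto
  obtain J where J': "countable J" "J \<subseteq> ?I" "(\<Union>i\<in>J. ?X i) = pts (base L)"
    by (rule smooth_manifold_countable_subcover[OF base_manifold[OF L] o e])
  let ?c = "\<lambda>((A, \<phi>), (U, h)). (Sigma (A \<inter> U) (jet_fibre L), jet_chart L A \<phi> h)"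
  show "second_countable (mfd_topology (jet_bundle L))"
  proof (rule premanifold_second_countableI[OF J])
    show "countable (?c ` J)" using J'(1) by blast
    show "?c ` J \<subseteq> atlas (jet_bundle L)"
    proof
      fix d assume "d \<in> ?c ` J"
      then obtain A \<phi> U h where "((A, \<phi>), (U, h)) \<in> J" "d = ?c ((A, \<phi>), (U, h))"
        by (metis (no_types, lifting) imageE prod.exhaust)
      then show "d \<in> atlas (jet_bundle L)" using J'(2) jet_atlasI by auto
    qed
    have "(\<Union>(U, \<phi>)\<in>?c ` J. U) = Sigma (\<Union>i\<in>J. ?X i) (jet_fibre L)" by (auto simp: split_beta)
    then show "(\<Union>(U, \<phi>)\<in>?c ` J. U) = pts (jet_bundle L)" unfolding J'(3) by (simp add: jet_bundle_def)
  qed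
qed

lemma line_bundle_jet: "line_bundle (jet_line_bundle L)"
  unfolding jet_line_bundle_def
  by (rule line_bundle_pullback[OF L smooth_manifold_jet_bundle smooth_map_jet_proj])

end


section \<open>The line product\<close>

text \<open>The carrier of the base product, its chart domains and the fibres over single pairs of
  points are all of this form.\<close>

definition fibre_isos ::
    "('p, 'v::real_vector, 'e::real_inner) line_bundle \<Rightarrow> ('q, 'w::real_vector, 'f::real_inner) line_bundle \<Rightarrow>
     'p set \<Rightarrow> 'q set \<Rightarrow> ('p \<times> 'q \<times> ('v \<Rightarrow> 'w)) set" where
  "fibre_isos L1 L2 W1 W2 = {(x1, x2, b). x1 \<in> W1 \<and> x2 \<in> W2 \<and>
     zero_off (fib L1 x1) b \<and> linear_iso_betw (fib L1 x1) (fib L2 x2) b}"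

text \<open>The coordinate \<open>t\<close> of a fibre isomorphism, kept apart from the chart
  because it depends on the trivialisations only.\<close>

definition fibre_coord ::
    "('p, 'v::real_vector, 'e::real_inner) line_bundle \<Rightarrow> ('p \<Rightarrow> 'v \<Rightarrow> real) \<Rightarrow> ('q \<Rightarrow> 'w \<Rightarrow> real) \<Rightarrow>
     'p \<times> 'q \<times> ('v \<Rightarrow> 'w) \<Rightarrow> real" where
  "fibre_coord L1 h1 h2 = (\<lambda>(x1, x2, b). h2 x2 (b (the_inv_into (fib L1 x1) (h1 x1) 1)))"

definition product_chart ::
    "('p, 'v::real_vector, 'e::real_inner) line_bundle \<Rightarrow> ('p \<Rightarrow> 'e) \<Rightarrow> ('p \<Rightarrow> 'v \<Rightarrow> real) \<Rightarrow> ('q \<Rightarrow> 'f) \<Rightarrow> ('q \<Rightarrow> 'w \<Rightarrow> real) \<Rightarrow>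
     'p \<times> 'q \<times> ('v \<Rightarrow> 'w) \<Rightarrow> 'e \<times> 'f \<times> real" where
  "product_chart L1 \<phi>1 h1 \<phi>2 h2 = (\<lambda>(x1, x2, b). (\<phi>1 x1, \<phi>2 x2,
     h2 x2 (b (the_inv_into (fib L1 x1) (h1 x1) 1))))"

lemma product_chart_apply:
  "product_chart L1 \<phi>1 h1 \<phi>2 h2 z = (\<phi>1 (fst z), \<phi>2 (fst (snd z)), fibre_coord L1 h1 h2 z)"
  by (simp add: product_chart_def fibre_coord_def split_beta)

lemma pts_base_product: "pts (base_product L1 L2) = fibre_isos L1 L2 (pts (base L1)) (pts (base L2))"
  by (simp add: base_product_def fibre_isos_def)

lemma fibre_isosD:
  "z \<in> fibre_isos L1 L2 W1 W2 \<Longrightarrow> fst z \<in> W1 \<and> fst (snd z) \<in> W2 \<and> zero_off (fib L1 (fst z)) (snd (snd z)) \<and>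
    linear_iso_betw (fib L1 (fst z)) (fib L2 (fst (snd z))) (snd (snd z))"
  by (auto simp: fibre_isos_def)

lemma fibre_isosI:
  "fst z \<in> W1 \<Longrightarrow> fst (snd z) \<in> W2 \<Longrightarrow> zero_off (fib L1 (fst z)) (snd (snd z)) \<Longrightarrow>
    linear_iso_betw (fib L1 (fst z)) (fib L2 (fst (snd z))) (snd (snd z)) \<Longrightarrow> z \<in> fibre_isos L1 L2 W1 W2"
  by (cases z) (auto simp: fibre_isos_def)

context
  fixes L1 :: "('p, 'v::real_vector, 'e::real_inner) line_bundle"
    and L2 :: "('q, 'w::real_vector, 'f::real_inner) line_bundle"
  assumes L1: "line_bundle L1" and L2: "line_bundle L2"
begin

lemma base_product_atlasI:
  "(A1, \<phi>1) \<in> atlas (base L1) \<Longrightarrow> (U1, h1) \<in> trivs L1 \<Longrightarrow> (A2, \<phi>2) \<in> atlas (base L2) \<Longrightarrow> (U2, h2) \<in> trivs L2 \<Longrightarrow>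
    (fibre_isos L1 L2 (A1 \<inter> U1) (A2 \<inter> U2), product_chart L1 \<phi>1 h1 \<phi>2 h2) \<in> atlas (base_product L1 L2)"
  unfolding base_product_def fibre_isos_def product_chart_def by auto blast

lemma base_product_atlasE:
  assumes "(D, \<Phi>) \<in> atlas (base_product L1 L2)"
  obtains A1 \<phi>1 U1 h1 A2 \<phi>2 U2 h2 where "(A1, \<phi>1) \<in> atlas (base L1)" "(U1, h1) \<in> trivs L1"
    "(A2, \<phi>2) \<in> atlas (base L2)" "(U2, h2) \<in> trivs L2"
    "D = fibre_isos L1 L2 (A1 \<inter> U1) (A2 \<inter> U2)" "\<Phi> = product_chart L1 \<phi>1 h1 \<phi>2 h2"
  using assms that unfolding base_product_def fibre_isos_def product_chart_def by auto

lemma base_product_atlas_cover: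
  assumes "z \<in> pts (base_product L1 L2)"
  obtains A1 \<phi>1 U1 h1 A2 \<phi>2 U2 h2 where "(A1, \<phi>1) \<in> atlas (base L1)" "(U1, h1) \<in> trivs L1"
    "(A2, \<phi>2) \<in> atlas (base L2)" "(U2, h2) \<in> trivs L2" "fst z \<in> A1 \<inter> U1" "fst (snd z) \<in> A2 \<inter> U2"
    "z \<in> fibre_isos L1 L2 (A1 \<inter> U1) (A2 \<inter> U2)"
proof -
  have z: "fst z \<in> pts (base L1)" "fst (snd z) \<in> pts (base L2)"
    using fibre_isosD assms unfolding pts_base_product by blast+
  obtain A1 \<phi>1 where 1: "(A1, \<phi>1) \<in> atlas (base L1)" "fst z \<in> A1" using chart_cover[OF base_premanifold[OF L1] z(1)] by blast
  obtain A2 \<phi>2 where 2: "(A2, \<phi>2) \<in> atlas (base L2)" "fst (snd z) \<in> A2" using chart_cover[OF base_premanifold[OF L2] z(2)] by blast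
  obtain U1 h1 where 3: "(U1, h1) \<in> trivs L1" "fst z \<in> U1" using triv_cover[OF L1 z(1)] by blast
  obtain U2 h2 where 4: "(U2, h2) \<in> trivs L2" "fst (snd z) \<in> U2" using triv_cover[OF L2 z(2)] by blast
  have "z \<in> fibre_isos L1 L2 (A1 \<inter> U1) (A2 \<inter> U2)"
    by (rule fibre_isosI) (use fibre_isosD[OF assms[unfolded pts_base_product]] 1 2 3 4 in auto)
  then show ?thesis using that 1 2 3 4 by blast
qed

context
  fixes U1 h1 U2 h2
  assumes U1: "(U1, h1) \<in> trivs L1" and U2: "(U2, h2) \<in> trivs L2"
begin

text \<open>Every vector is its coordinate times the frame vector, whose image has coordinate
  \<open>t\<close>. So in the two trivialisations a fibre isomorphism is multiplication by
  \<open>t\<close>.\<close>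

lemma fibre_coord_apply:
  assumes z: "z \<in> fibre_isos L1 L2 U1 U2" and v: "v \<in> fib L1 (fst z)"
  shows "h2 (fst (snd z)) (snd (snd z) v) = fibre_coord L1 h1 h2 z * h1 (fst z) v"
proof -
  obtain x1 x2 b where zz: "z = (x1, x2, b)" by (cases z)
  have x: "x1 \<in> U1" "x2 \<in> U2" "linear_iso_betw (fib L1 x1) (fib L2 x2) b" using z by (auto simp: fibre_isos_def zz)
  let ?i = "the_inv_into (fib L1 x1) (h1 x1)"
  note b = linear_iso_betwD[OF x(3)]
  have "v = h1 x1 v *\<^sub>R ?i 1"
    using triv_inv(5)[OF L1 U1 x(1), of "h1 x1 v" 1] triv_inv(3)[OF L1 U1 x(1)] v zz by simp
  then have "b v = h1 x1 v *\<^sub>R b (?i 1)" using b(3)[OF triv_inv(1)[OF L1 U1 x(1)]] by metis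
  then show ?thesis
    using triv_scale[OF L2 U2 x(2) b(4)[OF triv_inv(1)[OF L1 U1 x(1)]]] by (simp add: zz fibre_coord_def)
qed

lemma fibre_coord_nonzero:
  assumes z: "z \<in> fibre_isos L1 L2 U1 U2"
  shows "fibre_coord L1 h1 h2 z \<noteq> 0"
proof
  assume 0: "fibre_coord L1 h1 h2 z = 0"
  have x: "fst z \<in> U1" "fst (snd z) \<in> U2" "linear_iso_betw (fib L1 (fst z)) (fib L2 (fst (snd z))) (snd (snd z))"
    using fibre_isosD[OF z] by blast+
  let ?i = "the_inv_into (fib L2 (fst (snd z))) (h2 (fst (snd z)))"
  have "?i 1 \<in> snd (snd z) ` fib L1 (fst z)"
    using linear_iso_betwD(1)[OF x(3)] triv_inv(1)[OF L2 U2 x(2)] by (auto simp: bij_betw_def)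
  then have "h2 (fst (snd z)) (?i 1) = 0" using fibre_coord_apply[OF z] 0 by auto
  then show False using triv_inv(2)[OF L2 U2 x(2)] by simp
qed

text \<open>Off the fibre both maps are zero by convention, so agreement on the fibre, which the
  coordinate \<open>t\<close> decides, is equality of functions.\<close>

lemma fibre_iso_eqI:
  assumes "z \<in> fibre_isos L1 L2 U1 U2" "z' \<in> fibre_isos L1 L2 U1 U2" "fst z = fst z'" "fst (snd z) = fst (snd z')"
    "fibre_coord L1 h1 h2 z = fibre_coord L1 h1 h2 z'"
  shows "z = z'"
proof -
  have "snd (snd z) v = snd (snd z') v" for v
  proof (cases "v \<in> fib L1 (fst z)")
    case True
    have "snd (snd z) v \<in> fib L2 (fst (snd z))" "snd (snd z') v \<in> fib L2 (fst (snd z))" "fst (snd z) \<in> U2"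
      using fibre_isosD[OF assms(1)] fibre_isosD[OF assms(2)] linear_iso_betwD(4) assms(3,4) True by metis+
    moreover have "h2 (fst (snd z)) (snd (snd z) v) = h2 (fst (snd z)) (snd (snd z') v)"
      using fibre_coord_apply[OF assms(1)] fibre_coord_apply[OF assms(2)] True assms by simp
    ultimately show ?thesis using triv_eqI[OF L2 U2] by blast
  next
    case False
    then show ?thesis
      using fibre_isosD[OF assms(1)] fibre_isosD[OF assms(2)] assms(3) unfolding zero_off_def by metis
  qed
  then show ?thesis using assms(3,4) by (simp add: prod_eq_iff ext)
qed

lemma fibre_iso_exists:
  assumes x: "x1 \<in> U1" "x2 \<in> U2" and t: "t \<noteq> 0"
  obtains b where "(x1, x2, b) \<in> fibre_isos L1 L2 {x1} {x2}" "fibre_coord L1 h1 h2 (x1, x2, b) = t"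
proof -
  let ?i1 = "the_inv_into (fib L1 x1) (h1 x1)" and ?i2 = "the_inv_into (fib L2 x2) (h2 x2)"
  note i1 = triv_inv[OF L1 U1 x(1)] and i2 = triv_inv[OF L2 U2 x(2)]
  define b where "b v = (if v \<in> fib L1 x1 then ?i2 (t * h1 x1 v) else 0)" for v
  have sub: "subspace (fib L1 x1)" using fib_subspace[OF L1] triv_subset[OF L1 U1] x(1) by blast
  have bij: "bij_betw b (fib L1 x1) (fib L2 x2)"
  proof (rule bij_betw_byWitness[of _ "\<lambda>w. ?i1 (h2 x2 w / t)"])
    show "\<forall>v\<in>fib L1 x1. ?i1 (h2 x2 (b v) / t) = v" using i1(3) i2(2) t by (simp add: b_def)
    show "\<forall>w\<in>fib L2 x2. b (?i1 (h2 x2 w / t)) = w" using i1(1,2) i2(3) t by (simp add: b_def)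
    show "b ` fib L1 x1 \<subseteq> fib L2 x2" using i2(1) by (auto simp: b_def)
    show "(\<lambda>w. ?i1 (h2 x2 w / t)) ` fib L2 x2 \<subseteq> fib L1 x1" using i1(1) by auto
  qed
  have "b (u + v) = b u + b v" if "u \<in> fib L1 x1" "v \<in> fib L1 x1" for u v
    using that subspace_add[OF sub that] triv_add[OF L1 U1 x(1) that] by (simp add: b_def distrib_left i2(4))
  moreover have "b (c *\<^sub>R v) = c *\<^sub>R b v" if "v \<in> fib L1 x1" for c v
    using that subspace_scale[OF sub that, of c] triv_scale[OF L1 U1 x(1) that] i2(5)[of c "t * h1 x1 v"]
    by (simp add: b_def mult.left_commute)
  ultimately have "linear_iso_betw (fib L1 x1) (fib L2 x2) b" using bij unfolding linear_iso_betw_def by blast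
  moreover have "zero_off (fib L1 x1) b" by (simp add: zero_off_def b_def)
  moreover have "fibre_coord L1 h1 h2 (x1, x2, b) = t" by (simp add: fibre_coord_def b_def i1 i2(2))
  ultimately show ?thesis using that by (simp add: fibre_isos_def)
qed

lemma product_chart_image:
  assumes W: "W1 \<subseteq> U1" "W2 \<subseteq> U2"
  shows "product_chart L1 \<phi>1 h1 \<phi>2 h2 ` fibre_isos L1 L2 W1 W2 = \<phi>1 ` W1 \<times> \<phi>2 ` W2 \<times> (- {0})"
proof
  have "z \<in> fibre_isos L1 L2 U1 U2" if "z \<in> fibre_isos L1 L2 W1 W2" for z
    using that W by (auto simp: fibre_isos_def)
  then show "product_chart L1 \<phi>1 h1 \<phi>2 h2 ` fibre_isos L1 L2 W1 W2 \<subseteq> \<phi>1 ` W1 \<times> \<phi>2 ` W2 \<times> (- {0})"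
    using fibre_coord_nonzero fibre_isosD unfolding product_chart_apply by fastforce
  show "\<phi>1 ` W1 \<times> \<phi>2 ` W2 \<times> (- {0}) \<subseteq> product_chart L1 \<phi>1 h1 \<phi>2 h2 ` fibre_isos L1 L2 W1 W2"
  proof
    fix y assume "y \<in> \<phi>1 ` W1 \<times> \<phi>2 ` W2 \<times> (- {0::real})"
    then obtain x1 x2 t where y: "y = (\<phi>1 x1, \<phi>2 x2, t)" "x1 \<in> W1" "x2 \<in> W2" "t \<noteq> 0" by (cases y) auto
    obtain b where b: "(x1, x2, b) \<in> fibre_isos L1 L2 {x1} {x2}" "fibre_coord L1 h1 h2 (x1, x2, b) = t"
      by (rule fibre_iso_exists[OF subsetD[OF W(1) y(2)] subsetD[OF W(2) y(3)] y(4)])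
    then have "(x1, x2, b) \<in> fibre_isos L1 L2 W1 W2" using y by (auto simp: fibre_isos_def)
    moreover have "y = product_chart L1 \<phi>1 h1 \<phi>2 h2 (x1, x2, b)" by (simp add: product_chart_apply b(2) y(1))
    ultimately show "y \<in> product_chart L1 \<phi>1 h1 \<phi>2 h2 ` fibre_isos L1 L2 W1 W2" by blast
  qed
qed

end

lemma premanifold_base_product: "premanifold (base_product L1 L2)"
proof (rule premanifoldI)
  note M1 = base_premanifold[OF L1] and M2 = base_premanifold[OF L2]
  note fd1 = premanifold_findim[OF M1] and fd2 = premanifold_findim[OF M2]
  show "findim TYPE('e \<times> 'f \<times> real)" using findim_prod[OF fd1 findim_prod[OF fd2 findim_real]] .
  show "(\<Union>(U, \<phi>)\<in>atlas (base_product L1 L2). U) = pts (base_product L1 L2)"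
  proof
    show "(\<Union>(U, \<phi>)\<in>atlas (base_product L1 L2). U) \<subseteq> pts (base_product L1 L2)"
    proof
      fix z assume "z \<in> (\<Union>(U, \<phi>)\<in>atlas (base_product L1 L2). U)"
      then obtain D \<Phi> where D: "(D, \<Phi>) \<in> atlas (base_product L1 L2)" "z \<in> D" by blast
      obtain A1 \<phi>1 U1 h1 A2 \<phi>2 U2 h2 where c: "(A1, \<phi>1) \<in> atlas (base L1)" "(U1, h1) \<in> trivs L1"
        "(A2, \<phi>2) \<in> atlas (base L2)" "(U2, h2) \<in> trivs L2"
        "D = fibre_isos L1 L2 (A1 \<inter> U1) (A2 \<inter> U2)" "\<Phi> = product_chart L1 \<phi>1 h1 \<phi>2 h2"
        by (rule base_product_atlasE[OF D(1)])
      show "z \<in> pts (base_product L1 L2)"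
        using D(2) triv_subset[OF L1 c(2)] triv_subset[OF L2 c(4)]
        unfolding c(5) pts_base_product fibre_isos_def by blast
    qed
    show "pts (base_product L1 L2) \<subseteq> (\<Union>(U, \<phi>)\<in>atlas (base_product L1 L2). U)"
    proof
      fix z assume z: "z \<in> pts (base_product L1 L2)"
      obtain A1 \<phi>1 U1 h1 A2 \<phi>2 U2 h2 where c: "(A1, \<phi>1) \<in> atlas (base L1)" "(U1, h1) \<in> trivs L1"
        "(A2, \<phi>2) \<in> atlas (base L2)" "(U2, h2) \<in> trivs L2" "fst z \<in> A1 \<inter> U1" "fst (snd z) \<in> A2 \<inter> U2"
        "z \<in> fibre_isos L1 L2 (A1 \<inter> U1) (A2 \<inter> U2)" by (rule base_product_atlas_cover[OF z])
      show "z \<in> (\<Union>(U, \<phi>)\<in>atlas (base_product L1 L2). U)"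
        using base_product_atlasI[OF c(1-4)] c(7) by blast
    qed
  qed
  fix D \<Phi> assume "(D, \<Phi>) \<in> atlas (base_product L1 L2)"
  then obtain A1 \<phi>1 U1 h1 A2 \<phi>2 U2 h2 where c: "(A1, \<phi>1) \<in> atlas (base L1)" "(U1, h1) \<in> trivs L1"
    "(A2, \<phi>2) \<in> atlas (base L2)" "(U2, h2) \<in> trivs L2"
    "D = fibre_isos L1 L2 (A1 \<inter> U1) (A2 \<inter> U2)" "\<Phi> = product_chart L1 \<phi>1 h1 \<phi>2 h2"
    by (rule base_product_atlasE)
  show "inj_on \<Phi> D"
  proof (rule inj_onI)
    fix z z' assume z: "z \<in> D" "z' \<in> D" and eq: "\<Phi> z = \<Phi> z'"
    have zU: "z \<in> fibre_isos L1 L2 U1 U2" "z' \<in> fibre_isos L1 L2 U1 U2" using z by (auto simp: c(5) fibre_isos_def)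
    have "\<phi>1 (fst z) = \<phi>1 (fst z')" "\<phi>2 (fst (snd z)) = \<phi>2 (fst (snd z'))"
      "fibre_coord L1 h1 h2 z = fibre_coord L1 h1 h2 z'" using eq by (simp_all add: c(6) product_chart_apply)
    moreover have "fst z = fst z'"
      by (rule inj_onD[OF chart_inj[OF M1 c(1)] calculation(1)]) (use z in \<open>auto simp: c(5) fibre_isos_def\<close>)
    moreover have "fst (snd z) = fst (snd z')"
      by (rule inj_onD[OF chart_inj[OF M2 c(3)] calculation(2)]) (use z in \<open>auto simp: c(5) fibre_isos_def\<close>)
    ultimately show "z = z'" using fibre_iso_eqI[OF c(2,4) zU] by blast
  qed
  fix D' \<Phi>' assume "(D', \<Phi>') \<in> atlas (base_product L1 L2)"
  then obtain A1' \<phi>1' U1' h1' A2' \<phi>2' U2' h2' where c': "(A1', \<phi>1') \<in> atlas (base L1)" "(U1', h1') \<in> trivs L1"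
    "(A2', \<phi>2') \<in> atlas (base L2)" "(U2', h2') \<in> trivs L2"
    "D' = fibre_isos L1 L2 (A1' \<inter> U1') (A2' \<inter> U2')" "\<Phi>' = product_chart L1 \<phi>1' h1' \<phi>2' h2'"
    by (rule base_product_atlasE)
  obtain q1 where q1: "\<forall>x\<in>U1 \<inter> U1'. sm_at (base L1) q1 x \<and> q1 x \<noteq> 0 \<and> (\<forall>v\<in>fib L1 x. h1' x v = q1 x * h1 x v)"
    using triv_change[OF L1 c(2) c'(2)] by blast
  obtain q2 where q2: "\<forall>x\<in>U2 \<inter> U2'. sm_at (base L2) q2 x \<and> q2 x \<noteq> 0 \<and> (\<forall>v\<in>fib L2 x. h2' x v = q2 x * h2 x v)"
    using triv_change[OF L2 c(4) c'(4)] by blast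
  define W1 where "W1 = A1 \<inter> U1 \<inter> (A1' \<inter> U1')"
  define W2 where "W2 = A2 \<inter> U2 \<inter> (A2' \<inter> U2')"
  have DD: "D \<inter> D' = fibre_isos L1 L2 W1 W2" unfolding c(5) c'(5) W1_def W2_def fibre_isos_def by blast
  have im: "\<Phi> ` (D \<inter> D') = \<phi>1 ` W1 \<times> \<phi>2 ` W2 \<times> (- {0})"
    unfolding DD c(6) by (rule product_chart_image[OF c(2,4)]) (auto simp: W1_def W2_def)
  have oW: "openin (mfd_topology (base L1)) W1" "openin (mfd_topology (base L2)) W2"
    unfolding W1_def W2_def using openin_chart[OF M1] triv_openin[OF L1] openin_chart[OF M2] triv_openin[OF L2] c c'
    by blast+
  have o: "open (\<phi>1 ` W1)" "open (\<phi>2 ` W2)"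
    by (rule open_chart_image[OF M1 oW(1) c(1)], force simp: W1_def)
       (rule open_chart_image[OF M2 oW(2) c(3)], force simp: W2_def)
  let ?S = "\<phi>1 ` W1 \<times> \<phi>2 ` W2 \<times> (- {0::real})"
  have o2: "open ?S" using o by (intro open_Times) auto
  have 1: "smooth_on ?S (\<lambda>z. (f \<circ> the_inv_into A1 \<phi>1) (fst z))" if "\<And>x. x \<in> W1 \<Longrightarrow> sm_at (base L1) f x"
    for f :: "'p \<Rightarrow> 'x::real_normed_vector"
  proof -
    have "smooth_on (\<phi>1 ` W1) (f \<circ> the_inv_into A1 \<phi>1)"
      using smooth_on_chart_iff[OF M1 c(1) oW(1), of f] that by (auto simp: W1_def)
    then show ?thesis
      by (rule smooth_on_compose[OF _ _ fd1 o2 o(1)]) (use o2 in \<open>auto intro: smooth_intros\<close>)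
  qed
  have 2: "smooth_on ?S (\<lambda>z. (f \<circ> the_inv_into A2 \<phi>2) (fst (snd z)))" if "\<And>x. x \<in> W2 \<Longrightarrow> sm_at (base L2) f x"
    for f :: "'q \<Rightarrow> 'x::real_normed_vector"
  proof -
    have "smooth_on (\<phi>2 ` W2) (f \<circ> the_inv_into A2 \<phi>2)"
      using smooth_on_chart_iff[OF M2 c(3) oW(2), of f] that by (auto simp: W2_def)
    then show ?thesis
      by (rule smooth_on_compose[OF _ smooth_on_fst[OF o2 smooth_on_snd[OF o2 smooth_on_id[OF o2]]] fd2 o2 o(2)]) auto
  qed
  let ?i1 = "the_inv_into A1 \<phi>1" and ?i2 = "the_inv_into A2 \<phi>2"
  \<comment> \<open>Rescaling the source trivialisation by \<open>q1\<close> and the target one by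
    \<open>q2\<close> changes the matrix \<open>t\<close> into \<open>q2 * t / q1\<close>.\<close>
  define E where "E = (\<lambda>z. ((\<phi>1' \<circ> ?i1) (fst z), (\<phi>2' \<circ> ?i2) (fst (snd z)),
    (q2 \<circ> ?i2) (fst (snd z)) * snd (snd z) / (q1 \<circ> ?i1) (fst z)))"
  have "smooth_on ?S E"
    unfolding E_def
  proof (intro smooth_on_Pair smooth_on_divide smooth_on_mult smooth_on_snd smooth_on_id o2 1 2)
    fix z assume "z \<in> ?S"
    then show "(q1 \<circ> ?i1) (fst z) \<noteq> 0" using q1 chart_inv[OF M1 c(1)] by (auto simp: W1_def)
  qed (use q1 q2 sm_at_chart[OF M1 c'(1)] sm_at_chart[OF M2 c'(3)] in \<open>auto simp: W1_def W2_def\<close>)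
  moreover have "\<forall>z\<in>D \<inter> D'. \<Phi>' z = E (\<Phi> z)"
  proof
    fix z assume zD: "z \<in> D \<inter> D'"
    then have x: "fst z \<in> W1" "fst (snd z) \<in> W2" using fibre_isosD unfolding DD by blast+
    have zU: "z \<in> fibre_isos L1 L2 U1 U2" using zD by (auto simp: c(5) fibre_isos_def)
    have xU: "fst z \<in> U1 \<inter> U1'" "fst (snd z) \<in> U2 \<inter> U2'" using x by (auto simp: W1_def W2_def)
    let ?v = "the_inv_into (fib L1 (fst z)) (h1' (fst z)) 1"
    have v: "?v \<in> fib L1 (fst z)" "h1' (fst z) ?v = 1" using triv_inv[OF L1 c'(2)] xU by auto
    then have "h1 (fst z) ?v = 1 / q1 (fst z)" using q1 xU(1) by (auto simp: field_simps)
    moreover have "snd (snd z) ?v \<in> fib L2 (fst (snd z))"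
      using fibre_isosD[OF zU] linear_iso_betwD(4) v(1) by metis
    moreover have "fibre_coord L1 h1' h2' z = h2' (fst (snd z)) (snd (snd z) ?v)"
      by (simp add: fibre_coord_def split_beta)
    ultimately have "fibre_coord L1 h1' h2' z = q2 (fst (snd z)) * fibre_coord L1 h1 h2 z / q1 (fst z)"
      using q2 xU(2) fibre_coord_apply[OF c(2,4) zU v(1)] by simp
    then show "\<Phi>' z = E (\<Phi> z)"
      unfolding c(6) c'(6) E_def product_chart_apply
      using chart_inv[OF M1 c(1)] chart_inv[OF M2 c(3)] x by (simp add: W1_def W2_def)
  qed
  ultimately show "open (\<Phi> ` (D \<inter> D')) \<and> (\<exists>E. smooth_on (\<Phi> ` (D \<inter> D')) E \<and> (\<forall>x\<in>D \<inter> D'. \<Phi>' x = E (\<Phi> x)))"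
    unfolding im using o2 by blast
qed

lemma bp_proj_eq: "bp_proj1 = fst" "bp_proj2 = (\<lambda>z. fst (snd z))"
  by (auto simp: bp_proj1_def bp_proj2_def)

lemma smooth_map_bp_proj1: "smooth_map (base_product L1 L2) (base L1) fst"
  and smooth_map_bp_proj2: "smooth_map (base_product L1 L2) (base L2) (\<lambda>z. fst (snd z))"
proof -
  note J = premanifold_base_product
  have *: "\<exists>A1 \<phi>1 A2 \<phi>2 S. (A1, \<phi>1) \<in> atlas (base L1) \<and> (A2, \<phi>2) \<in> atlas (base L2) \<and>
      openin (mfd_topology (base_product L1 L2)) S \<and> z \<in> S \<and> fst ` S \<subseteq> A1 \<and> (\<lambda>z. fst (snd z)) ` S \<subseteq> A2 \<and>
      sm_at (base_product L1 L2) (\<lambda>z. \<phi>1 (fst z)) z \<and> sm_at (base_product L1 L2) (\<lambda>z. \<phi>2 (fst (snd z))) z"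
    if z: "z \<in> pts (base_product L1 L2)" for z
  proof -
    obtain A1 \<phi>1 U1 h1 A2 \<phi>2 U2 h2 where c: "(A1, \<phi>1) \<in> atlas (base L1)" "(U1, h1) \<in> trivs L1"
      "(A2, \<phi>2) \<in> atlas (base L2)" "(U2, h2) \<in> trivs L2" "fst z \<in> A1 \<inter> U1" "fst (snd z) \<in> A2 \<inter> U2"
      "z \<in> fibre_isos L1 L2 (A1 \<inter> U1) (A2 \<inter> U2)" by (rule base_product_atlas_cover[OF z])
    note a = base_product_atlasI[OF c(1-4)]
    note s = sm_at_chart[OF J a c(7)]
    have "fst ` fibre_isos L1 L2 (A1 \<inter> U1) (A2 \<inter> U2) \<subseteq> A1"
      "(\<lambda>z. fst (snd z)) ` fibre_isos L1 L2 (A1 \<inter> U1) (A2 \<inter> U2) \<subseteq> A2"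
      using fibre_isosD by blast+
    moreover have "sm_at (base_product L1 L2) (\<lambda>z. \<phi>1 (fst z)) z"
      "sm_at (base_product L1 L2) (\<lambda>z. \<phi>2 (fst (snd z))) z"
      using sm_at_fst[OF J s] sm_at_fst[OF J sm_at_snd[OF J s]] by (simp_all add: product_chart_apply)
    ultimately show ?thesis using c(1,3,7) openin_chart[OF J a] by blast
  qed
  have pts: "fst z \<in> pts (base L1)" "fst (snd z) \<in> pts (base L2)" if "z \<in> pts (base_product L1 L2)" for z
    using that fibre_isosD unfolding pts_base_product by blast+
  show "smooth_map (base_product L1 L2) (base L1) fst"
  proof (rule smooth_mapI[OF J base_premanifold[OF L1] pts(1)])
    fix z assume "z \<in> pts (base_product L1 L2)"
    from *[OF this] show "\<exists>V \<psi> S. (V, \<psi>) \<in> atlas (base L1) \<and> openin (mfd_topology (base_product L1 L2)) S \<and>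
        z \<in> S \<and> fst ` S \<subseteq> V \<and> sm_at (base_product L1 L2) (\<lambda>z. \<psi> (fst z)) z" by blast
  qed
  show "smooth_map (base_product L1 L2) (base L2) (\<lambda>z. fst (snd z))"
  proof (rule smooth_mapI[OF J base_premanifold[OF L2] pts(2)])
    fix z assume "z \<in> pts (base_product L1 L2)"
    from *[OF this] show "\<exists>V \<psi> S. (V, \<psi>) \<in> atlas (base L2) \<and> openin (mfd_topology (base_product L1 L2)) S \<and>
        z \<in> S \<and> (\<lambda>z. fst (snd z)) ` S \<subseteq> V \<and> sm_at (base_product L1 L2) (\<lambda>z. \<psi> (fst (snd z))) z" by blast
  qed
qed

text \<open>Points with equal projections share a chart domain; all others are separated in one of
  the two factors and pulled back. Countable covers of the two bases by trivialising chart domains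
  combine in pairs to a countable atlas.\<close>

lemma smooth_manifold_base_product: "smooth_manifold (base_product L1 L2)"
  unfolding smooth_manifold_iff
proof (intro conjI)
  note J = premanifold_base_product and M1 = base_premanifold[OF L1] and M2 = base_premanifold[OF L2]
  let ?P = "base_product L1 L2"
  show "premanifold ?P" by (rule J)
  have sep: "\<exists>S T. openin (mfd_topology ?P) S \<and> openin (mfd_topology ?P) T \<and> z \<in> S \<and> z' \<in> T \<and> S \<inter> T = {}"
    if N: "smooth_manifold N" and f: "smooth_map ?P N f" and z: "z \<in> pts ?P" "z' \<in> pts ?P" "f z \<noteq> f z'"
    for N :: "('x, 'y::real_inner) mfd" and f z z'
  proof -
    have Np: "premanifold N" using N smooth_manifold_iff by blast
    have "f z \<in> pts N" "f z' \<in> pts N" using smooth_map_pts[OF J Np f] z by blast+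
    then obtain S T where ST: "openin (mfd_topology N) S" "openin (mfd_topology N) T" "f z \<in> S" "f z' \<in> T" "disjnt S T"
      using N z(3) unfolding smooth_manifold_iff Hausdorff_space_def topspace_mfd[OF Np] by blast
    note pre = smooth_map_openin_preimage[OF J Np f]
    have "{y \<in> pts ?P. f y \<in> S} \<inter> {y \<in> pts ?P. f y \<in> T} = {}" using ST(5) by (auto simp: disjnt_iff)
    then show ?thesis using pre[OF ST(1)] pre[OF ST(2)] ST(3,4) z by blast
  qed
  show "Hausdorff_space (mfd_topology ?P)"
  proof (rule premanifold_HausdorffI[OF J])
    fix z z' assume z: "z \<in> pts ?P" "z' \<in> pts ?P" "z \<noteq> z'"
    show "(\<exists>U \<phi>. (U, \<phi>) \<in> atlas ?P \<and> z \<in> U \<and> z' \<in> U) \<or>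
      (\<exists>S T. openin (mfd_topology ?P) S \<and> openin (mfd_topology ?P) T \<and> z \<in> S \<and> z' \<in> T \<and> S \<inter> T = {})"
    proof (cases "fst z = fst z' \<and> fst (snd z) = fst (snd z')")
      case True
      obtain A1 \<phi>1 U1 h1 A2 \<phi>2 U2 h2 where c: "(A1, \<phi>1) \<in> atlas (base L1)" "(U1, h1) \<in> trivs L1"
        "(A2, \<phi>2) \<in> atlas (base L2)" "(U2, h2) \<in> trivs L2" "fst z \<in> A1 \<inter> U1" "fst (snd z) \<in> A2 \<inter> U2"
        "z \<in> fibre_isos L1 L2 (A1 \<inter> U1) (A2 \<inter> U2)" by (rule base_product_atlas_cover[OF z(1)])
      have "z' \<in> fibre_isos L1 L2 (A1 \<inter> U1) (A2 \<inter> U2)"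
        by (rule fibre_isosI) (use True c fibre_isosD[of z'] z(2) in \<open>auto simp: pts_base_product\<close>)
      then show ?thesis using base_product_atlasI[OF c(1-4)] c(7) by blast
    next
      case False
      then show ?thesis
        using sep[OF base_manifold[OF L1] smooth_map_bp_proj1 z(1,2)]
          sep[OF base_manifold[OF L2] smooth_map_bp_proj2 z(1,2)] by blast
    qed
  qed
  have cov: "\<exists>J. countable J \<and> J \<subseteq> atlas (base L) \<times> trivs L \<and> (\<Union>((A, \<phi>), (U, h))\<in>J. A \<inter> U) = pts (base L)"
    if L: "line_bundle L" for L :: "('x, 'y::real_vector, 'z::real_inner) line_bundle"
  proof -
    let ?I = "atlas (base L) \<times> trivs L" and ?X = "\<lambda>((A, \<phi>), (U, h)). A \<inter> U"
    have e: "(\<Union>i\<in>?I. ?X i) = pts (base L)"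
    proof
      show "(\<Union>i\<in>?I. ?X i) \<subseteq> pts (base L)" using triv_subset[OF L] by auto
      show "pts (base L) \<subseteq> (\<Union>i\<in>?I. ?X i)"
      proof
        fix x assume x: "x \<in> pts (base L)"
        obtain A \<phi> where A: "(A, \<phi>) \<in> atlas (base L)" "x \<in> A" using chart_cover[OF base_premanifold[OF L] x] by blast
        obtain U h where U: "(U, h) \<in> trivs L" "x \<in> U" using triv_cover[OF L x] by blast
        show "x \<in> (\<Union>i\<in>?I. ?X i)" using A U by (intro UN_I[of "((A, \<phi>), (U, h))"]) auto
      qed
    qed
    have o: "openin (mfd_topology (base L)) (?X i)" if "i \<in> ?I" for i
      using that openin_chart[OF base_premanifold[OF L]] triv_openin[OF L] by auto
    obtain J where J': "countable J" "J \<subseteq> ?I" "(\<Union>i\<in>J. ?X i) = pts (base L)"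
      by (rule smooth_manifold_countable_subcover[OF base_manifold[OF L] o e])
    then show ?thesis by blast
  qed
  obtain J1 where J1: "countable J1" "J1 \<subseteq> atlas (base L1) \<times> trivs L1" "(\<Union>((A, \<phi>), (U, h))\<in>J1. A \<inter> U) = pts (base L1)"
    using cov[OF L1] by blast
  obtain J2 where J2: "countable J2" "J2 \<subseteq> atlas (base L2) \<times> trivs L2" "(\<Union>((A, \<phi>), (U, h))\<in>J2. A \<inter> U) = pts (base L2)"
    using cov[OF L2] by blast
  let ?c = "\<lambda>(((A1, \<phi>1), (U1, h1)), ((A2, \<phi>2), (U2, h2))).
    (fibre_isos L1 L2 (A1 \<inter> U1) (A2 \<inter> U2), product_chart L1 \<phi>1 h1 \<phi>2 h2)"
  show "second_countable (mfd_topology ?P)"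
  proof (rule premanifold_second_countableI[OF J])
    show "countable (?c ` (J1 \<times> J2))" using J1(1) J2(1) by blast
    show sub: "?c ` (J1 \<times> J2) \<subseteq> atlas ?P"
    proof
      fix d assume "d \<in> ?c ` (J1 \<times> J2)"
      then obtain i j where "i \<in> J1" "j \<in> J2" "d = ?c (i, j)" by blast
      moreover obtain A1 \<phi>1 U1 h1 where "i = ((A1, \<phi>1), (U1, h1))" by (metis prod.exhaust)
      moreover obtain A2 \<phi>2 U2 h2 where "j = ((A2, \<phi>2), (U2, h2))" by (metis prod.exhaust)
      ultimately have d: "d = ?c (((A1, \<phi>1), (U1, h1)), ((A2, \<phi>2), (U2, h2)))"
        "((A1, \<phi>1), (U1, h1)) \<in> atlas (base L1) \<times> trivs L1" "((A2, \<phi>2), (U2, h2)) \<in> atlas (base L2) \<times> trivs L2"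
        using J1(2) J2(2) by blast+
      show "d \<in> atlas ?P" using d(2,3) unfolding d(1) by (auto intro: base_product_atlasI)
    qed
    show "(\<Union>(U, \<phi>)\<in>?c ` (J1 \<times> J2). U) = pts ?P"
    proof
      show "(\<Union>(U, \<phi>)\<in>?c ` (J1 \<times> J2). U) \<subseteq> pts ?P"
      proof
        fix z assume "z \<in> (\<Union>(U, \<phi>)\<in>?c ` (J1 \<times> J2). U)"
        then obtain d where d: "d \<in> ?c ` (J1 \<times> J2)" "z \<in> (case d of (U, \<phi>) \<Rightarrow> U)" by (elim UN_E)
        obtain D \<Phi> where "d = (D, \<Phi>)" by (cases d)
        then show "z \<in> pts ?P" using subsetD[OF sub d(1)] d(2) chart_subset[OF J] by auto
      qed
      show "pts ?P \<subseteq> (\<Union>(U, \<phi>)\<in>?c ` (J1 \<times> J2). U)"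
      proof
        fix z assume z: "z \<in> pts ?P"
        then have m: "fst z \<in> (\<Union>((A, \<phi>), (U, h))\<in>J1. A \<inter> U)" "fst (snd z) \<in> (\<Union>((A, \<phi>), (U, h))\<in>J2. A \<inter> U)"
          using fibre_isosD[OF z[unfolded pts_base_product]] unfolding J1(3) J2(3) by blast+
        from m(1) obtain i where ij1: "i \<in> J1" "fst z \<in> (\<lambda>((A, \<phi>), (U, h)). A \<inter> U) i" by (elim UN_E)
        from m(2) obtain j where ij2: "j \<in> J2" "fst (snd z) \<in> (\<lambda>((A, \<phi>), (U, h)). A \<inter> U) j" by (elim UN_E)
        obtain A1 \<phi>1 U1 h1 where e1: "i = ((A1, \<phi>1), (U1, h1))" by (metis prod.exhaust)
        obtain A2 \<phi>2 U2 h2 where e2: "j = ((A2, \<phi>2), (U2, h2))" by (metis prod.exhaust)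
        have i: "((A1, \<phi>1), (U1, h1)) \<in> J1" "fst z \<in> A1 \<inter> U1"
          "((A2, \<phi>2), (U2, h2)) \<in> J2" "fst (snd z) \<in> A2 \<inter> U2" using ij1 ij2 unfolding e1 e2 by simp_all
        have "z \<in> fibre_isos L1 L2 (A1 \<inter> U1) (A2 \<inter> U2)"
          by (rule fibre_isosI) (use i fibre_isosD[of z] z in \<open>auto simp: pts_base_product\<close>)
        then show "z \<in> (\<Union>(U, \<phi>)\<in>?c ` (J1 \<times> J2). U)"
          by (intro UN_I[of "?c (((A1, \<phi>1), (U1, h1)), ((A2, \<phi>2), (U2, h2)))"] imageI) (use i in auto)
      qed
    qed
  qed
qed

lemma line_bundle_line_product: "line_bundle (line_product L1 L2)"
  unfolding line_product_def bp_proj_eq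
  by (rule line_bundle_pullback[OF L1 smooth_manifold_base_product smooth_map_bp_proj1])

end

lemma line_product_simps:
  "base (line_product L1 L2) = base_product L1 L2"
  "fib (line_product L1 L2) z = fib L1 (fst z)"
  by (simp_all add: line_product_def pullback_bundle_def bp_proj1_def split_beta)

lemma line_product_trivs:
  "trivs (line_product L1 L2) = (\<lambda>(U, h). ({z \<in> pts (base_product L1 L2). fst z \<in> U}, \<lambda>z. h (fst z))) ` trivs L1"
  by (simp add: line_product_def pullback_bundle_def bp_proj1_def split_beta)


section \<open>The der bundle of a line product\<close>

lemma pull_section_add:
  assumes L: "line_bundle L" and iso: "\<And>x. x \<in> pts (base L) \<Longrightarrow> linear_iso_betw (fib L x) (fib L' (\<phi> x)) (fibre_map B x)"
    and s: "\<And>x. x \<in> pts (base L) \<Longrightarrow> s (\<phi> x) \<in> fib L' (\<phi> x)" "\<And>x. x \<in> pts (base L) \<Longrightarrow> r (\<phi> x) \<in> fib L' (\<phi> x)"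
  shows "pull_section L \<phi> B (\<lambda>y. s y + r y) = (\<lambda>x. pull_section L \<phi> B s x + pull_section L \<phi> B r x)"
  using linear_iso_betw_inv(4)[OF iso fib_subspace[OF L]] s by (auto simp: pull_section_def)

lemma pull_section_scale:
  assumes L: "line_bundle L" and iso: "\<And>x. x \<in> pts (base L) \<Longrightarrow> linear_iso_betw (fib L x) (fib L' (\<phi> x)) (fibre_map B x)"
    and s: "\<And>x. x \<in> pts (base L) \<Longrightarrow> s (\<phi> x) \<in> fib L' (\<phi> x)"
  shows "pull_section L \<phi> B (\<lambda>y. f y *\<^sub>R s y) = (\<lambda>x. f (\<phi> x) *\<^sub>R pull_section L \<phi> B s x)"
  using linear_iso_betw_inv(5)[OF iso fib_subspace[OF L]] s by (auto simp: pull_section_def)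

lemma pull_section_off: "x \<notin> pts (base L) \<Longrightarrow> pull_section L \<phi> B s x = 0"
  by (simp add: pull_section_def)

text \<open>By \<open>der_fibre_iff\<close> it is enough to transport the order condition. Functions
  vanishing at \<open>\<phi> x\<close> pull back to functions vanishing at \<open>x\<close>, so no
  symbol has to be pushed forward.\<close>

lemma der_map_der_fibre:
  assumes L: "line_bundle L" and L': "line_bundle L'" and \<phi>: "smooth_map (base L) (base L') \<phi>"
    and iso: "\<And>x. x \<in> pts (base L) \<Longrightarrow> linear_iso_betw (fib L x) (fib L' (\<phi> x)) (fibre_map B x)"
    and pull: "\<And>s. s \<in> sections L' \<Longrightarrow> pull_section L \<phi> B s \<in> sections L"
    and x: "x \<in> pts (base L)" and a: "a \<in> der_fibre L x"
  shows "der_map L L' \<phi> B x a \<in> der_fibre L' (\<phi> x)"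
proof -
  note M = base_premanifold[OF L] and M' = base_premanifold[OF L']
  note pt = smooth_map_pts[OF M M' \<phi>]
  have O: "order_one_at L x a" using der_fibre_iff[OF L x] a by blast
  note o = order_one_fib[OF L O x] order_one_add[OF L O x] order_one_scale[OF L O x] order_one_prod[OF L O x]
  note B = linear_iso_betwD[OF iso[OF x]]
  have inf: "s (\<phi> y) \<in> fib L' (\<phi> y)" if "s \<in> sections L'" "y \<in> pts (base L)" for s y
    using section_in_fib[OF L' that(1) pt[OF that(2)]] .
  have pa: "pull_section L \<phi> B (\<lambda>y. s y + r y) = (\<lambda>x. pull_section L \<phi> B s x + pull_section L \<phi> B r x)"
    if "s \<in> sections L'" "r \<in> sections L'" for s r
    by (rule pull_section_add[where L' = L', OF L iso inf[OF that(1)] inf[OF that(2)]])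
  have ps: "pull_section L \<phi> B (\<lambda>y. f y *\<^sub>R s y) = (\<lambda>x. f (\<phi> x) *\<^sub>R pull_section L \<phi> B s x)"
    if "s \<in> sections L'" for f s
    by (rule pull_section_scale[where L' = L', OF L iso inf[OF that]])
  have "order_one_at L' (\<phi> x) (der_map L L' \<phi> B x a)"
    unfolding order_one_at_def
  proof (intro conjI ballI allI impI)
    fix s assume s: "s \<in> sections L'"
    show "der_map L L' \<phi> B x a s \<in> fib L' (\<phi> x)"
      using B(4)[OF o(1)[OF pull[OF s]]] s by (simp add: der_map_def)
    show "der_map L L' \<phi> B x a (\<lambda>y. c *\<^sub>R s y) = c *\<^sub>R der_map L L' \<phi> B x a s" for c
      using s section_scale[OF L' s] B(3)[OF o(1)[OF pull[OF s]]] o(3)[OF pull[OF s]]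
      by (simp add: der_map_def ps[OF s])
    show "der_map L L' \<phi> B x a (\<lambda>y. s y + r y) = der_map L L' \<phi> B x a s + der_map L L' \<phi> B x a r"
      if r: "r \<in> sections L'" for r
      using s r section_add[OF L' s r] B(2)[OF o(1)[OF pull[OF s]] o(1)[OF pull[OF r]]] o(2)[OF pull[OF s] pull[OF r]]
      by (simp add: der_map_def pa[OF s r])
    fix f g assume fg: "f \<in> smooth_funs (base L')" "g \<in> smooth_funs (base L')" "f (\<phi> x) = 0" "g (\<phi> x) = 0"
    \<comment> \<open>The composition is cut to zero off the carrier, as membership in
      \<open>smooth_funs\<close> demands.\<close>
    define F where "F f y = (if y \<in> pts (base L) then f (\<phi> y) else 0)" for f :: "'d \<Rightarrow> real" and y
    have F: "F f \<in> smooth_funs (base L)" if f: "f \<in> smooth_funs (base L')" for f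
      unfolding smooth_funs_iff[OF M]
    proof (intro conjI ballI)
      show "zero_off (pts (base L)) (F f)" by (simp add: zero_off_def F_def)
      fix p assume p: "p \<in> pts (base L)"
      have "sm_at (base L) (\<lambda>y. f (\<phi> y)) p"
        using sm_at_pullback[OF M M' \<phi> p] f pt[OF p] smooth_funs_iff[OF M'] by blast
      then show "sm_at (base L) (F f) p"
        by (rule sm_at_cong[OF M _ openin_pts[OF M] p]) (simp add: F_def)
    qed
    have "pull_section L \<phi> B (\<lambda>y. (f y * g y) *\<^sub>R s y) = (\<lambda>y. (F f y * F g y) *\<^sub>R pull_section L \<phi> B s y)"
      unfolding ps[OF s] by (auto simp: F_def pull_section_off)
    then have "a (pull_section L \<phi> B (\<lambda>y. (f y * g y) *\<^sub>R s y)) = 0"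
      using o(4)[OF F[OF fg(1)] F[OF fg(2)] pull[OF s]] fg(3,4) by (simp add: F_def)
    then show "der_map L L' \<phi> B x a (\<lambda>y. (f y * g y) *\<^sub>R s y) = 0"
      using B(3)[OF subspace_0[OF fib_subspace[OF L x]], of 0] by (simp add: der_map_def)
  qed
  moreover have "zero_off (sections L') (der_map L L' \<phi> B x a)" by (simp add: zero_off_def der_map_def)
  ultimately show ?thesis using der_fibre_iff[OF L' pt[OF x]] by blast
qed

lemma fibre_map_proj: "fibre_map proj_factor1 z v = v" "fibre_map proj_factor2 z v = snd (snd z) v"
  by (simp_all add: fibre_map_def proj_factor1_def proj_factor2_def split_beta)

abbreviation pull1 where
  "pull1 L1 L2 \<equiv> pull_section (line_product L1 L2) bp_proj1 proj_factor1"

abbreviation pull2 where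
  "pull2 L1 L2 \<equiv> pull_section (line_product L1 L2) bp_proj2 proj_factor2"

abbreviation der1 where
  "der1 L1 L2 \<equiv> der_map (line_product L1 L2) L1 bp_proj1 proj_factor1"

abbreviation der2 where
  "der2 L1 L2 \<equiv> der_map (line_product L1 L2) L2 bp_proj2 proj_factor2"

abbreviation product_frame where
  "product_frame L1 L2 A1 \<phi>1 U1 h1 A2 \<phi>2 U2 h2 z \<equiv> der_frame (line_product L1 L2)
     (fibre_isos L1 L2 (A1 \<inter> U1) (A2 \<inter> U2)) (product_chart L1 \<phi>1 h1 \<phi>2 h2) (\<lambda>z. h1 (fst z)) z"

section \<open>Pull-backs along the projection factors of a line product\<close>

context
  fixes L1 :: "('p, 'v::real_vector, 'e::real_inner) line_bundle"
    and L2 :: "('q, 'w::real_vector, 'f::real_inner) line_bundle"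
  assumes L1: "line_bundle L1" and L2: "line_bundle L2"
begin

lemma base_product_pts:
  assumes "z \<in> pts (base_product L1 L2)"
  shows "fst z \<in> pts (base L1)" "fst (snd z) \<in> pts (base L2)" "zero_off (fib L1 (fst z)) (snd (snd z))"
    "linear_iso_betw (fib L1 (fst z)) (fib L2 (fst (snd z))) (snd (snd z))"
  using fibre_isosD[OF assms[unfolded pts_base_product]] by blast+

lemma line_product_trivI:
  "(U1, h1) \<in> trivs L1 \<Longrightarrow> ({z \<in> pts (base_product L1 L2). fst z \<in> U1}, \<lambda>z. h1 (fst z)) \<in> trivs (line_product L1 L2)"
  unfolding line_product_trivs by force

lemma proj1_iso: "linear_iso_betw (fib (line_product L1 L2) z) (fib L1 (bp_proj1 z)) (fibre_map proj_factor1 z)"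
  by (simp add: linear_iso_betw_def bij_betw_def inj_on_def line_product_simps fibre_map_proj bp_proj_eq[OF L1 L2])

lemma proj2_iso: "z \<in> pts (base_product L1 L2) \<Longrightarrow>
    linear_iso_betw (fib (line_product L1 L2) z) (fib L2 (bp_proj2 z)) (fibre_map proj_factor2 z)"
  using base_product_pts(4)[of z] by (simp add: line_product_simps fibre_map_proj[abs_def] bp_proj_eq[OF L1 L2])

lemma pull1_apply:
  assumes "z \<in> pts (base_product L1 L2)" "s (fst z) \<in> fib L1 (fst z)"
  shows "pull1 L1 L2 s z = s (fst z)"
proof -
  have "fibre_map proj_factor1 z = (\<lambda>v. v)" by (rule ext) (rule fibre_map_proj)
  moreover have "the_inv_into (fib L1 (fst z)) (\<lambda>v. v) (s (fst z)) = s (fst z)"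
    using the_inv_into_f_f[of "\<lambda>v. v" "fib L1 (fst z)"] assms(2) by simp
  ultimately show ?thesis
    using assms by (simp add: pull_section_def line_product_simps bp_proj_eq[OF L1 L2])
qed

lemma pull2_apply:
  assumes "z \<in> pts (base_product L1 L2)" "s (fst (snd z)) \<in> fib L2 (fst (snd z))"
  shows "pull2 L1 L2 s z \<in> fib L1 (fst z)" "snd (snd z) (pull2 L1 L2 s z) = s (fst (snd z))"
proof -
  have eq: "pull2 L1 L2 s z = the_inv_into (fib L1 (fst z)) (snd (snd z)) (s (fst (snd z)))"
    using assms by (simp add: pull_section_def line_product_simps fibre_map_proj[abs_def] bp_proj_eq[OF L1 L2])
  note inv = linear_iso_betw_inv[OF base_product_pts(4)[OF assms(1)] fib_subspace[OF L1 base_product_pts(1)[OF assms(1)]]]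
  show "pull2 L1 L2 s z \<in> fib L1 (fst z)" "snd (snd z) (pull2 L1 L2 s z) = s (fst (snd z))"
    unfolding eq using inv(1,2) assms(2) by blast+
qed

text \<open>The fibre map of the second projection factor is multiplication by \<open>t\<close> in
  coordinates, and the pull-back inverts it.\<close>

lemma pull2_triv:
  assumes "z \<in> pts (base_product L1 L2)" "s (fst (snd z)) \<in> fib L2 (fst (snd z))"
    "(U1, h1) \<in> trivs L1" "(U2, h2) \<in> trivs L2" "fst z \<in> U1" "fst (snd z) \<in> U2"
  shows "h1 (fst z) (pull2 L1 L2 s z) = h2 (fst (snd z)) (s (fst (snd z))) / fibre_coord L1 h1 h2 z"
proof -
  have zU: "z \<in> fibre_isos L1 L2 U1 U2"
    by (rule fibre_isosI) (use base_product_pts[OF assms(1)] assms in auto)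
  show ?thesis
    using fibre_coord_apply[OF L1 L2 assms(3,4) zU pull2_apply(1)[of z s, OF assms(1,2)]] pull2_apply(2)[of z s, OF assms(1,2)]
      fibre_coord_nonzero[OF L1 L2 assms(3,4) zU] by (simp add: field_simps)
qed

lemma sm_at_fibre_coord:
  assumes z: "z \<in> pts (base_product L1 L2)" and U: "(U1, h1) \<in> trivs L1" "(U2, h2) \<in> trivs L2" "fst z \<in> U1" "fst (snd z) \<in> U2"
  shows "sm_at (base_product L1 L2) (fibre_coord L1 h1 h2) z"
proof -
  note P = premanifold_base_product[OF L1 L2]
  obtain A1 \<phi>1 where A1: "(A1, \<phi>1) \<in> atlas (base L1)" "fst z \<in> A1"
    using chart_cover[OF base_premanifold[OF L1] base_product_pts(1)[OF z]] by blast
  obtain A2 \<phi>2 where A2: "(A2, \<phi>2) \<in> atlas (base L2)" "fst (snd z) \<in> A2"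
    using chart_cover[OF base_premanifold[OF L2] base_product_pts(2)[OF z]] by blast
  have "z \<in> fibre_isos L1 L2 (A1 \<inter> U1) (A2 \<inter> U2)"
    by (rule fibre_isosI) (use base_product_pts[OF z] A1 A2 U in auto)
  from sm_at_snd[OF P sm_at_snd[OF P sm_at_chart[OF P base_product_atlasI[OF L1 L2 A1(1) U(1) A2(1) U(2)] this]]]
  show ?thesis by (simp add: product_chart_apply)
qed

lemma openin_proj1: "openin (mfd_topology (base L1)) W \<Longrightarrow>
    openin (mfd_topology (base_product L1 L2)) {z \<in> pts (base_product L1 L2). fst z \<in> W}"
  and openin_proj2: "openin (mfd_topology (base L2)) W' \<Longrightarrow>
    openin (mfd_topology (base_product L1 L2)) {z \<in> pts (base_product L1 L2). fst (snd z) \<in> W'}"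
  using smooth_map_openin_preimage[OF premanifold_base_product[OF L1 L2] base_premanifold[OF L1] smooth_map_bp_proj1[OF L1 L2]]
    smooth_map_openin_preimage[OF premanifold_base_product[OF L1 L2] base_premanifold[OF L2] smooth_map_bp_proj2[OF L1 L2]]
  by blast+

lemma sm_at_proj1: "z \<in> pts (base_product L1 L2) \<Longrightarrow> sm_at (base L1) f (fst z) \<Longrightarrow>
    sm_at (base_product L1 L2) (\<lambda>z. f (fst z)) z"
  by (rule sm_at_pullback[OF premanifold_base_product[OF L1 L2] base_premanifold[OF L1] smooth_map_bp_proj1[OF L1 L2]])

lemma sm_at_proj2: "z \<in> pts (base_product L1 L2) \<Longrightarrow> sm_at (base L2) f (fst (snd z)) \<Longrightarrow>
    sm_at (base_product L1 L2) (\<lambda>z. f (fst (snd z))) z"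
  by (rule sm_at_pullback[OF premanifold_base_product[OF L1 L2] base_premanifold[OF L2] smooth_map_bp_proj2[OF L1 L2]])

lemma pull1_section:
  assumes s: "s \<in> sections L1"
  shows "pull1 L1 L2 s \<in> sections (line_product L1 L2)"
proof (rule sectionsI[OF line_bundle_line_product[OF L1 L2]], unfold line_product_simps)
  note P = premanifold_base_product[OF L1 L2]
  have ap: "pull1 L1 L2 s z = s (fst z)" if "z \<in> pts (base_product L1 L2)" for z
    using pull1_apply[OF that] section_in_fib[OF L1 s base_product_pts(1)[OF that]] by blast
  fix z assume z: "z \<in> pts (base_product L1 L2)"
  show "pull1 L1 L2 s z \<in> fib L1 (fst z)" using ap[OF z] section_in_fib[OF L1 s base_product_pts(1)[OF z]] by simp
  obtain U h where U: "(U, h) \<in> trivs L1" "fst z \<in> U" using triv_cover[OF L1 base_product_pts(1)[OF z]] by blast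
  have "sm_at (base_product L1 L2) (\<lambda>w. h (fst w) (s (fst w))) z"
    by (rule sm_at_proj1[OF z, of "\<lambda>y. h y (s y)"]) (rule sm_at_section[OF L1 s U])
  then have "sm_at (base_product L1 L2) (\<lambda>w. h (fst w) (pull1 L1 L2 s w)) z"
    by (rule sm_at_cong[OF P _ openin_pts[OF P] z]) (simp add: ap)
  then show "\<exists>U h. (U, h) \<in> trivs (line_product L1 L2) \<and> z \<in> U \<and> sm_at (base_product L1 L2) (\<lambda>y. h y (pull1 L1 L2 s y)) z"
    using line_product_trivI[OF U(1)] U(2) z by blast
qed (simp add: pull_section_off line_product_simps)

lemma pull2_section:
  assumes s: "s \<in> sections L2"
  shows "pull2 L1 L2 s \<in> sections (line_product L1 L2)"
proof (rule sectionsI[OF line_bundle_line_product[OF L1 L2]], unfold line_product_simps)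
  note P = premanifold_base_product[OF L1 L2]
  note sf = section_in_fib[OF L2 s base_product_pts(2)]
  fix z assume z: "z \<in> pts (base_product L1 L2)"
  show "pull2 L1 L2 s z \<in> fib L1 (fst z)" using pull2_apply(1)[of z s, OF z sf[OF z]] .
  obtain U1 h1 where U1: "(U1, h1) \<in> trivs L1" "fst z \<in> U1" using triv_cover[OF L1 base_product_pts(1)[OF z]] by blast
  obtain U2 h2 where U2: "(U2, h2) \<in> trivs L2" "fst (snd z) \<in> U2" using triv_cover[OF L2 base_product_pts(2)[OF z]] by blast
  have zU: "z \<in> fibre_isos L1 L2 U1 U2"
    by (rule fibre_isosI) (use base_product_pts[OF z] U1 U2 in auto)
  have "sm_at (base_product L1 L2) (\<lambda>w. h2 (fst (snd w)) (s (fst (snd w))) / fibre_coord L1 h1 h2 w) z"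
    by (intro sm_at_divide[OF P] sm_at_proj2[OF z, of "\<lambda>y. h2 y (s y)"] sm_at_section[OF L2 s U2]
        sm_at_fibre_coord[OF z U1(1) U2(1) U1(2) U2(2)] fibre_coord_nonzero[OF L1 L2 U1(1) U2(1) zU])
  moreover have "openin (mfd_topology (base_product L1 L2)) ({z \<in> pts (base_product L1 L2). fst z \<in> U1} \<inter>
      {z \<in> pts (base_product L1 L2). fst (snd z) \<in> U2})"
    using openin_proj1[OF triv_openin[OF L1 U1(1)]] openin_proj2[OF triv_openin[OF L2 U2(1)]] by blast
  ultimately have "sm_at (base_product L1 L2) (\<lambda>w. h1 (fst w) (pull2 L1 L2 s w)) z"
    by (rule sm_at_cong[OF P]) (use z U1 U2 pull2_triv[of _ s, OF _ sf U1(1) U2(1)] in auto)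
  then show "\<exists>U h. (U, h) \<in> trivs (line_product L1 L2) \<and> z \<in> U \<and> sm_at (base_product L1 L2) (\<lambda>y. h y (pull2 L1 L2 s y)) z"
    using line_product_trivI[OF U1(1)] U1(2) z by blast
qed (simp add: pull_section_off line_product_simps)

lemma der1_der_fibre:
  assumes "z \<in> pts (base_product L1 L2)" "a \<in> der_fibre (line_product L1 L2) z"
  shows "der1 L1 L2 z a \<in> der_fibre L1 (fst z)"
proof -
  have "der1 L1 L2 z a \<in> der_fibre L1 (bp_proj1 z)"
    by (rule der_map_der_fibre[OF line_bundle_line_product[OF L1 L2] L1])
       (use smooth_map_bp_proj1[OF L1 L2] proj1_iso pull1_section assms in \<open>auto simp: line_product_simps bp_proj_eq[OF L1 L2]\<close>)
  then show ?thesis by (simp add: bp_proj_eq[OF L1 L2])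
qed

lemma der2_der_fibre:
  assumes "z \<in> pts (base_product L1 L2)" "a \<in> der_fibre (line_product L1 L2) z"
  shows "der2 L1 L2 z a \<in> der_fibre L2 (fst (snd z))"
proof -
  have "der2 L1 L2 z a \<in> der_fibre L2 (bp_proj2 z)"
    by (rule der_map_der_fibre[OF line_bundle_line_product[OF L1 L2] L2])
       (use smooth_map_bp_proj2[OF L1 L2] proj2_iso pull2_section assms in \<open>auto simp: line_product_simps bp_proj_eq[OF L1 L2]\<close>)
  then show ?thesis by (simp add: bp_proj_eq[OF L1 L2])
qed

section \<open>Der maps of the projections in a frame\<close>

context
  fixes A1 \<phi>1 U1 h1 A2 \<phi>2 U2 h2 z
  assumes A1: "(A1, \<phi>1) \<in> atlas (base L1)" and U1: "(U1, h1) \<in> trivs L1"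
    and A2: "(A2, \<phi>2) \<in> atlas (base L2)" and U2: "(U2, h2) \<in> trivs L2"
    and z: "z \<in> fibre_isos L1 L2 (A1 \<inter> U1) (A2 \<inter> U2)"
begin

lemma product_point:
  "z \<in> pts (base_product L1 L2)" "fst z \<in> A1" "fst z \<in> U1" "fst (snd z) \<in> A2" "fst (snd z) \<in> U2"
  "z \<in> fibre_isos L1 L2 U1 U2" "z \<in> {z \<in> pts (base_product L1 L2). fst z \<in> U1}"
  using z chart_subset[OF base_premanifold[OF L1] A1] chart_subset[OF base_premanifold[OF L2] A2]
  by (auto simp: pts_base_product fibre_isos_def)

lemma product_atlas: "(fibre_isos L1 L2 (A1 \<inter> U1) (A2 \<inter> U2), product_chart L1 \<phi>1 h1 \<phi>2 h2) \<in> atlas (base (line_product L1 L2))"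
  using base_product_atlasI[OF L1 L2 A1 U1 A2 U2] by (simp add: line_product_simps)

text \<open>In its own coordinates the chart is the identity, so a linear function of it is its own
  derivative. The coordinate directions are read off with projections as \<open>F\<close>.\<close>

lemma chart_deriv_product_chart:
  "bounded_linear F \<Longrightarrow> chart_deriv (fibre_isos L1 L2 (A1 \<inter> U1) (A2 \<inter> U2)) (product_chart L1 \<phi>1 h1 \<phi>2 h2)
     (\<lambda>w. F (product_chart L1 \<phi>1 h1 \<phi>2 h2 w)) z E = F E"
  using chart_deriv_bounded_linear[OF premanifold_base_product[OF L1 L2] base_product_atlasI[OF L1 L2 A1 U1 A2 U2] z _
      sm_at_chart[OF premanifold_base_product[OF L1 L2] base_product_atlasI[OF L1 L2 A1 U1 A2 U2] z]]
    chart_deriv_chart[OF premanifold_base_product[OF L1 L2] base_product_atlasI[OF L1 L2 A1 U1 A2 U2] z]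
  by simp

lemma chart_deriv_fibre_coord:
  "chart_deriv (fibre_isos L1 L2 (A1 \<inter> U1) (A2 \<inter> U2)) (product_chart L1 \<phi>1 h1 \<phi>2 h2) (fibre_coord L1 h1 h2) z E = snd (snd E)"
  using chart_deriv_product_chart[OF bounded_linear_compose[OF bounded_linear_snd bounded_linear_snd], of E]
  by (simp add: product_chart_apply)

text \<open>In coordinates \<open>f\<close> depends on the first block only; the chain rule through
  \<open>\<phi>1\<close> discards the other components of the direction.\<close>

lemma chart_deriv_proj1:
  assumes f: "sm_at (base L1) f (fst z)"
  shows "chart_deriv (fibre_isos L1 L2 (A1 \<inter> U1) (A2 \<inter> U2)) (product_chart L1 \<phi>1 h1 \<phi>2 h2) (\<lambda>w. f (fst w)) z E =
    chart_deriv A1 \<phi>1 f (fst z) (fst E)"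
proof -
  note P = premanifold_base_product[OF L1 L2] and D = base_product_atlasI[OF L1 L2 A1 U1 A2 U2]
  let ?D = "fibre_isos L1 L2 (A1 \<inter> U1) (A2 \<inter> U2)" and ?P = "product_chart L1 \<phi>1 h1 \<phi>2 h2"
  have 1: "chart_deriv ?D ?P (\<lambda>w. \<phi>1 (fst w)) z E = fst E"
    using chart_deriv_product_chart[OF bounded_linear_fst, of E] by (simp add: product_chart_apply)
  have 2: "chart_deriv ?D ?P (\<lambda>w. f (fst w)) z = chart_deriv ?D ?P (\<lambda>w. (f \<circ> the_inv_into A1 \<phi>1) (\<phi>1 (fst w))) z"
    by (rule chart_deriv_cong[OF P D z openin_chart[OF P D] z])
       (use chart_inv[OF base_premanifold[OF L1] A1] sm_at_proj1[OF product_point(1) f] in \<open>auto simp: fibre_isos_def\<close>)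
  have 3: "chart_deriv ?D ?P (\<lambda>w. (f \<circ> the_inv_into A1 \<phi>1) (\<phi>1 (fst w))) z E = chart_deriv A1 \<phi>1 f (fst z) (chart_deriv ?D ?P (\<lambda>w. \<phi>1 (fst w)) z E)"
    by (rule chart_deriv_compose[OF P D z sm_at_proj1[OF product_point(1)
          sm_at_chart[OF base_premanifold[OF L1] A1 product_point(2)]]
          chart_deriv_has[OF base_premanifold[OF L1] A1 product_point(2) f]])
  show ?thesis unfolding 2 3 1 ..
qed

lemma chart_deriv_proj2:
  assumes f: "sm_at (base L2) f (fst (snd z))"
  shows "chart_deriv (fibre_isos L1 L2 (A1 \<inter> U1) (A2 \<inter> U2)) (product_chart L1 \<phi>1 h1 \<phi>2 h2) (\<lambda>w. f (fst (snd w))) z E =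
    chart_deriv A2 \<phi>2 f (fst (snd z)) (fst (snd E))"
proof -
  note P = premanifold_base_product[OF L1 L2] and D = base_product_atlasI[OF L1 L2 A1 U1 A2 U2]
  let ?D = "fibre_isos L1 L2 (A1 \<inter> U1) (A2 \<inter> U2)" and ?P = "product_chart L1 \<phi>1 h1 \<phi>2 h2"
  have 1: "chart_deriv ?D ?P (\<lambda>w. \<phi>2 (fst (snd w))) z E = fst (snd E)"
    using chart_deriv_product_chart[OF bounded_linear_compose[OF bounded_linear_fst bounded_linear_snd], of E]
    by (simp add: product_chart_apply)
  have 2: "chart_deriv ?D ?P (\<lambda>w. f (fst (snd w))) z = chart_deriv ?D ?P (\<lambda>w. (f \<circ> the_inv_into A2 \<phi>2) (\<phi>2 (fst (snd w)))) z"
    by (rule chart_deriv_cong[OF P D z openin_chart[OF P D] z])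
       (use chart_inv[OF base_premanifold[OF L2] A2] sm_at_proj2[OF product_point(1) f] in \<open>auto simp: fibre_isos_def\<close>)
  have 3: "chart_deriv ?D ?P (\<lambda>w. (f \<circ> the_inv_into A2 \<phi>2) (\<phi>2 (fst (snd w)))) z E = chart_deriv A2 \<phi>2 f (fst (snd z)) (chart_deriv ?D ?P (\<lambda>w. \<phi>2 (fst (snd w))) z E)"
    by (rule chart_deriv_compose[OF P D z sm_at_proj2[OF product_point(1)
          sm_at_chart[OF base_premanifold[OF L2] A2 product_point(4)]]
          chart_deriv_has[OF base_premanifold[OF L2] A2 product_point(4) f]])
  show ?thesis unfolding 2 3 1 ..
qed

text \<open>The first projection factor is the identity on fibres, so the pull-back is composition
  with the projection and the direction \<open>\<tau>\<close> has no effect.\<close>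

lemma der1_product_frame:
  "der1 L1 L2 z (product_frame L1 L2 A1 \<phi>1 U1 h1 A2 \<phi>2 U2 h2 z ((e1, e2, \<tau>), c)) =
    der_frame L1 A1 \<phi>1 h1 (fst z) (e1, c)" (is "der1 L1 L2 z ?a = _")
proof (rule der_frame_eqI[OF L1 A1 product_point(2) U1 product_point(3)])
  note P = premanifold_base_product[OF L1 L2] and LP = line_bundle_line_product[OF L1 L2]
  note T = line_product_trivI[OF U1] and D = base_product_atlasI[OF L1 L2 A1 U1 A2 U2]
  let ?D = "fibre_isos L1 L2 (A1 \<inter> U1) (A2 \<inter> U2)" and ?P = "product_chart L1 \<phi>1 h1 \<phi>2 h2"
  show "zero_off (sections L1) (der1 L1 L2 z ?a)" by (simp add: zero_off_def der_map_def)
  fix s assume s: "s \<in> sections L1"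
  have eq: "der1 L1 L2 z ?a s = ?a (pull1 L1 L2 s)" using s by (simp add: der_map_def fibre_map_proj)
  have ap: "pull1 L1 L2 s w = s (fst w)" if "w \<in> pts (base_product L1 L2)" for w
    using pull1_apply[OF that] section_in_fib[OF L1 s base_product_pts(1)[OF that]] by blast
  show "der1 L1 L2 z ?a s \<in> fib L1 (fst z)"
    unfolding eq using der_frame_fib[OF LP product_atlas z T product_point(7) pull1_section[OF s]]
    by (simp add: line_product_simps)
  have "chart_deriv ?D ?P (\<lambda>w. h1 (fst w) (s (fst w))) z = chart_deriv ?D ?P (\<lambda>w. h1 (fst w) (pull1 L1 L2 s w)) z"
    by (rule chart_deriv_cong[OF P D z openin_pts[OF P] product_point(1)])
       (use ap sm_at_proj1[OF product_point(1) sm_at_section[OF L1 s U1 product_point(3)]] in auto)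
  then show "h1 (fst z) (der1 L1 L2 z ?a s) = chart_deriv A1 \<phi>1 (\<lambda>y. h1 y (s y)) (fst z) e1 + c * h1 (fst z) (s (fst z))"
    unfolding eq der_frame_triv[OF LP product_atlas z T product_point(7) pull1_section[OF s]]
    using chart_deriv_proj1[OF sm_at_section[OF L1 s U1 product_point(3)], of "(e1, e2, \<tau>)"] ap[OF product_point(1)]
    by simp
qed

text \<open>The pulled-back section has coordinate \<open>f / t\<close>. The product rule in the
  direction \<open>(e1, e2, \<tau>)\<close> gives the derivative of \<open>f\<close> along
  \<open>e2\<close> over \<open>t\<close> minus \<open>f * \<tau> / t^2\<close>, and the fibre map
  multiplies the result by \<open>t\<close>.\<close>

lemma der2_product_frame:
  "der2 L1 L2 z (product_frame L1 L2 A1 \<phi>1 U1 h1 A2 \<phi>2 U2 h2 z ((e1, e2, \<tau>), c)) =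
    der_frame L2 A2 \<phi>2 h2 (fst (snd z)) (e2, c - \<tau> / fibre_coord L1 h1 h2 z)" (is "der2 L1 L2 z ?a = _")
proof (rule der_frame_eqI[OF L2 A2 product_point(4) U2 product_point(5)])
  note P = premanifold_base_product[OF L1 L2] and LP = line_bundle_line_product[OF L1 L2]
  note T = line_product_trivI[OF U1] and D = base_product_atlasI[OF L1 L2 A1 U1 A2 U2]
  let ?D = "fibre_isos L1 L2 (A1 \<inter> U1) (A2 \<inter> U2)" and ?P = "product_chart L1 \<phi>1 h1 \<phi>2 h2"
  let ?t = "fibre_coord L1 h1 h2"
  show "zero_off (sections L2) (der2 L1 L2 z ?a)" by (simp add: zero_off_def der_map_def)
  fix s assume s: "s \<in> sections L2"
  note sf = section_in_fib[OF L2 s base_product_pts(2)]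
  have eq: "der2 L1 L2 z ?a s = snd (snd z) (?a (pull2 L1 L2 s))" using s by (simp add: der_map_def fibre_map_proj)
  have af: "?a (pull2 L1 L2 s) \<in> fib L1 (fst z)"
    using der_frame_fib[OF LP product_atlas z T product_point(7) pull2_section[OF s]] by (simp add: line_product_simps)
  then show "der2 L1 L2 z ?a s \<in> fib L2 (fst (snd z))"
    unfolding eq using linear_iso_betwD(4)[OF base_product_pts(4)[OF product_point(1)]] by blast
  let ?f = "\<lambda>y. h2 y (s y)"
  have fs: "sm_at (base L2) ?f (fst (snd z))" by (rule sm_at_section[OF L2 s U2 product_point(5)])
  have fsm: "sm_at (base_product L1 L2) (\<lambda>w. ?f (fst (snd w))) z" by (rule sm_at_proj2[OF product_point(1) fs])
  have ts: "sm_at (base_product L1 L2) ?t z"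
    by (rule sm_at_fibre_coord[OF product_point(1) U1 U2 product_point(3,5)])
  have tz: "?t z \<noteq> 0" by (rule fibre_coord_nonzero[OF L1 L2 U1 U2 product_point(6)])
  have invs: "sm_at (base_product L1 L2) (\<lambda>w. inverse (?t w)) z"
    by (rule sm_at_compose[OF P smooth_on_inverse_real ts findim_real]) (use tz in auto)
  have di: "chart_deriv ?D ?P (\<lambda>w. inverse (?t w)) z E = - (inverse (?t z) * snd (snd E) * inverse (?t z))" for E
    using chart_deriv_compose[OF P D z ts has_derivative_inverse'[OF tz]] chart_deriv_fibre_coord by simp
  have "chart_deriv ?D ?P (\<lambda>w. ?f (fst (snd w)) * inverse (?t w)) z =
      chart_deriv ?D ?P (\<lambda>w. h1 (fst w) (pull2 L1 L2 s w)) z"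
  proof (rule chart_deriv_cong[OF P D z openin_chart[OF P D] z _ sm_at_mult[OF P fsm invs]])
    fix w assume w: "w \<in> ?D"
    then have "w \<in> pts (base_product L1 L2)" using chart_subset[OF P D] by blast
    then show "?f (fst (snd w)) * inverse (?t w) = h1 (fst w) (pull2 L1 L2 s w)"
      using pull2_triv[of w s, OF _ sf U1 U2] fibre_isosD[OF w] by (simp add: divide_inverse)
  qed
  then have "chart_deriv ?D ?P (\<lambda>w. h1 (fst w) (pull2 L1 L2 s w)) z (e1, e2, \<tau>) =
      ?f (fst (snd z)) * - (inverse (?t z) * \<tau> * inverse (?t z)) +
      chart_deriv A2 \<phi>2 ?f (fst (snd z)) e2 * inverse (?t z)"
    using chart_deriv_mult[OF P D z fsm invs, of "(e1, e2, \<tau>)"] di chart_deriv_proj2[OF fs, of "(e1, e2, \<tau>)"] by simp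
  then have "h1 (fst z) (?a (pull2 L1 L2 s)) = ?f (fst (snd z)) * - (inverse (?t z) * \<tau> * inverse (?t z)) +
      chart_deriv A2 \<phi>2 ?f (fst (snd z)) e2 * inverse (?t z) + c * (?f (fst (snd z)) / ?t z)"
    unfolding der_frame_triv[OF LP product_atlas z T product_point(7) pull2_section[OF s]]
    using pull2_triv[of z s, OF product_point(1) sf[OF product_point(1)] U1 U2 product_point(3,5)] by simp
  moreover have "h2 (fst (snd z)) (der2 L1 L2 z ?a s) = ?t z * h1 (fst z) (?a (pull2 L1 L2 s))"
    unfolding eq by (rule fibre_coord_apply[OF L1 L2 U1 U2 product_point(6) af])
  ultimately show "h2 (fst (snd z)) (der2 L1 L2 z ?a s) =
      chart_deriv A2 \<phi>2 (\<lambda>y. h2 y (s y)) (fst (snd z)) e2 + (c - \<tau> / ?t z) * h2 (fst (snd z)) (s (fst (snd z)))"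
    using tz by (simp add: field_simps power2_eq_square)
qed

lemma der_product_eqI_chart:
  assumes a: "a \<in> der_fibre (line_product L1 L2) z" "a' \<in> der_fibre (line_product L1 L2) z"
    and eq: "der1 L1 L2 z a = der1 L1 L2 z a'" "der2 L1 L2 z a = der2 L1 L2 z a'"
  shows "a = a'"
proof -
  note LP = line_bundle_line_product[OF L1 L2] and T = line_product_trivI[OF U1]
  obtain E c where 1: "a = product_frame L1 L2 A1 \<phi>1 U1 h1 A2 \<phi>2 U2 h2 z (E, c)"
    by (rule der_fibreE[OF LP product_atlas z T product_point(7) a(1)])
  obtain E' c' where 2: "a' = product_frame L1 L2 A1 \<phi>1 U1 h1 A2 \<phi>2 U2 h2 z (E', c')"
    by (rule der_fibreE[OF LP product_atlas z T product_point(7) a(2)])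
  obtain e1 e2 \<tau> where E: "E = (e1, e2, \<tau>)" by (cases E)
  obtain e1' e2' \<tau>' where E': "E' = (e1', e2', \<tau>')" by (cases E')
  have "e1 = e1'" "c = c'"
    using der_frame_inj[OF L1 A1 product_point(2) U1 product_point(3)] eq(1)
    unfolding 1 2 E E' der1_product_frame by blast+
  moreover have "e2 = e2'" "c - \<tau> / fibre_coord L1 h1 h2 z = c' - \<tau>' / fibre_coord L1 h1 h2 z"
    using der_frame_inj[OF L2 A2 product_point(4) U2 product_point(5)] eq(2)
    unfolding 1 2 E E' der2_product_frame by blast+
  ultimately show ?thesis
    using fibre_coord_nonzero[OF L1 L2 U1 U2 product_point(6)] by (simp add: 1 2 E E')
qed

text \<open>The zeroth-order part must be \<open>c1\<close>, and \<open>t * (c1 - c2)\<close> is the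
  solution \<open>\<tau>\<close> of \<open>c1 - \<tau> / t = c2\<close>.\<close>

lemma der_pair_frame:
  "der_pair L1 L2 z (der_frame L1 A1 \<phi>1 h1 (fst z) (e1, c1)) (der_frame L2 A2 \<phi>2 h2 (fst (snd z)) (e2, c2)) =
    product_frame L1 L2 A1 \<phi>1 U1 h1 A2 \<phi>2 U2 h2 z ((e1, e2, fibre_coord L1 h1 h2 z * (c1 - c2)), c1)"
  unfolding der_pair_def
proof (rule the_equality)
  note LP = line_bundle_line_product[OF L1 L2] and T = line_product_trivI[OF U1]
  let ?a = "product_frame L1 L2 A1 \<phi>1 U1 h1 A2 \<phi>2 U2 h2 z ((e1, e2, fibre_coord L1 h1 h2 z * (c1 - c2)), c1)"
  have a: "?a \<in> der_fibre (line_product L1 L2) z"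
    by (rule der_frame_der_fibre[OF LP product_atlas z T product_point(7)])
  then show *: "?a \<in> der_fibre (line_product L1 L2) z \<and> der1 L1 L2 z ?a = der_frame L1 A1 \<phi>1 h1 (fst z) (e1, c1) \<and>
      der2 L1 L2 z ?a = der_frame L2 A2 \<phi>2 h2 (fst (snd z)) (e2, c2)"
    unfolding der1_product_frame der2_product_frame
    using fibre_coord_nonzero[OF L1 L2 U1 U2 product_point(6)] by simp
  show "b = ?a" if "b \<in> der_fibre (line_product L1 L2) z \<and> der1 L1 L2 z b = der_frame L1 A1 \<phi>1 h1 (fst z) (e1, c1) \<and>
      der2 L1 L2 z b = der_frame L2 A2 \<phi>2 h2 (fst (snd z)) (e2, c2)" for b
    using der_product_eqI_chart[of b ?a] that * by simp
qed

end

lemma der_product_eqI: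
  assumes z: "z \<in> pts (base_product L1 L2)"
    and "a \<in> der_fibre (line_product L1 L2) z" "a' \<in> der_fibre (line_product L1 L2) z"
    "der1 L1 L2 z a = der1 L1 L2 z a'" "der2 L1 L2 z a = der2 L1 L2 z a'"
  shows "a = a'"
proof -
  obtain A1 \<phi>1 U1 h1 A2 \<phi>2 U2 h2 where c: "(A1, \<phi>1) \<in> atlas (base L1)" "(U1, h1) \<in> trivs L1"
    "(A2, \<phi>2) \<in> atlas (base L2)" "(U2, h2) \<in> trivs L2" "fst z \<in> A1 \<inter> U1" "fst (snd z) \<in> A2 \<inter> U2"
    "z \<in> fibre_isos L1 L2 (A1 \<inter> U1) (A2 \<inter> U2)" by (rule base_product_atlas_cover[OF L1 L2 z])
  show ?thesis by (rule der_product_eqI_chart[OF c(1-4,7) assms(2-5)])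
qed

lemma der_pair_der_map:
  assumes z: "z \<in> pts (base_product L1 L2)" and a: "a \<in> der_fibre (line_product L1 L2) z"
  shows "der_pair L1 L2 z (der1 L1 L2 z a) (der2 L1 L2 z a) = a"
  unfolding der_pair_def using der_product_eqI[OF z] a by (intro the_equality) auto

lemma zero_der_fibre: "line_bundle L \<Longrightarrow> x \<in> pts (base L) \<Longrightarrow> (\<lambda>s. 0) \<in> der_fibre L x"
  using der_fibre_iff[of L x "\<lambda>s. 0"] fib_subspace[of L x] by (simp add: zero_off_def order_one_at_def subspace_0)

text \<open>Justifies the definite description in \<open>der_pair\<close> for arbitrary elements: in
  frames the pair of equations has the explicit solution of \<open>der_pair_frame\<close>.\<close>

lemma der_pair_spec:
  assumes z: "z \<in> pts (base_product L1 L2)" and a1: "a1 \<in> der_fibre L1 (fst z)" and a2: "a2 \<in> der_fibre L2 (fst (snd z))"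
  shows "der_pair L1 L2 z a1 a2 \<in> der_fibre (line_product L1 L2) z"
    "der1 L1 L2 z (der_pair L1 L2 z a1 a2) = a1" "der2 L1 L2 z (der_pair L1 L2 z a1 a2) = a2"
proof -
  obtain A1 \<phi>1 U1 h1 A2 \<phi>2 U2 h2 where c: "(A1, \<phi>1) \<in> atlas (base L1)" "(U1, h1) \<in> trivs L1"
    "(A2, \<phi>2) \<in> atlas (base L2)" "(U2, h2) \<in> trivs L2" "fst z \<in> A1 \<inter> U1" "fst (snd z) \<in> A2 \<inter> U2"
    "z \<in> fibre_isos L1 L2 (A1 \<inter> U1) (A2 \<inter> U2)" by (rule base_product_atlas_cover[OF L1 L2 z])
  note pp = product_point[OF c(1-4,7)]
  obtain e1 c1 where 1: "a1 = der_frame L1 A1 \<phi>1 h1 (fst z) (e1, c1)" by (rule der_fibreE[OF L1 c(1) pp(2) c(2) pp(3) a1])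
  obtain e2 c2 where 2: "a2 = der_frame L2 A2 \<phi>2 h2 (fst (snd z)) (e2, c2)" by (rule der_fibreE[OF L2 c(3) pp(4) c(4) pp(5) a2])
  show "der_pair L1 L2 z a1 a2 \<in> der_fibre (line_product L1 L2) z"
    unfolding 1 2 der_pair_frame[OF c(1-4,7)]
    by (rule der_frame_der_fibre[OF line_bundle_line_product[OF L1 L2] product_atlas[OF c(1-4,7)] c(7) line_product_trivI[OF c(2)] pp(7)])
  show "der1 L1 L2 z (der_pair L1 L2 z a1 a2) = a1" "der2 L1 L2 z (der_pair L1 L2 z a1 a2) = a2"
    unfolding 1 2 der_pair_frame[OF c(1-4,7)] der1_product_frame[OF c(1-4,7)] der2_product_frame[OF c(1-4,7)]
    using fibre_coord_nonzero[OF L1 L2 c(2,4) pp(6)] by simp_all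
qed

end


section \<open>The canonical factor is diffeomorphic\<close>

text \<open>\<open>Q\<close> pairs charts of \<open>M\<close> and \<open>N\<close> with a coordinate
  expression of \<open>f\<close> and its inverse. The condition that each \<open>D\<close> is the
  full preimage of \<open>D'\<close> is what makes bijectivity a local matter: two points with the
  same image lie in the same \<open>D\<close>, where coordinates separate them.\<close>

lemma charts_diffeomorphism:
  fixes M :: "('a, 'e::real_inner) mfd" and N :: "('b, 'f::real_inner) mfd"
  assumes M: "premanifold M" and N: "premanifold N"
    and f: "\<And>z. z \<in> pts M \<Longrightarrow> f z \<in> pts N"
    and cov1: "\<And>z. z \<in> pts M \<Longrightarrow> \<exists>D \<Phi> D' \<Psi> E E'. Q D \<Phi> D' \<Psi> E E' \<and> z \<in> D"
    and cov2: "\<And>y. y \<in> pts N \<Longrightarrow> \<exists>D \<Phi> D' \<Psi> E E'. Q D \<Phi> D' \<Psi> E E' \<and> y \<in> D'"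
    and atl: "\<And>D \<Phi> D' \<Psi> E E'. Q D \<Phi> D' \<Psi> E E' \<Longrightarrow> (D, \<Phi>) \<in> atlas M \<and> (D', \<Psi>) \<in> atlas N"
    and dom: "\<And>D \<Phi> D' \<Psi> E E' z. Q D \<Phi> D' \<Psi> E E' \<Longrightarrow> z \<in> pts M \<Longrightarrow> z \<in> D \<longleftrightarrow> f z \<in> D'"
    and sm: "\<And>D \<Phi> D' \<Psi> E E'. Q D \<Phi> D' \<Psi> E E' \<Longrightarrow> smooth_on (\<Phi> ` D) E \<and> smooth_on (\<Psi> ` D') E'"
    and rep: "\<And>D \<Phi> D' \<Psi> E E' z. Q D \<Phi> D' \<Psi> E E' \<Longrightarrow> z \<in> D \<Longrightarrow> \<Psi> (f z) = E (\<Phi> z)"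
    and inv1: "\<And>D \<Phi> D' \<Psi> E E' u. Q D \<Phi> D' \<Psi> E E' \<Longrightarrow> u \<in> \<Phi> ` D \<Longrightarrow> E' (E u) = u"
    and inv2: "\<And>D \<Phi> D' \<Psi> E E' v. Q D \<Phi> D' \<Psi> E E' \<Longrightarrow> v \<in> \<Psi> ` D' \<Longrightarrow> E' v \<in> \<Phi> ` D \<and> E (E' v) = v"
  obtains g where "smooth_map M N f" "smooth_map N M g" "\<And>z. z \<in> pts M \<Longrightarrow> g (f z) = z"
    "\<And>y. y \<in> pts N \<Longrightarrow> f (g y) = y"
proof -
  have sf: "smooth_map M N f"
  proof (rule smooth_mapI[OF M N f])
    fix z assume z: "z \<in> pts M"
    obtain D \<Phi> D' \<Psi> E E' where Q: "Q D \<Phi> D' \<Psi> E E'" "z \<in> D" using cov1[OF z] by blast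
    have D: "(D, \<Phi>) \<in> atlas M" "(D', \<Psi>) \<in> atlas N" using atl[OF Q(1)] by blast+
    have "sm_at M (\<lambda>x. E (\<Phi> x)) z"
      by (rule sm_at_compose[OF M _ sm_at_chart[OF M D(1) Q(2)] premanifold_findim[OF M] chart_open_image[OF M D(1)]])
         (use sm[OF Q(1)] Q(2) in auto)
    then have "sm_at M (\<lambda>x. \<Psi> (f x)) z"
      by (rule sm_at_cong[OF M _ openin_chart[OF M D(1)] Q(2)]) (use rep[OF Q(1)] in auto)
    moreover have "f ` D \<subseteq> D'" using dom[OF Q(1)] chart_subset[OF M D(1)] by blast
    ultimately show "\<exists>V \<psi> S. (V, \<psi>) \<in> atlas N \<and> openin (mfd_topology M) S \<and> z \<in> S \<and> f ` S \<subseteq> V \<and> sm_at M (\<lambda>x. \<psi> (f x)) z"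
      using D(2) openin_chart[OF M D(1)] Q(2) by blast
  qed
  have inj: "inj_on f (pts M)"
  proof (rule inj_onI)
    fix z z' assume z: "z \<in> pts M" "z' \<in> pts M" "f z = f z'"
    obtain D \<Phi> D' \<Psi> E E' where Q: "Q D \<Phi> D' \<Psi> E E'" "z \<in> D" using cov1[OF z(1)] by blast
    have z': "z' \<in> D" using dom[OF Q(1)] z Q(2) by metis
    have "\<Phi> z = E' (\<Psi> (f z))" "\<Phi> z' = E' (\<Psi> (f z'))"
      using rep[OF Q(1)] inv1[OF Q(1)] Q(2) z' by simp_all
    then have "\<Phi> z = \<Phi> z'" using z(3) by simp
    then show "z = z'" using chart_inj[OF M] atl[OF Q(1)] Q(2) z' by (meson inj_onD)
  qed
  have surj: "\<exists>z\<in>D. f z = y" if Q: "Q D \<Phi> D' \<Psi> E E'" and y: "y \<in> D'" for D \<Phi> D' \<Psi> E E' y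
  proof -
    have D: "(D, \<Phi>) \<in> atlas M" "(D', \<Psi>) \<in> atlas N" using atl[OF Q] by blast+
    obtain z where z: "z \<in> D" "E' (\<Psi> y) = \<Phi> z" using inv2[OF Q, of "\<Psi> y"] y by blast
    have "\<Psi> (f z) = \<Psi> y" using rep[OF Q z(1)] z(2) inv2[OF Q, of "\<Psi> y"] y by force
    moreover have "f z \<in> D'" using dom[OF Q] z(1) chart_subset[OF M D(1)] by blast
    ultimately have "f z = y" using chart_inj[OF N D(2)] y by (meson inj_onD)
    then show ?thesis using z(1) by blast
  qed
  \<comment> \<open>The inverse is taken as a map of sets once \<open>f\<close> is known to be
    injective; its coordinate expression \<open>E'\<close> then shows it to be smooth.\<close>
  define g where "g = the_inv_into (pts M) f"
  have gf: "g (f z) = z" if "z \<in> pts M" for z using the_inv_into_f_f[OF inj that] by (simp add: g_def)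
  have fg: "f (g y) = y" and gp: "g y \<in> pts M" if y: "y \<in> pts N" for y
  proof -
    obtain D \<Phi> D' \<Psi> E E' where Q: "Q D \<Phi> D' \<Psi> E E'" "y \<in> D'" using cov2[OF y] by blast
    obtain z where z: "z \<in> D" "f z = y" using surj[OF Q] by blast
    then have "z \<in> pts M" using chart_subset[OF M] atl[OF Q(1)] by blast
    then show "f (g y) = y" "g y \<in> pts M" using gf z(2) by auto
  qed
  have "smooth_map N M g"
  proof (rule smooth_mapI[OF N M gp])
    fix y assume y: "y \<in> pts N"
    obtain D \<Phi> D' \<Psi> E E' where Q: "Q D \<Phi> D' \<Psi> E E'" "y \<in> D'" using cov2[OF y] by blast
    have D: "(D, \<Phi>) \<in> atlas M" "(D', \<Psi>) \<in> atlas N" using atl[OF Q(1)] by blast+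
    have gD: "g w \<in> D" if "w \<in> D'" for w
      using that dom[OF Q(1) gp] fg chart_subset[OF N D(2)] by (metis subsetD)
    have rg: "\<Phi> (g w) = E' (\<Psi> w)" if "w \<in> D'" for w
      using rep[OF Q(1) gD[OF that]] inv1[OF Q(1), of "\<Phi> (g w)"] gD[OF that] fg that chart_subset[OF N D(2)] by force
    have "sm_at N (\<lambda>x. E' (\<Psi> x)) y"
      by (rule sm_at_compose[OF N _ sm_at_chart[OF N D(2) Q(2)] premanifold_findim[OF N] chart_open_image[OF N D(2)]])
         (use sm[OF Q(1)] Q(2) in auto)
    then have "sm_at N (\<lambda>x. \<Phi> (g x)) y"
      by (rule sm_at_cong[OF N _ openin_chart[OF N D(2)] Q(2)]) (use rg in auto)
    moreover have "g ` D' \<subseteq> D" using gD by blast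
    ultimately show "\<exists>V \<psi> S. (V, \<psi>) \<in> atlas M \<and> openin (mfd_topology N) S \<and> y \<in> S \<and> g ` S \<subseteq> V \<and> sm_at N (\<lambda>x. \<psi> (g x)) y"
      using D(1) openin_chart[OF N D(2)] Q(2) by blast
  qed
  then show ?thesis using that sf gf fg by blast
qed

lemma total_space_atlasI:
  "(A, \<phi>) \<in> atlas (base L) \<Longrightarrow> (U, h) \<in> trivs L \<Longrightarrow>
    (Sigma (A \<inter> U) (fib L), \<lambda>(x, v). (\<phi> x, h x v)) \<in> atlas (total_space L)"
  unfolding total_space_def by auto

lemma smooth_map_total_proj:
  assumes L: "line_bundle L"
  shows "smooth_map (total_space L) (base L) fst"
proof (rule smooth_mapI[OF premanifold_total_space[OF L] base_premanifold[OF L]])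
  note T = premanifold_total_space[OF L] and M = base_premanifold[OF L]
  fix z assume "z \<in> pts (total_space L)"
  then have z: "fst z \<in> pts (base L)" "snd z \<in> fib L (fst z)" by (auto simp: total_space_def)
  show "fst z \<in> pts (base L)" by (rule z(1))
  obtain A \<phi> where A: "(A, \<phi>) \<in> atlas (base L)" "fst z \<in> A" using chart_cover[OF M z(1)] by blast
  obtain U h where U: "(U, h) \<in> trivs L" "fst z \<in> U" using triv_cover[OF L z(1)] by blast
  note ta = total_space_atlasI[OF A(1) U(1)]
  have zs: "z \<in> Sigma (A \<inter> U) (fib L)" using z A U by (cases z) auto
  have "sm_at (total_space L) (\<lambda>z. \<phi> (fst z)) z"
    using sm_at_fst[OF T sm_at_chart[OF T ta zs]] by (simp add: split_beta)
  moreover have "fst ` Sigma (A \<inter> U) (fib L) \<subseteq> A" by auto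
  ultimately show "\<exists>V \<psi> S. (V, \<psi>) \<in> atlas (base L) \<and> openin (mfd_topology (total_space L)) S \<and> z \<in> S \<and>
      fst ` S \<subseteq> V \<and> sm_at (total_space L) (\<lambda>x. \<psi> (fst x)) z"
    using A(1) openin_chart[OF T ta] zs by blast
qed

text \<open>If corresponding fibres are literally equal and the fibre coordinates agree along
  \<open>f\<close>, the identity on fibres covers \<open>f\<close>. It serves both for the canonical
  factor and for its inverse.\<close>

lemma factor_of_base_map:
  fixes L :: "('p, 'v::real_vector, 'e::real_inner) line_bundle"
    and L' :: "('q, 'v, 'f::real_inner) line_bundle"
  assumes L: "line_bundle L" and L': "line_bundle L'" and f: "smooth_map (base L) (base L') f"
    and fib: "\<And>x. x \<in> pts (base L) \<Longrightarrow> fib L' (f x) = fib L x"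
    and triv: "\<And>x. x \<in> pts (base L) \<Longrightarrow> \<exists>U h V k. (U, h) \<in> trivs L \<and> (V, k) \<in> trivs L' \<and> x \<in> U \<and> f x \<in> V \<and>
      (\<forall>y\<in>pts (base L). k (f y) = h y)"
  shows "factor L L' f (\<lambda>(x, v). (f x, v))"
proof -
  note M = base_premanifold[OF L] and M' = base_premanifold[OF L']
  note T = premanifold_total_space[OF L] and T' = premanifold_total_space[OF L']
  have "smooth_map (total_space L) (total_space L') (\<lambda>(x, v). (f x, v))"
  proof (rule smooth_mapI[OF T T'])
    fix z assume z: "z \<in> pts (total_space L)"
    then have x: "fst z \<in> pts (base L)" "snd z \<in> fib L (fst z)" by (auto simp: total_space_def)
    have fx: "f (fst z) \<in> pts (base L')" by (rule smooth_map_pts[OF M M' f x(1)])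
    show "(\<lambda>(x, v). (f x, v)) z \<in> pts (total_space L')"
      using fx x fib[OF x(1)] by (cases z) (auto simp: total_space_def)
    obtain U h V k where t: "(U, h) \<in> trivs L" "(V, k) \<in> trivs L'" "fst z \<in> U" "f (fst z) \<in> V"
      "\<And>y. y \<in> pts (base L) \<Longrightarrow> k (f y) = h y"
      using triv[OF x(1)] by blast
    obtain A \<phi> where A: "(A, \<phi>) \<in> atlas (base L)" "fst z \<in> A" using chart_cover[OF M x(1)] by blast
    obtain A' \<phi>' where A': "(A', \<phi>') \<in> atlas (base L')" "f (fst z) \<in> A'" using chart_cover[OF M' fx] by blast
    note ta = total_space_atlasI[OF A(1) t(1)] and ta' = total_space_atlasI[OF A'(1) t(2)]
    have zs: "z \<in> Sigma (A \<inter> U) (fib L)" using x A t by (cases z) auto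
    have s2: "sm_at (total_space L) (\<lambda>z. h (fst z) (snd z)) z"
      using sm_at_snd[OF T sm_at_chart[OF T ta zs]] by (simp add: split_beta)
    obtain S0 where S0: "sm_at (base L) (\<lambda>x. \<phi>' (f x)) (fst z)" using smooth_map_chart[OF M M' f x(1) A'] by blast
    have s1: "sm_at (total_space L) (\<lambda>z. \<phi>' (f (fst z))) z"
      by (rule sm_at_pullback[OF T M smooth_map_total_proj[OF L] z S0])
    let ?W = "{x \<in> pts (base L). f x \<in> A' \<inter> V}"
    let ?S = "{z \<in> pts (total_space L). fst z \<in> ?W}"
    have "openin (mfd_topology (base L')) (A' \<inter> V)"
      using openin_chart[OF M' A'(1)] triv_openin[OF L' t(2)] by blast
    then have oS: "openin (mfd_topology (total_space L)) ?S"
      by (rule smooth_map_openin_preimage[OF T M smooth_map_total_proj[OF L] smooth_map_openin_preimage[OF M M' f]])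
    have zS: "z \<in> ?S" using z x A' t by auto
    have "(\<lambda>(x, v). (f x, v)) ` ?S \<subseteq> Sigma (A' \<inter> V) (fib L')"
      using fib by (auto simp: total_space_def)
    moreover have "sm_at (total_space L) (\<lambda>z. (\<lambda>(x, v). (\<phi>' x, k x v)) ((\<lambda>(x, v). (f x, v)) z)) z"
      by (rule sm_at_cong[OF T sm_at_Pair[OF T s1 s2] oS zS]) (use t(5) in auto)
    ultimately show "\<exists>V \<psi> S. (V, \<psi>) \<in> atlas (total_space L') \<and> openin (mfd_topology (total_space L)) S \<and> z \<in> S \<and>
        (\<lambda>(x, v). (f x, v)) ` S \<subseteq> V \<and> sm_at (total_space L) (\<lambda>x. \<psi> ((\<lambda>(x, v). (f x, v)) x)) z"
      using ta' oS zS by blast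
  qed
  moreover have "linear_iso_betw (fib L x) (fib L' (f x)) (fibre_map (\<lambda>(x, v). (f x, v)) x)" if "x \<in> pts (base L)" for x
    using fib[OF that] by (simp add: linear_iso_betw_def bij_betw_def inj_on_def fibre_map_def)
  ultimately show ?thesis unfolding factor_def using L L' f by auto
qed

text \<open>As the fibre maps are identities, pulling back is composition with \<open>f\<close>, cut
  to zero off the carrier.\<close>

lemma pull_section_of_base_map:
  fixes L :: "('p, 'v::real_vector, 'e::real_inner) line_bundle"
    and L' :: "('q, 'v, 'f::real_inner) line_bundle"
  assumes L: "line_bundle L" and L': "line_bundle L'" and f: "smooth_map (base L) (base L') f"
    and fib: "\<And>x. x \<in> pts (base L) \<Longrightarrow> fib L' (f x) = fib L x"
    and triv: "\<And>x. x \<in> pts (base L) \<Longrightarrow> \<exists>U h V k. (U, h) \<in> trivs L \<and> (V, k) \<in> trivs L' \<and> x \<in> U \<and> f x \<in> V \<and>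
      (\<forall>y\<in>pts (base L). k (f y) = h y)"
    and s: "s \<in> sections L'"
  shows "pull_section L f (\<lambda>(x, v). (f x, v)) s = (\<lambda>x. if x \<in> pts (base L) then s (f x) else 0)"
    "pull_section L f (\<lambda>(x, v). (f x, v)) s \<in> sections L"
proof -
  note M = base_premanifold[OF L] and M' = base_premanifold[OF L']
  note sf = section_in_fib[OF L' s smooth_map_pts[OF M M' f]]
  have fm: "fibre_map (\<lambda>(x, v). (f x, v)) x = (\<lambda>v. v)" for x by (rule ext) (simp add: fibre_map_def)
  have "the_inv_into (fib L x) (\<lambda>v. v) (s (f x)) = s (f x)" if "x \<in> pts (base L)" for x
    using the_inv_into_f_f[of "\<lambda>v. v" "fib L x" "s (f x)"] sf[OF that] fib[OF that] by simp
  then show eq: "pull_section L f (\<lambda>(x, v). (f x, v)) s = (\<lambda>x. if x \<in> pts (base L) then s (f x) else 0)"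
    by (auto simp: pull_section_def fm)
  show "pull_section L f (\<lambda>(x, v). (f x, v)) s \<in> sections L"
    unfolding eq
  proof (rule sectionsI[OF L])
    fix x assume x: "x \<in> pts (base L)"
    show "(if x \<in> pts (base L) then s (f x) else 0) \<in> fib L x" using sf[OF x] fib[OF x] x by simp
    obtain U h V k where t: "(U, h) \<in> trivs L" "(V, k) \<in> trivs L'" "x \<in> U" "f x \<in> V"
      "\<And>y. y \<in> pts (base L) \<Longrightarrow> k (f y) = h y" using triv[OF x] by blast
    have "sm_at (base L) (\<lambda>y. k (f y) (s (f y))) x"
      by (rule sm_at_pullback[OF M M' f x, of "\<lambda>y. k y (s y)"]) (rule sm_at_section[OF L' s t(2,4)])
    then have "sm_at (base L) (\<lambda>y. h y (if y \<in> pts (base L) then s (f y) else 0)) x"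
      by (rule sm_at_cong[OF M _ openin_pts[OF M] x]) (simp add: t(5))
    then show "\<exists>U h. (U, h) \<in> trivs L \<and> x \<in> U \<and> sm_at (base L) (\<lambda>y. h y (if y \<in> pts (base L) then s (f y) else 0)) x"
      using t by blast
  qed simp
qed

lemma jet_line_bundle_simps:
  "base (jet_line_bundle L) = jet_bundle L" "fib (jet_line_bundle L) z = fib L (fst z)"
  by (simp_all add: jet_line_bundle_def pullback_bundle_def)

lemma jet_line_bundle_trivs:
  "trivs (jet_line_bundle L) = (\<lambda>(U, h). ({z \<in> pts (jet_bundle L). fst z \<in> U}, \<lambda>z. h (fst z))) ` trivs L"
  by (simp add: jet_line_bundle_def pullback_bundle_def)

lemma jet_line_bundle_trivI: "(U, h) \<in> trivs L \<Longrightarrow>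
    ({z \<in> pts (jet_bundle L). fst z \<in> U}, \<lambda>z. h (fst z)) \<in> trivs (jet_line_bundle L)"
  unfolding jet_line_bundle_trivs by force

lemma pts_jet_bundle: "pts (jet_bundle L) = Sigma (pts (base L)) (jet_fibre L)"
  by (simp add: jet_bundle_def)

lemma jet_fibre_fib: "\<alpha> \<in> jet_fibre L x \<Longrightarrow> a \<in> der_fibre L x \<Longrightarrow> \<alpha> a \<in> fib L x"
  and jet_fibre_off: "\<alpha> \<in> jet_fibre L x \<Longrightarrow> a \<notin> der_fibre L x \<Longrightarrow> \<alpha> a = 0"
  unfolding jet_fibre_def zero_off_def by blast+

text \<open>Linearity need not be checked directly: \<open>\<beta>\<close> agrees with the jet
  having the coordinates \<open>g\<close> and \<open>\<gamma>\<close>, since the frame exhausts the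
  der fibre.\<close>

lemma jet_fibreI_chart:
  assumes L: "line_bundle L" and A: "(A, \<phi>) \<in> atlas (base L)" "x \<in> A" and U: "(U, h) \<in> trivs L" "x \<in> U"
    and \<beta>: "zero_off (der_fibre L x) \<beta>" "\<And>a. a \<in> der_fibre L x \<Longrightarrow> \<beta> a \<in> fib L x"
      "\<And>e c. h x (\<beta> (der_frame L A \<phi> h x (e, c))) = inner g e + \<gamma> * c"
  shows "\<beta> \<in> jet_fibre L x"
proof -
  obtain \<alpha> where \<alpha>: "\<alpha> \<in> jet_fibre L x" "\<And>e c. h x (\<alpha> (der_frame L A \<phi> h x (e, c))) = inner g e + \<gamma> * c"
    using jet_of_coords[OF L A U] by metis
  have "\<beta> a = \<alpha> a" for a
  proof (cases "a \<in> der_fibre L x")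
    case True
    obtain e c where a: "a = der_frame L A \<phi> h x (e, c)" by (rule der_fibreE[OF L A U True])
    show ?thesis
      by (rule triv_eqI[OF L U \<beta>(2)[OF True] jet_fibre_fib[OF \<alpha>(1) True]]) (use \<alpha>(2) \<beta>(3) a in simp)
  next
    case False
    then show ?thesis using \<beta>(1) jet_fibre_off[OF \<alpha>(1)] by (simp add: zero_off_def)
  qed
  then have "\<beta> = \<alpha>" by blast
  then show ?thesis using \<alpha>(1) by simp
qed

text \<open>
  The expression of \<^const>\<open>jet_product_map\<close> in charts and its inverse, read off from the splitting
  \<open>(e1, e2, \<tau>, c) \<mapsto> ((e1, c), (e2, c - \<tau> / t))\<close> of the der spaces.
\<close>

definition split_coords ::
    "('e \<times> 'f \<times> real) \<times> ('e \<times> 'f \<times> real) \<times> real \<Rightarrow>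
     ('e::real_inner \<times> 'e \<times> real) \<times> ('f::real_inner \<times> 'f \<times> real) \<times> real" where
  "split_coords = (\<lambda>((y1, y2, t), (g1, g2, g\<tau>), c).
     ((y1, g1, t * g\<tau> + c), (y2, t *\<^sub>R g2, - (t * (t * g\<tau>))), t))"

definition merge_coords ::
    "('e::real_inner \<times> 'e \<times> real) \<times> ('f::real_inner \<times> 'f \<times> real) \<times> real \<Rightarrow>
     ('e \<times> 'f \<times> real) \<times> ('e \<times> 'f \<times> real) \<times> real" where
  "merge_coords = (\<lambda>((y1, g1, c1), (y2, g2, c2), t).
     ((y1, y2, t), (g1, (1 / t) *\<^sub>R g2, - (c2 / t / t)), c1 + c2 / t))"

section \<open>The canonical map in charts\<close>

context
  fixes L1 :: "('p, 'v::real_vector, 'e::real_inner) line_bundle"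
    and L2 :: "('q, 'w::real_vector, 'f::real_inner) line_bundle"
  assumes L1: "line_bundle L1" and L2: "line_bundle L2"
begin

lemma jet_product_map_apply:
  "jet_product_map L1 L2 z =
    ((fst (fst z), \<lambda>a. if a \<in> der_fibre L1 (fst (fst z)) then snd z (der_pair L1 L2 (fst z) a (\<lambda>s. 0)) else 0),
     (fst (snd (fst z)), \<lambda>a. if a \<in> der_fibre L2 (fst (snd (fst z)))
        then snd (snd (fst z)) (snd z (der_pair L1 L2 (fst z) (\<lambda>s. 0) a)) else 0),
     snd (snd (fst z)))"
  by (simp add: jet_product_map_def split_beta cong: if_cong)

text \<open>Both sides are the fibre of \<open>L1\<close> over the first base point, which is why
  the canonical factor can act as the identity on fibres.\<close>

lemma fib_jet_product:
  "fib (line_product (jet_line_bundle L1) (jet_line_bundle L2)) (jet_product_map L1 L2 z) =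
    fib (jet_line_bundle (line_product L1 L2)) z"
  by (simp add: line_product_simps jet_line_bundle_simps jet_product_map_apply)

context
  fixes A1 \<phi>1 U1 h1 A2 \<phi>2 U2 h2
  assumes A1: "(A1, \<phi>1) \<in> atlas (base L1)" and U1: "(U1, h1) \<in> trivs L1"
    and A2: "(A2, \<phi>2) \<in> atlas (base L2)" and U2: "(U2, h2) \<in> trivs L2"
begin

lemma jet_product_map_chart:
  assumes p: "fst z \<in> fibre_isos L1 L2 (A1 \<inter> U1) (A2 \<inter> U2)" and \<alpha>: "snd z \<in> jet_fibre (line_product L1 L2) (fst z)"
  shows "fst (jet_product_map L1 L2 z) \<in> Sigma (A1 \<inter> U1) (jet_fibre L1)"
    "fst (snd (jet_product_map L1 L2 z)) \<in> Sigma (A2 \<inter> U2) (jet_fibre L2)"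
    "product_chart (jet_line_bundle L1) (jet_chart L1 A1 \<phi>1 h1) (\<lambda>y. h1 (fst y)) (jet_chart L2 A2 \<phi>2 h2) (\<lambda>y. h2 (fst y))
       (jet_product_map L1 L2 z) =
     split_coords (jet_chart (line_product L1 L2) (fibre_isos L1 L2 (A1 \<inter> U1) (A2 \<inter> U2))
       (product_chart L1 \<phi>1 h1 \<phi>2 h2) (\<lambda>p. h1 (fst p)) z)"
proof -
  obtain p \<alpha> where z: "z = (p, \<alpha>)" by (cases z)
  note pz = p[unfolded z fst_conv] and \<alpha>z = \<alpha>[unfolded z fst_conv snd_conv]
  note pp = product_point[OF L1 L2 A1 U1 A2 U2 pz]
  note LP = line_bundle_line_product[OF L1 L2] and T = line_product_trivI[OF L1 L2 U1]
  note pa = product_atlas[OF L1 L2 A1 U1 A2 U2 pz]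
  let ?t = "fibre_coord L1 h1 h2 p"
  let ?pf = "product_frame L1 L2 A1 \<phi>1 U1 h1 A2 \<phi>2 U2 h2 p"
  obtain G \<gamma> where G: "jet_chart (line_product L1 L2) (fibre_isos L1 L2 (A1 \<inter> U1) (A2 \<inter> U2))
      (product_chart L1 \<phi>1 h1 \<phi>2 h2) (\<lambda>p. h1 (fst p)) (p, \<alpha>) = (product_chart L1 \<phi>1 h1 \<phi>2 h2 p, G, \<gamma>)"
    "\<And>e c. h1 (fst p) (\<alpha> (?pf (e, c))) = inner G e + \<gamma> * c"
    by (rule jet_frame_apply[OF LP pa pz T pp(7) \<alpha>z]) blast
  obtain g1 g2 g\<tau> where Gg: "G = (g1, g2, g\<tau>)" by (cases G)
  define \<beta>1 where "\<beta>1 = (\<lambda>a. if a \<in> der_fibre L1 (fst p) then \<alpha> (der_pair L1 L2 p a (\<lambda>s. 0)) else 0)"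
  define \<beta>2 where "\<beta>2 = (\<lambda>a. if a \<in> der_fibre L2 (fst (snd p)) then snd (snd p) (\<alpha> (der_pair L1 L2 p (\<lambda>s. 0) a)) else 0)"
  have w: "jet_product_map L1 L2 z = ((fst p, \<beta>1), (fst (snd p), \<beta>2), snd (snd p))"
    by (simp add: jet_product_map_apply z \<beta>1_def \<beta>2_def cong: if_cong)
  note z1 = zero_der_fibre[OF L1 L2 L1 base_product_pts(1)[OF L1 L2 pp(1)]]
  note z2 = zero_der_fibre[OF L1 L2 L2 base_product_pts(2)[OF L1 L2 pp(1)]]
  have f1: "\<alpha> (der_pair L1 L2 p a (\<lambda>s. 0)) \<in> fib L1 (fst p)" if "a \<in> der_fibre L1 (fst p)" for a
    using jet_fibre_fib[OF \<alpha>z der_pair_spec(1)[OF L1 L2 pp(1) that z2]] by (simp add: line_product_simps)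
  have f2: "\<alpha> (der_pair L1 L2 p (\<lambda>s. 0) a) \<in> fib L1 (fst p)" if "a \<in> der_fibre L2 (fst (snd p))" for a
    using jet_fibre_fib[OF \<alpha>z der_pair_spec(1)[OF L1 L2 pp(1) z1 that]] by (simp add: line_product_simps)
  \<comment> \<open>The pair \<open>((e, c), 0)\<close> has frame coordinates
    \<open>((e, 0, t * c), c)\<close>, and the product jet gives the value
    \<open>inner g1 e + g\<tau> * t * c + \<gamma> * c\<close> on it.\<close>
  have b1: "h1 (fst p) (\<beta>1 (der_frame L1 A1 \<phi>1 h1 (fst p) (e, c))) = inner g1 e + (?t * g\<tau> + \<gamma>) * c" for e c
    using der_pair_frame[OF L1 L2 A1 U1 A2 U2 pz, of e c 0 0] der_frame_der_fibre[OF L1 A1 pp(2) U1 pp(3)] G(2)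
    by (simp add: \<beta>1_def der_frame_zero[OF L2 A2 pp(4) U2 pp(5)] Gg algebra_simps)
  \<comment> \<open>The pair \<open>(0, (e, c))\<close> has frame coordinates
    \<open>((0, e, - t * c), 0)\<close>. The jet is evaluated there and carried by the fibre
    isomorphism, which contributes one more factor \<open>t\<close>.\<close>
  have b2: "h2 (fst (snd p)) (\<beta>2 (der_frame L2 A2 \<phi>2 h2 (fst (snd p)) (e, c))) =
      inner (?t *\<^sub>R g2) e + (- (?t * (?t * g\<tau>))) * c" for e c
  proof -
    have "der_pair L1 L2 p (\<lambda>s. 0) (der_frame L2 A2 \<phi>2 h2 (fst (snd p)) (e, c)) = ?pf ((0, e, - (?t * c)), 0)"
      using der_pair_frame[OF L1 L2 A1 U1 A2 U2 pz, of 0 0 e c] by (simp add: der_frame_zero[OF L1 A1 pp(2) U1 pp(3)])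
    moreover have "h2 (fst (snd p)) (snd (snd p) (\<alpha> (?pf ((0, e, - (?t * c)), 0)))) =
        ?t * h1 (fst p) (\<alpha> (?pf ((0, e, - (?t * c)), 0)))"
      by (rule fibre_coord_apply[OF L1 L2 U1 U2 pp(6)])
         (use jet_fibre_fib[OF \<alpha>z der_frame_der_fibre[OF LP pa pz T pp(7)]] in \<open>simp add: line_product_simps\<close>)
    ultimately show ?thesis
      using der_frame_der_fibre[OF L2 A2 pp(4) U2 pp(5)] G(2) by (simp add: \<beta>2_def Gg algebra_simps)
  qed
  have "\<beta>1 \<in> jet_fibre L1 (fst p)"
    by (rule jet_fibreI_chart[OF L1 A1 pp(2) U1 pp(3) _ _ b1]) (use f1 in \<open>auto simp: \<beta>1_def zero_off_def\<close>)
  moreover have "\<beta>2 \<in> jet_fibre L2 (fst (snd p))"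
    by (rule jet_fibreI_chart[OF L2 A2 pp(4) U2 pp(5) _ _ b2])
       (use f2 linear_iso_betwD(4)[OF base_product_pts(4)[OF L1 L2 pp(1)]] in \<open>auto simp: \<beta>2_def zero_off_def\<close>)
  ultimately show "fst (jet_product_map L1 L2 z) \<in> Sigma (A1 \<inter> U1) (jet_fibre L1)"
    "fst (snd (jet_product_map L1 L2 z)) \<in> Sigma (A2 \<inter> U2) (jet_fibre L2)"
    using pp by (simp_all add: w)
  have fc: "fibre_coord (jet_line_bundle L1) (\<lambda>y. h1 (fst y)) (\<lambda>y. h2 (fst y)) ((fst p, \<beta>1), (fst (snd p), \<beta>2), snd (snd p)) = ?t"
    by (simp add: fibre_coord_def jet_line_bundle_simps split_beta)
  show "product_chart (jet_line_bundle L1) (jet_chart L1 A1 \<phi>1 h1) (\<lambda>y. h1 (fst y)) (jet_chart L2 A2 \<phi>2 h2) (\<lambda>y. h2 (fst y))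
       (jet_product_map L1 L2 z) =
     split_coords (jet_chart (line_product L1 L2) (fibre_isos L1 L2 (A1 \<inter> U1) (A2 \<inter> U2))
       (product_chart L1 \<phi>1 h1 \<phi>2 h2) (\<lambda>p. h1 (fst p)) z)"
    unfolding product_chart_apply[of "jet_line_bundle L1"] w fc unfolding z G(1)
    using jet_chart_eq[OF L1 A1 pp(2) U1 pp(3) b1] jet_chart_eq[OF L2 A2 pp(4) U2 pp(5) b2]
    by (simp add: product_chart_apply Gg split_coords_def)
qed

end

lemma jet_product_map_pts:
  assumes z: "z \<in> pts (jet_bundle (line_product L1 L2))"
  shows "jet_product_map L1 L2 z \<in> pts (base_product (jet_line_bundle L1) (jet_line_bundle L2))"
proof -
  have p: "fst z \<in> pts (base_product L1 L2)" and \<alpha>: "snd z \<in> jet_fibre (line_product L1 L2) (fst z)"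
    using z by (auto simp: pts_jet_bundle line_product_simps)
  obtain A1 \<phi>1 U1 h1 A2 \<phi>2 U2 h2 where c: "(A1, \<phi>1) \<in> atlas (base L1)" "(U1, h1) \<in> trivs L1"
    "(A2, \<phi>2) \<in> atlas (base L2)" "(U2, h2) \<in> trivs L2" "fst (fst z) \<in> A1 \<inter> U1" "fst (snd (fst z)) \<in> A2 \<inter> U2"
    "fst z \<in> fibre_isos L1 L2 (A1 \<inter> U1) (A2 \<inter> U2)" by (rule base_product_atlas_cover[OF L1 L2 p])
  note w = jet_product_map_chart[OF c(1-4) c(7) \<alpha>]
  show ?thesis
    unfolding pts_base_product
    by (rule fibre_isosI)
       (use w(1,2) base_product_pts[OF L1 L2 p] chart_subset[OF base_premanifold[OF L1] c(1)]
          chart_subset[OF base_premanifold[OF L2] c(3)]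
        in \<open>auto simp: jet_line_bundle_simps pts_jet_bundle jet_product_map_apply\<close>)
qed

lemma jet_product_map_diffeo:
  obtains g where
    "smooth_map (jet_bundle (line_product L1 L2)) (base_product (jet_line_bundle L1) (jet_line_bundle L2)) (jet_product_map L1 L2)"
    "smooth_map (base_product (jet_line_bundle L1) (jet_line_bundle L2)) (jet_bundle (line_product L1 L2)) g"
    "\<And>z. z \<in> pts (jet_bundle (line_product L1 L2)) \<Longrightarrow> g (jet_product_map L1 L2 z) = z"
    "\<And>y. y \<in> pts (base_product (jet_line_bundle L1) (jet_line_bundle L2)) \<Longrightarrow> jet_product_map L1 L2 (g y) = y"
proof -
  let ?L = "line_product L1 L2" and ?J1 = "jet_line_bundle L1" and ?J2 = "jet_line_bundle L2"
  note LP = line_bundle_line_product[OF L1 L2] and LJ1 = line_bundle_jet[OF L1] and LJ2 = line_bundle_jet[OF L2]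
  note fd1 = premanifold_findim[OF base_premanifold[OF L1]] and fd2 = premanifold_findim[OF base_premanifold[OF L2]]
  \<comment> \<open>The intersections in \<open>dm\<close> and \<open>dn\<close> reproduce the chart
    domains in the shape in which the atlases form them from pulled-back trivialisations.\<close>
  define dm where "dm A1 U1 A2 U2 = Sigma (fibre_isos L1 L2 (A1 \<inter> U1) (A2 \<inter> U2) \<inter> {p \<in> pts (base_product L1 L2). fst p \<in> U1}) (jet_fibre ?L)"
    for A1 U1 A2 U2
  define dn where "dn A1 U1 A2 U2 = fibre_isos ?J1 ?J2 (Sigma (A1 \<inter> U1) (jet_fibre L1) \<inter> {y \<in> pts (jet_bundle L1). fst y \<in> U1})
      (Sigma (A2 \<inter> U2) (jet_fibre L2) \<inter> {y \<in> pts (jet_bundle L2). fst y \<in> U2})" for A1 U1 A2 U2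
  \<comment> \<open>The same \<open>split_coords\<close> and \<open>merge_coords\<close> serve for
    every choice of charts; only the chart domains vary.\<close>
  define Q where "Q D \<Phi> D' \<Psi> E E' \<longleftrightarrow> (\<exists>A1 \<phi>1 U1 h1 A2 \<phi>2 U2 h2. (A1, \<phi>1) \<in> atlas (base L1) \<and> (U1, h1) \<in> trivs L1 \<and>
    (A2, \<phi>2) \<in> atlas (base L2) \<and> (U2, h2) \<in> trivs L2 \<and> D = dm A1 U1 A2 U2 \<and> D' = dn A1 U1 A2 U2 \<and>
    \<Phi> = jet_chart ?L (fibre_isos L1 L2 (A1 \<inter> U1) (A2 \<inter> U2)) (product_chart L1 \<phi>1 h1 \<phi>2 h2) (\<lambda>p. h1 (fst p)) \<and>
    \<Psi> = product_chart ?J1 (jet_chart L1 A1 \<phi>1 h1) (\<lambda>y. h1 (fst y)) (jet_chart L2 A2 \<phi>2 h2) (\<lambda>y. h2 (fst y)) \<and>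
    E = split_coords \<and> E' = merge_coords)"
    for D \<Phi> D' \<Psi> and E :: "('e \<times> 'f \<times> real) \<times> ('e \<times> 'f \<times> real) \<times> real \<Rightarrow> ('e \<times> 'e \<times> real) \<times> ('f \<times> 'f \<times> real) \<times> real"
      and E' :: "('e \<times> 'e \<times> real) \<times> ('f \<times> 'f \<times> real) \<times> real \<Rightarrow> ('e \<times> 'f \<times> real) \<times> ('e \<times> 'f \<times> real) \<times> real"
  have dmI: "z \<in> dm A1 U1 A2 U2 \<longleftrightarrow> fst z \<in> fibre_isos L1 L2 (A1 \<inter> U1) (A2 \<inter> U2) \<and> snd z \<in> jet_fibre ?L (fst z)"
    if "(A1, \<phi>1) \<in> atlas (base L1)" "(A2, \<phi>2) \<in> atlas (base L2)" "(U1, h1) \<in> trivs L1" "(U2, h2) \<in> trivs L2"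
    for z A1 \<phi>1 A2 \<phi>2 U1 h1 U2 h2
    using product_point(7)[OF L1 L2 that(1,3,2,4), of "fst z"] by (cases z) (auto simp: dm_def)
  have atl: "(D, \<Phi>) \<in> atlas (jet_bundle ?L) \<and> (D', \<Psi>) \<in> atlas (base_product ?J1 ?J2)" if Q: "Q D \<Phi> D' \<Psi> E E'" for D \<Phi> D' \<Psi> E E'
  proof -
    obtain A1 \<phi>1 U1 h1 A2 \<phi>2 U2 h2 where c: "(A1, \<phi>1) \<in> atlas (base L1)" "(U1, h1) \<in> trivs L1"
      "(A2, \<phi>2) \<in> atlas (base L2)" "(U2, h2) \<in> trivs L2" "D = dm A1 U1 A2 U2" "D' = dn A1 U1 A2 U2"
      "\<Phi> = jet_chart ?L (fibre_isos L1 L2 (A1 \<inter> U1) (A2 \<inter> U2)) (product_chart L1 \<phi>1 h1 \<phi>2 h2) (\<lambda>p. h1 (fst p))"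
      "\<Psi> = product_chart ?J1 (jet_chart L1 A1 \<phi>1 h1) (\<lambda>y. h1 (fst y)) (jet_chart L2 A2 \<phi>2 h2) (\<lambda>y. h2 (fst y))"
      using Q unfolding Q_def by blast
    have "(D, \<Phi>) \<in> atlas (jet_bundle ?L)"
      unfolding c(5,7) dm_def
      by (rule jet_atlasI[OF LP _ line_product_trivI[OF L1 L2 c(2)]])
         (use base_product_atlasI[OF L1 L2 c(1-4)] in \<open>simp add: line_product_simps\<close>)
    moreover have "(D', \<Psi>) \<in> atlas (base_product ?J1 ?J2)"
      unfolding c(6,8) dn_def
      by (rule base_product_atlasI[OF LJ1 LJ2 _ jet_line_bundle_trivI[OF c(2)] _ jet_line_bundle_trivI[OF c(4)]])
         (simp_all add: jet_line_bundle_simps jet_atlasI[OF L1 c(1,2)] jet_atlasI[OF L2 c(3,4)])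
    ultimately show ?thesis by blast
  qed
  have im1: "\<Phi> ` D = (\<phi>1 ` (A1 \<inter> U1) \<times> \<phi>2 ` (A2 \<inter> U2) \<times> (- {0})) \<times> UNIV"
    if "(A1, \<phi>1) \<in> atlas (base L1)" "(U1, h1) \<in> trivs L1" "(A2, \<phi>2) \<in> atlas (base L2)" "(U2, h2) \<in> trivs L2"
      "D = dm A1 U1 A2 U2" "\<Phi> = jet_chart ?L (fibre_isos L1 L2 (A1 \<inter> U1) (A2 \<inter> U2)) (product_chart L1 \<phi>1 h1 \<phi>2 h2) (\<lambda>p. h1 (fst p))"
    for D \<Phi> A1 \<phi>1 U1 h1 A2 \<phi>2 U2 h2
  proof -
    have eq: "fibre_isos L1 L2 (A1 \<inter> U1) (A2 \<inter> U2) \<inter> {p \<in> pts (base_product L1 L2). fst p \<in> U1} = fibre_isos L1 L2 (A1 \<inter> U1) (A2 \<inter> U2)"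
      using product_point(7)[OF L1 L2 that(1-4)] by blast
    have "\<Phi> ` D = product_chart L1 \<phi>1 h1 \<phi>2 h2 ` fibre_isos L1 L2 (A1 \<inter> U1) (A2 \<inter> U2) \<times> UNIV"
      unfolding that(5,6) dm_def eq
      by (rule jet_chart_image[OF LP _ line_product_trivI[OF L1 L2 that(2)]])
         (use eq base_product_atlasI[OF L1 L2 that(1-4)] in \<open>auto simp: line_product_simps\<close>)
    moreover have "product_chart L1 \<phi>1 h1 \<phi>2 h2 ` fibre_isos L1 L2 (A1 \<inter> U1) (A2 \<inter> U2) =
        \<phi>1 ` (A1 \<inter> U1) \<times> \<phi>2 ` (A2 \<inter> U2) \<times> (- {0})"
      by (rule product_chart_image[OF L1 L2 that(2,4)]) auto
    ultimately show ?thesis by (simp only:)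
  qed
  have im2: "\<Psi> ` D' = (\<phi>1 ` (A1 \<inter> U1) \<times> UNIV) \<times> (\<phi>2 ` (A2 \<inter> U2) \<times> UNIV) \<times> (- {0})"
    if "(A1, \<phi>1) \<in> atlas (base L1)" "(U1, h1) \<in> trivs L1" "(A2, \<phi>2) \<in> atlas (base L2)" "(U2, h2) \<in> trivs L2"
      "D' = dn A1 U1 A2 U2" "\<Psi> = product_chart ?J1 (jet_chart L1 A1 \<phi>1 h1) (\<lambda>y. h1 (fst y)) (jet_chart L2 A2 \<phi>2 h2) (\<lambda>y. h2 (fst y))"
    for D' \<Psi> A1 \<phi>1 U1 h1 A2 \<phi>2 U2 h2
  proof -
    have eq: "Sigma (A1 \<inter> U1) (jet_fibre L1) \<inter> {y \<in> pts (jet_bundle L1). fst y \<in> U1} = Sigma (A1 \<inter> U1) (jet_fibre L1)"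
      "Sigma (A2 \<inter> U2) (jet_fibre L2) \<inter> {y \<in> pts (jet_bundle L2). fst y \<in> U2} = Sigma (A2 \<inter> U2) (jet_fibre L2)"
      using triv_subset[OF L1 that(2)] triv_subset[OF L2 that(4)] by (auto simp: pts_jet_bundle)
    have "\<Psi> ` D' = jet_chart L1 A1 \<phi>1 h1 ` Sigma (A1 \<inter> U1) (jet_fibre L1) \<times> jet_chart L2 A2 \<phi>2 h2 ` Sigma (A2 \<inter> U2) (jet_fibre L2) \<times> (- {0})"
      unfolding that(5,6) dn_def eq
      by (rule product_chart_image[OF LJ1 LJ2 jet_line_bundle_trivI[OF that(2)] jet_line_bundle_trivI[OF that(4)]])
         (use eq in blast)+
    moreover have "jet_chart L1 A1 \<phi>1 h1 ` Sigma (A1 \<inter> U1) (jet_fibre L1) = \<phi>1 ` (A1 \<inter> U1) \<times> UNIV"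
      "jet_chart L2 A2 \<phi>2 h2 ` Sigma (A2 \<inter> U2) (jet_fibre L2) = \<phi>2 ` (A2 \<inter> U2) \<times> UNIV"
      by (rule jet_chart_image[OF L1 that(1,2) order_refl], rule jet_chart_image[OF L2 that(3,4) order_refl])
    ultimately show ?thesis by (simp only:)
  qed
  have QE: thesis if "Q D \<Phi> D' \<Psi> E E'" "\<And>A1 \<phi>1 U1 h1 A2 \<phi>2 U2 h2. (A1, \<phi>1) \<in> atlas (base L1) \<Longrightarrow> (U1, h1) \<in> trivs L1 \<Longrightarrow>
    (A2, \<phi>2) \<in> atlas (base L2) \<Longrightarrow> (U2, h2) \<in> trivs L2 \<Longrightarrow> D = dm A1 U1 A2 U2 \<Longrightarrow> D' = dn A1 U1 A2 U2 \<Longrightarrow>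
    \<Phi> = jet_chart ?L (fibre_isos L1 L2 (A1 \<inter> U1) (A2 \<inter> U2)) (product_chart L1 \<phi>1 h1 \<phi>2 h2) (\<lambda>p. h1 (fst p)) \<Longrightarrow>
    \<Psi> = product_chart ?J1 (jet_chart L1 A1 \<phi>1 h1) (\<lambda>y. h1 (fst y)) (jet_chart L2 A2 \<phi>2 h2) (\<lambda>y. h2 (fst y)) \<Longrightarrow>
    E = split_coords \<Longrightarrow> E' = merge_coords \<Longrightarrow>
    \<Phi> ` D = (\<phi>1 ` (A1 \<inter> U1) \<times> \<phi>2 ` (A2 \<inter> U2) \<times> (- {0})) \<times> UNIV \<Longrightarrow>
    \<Psi> ` D' = (\<phi>1 ` (A1 \<inter> U1) \<times> UNIV) \<times> (\<phi>2 ` (A2 \<inter> U2) \<times> UNIV) \<times> (- {0}) \<Longrightarrow> thesis"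
    for D \<Phi> D' \<Psi> E E' thesis
    using that(1) unfolding Q_def by (elim exE conjE) (rule that(2); (assumption | rule im1 im2)+)
  show ?thesis
  proof (rule charts_diffeomorphism[where Q = Q and M = "jet_bundle ?L" and N = "base_product ?J1 ?J2" and f = "jet_product_map L1 L2"])
    show "premanifold (jet_bundle ?L)" by (rule premanifold_jet_bundle[OF LP])
    show "premanifold (base_product ?J1 ?J2)" by (rule premanifold_base_product[OF LJ1 LJ2])
    show "jet_product_map L1 L2 z \<in> pts (base_product ?J1 ?J2)" if "z \<in> pts (jet_bundle ?L)" for z
      by (rule jet_product_map_pts[OF that])
    show "\<exists>D \<Phi> D' \<Psi> E E'. Q D \<Phi> D' \<Psi> E E' \<and> z \<in> D" if z: "z \<in> pts (jet_bundle ?L)" for z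
    proof -
      have p: "fst z \<in> pts (base_product L1 L2)" and \<alpha>: "snd z \<in> jet_fibre ?L (fst z)"
        using z by (auto simp: pts_jet_bundle line_product_simps)
      obtain A1 \<phi>1 U1 h1 A2 \<phi>2 U2 h2 where c: "(A1, \<phi>1) \<in> atlas (base L1)" "(U1, h1) \<in> trivs L1"
        "(A2, \<phi>2) \<in> atlas (base L2)" "(U2, h2) \<in> trivs L2" "fst (fst z) \<in> A1 \<inter> U1" "fst (snd (fst z)) \<in> A2 \<inter> U2"
        "fst z \<in> fibre_isos L1 L2 (A1 \<inter> U1) (A2 \<inter> U2)" by (rule base_product_atlas_cover[OF L1 L2 p])
      have "z \<in> dm A1 U1 A2 U2" using dmI[OF c(1,3,2,4)] c(7) \<alpha> by blast
      then show ?thesis unfolding Q_def using c(1-4) by blast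
    qed
    show "\<exists>D \<Phi> D' \<Psi> E E'. Q D \<Phi> D' \<Psi> E E' \<and> y \<in> D'" if y: "y \<in> pts (base_product ?J1 ?J2)" for y
    proof -
      note y' = base_product_pts[OF LJ1 LJ2 y, unfolded jet_line_bundle_simps]
      have x: "fst (fst y) \<in> pts (base L1)" "fst (fst (snd y)) \<in> pts (base L2)"
        using y'(1,2) by (auto simp: pts_jet_bundle)
      obtain A1 \<phi>1 where 1: "(A1, \<phi>1) \<in> atlas (base L1)" "fst (fst y) \<in> A1" using chart_cover[OF base_premanifold[OF L1] x(1)] by blast
      obtain A2 \<phi>2 where 2: "(A2, \<phi>2) \<in> atlas (base L2)" "fst (fst (snd y)) \<in> A2" using chart_cover[OF base_premanifold[OF L2] x(2)] by blast
      obtain U1 h1 where 3: "(U1, h1) \<in> trivs L1" "fst (fst y) \<in> U1" using triv_cover[OF L1 x(1)] by blast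
      obtain U2 h2 where 4: "(U2, h2) \<in> trivs L2" "fst (fst (snd y)) \<in> U2" using triv_cover[OF L2 x(2)] by blast
      have "y \<in> dn A1 U1 A2 U2"
        unfolding dn_def by (rule fibre_isosI) (use y' 1 2 3 4 in \<open>auto simp: jet_line_bundle_simps pts_jet_bundle\<close>)
      then show ?thesis unfolding Q_def using 1 2 3 4 by blast
    qed
    show "(D, \<Phi>) \<in> atlas (jet_bundle ?L) \<and> (D', \<Psi>) \<in> atlas (base_product ?J1 ?J2)" if "Q D \<Phi> D' \<Psi> E E'" for D \<Phi> D' \<Psi> E E'
      by (rule atl[OF that])
    show "z \<in> D \<longleftrightarrow> jet_product_map L1 L2 z \<in> D'" if Q: "Q D \<Phi> D' \<Psi> E E'" and z: "z \<in> pts (jet_bundle ?L)" for D \<Phi> D' \<Psi> E E' z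
    proof (rule QE[OF Q])
      fix A1 \<phi>1 U1 h1 A2 \<phi>2 U2 h2
      assume c: "(A1, \<phi>1) \<in> atlas (base L1)" "(U1, h1) \<in> trivs L1" "(A2, \<phi>2) \<in> atlas (base L2)" "(U2, h2) \<in> trivs L2"
        "D = dm A1 U1 A2 U2" "D' = dn A1 U1 A2 U2"
      have p: "fst z \<in> pts (base_product L1 L2)" and \<alpha>: "snd z \<in> jet_fibre ?L (fst z)"
        using z by (auto simp: pts_jet_bundle line_product_simps)
      note w = base_product_pts[OF LJ1 LJ2 jet_product_map_pts[OF z], unfolded jet_line_bundle_simps]
      show "z \<in> D \<longleftrightarrow> jet_product_map L1 L2 z \<in> D'"
      proof
        assume "z \<in> D"
        then have fz: "fst z \<in> fibre_isos L1 L2 (A1 \<inter> U1) (A2 \<inter> U2)" using dmI[OF c(1,3,2,4)] c(5) by blast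
        note w2 = jet_product_map_chart[OF c(1-4) fz \<alpha>]
        show "jet_product_map L1 L2 z \<in> D'"
          unfolding c(6) dn_def by (rule fibre_isosI) (use w w2(1,2) in \<open>auto simp: jet_line_bundle_simps\<close>)
      next
        \<comment> \<open>The map does not move the underlying point of the base product, so the
          base points of the image decide in which domain \<open>z\<close> lies.\<close>
        assume "jet_product_map L1 L2 z \<in> D'"
        then have "fst (fst z) \<in> A1 \<inter> U1" "fst (snd (fst z)) \<in> A2 \<inter> U2"
          unfolding c(6) dn_def using fibre_isosD by (fastforce simp: jet_product_map_apply)+
        then have "fst z \<in> fibre_isos L1 L2 (A1 \<inter> U1) (A2 \<inter> U2)"
          by (intro fibre_isosI) (use base_product_pts[OF L1 L2 p] in auto)
        then show "z \<in> D" using dmI[OF c(1,3,2,4)] c(5) \<alpha> by blast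
      qed
    qed
    show "smooth_on (\<Phi> ` D) E \<and> smooth_on (\<Psi> ` D') E'" if Q: "Q D \<Phi> D' \<Psi> E E'" for D \<Phi> D' \<Psi> E E'
    proof (rule QE[OF Q])
      fix A1 \<phi>1 U1 h1 A2 \<phi>2 U2 h2
      assume c: "E = split_coords" "E' = merge_coords" 
        "\<Psi> ` D' = (\<phi>1 ` (A1 \<inter> U1) \<times> UNIV) \<times> (\<phi>2 ` (A2 \<inter> U2) \<times> UNIV) \<times> (- {0})"
      have o: "open (\<Phi> ` D)" "open (\<Psi> ` D')"
        using atl[OF Q] chart_open_image[OF premanifold_jet_bundle[OF LP]] chart_open_image[OF premanifold_base_product[OF LJ1 LJ2]] by blast+
      have "E = (\<lambda>z. ((fst (fst z), fst (fst (snd z)), snd (snd (fst z)) * snd (snd (fst (snd z))) + snd (snd z)),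
          (fst (snd (fst z)), snd (snd (fst z)) *\<^sub>R fst (snd (fst (snd z))), - (snd (snd (fst z)) * (snd (snd (fst z)) * snd (snd (fst (snd z)))))),
          snd (snd (fst z))))"
        unfolding c(1) split_coords_def by (auto simp: split_beta)
      then have "smooth_on (\<Phi> ` D) E"
        by (simp only:) (intro smooth_on_Pair smooth_on_add smooth_on_mult smooth_on_scaleR smooth_on_uminus
            smooth_on_fst smooth_on_snd smooth_on_id o)
      moreover have "E' = (\<lambda>z. ((fst (fst z), fst (fst (snd z)), snd (snd z)),
          (fst (snd (fst z)), (1 / snd (snd z)) *\<^sub>R fst (snd (fst (snd z))), - (snd (snd (fst (snd z))) / snd (snd z) / snd (snd z))),
          snd (snd (fst z)) + snd (snd (fst (snd z))) / snd (snd z)))"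
        unfolding c(2) merge_coords_def by (auto simp: split_beta)
      then have "smooth_on (\<Psi> ` D') E'"
        by (simp only:) (intro smooth_on_Pair smooth_on_add smooth_on_divide smooth_on_scaleR smooth_on_uminus
            smooth_on_fst smooth_on_snd smooth_on_const smooth_on_id o; use c(3) in auto)
      ultimately show ?thesis by blast
    qed
    show "\<Psi> (jet_product_map L1 L2 z) = E (\<Phi> z)" if Q: "Q D \<Phi> D' \<Psi> E E'" and z: "z \<in> D" for D \<Phi> D' \<Psi> E E' z
    proof (rule QE[OF Q])
      fix A1 \<phi>1 U1 h1 A2 \<phi>2 U2 h2
      assume c: "(A1, \<phi>1) \<in> atlas (base L1)" "(U1, h1) \<in> trivs L1" "(A2, \<phi>2) \<in> atlas (base L2)" "(U2, h2) \<in> trivs L2"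
        "D = dm A1 U1 A2 U2"
        "\<Phi> = jet_chart ?L (fibre_isos L1 L2 (A1 \<inter> U1) (A2 \<inter> U2)) (product_chart L1 \<phi>1 h1 \<phi>2 h2) (\<lambda>p. h1 (fst p))"
        "\<Psi> = product_chart ?J1 (jet_chart L1 A1 \<phi>1 h1) (\<lambda>y. h1 (fst y)) (jet_chart L2 A2 \<phi>2 h2) (\<lambda>y. h2 (fst y))"
        "E = split_coords"
      have "fst z \<in> fibre_isos L1 L2 (A1 \<inter> U1) (A2 \<inter> U2)" "snd z \<in> jet_fibre ?L (fst z)"
        using z dmI[OF c(1,3,2,4)] c(5) by blast+
      from jet_product_map_chart(3)[OF c(1-4) this] show ?thesis unfolding c(6-8) .
    qed
    show "E' (E u) = u" if Q: "Q D \<Phi> D' \<Psi> E E'" and u: "u \<in> \<Phi> ` D" for D \<Phi> D' \<Psi> E E' u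
    proof (rule QE[OF Q])
      fix A1 \<phi>1 U1 h1 A2 \<phi>2 U2 h2
      assume c: "E = split_coords" "E' = merge_coords" "\<Phi> ` D = (\<phi>1 ` (A1 \<inter> U1) \<times> \<phi>2 ` (A2 \<inter> U2) \<times> (- {0})) \<times> UNIV"
      show ?thesis using u unfolding c by (auto simp: split_coords_def merge_coords_def)
    qed
    show "E' v \<in> \<Phi> ` D \<and> E (E' v) = v" if Q: "Q D \<Phi> D' \<Psi> E E'" and v: "v \<in> \<Psi> ` D'" for D \<Phi> D' \<Psi> E E' v
    proof (rule QE[OF Q])
      fix A1 \<phi>1 U1 h1 A2 \<phi>2 U2 h2
      assume c: "E = split_coords" "E' = merge_coords" "\<Phi> ` D = (\<phi>1 ` (A1 \<inter> U1) \<times> \<phi>2 ` (A2 \<inter> U2) \<times> (- {0})) \<times> UNIV"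
        "\<Psi> ` D' = (\<phi>1 ` (A1 \<inter> U1) \<times> UNIV) \<times> (\<phi>2 ` (A2 \<inter> U2) \<times> UNIV) \<times> (- {0})"
      show ?thesis using v unfolding c by (auto simp: split_coords_def merge_coords_def)
    qed
  qed (rule that)
qed

text \<open>Packages the inverse base map together with the pull-back formulas in both directions.
  Through these the comparison of brackets can treat pull-back along the canonical factor as
  composition of functions.\<close>

lemma jet_product_factor_diffeomorphic:
  obtains g where
    "diffeomorphic_factor (jet_line_bundle (line_product L1 L2)) (line_product (jet_line_bundle L1) (jet_line_bundle L2))
       (jet_product_map L1 L2) (jet_product_factor L1 L2)"
    "factor (line_product (jet_line_bundle L1) (jet_line_bundle L2)) (jet_line_bundle (line_product L1 L2)) g (\<lambda>(y, v). (g y, v))"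
    "\<And>z. z \<in> pts (jet_bundle (line_product L1 L2)) \<Longrightarrow> g (jet_product_map L1 L2 z) = z"
    "\<And>y. y \<in> pts (base_product (jet_line_bundle L1) (jet_line_bundle L2)) \<Longrightarrow> jet_product_map L1 L2 (g y) = y"
    "\<And>y. y \<in> pts (base_product (jet_line_bundle L1) (jet_line_bundle L2)) \<Longrightarrow> g y \<in> pts (jet_bundle (line_product L1 L2))"
    "\<And>s. s \<in> sections (line_product (jet_line_bundle L1) (jet_line_bundle L2)) \<Longrightarrow>
       pull_section (jet_line_bundle (line_product L1 L2)) (jet_product_map L1 L2) (jet_product_factor L1 L2) s =
         (\<lambda>z. if z \<in> pts (jet_bundle (line_product L1 L2)) then s (jet_product_map L1 L2 z) else 0)"
    "\<And>s. s \<in> sections (line_product (jet_line_bundle L1) (jet_line_bundle L2)) \<Longrightarrow>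
       pull_section (jet_line_bundle (line_product L1 L2)) (jet_product_map L1 L2) (jet_product_factor L1 L2) s
         \<in> sections (jet_line_bundle (line_product L1 L2))"
    "\<And>s. s \<in> sections (jet_line_bundle (line_product L1 L2)) \<Longrightarrow>
       pull_section (line_product (jet_line_bundle L1) (jet_line_bundle L2)) g (\<lambda>(y, v). (g y, v)) s =
         (\<lambda>y. if y \<in> pts (base_product (jet_line_bundle L1) (jet_line_bundle L2)) then s (g y) else 0)"
    "\<And>s. s \<in> sections (jet_line_bundle (line_product L1 L2)) \<Longrightarrow>
       pull_section (line_product (jet_line_bundle L1) (jet_line_bundle L2)) g (\<lambda>(y, v). (g y, v)) s
         \<in> sections (line_product (jet_line_bundle L1) (jet_line_bundle L2))"
proof -
  let ?L = "line_product L1 L2" and ?J1 = "jet_line_bundle L1" and ?J2 = "jet_line_bundle L2"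
  let ?w = "jet_product_map L1 L2"
  note LP = line_bundle_line_product[OF L1 L2] and LJ1 = line_bundle_jet[OF L1] and LJ2 = line_bundle_jet[OF L2]
  note LJ = line_bundle_jet[OF LP] and LT = line_bundle_line_product[OF LJ1 LJ2]
  obtain g where g: "smooth_map (jet_bundle ?L) (base_product ?J1 ?J2) ?w" "smooth_map (base_product ?J1 ?J2) (jet_bundle ?L) g"
    "\<And>z. z \<in> pts (jet_bundle ?L) \<Longrightarrow> g (?w z) = z" "\<And>y. y \<in> pts (base_product ?J1 ?J2) \<Longrightarrow> ?w (g y) = y"
    by (rule jet_product_map_diffeo) blast
  have tr: "\<exists>U h V k. (U, h) \<in> trivs (jet_line_bundle ?L) \<and> (V, k) \<in> trivs (line_product ?J1 ?J2) \<and> z \<in> U \<and> ?w z \<in> V \<and>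
      h = (\<lambda>z. H (fst (fst z))) \<and> k = (\<lambda>y. H (fst (fst y)))"
    if z: "z \<in> pts (jet_bundle ?L)" and U: "(U, H) \<in> trivs L1" "fst (fst z) \<in> U" for z U H
  proof -
    have p: "fst z \<in> pts (base_product L1 L2)" using z by (auto simp: pts_jet_bundle line_product_simps)
    note w = jet_product_map_pts[OF z]
    note t1 = jet_line_bundle_trivI[OF line_product_trivI[OF L1 L2 U(1)]]
    note t2 = line_product_trivI[OF LJ1 LJ2 jet_line_bundle_trivI[OF U(1)]]
    have z1: "z \<in> {z \<in> pts (jet_bundle ?L). fst z \<in> {p \<in> pts (base_product L1 L2). fst p \<in> U}}"
      using z p U(2) by blast
    have "fst (fst (?w z)) \<in> U" using U(2) by (simp add: jet_product_map_apply)
    then have z2: "?w z \<in> {y \<in> pts (base_product ?J1 ?J2). fst y \<in> {y \<in> pts (jet_bundle L1). fst y \<in> U}}"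
      using w base_product_pts(1)[OF LJ1 LJ2 w, unfolded jet_line_bundle_simps] by blast
    show ?thesis using t1 t2 z1 z2 by blast
  qed
  have cov: "\<exists>U H. (U, H) \<in> trivs L1 \<and> fst (fst z) \<in> U" if "z \<in> pts (jet_bundle ?L)" for z
    using that triv_cover[OF L1] base_product_pts(1)[OF L1 L2] by (auto simp: pts_jet_bundle line_product_simps)
  have ww: "fst (fst (?w z)) = fst (fst z)" for z by (simp add: jet_product_map_apply)
  note gp = smooth_map_pts[OF premanifold_base_product[OF LJ1 LJ2] premanifold_jet_bundle[OF LP] g(2)]
  have gg: "fst (fst (g y)) = fst (fst y)" if "y \<in> pts (base_product ?J1 ?J2)" for y using ww[of "g y"] g(4)[OF that] by simp
  have tw: "\<exists>U h V k. (U, h) \<in> trivs (jet_line_bundle ?L) \<and> (V, k) \<in> trivs (line_product ?J1 ?J2) \<and> x \<in> U \<and> ?w x \<in> V \<and>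
      (\<forall>y\<in>pts (base (jet_line_bundle ?L)). k (?w y) = h y)" if x: "x \<in> pts (base (jet_line_bundle ?L))" for x
  proof -
    have x': "x \<in> pts (jet_bundle ?L)" using x by (simp add: jet_line_bundle_simps)
    obtain U H where U: "(U, H) \<in> trivs L1" "fst (fst x) \<in> U" using cov[OF x'] by blast
    show ?thesis using tr[OF x' U] ww by metis
  qed
  have tg: "\<exists>U h V k. (U, h) \<in> trivs (line_product ?J1 ?J2) \<and> (V, k) \<in> trivs (jet_line_bundle ?L) \<and> y \<in> U \<and> g y \<in> V \<and>
      (\<forall>y\<in>pts (base (line_product ?J1 ?J2)). k (g y) = h y)" if y: "y \<in> pts (base (line_product ?J1 ?J2))" for y
  proof -
    have y': "y \<in> pts (base_product ?J1 ?J2)" using y by (simp add: line_product_simps)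
    obtain U H where U: "(U, H) \<in> trivs L1" "fst (fst (g y)) \<in> U" using cov[OF gp[OF y']] by blast
    show ?thesis using tr[OF gp[OF y'] U] gg g(4)[OF y'] unfolding line_product_simps by metis
  qed
  have sw: "smooth_map (base (jet_line_bundle ?L)) (base (line_product ?J1 ?J2)) ?w"
    and sg: "smooth_map (base (line_product ?J1 ?J2)) (base (jet_line_bundle ?L)) g"
    using g(1,2) by (simp_all add: line_product_simps jet_line_bundle_simps)
  have fw: "fib (line_product ?J1 ?J2) (?w x) = fib (jet_line_bundle ?L) x" for x by (rule fib_jet_product)
  have fg: "fib (jet_line_bundle ?L) (g y) = fib (line_product ?J1 ?J2) y" if "y \<in> pts (base (line_product ?J1 ?J2))" for y
    using fib_jet_product[of "g y"] g(4)[of y] that by (simp add: line_product_simps(1))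
  have W: "(\<lambda>(x, v). (?w x, v)) = jet_product_factor L1 L2" by (simp add: jet_product_factor_def)
  have "factor (jet_line_bundle ?L) (line_product ?J1 ?J2) ?w (jet_product_factor L1 L2)"
    using factor_of_base_map[OF LJ LT sw fw tw] unfolding W .
  then have 1: "diffeomorphic_factor (jet_line_bundle ?L) (line_product ?J1 ?J2) ?w (jet_product_factor L1 L2)"
    unfolding diffeomorphic_factor_def diffeomorphism_def line_product_simps(1) jet_line_bundle_simps(1) using g by metis
  note 2 = factor_of_base_map[OF LT LJ sg fg tg]
  note 3 = pull_section_of_base_map[OF LJ LT sw fw tw, unfolded W, unfolded jet_line_bundle_simps(1)]
  note 4 = pull_section_of_base_map[OF LT LJ sg fg tg, unfolded line_product_simps(1)]
  show ?thesis by (rule that[OF 1 2 g(3,4) gp 3 4])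
qed

end


section \<open>Derivations with smooth coefficients\<close>

definition der_coords where
  "der_coords L a A \<phi> U h S E C \<longleftrightarrow> (A, \<phi>) \<in> atlas (base L) \<and> (U, h) \<in> trivs L \<and>
     openin (mfd_topology (base L)) S \<and> S \<subseteq> A \<inter> U \<and>
     (\<forall>y\<in>S. sm_at (base L) E y \<and> sm_at (base L) C y \<and> der_at a y = der_frame L A \<phi> h y (E y, C y))"

text \<open>Smoothness is asked of the frame coefficients, not only of the images of sections as in
  \<open>derivations\<close>. With it linear sections are visibly smooth and lifts to the line
  product are given by formulas, while enough such derivations exist to realise every frame element
  at a point.\<close>

definition smooth_der ::
    "('q, 'v::real_vector, 'e::real_inner) line_bundle \<Rightarrow> (('q \<Rightarrow> 'v) \<Rightarrow> 'q \<Rightarrow> 'v) \<Rightarrow> bool" where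
  "smooth_der L a \<longleftrightarrow> (\<forall>s. s \<notin> sections L \<longrightarrow> a s = (\<lambda>x. 0)) \<and> (\<forall>s x. x \<notin> pts (base L) \<longrightarrow> a s x = 0) \<and>
     (\<forall>p\<in>pts (base L). \<exists>A \<phi> U h S E C. der_coords L a A \<phi> U h S E C \<and> p \<in> S)"

lemma der_coordsD:
  assumes "der_coords L a A \<phi> U h S E C"
  shows "(A, \<phi>) \<in> atlas (base L)" "(U, h) \<in> trivs L" "openin (mfd_topology (base L)) S"
    "y \<in> S \<Longrightarrow> y \<in> A" "y \<in> S \<Longrightarrow> y \<in> U" "y \<in> S \<Longrightarrow> sm_at (base L) E y" "y \<in> S \<Longrightarrow> sm_at (base L) C y"
    "y \<in> S \<Longrightarrow> der_at a y = der_frame L A \<phi> h y (E y, C y)"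
  using assms unfolding der_coords_def by auto

context
  fixes L :: "('q, 'v::real_vector, 'e::real_inner) line_bundle"
  assumes L: "line_bundle L"
begin

lemma smooth_der_fibre:
  assumes a: "smooth_der L a" and x: "x \<in> pts (base L)"
  shows "der_at a x \<in> der_fibre L x"
proof -
  obtain A \<phi> U h S E C where c: "der_coords L a A \<phi> U h S E C" "x \<in> S" using a x unfolding smooth_der_def by blast
  note d = der_coordsD[OF c(1)]
  show ?thesis unfolding d(8)[OF c(2)] by (rule der_frame_der_fibre[OF L d(1) d(4)[OF c(2)] d(2) d(5)[OF c(2)]])
qed

lemma smooth_der_derivation:
  assumes a: "smooth_der L a"
  shows "a \<in> derivations L"
proof -
  note M = base_premanifold[OF L]
  have "a s \<in> sections L" if s: "s \<in> sections L" for s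
  proof (rule sectionsI[OF L])
    show "a s x = 0" if "x \<notin> pts (base L)" for x using a that unfolding smooth_der_def by blast
    fix x assume x: "x \<in> pts (base L)"
    show "a s x \<in> fib L x" using smooth_der_fibre[OF a x] s unfolding der_fibre_def der_at_def by blast
    obtain A \<phi> U h S E C where c: "der_coords L a A \<phi> U h S E C" "x \<in> S" using a x unfolding smooth_der_def by blast
    note d = der_coordsD[OF c(1)]
    obtain B :: "'e set" where B: "onb B" using findim_onb[OF premanifold_findim[OF M]] by blast
    let ?f = "\<lambda>y. h y (s y)"
    have sm: "sm_at (base L) ?f y" if "y \<in> S" for y by (rule sm_at_section[OF L s d(2) d(5)[OF that]])
    \<comment> \<open>Expanding the variable direction \<open>E y\<close> in a fixed basis leaves
      derivatives in fixed directions, which are smooth functions.\<close>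
    have "sm_at (base L) (\<lambda>y. (\<Sum>b\<in>B. inner (E y) b * chart_deriv A \<phi> ?f y b) + C y * ?f y) x"
      by (intro sm_at_add[OF M] sm_at_sum[OF M x] sm_at_mult[OF M] sm_at_inner[OF M] sm_at_const[OF M x] d(6,7) c(2) sm
          sm_at_chart_deriv[OF M d(1) d(4)])
    then have "sm_at (base L) (\<lambda>y. h y (a s y)) x"
    proof (rule sm_at_cong[OF M _ d(3) c(2)])
      fix y assume y: "y \<in> S"
      have "h y (a s y) = chart_deriv A \<phi> ?f y (E y) + C y * ?f y"
        using der_frame_triv[OF L d(1) d(4)[OF y] d(2) d(5)[OF y] s] d(8)[OF y] unfolding der_at_def by metis
      then show "(\<Sum>b\<in>B. inner (E y) b * chart_deriv A \<phi> ?f y b) + C y * ?f y = h y (a s y)"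
        using linear_onb[OF B chart_deriv_linear[OF M d(1) d(4)[OF y] sm[OF y]], of "E y"] by simp
    qed
    then show "\<exists>U h. (U, h) \<in> trivs L \<and> x \<in> U \<and> sm_at (base L) (\<lambda>y. h y (a s y)) x" using d(2,5) c(2) by blast
  qed
  then show ?thesis
    using smooth_der_fibre[OF a] a unfolding derivations_def smooth_der_def by blast
qed

text \<open>A bump function times the frame element with constant coordinates, extended by
  zero.\<close>

lemma smooth_der_exists:
  assumes A: "(A, \<phi>) \<in> atlas (base L)" "x \<in> A" and U: "(U, h) \<in> trivs L" "x \<in> U"
  obtains a S E C where "smooth_der L a" "der_coords L a A \<phi> U h S E C" "x \<in> S" "E x = e" "C x = c"
proof -
  note M = base_premanifold[OF L]
  let ?S = "A \<inter> U"
  have S: "openin (mfd_topology (base L)) ?S" "x \<in> ?S"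
    using A U openin_chart[OF M] triv_openin[OF L] by auto
  obtain \<theta> K where \<theta>: "\<theta> \<in> smooth_funs (base L)" "\<theta> x = 1" "closedin (mfd_topology (base L)) K" "K \<subseteq> ?S"
    "\<And>y. y \<notin> K \<Longrightarrow> \<theta> y = 0" using bump_function[OF base_manifold[OF L] S] by blast
  define a where "a s y = (if y \<in> ?S then \<theta> y *\<^sub>R der_frame L A \<phi> h y (e, c) s else 0)" for s y
  have Sp: "?S \<subseteq> pts (base L)" using openin_mfd_subset[OF M S(1)] .
  have th: "sm_at (base L) \<theta> y" if "y \<in> pts (base L)" for y using \<theta>(1) that smooth_funs_iff[OF M] by blast
  have c1: "der_coords L a A \<phi> U h ?S (\<lambda>y. \<theta> y *\<^sub>R e) (\<lambda>y. \<theta> y * c)"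
    unfolding der_coords_def
  proof (intro conjI ballI A(1) U(1) S(1) order_refl)
    fix y assume y: "y \<in> ?S"
    then have yp: "y \<in> pts (base L)" using Sp by blast
    show "sm_at (base L) (\<lambda>y. \<theta> y *\<^sub>R e) y" "sm_at (base L) (\<lambda>y. \<theta> y * c) y"
      by (intro sm_at_scaleR[OF M] sm_at_mult[OF M] th[OF yp] sm_at_const[OF M yp])+
    show "der_at a y = der_frame L A \<phi> h y (\<theta> y *\<^sub>R e, \<theta> y * c)"
      using der_frame_scale[OF L A(1) _ U(1), of y "\<theta> y" e c] y unfolding der_at_def a_def by simp
  qed
  have "smooth_der L a"
    unfolding smooth_der_def
  proof (intro conjI allI impI ballI)
    show "a s = (\<lambda>x. 0)" if "s \<notin> sections L" for s
      using der_frame_off[OF L A(1) _ U(1) _ that] by (auto simp: a_def)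
    show "a s y = 0" if "y \<notin> pts (base L)" for s y using that Sp by (auto simp: a_def)
    fix p assume p: "p \<in> pts (base L)"
    show "\<exists>A \<phi> U h S E C. der_coords L a A \<phi> U h S E C \<and> p \<in> S"
    proof (cases "p \<in> ?S")
      case True then show ?thesis using c1 by blast
    next
      case False
      obtain A' \<phi>' where A': "(A', \<phi>') \<in> atlas (base L)" "p \<in> A'" using chart_cover[OF M p] by blast
      obtain U' h' where U': "(U', h') \<in> trivs L" "p \<in> U'" using triv_cover[OF L p] by blast
      let ?T = "(pts (base L) - K) \<inter> (A' \<inter> U')"
      have "openin (mfd_topology (base L)) (pts (base L) - K)"
        using \<theta>(3) topspace_mfd[OF M] by (metis closedin_def)
      then have oT: "openin (mfd_topology (base L)) ?T" using openin_chart[OF M A'(1)] triv_openin[OF L U'(1)] by blast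
      have "der_coords L a A' \<phi>' U' h' ?T (\<lambda>y. 0) (\<lambda>y. 0)"
        unfolding der_coords_def
      proof (intro conjI ballI A'(1) U'(1) oT)
        fix y assume y: "y \<in> ?T"
        then show "sm_at (base L) (\<lambda>y. 0) y" "sm_at (base L) (\<lambda>y. 0) y" using sm_at_const[OF M] by blast+
        show "der_at a y = der_frame L A' \<phi>' h' y (0, 0)"
          using der_frame_zero[OF L A'(1) _ U'(1), of y] y \<theta>(5)[of y] unfolding der_at_def a_def by auto
      qed blast
      then show ?thesis using p False A' U' \<theta>(4) by blast
    qed
  qed
  then show ?thesis using that[OF _ c1 S(2)] \<theta>(2) by simp
qed

section \<open>Basic and linear sections over the jet bundle\<close>

lemma sm_at_jet_proj: "z \<in> pts (jet_bundle L) \<Longrightarrow> sm_at (base L) f (fst z) \<Longrightarrow> sm_at (jet_bundle L) (\<lambda>z. f (fst z)) z"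
  by (rule sm_at_pullback[OF premanifold_jet_bundle[OF L] base_premanifold[OF L] smooth_map_jet_proj[OF L]])

lemma openin_jet_proj: "openin (mfd_topology (base L)) W \<Longrightarrow> openin (mfd_topology (jet_bundle L)) {z \<in> pts (jet_bundle L). fst z \<in> W}"
  by (rule smooth_map_openin_preimage[OF premanifold_jet_bundle[OF L] base_premanifold[OF L] smooth_map_jet_proj[OF L]])

lemma jet_ptsD: "z \<in> pts (jet_bundle L) \<Longrightarrow> fst z \<in> pts (base L)" "z \<in> pts (jet_bundle L) \<Longrightarrow> snd z \<in> jet_fibre L (fst z)"
  by (auto simp: pts_jet_bundle)

lemma basic_section_apply: "s \<in> sections L \<Longrightarrow> basic_section L s z = (if z \<in> pts (jet_bundle L) then s (fst z) else 0)"
proof -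
  assume s: "s \<in> sections L"
  have fm: "fibre_map (pullback_factor fst) z = (\<lambda>v. v)" for z :: "'q \<times> ((('q \<Rightarrow> 'v) \<Rightarrow> 'v) \<Rightarrow> 'v)"
    by (rule ext) (simp add: fibre_map_def pullback_factor_def)
  show ?thesis
    using the_inv_into_f_f[of "\<lambda>v. v" "fib L (fst z)" "s (fst z)"] section_in_fib[OF L s jet_ptsD(1), of z]
    by (simp add: basic_section_def pull_section_def fm jet_line_bundle_simps)
qed

lemma basic_section_section:
  assumes s: "s \<in> sections L"
  shows "basic_section L s \<in> sections (jet_line_bundle L)"
proof (rule sectionsI[OF line_bundle_jet[OF L]], unfold jet_line_bundle_simps)
  note P = premanifold_jet_bundle[OF L]
  fix z assume z: "z \<in> pts (jet_bundle L)"
  show "basic_section L s z \<in> fib L (fst z)"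
    using section_in_fib[OF L s jet_ptsD(1)[OF z]] z by (simp add: basic_section_apply[OF s])
  obtain U h where U: "(U, h) \<in> trivs L" "fst z \<in> U" using triv_cover[OF L jet_ptsD(1)[OF z]] by blast
  have "sm_at (jet_bundle L) (\<lambda>w. h (fst w) (s (fst w))) z"
    by (rule sm_at_jet_proj[OF z, of "\<lambda>y. h y (s y)"]) (rule sm_at_section[OF L s U])
  then have "sm_at (jet_bundle L) (\<lambda>w. h (fst w) (basic_section L s w)) z"
    by (rule sm_at_cong[OF P _ openin_pts[OF P] z]) (simp add: basic_section_apply[OF s])
  then show "\<exists>U h. (U, h) \<in> trivs (jet_line_bundle L) \<and> z \<in> U \<and> sm_at (jet_bundle L) (\<lambda>y. h y (basic_section L s y)) z"
    using jet_line_bundle_trivI[OF U(1)] U(2) z by blast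
qed (simp add: basic_section_apply[OF s])

lemma linear_section_apply: "linear_section L a z = (if z \<in> pts (jet_bundle L) then snd z (der_at a (fst z)) else 0)"
  by (simp add: linear_section_def split_beta)

context
  fixes a A \<phi> U h S E C
  assumes d: "der_coords L a A \<phi> U h S E C"
begin

text \<open>Evaluation of a jet on a derivation is the pairing of dual frame coordinates. Smoothness
  and derivatives of linear sections are both read off from this formula.\<close>

lemma linear_section_coords:
  assumes w: "w \<in> pts (jet_bundle L)" "fst w \<in> S"
  shows "h (fst w) (linear_section L a w) =
    inner (fst (snd (jet_chart L A \<phi> h w))) (E (fst w)) + snd (snd (jet_chart L A \<phi> h w)) * C (fst w)"
proof -
  note D = der_coordsD[OF d]
  obtain g \<gamma> where g: "jet_chart L A \<phi> h (fst w, snd w) = (\<phi> (fst w), g, \<gamma>)"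
    "\<And>e c. h (fst w) (snd w (der_frame L A \<phi> h (fst w) (e, c))) = inner g e + \<gamma> * c"
    using jet_frame_apply[OF L D(1) D(4)[OF w(2)] D(2) D(5)[OF w(2)] jet_ptsD(2)[OF w(1)]] by blast
  then show ?thesis using w D(8)[OF w(2)] by (simp add: linear_section_apply)
qed

lemma sm_at_linear_section:
  assumes z: "z \<in> pts (jet_bundle L)" "fst z \<in> S"
  shows "sm_at (jet_bundle L) (\<lambda>w. h (fst w) (linear_section L a w)) z"
proof -
  note D = der_coordsD[OF d] and P = premanifold_jet_bundle[OF L]
  have zs: "z \<in> Sigma (A \<inter> U) (jet_fibre L)" using D(4,5)[OF z(2)] jet_ptsD(2)[OF z(1)] by (cases z) auto
  note s = sm_at_chart[OF P jet_atlasI[OF L D(1,2)] zs]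
  have "sm_at (jet_bundle L) (\<lambda>w. inner (fst (snd (jet_chart L A \<phi> h w))) (E (fst w)) + snd (snd (jet_chart L A \<phi> h w)) * C (fst w)) z"
    by (intro sm_at_add[OF P] sm_at_inner[OF P] sm_at_mult[OF P] sm_at_fst[OF P] sm_at_snd[OF P] s
        sm_at_jet_proj[OF z(1)] D(6,7) z(2))
  then show ?thesis
    by (rule sm_at_cong[OF P _ openin_jet_proj[OF D(3)]]) (use z linear_section_coords in auto)
qed

end

lemma linear_section_section:
  assumes a: "smooth_der L a"
  shows "linear_section L a \<in> sections (jet_line_bundle L)"
proof (rule sectionsI[OF line_bundle_jet[OF L]], unfold jet_line_bundle_simps)
  fix z assume z: "z \<in> pts (jet_bundle L)"
  show "linear_section L a z \<in> fib L (fst z)"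
    using jet_fibre_fib[OF jet_ptsD(2)[OF z] smooth_der_fibre[OF a jet_ptsD(1)[OF z]]] z by (simp add: linear_section_apply)
  obtain A \<phi> U h S E C where c: "der_coords L a A \<phi> U h S E C" "fst z \<in> S"
    using a jet_ptsD(1)[OF z] unfolding smooth_der_def by blast
  show "\<exists>U h. (U, h) \<in> trivs (jet_line_bundle L) \<and> z \<in> U \<and> sm_at (jet_bundle L) (\<lambda>y. h y (linear_section L a y)) z"
    using jet_line_bundle_trivI[OF der_coordsD(2)[OF c(1)]] der_coordsD(5)[OF c(1,2)] z sm_at_linear_section[OF c(1) z c(2)]
    by blast
qed (simp add: linear_section_apply)

text \<open>The 1-jets of the basic and linear sections span all 1-jets of the jet line bundle.\<close>

lemma jet_der_fibre_eq_0:
  assumes z: "z \<in> pts (jet_bundle L)" and \<Lambda>: "\<Lambda> \<in> der_fibre (jet_line_bundle L) z"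
    and basic: "\<And>s. s \<in> sections L \<Longrightarrow> \<Lambda> (basic_section L s) = 0"
    and lin: "\<And>a. smooth_der L a \<Longrightarrow> \<Lambda> (linear_section L a) = 0"
  shows "\<Lambda> = (\<lambda>s. 0)"
proof -
  note M = base_premanifold[OF L] and P = premanifold_jet_bundle[OF L] and LJ = line_bundle_jet[OF L]
  obtain A \<phi> U h where c: "(A, \<phi>) \<in> atlas (base L)" "fst z \<in> A" "(U, h) \<in> trivs L" "fst z \<in> U"
    "z \<in> Sigma (A \<inter> U) (jet_fibre L)" by (rule jet_atlas_cover[OF L z])
  let ?D = "Sigma (A \<inter> U) (jet_fibre L)" and ?\<Phi> = "jet_chart L A \<phi> h"
  note J = jet_atlasI[OF L c(1,3)] and T = jet_line_bundle_trivI[OF c(3)]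
  have J': "(?D, ?\<Phi>) \<in> atlas (base (jet_line_bundle L))" using J by (simp add: jet_line_bundle_simps)
  have zT: "z \<in> {z \<in> pts (jet_bundle L). fst z \<in> U}" using z c(4) by blast
  note cs = sm_at_chart[OF P J c(5)]
  have dch: "chart_deriv ?D ?\<Phi> (\<lambda>w. F (?\<Phi> w)) z X = F X" if "bounded_linear F" for F :: "_ \<Rightarrow> 'x::real_normed_vector" and X
    using chart_deriv_bounded_linear[OF P J c(5) that cs] chart_deriv_chart[OF P J c(5)] by simp
  have dproj: "chart_deriv ?D ?\<Phi> (\<lambda>w. f (fst w)) z X = chart_deriv A \<phi> f (fst z) (fst X)"
    if f: "sm_at (base L) f (fst z)" for f :: "'q \<Rightarrow> 'x::real_normed_vector" and X
  proof -
    have 1: "chart_deriv ?D ?\<Phi> (\<lambda>w. \<phi> (fst w)) z X = fst X"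
      using dch[OF bounded_linear_fst, of X] by (simp add: jet_chart_def split_beta)
    have 2: "chart_deriv ?D ?\<Phi> (\<lambda>w. f (fst w)) z = chart_deriv ?D ?\<Phi> (\<lambda>w. (f \<circ> the_inv_into A \<phi>) (\<phi> (fst w))) z"
      by (rule chart_deriv_cong[OF P J c(5) openin_chart[OF P J] c(5)])
         (use chart_inv[OF M c(1)] sm_at_jet_proj[OF z f] in auto)
    have 3: "chart_deriv ?D ?\<Phi> (\<lambda>w. (f \<circ> the_inv_into A \<phi>) (\<phi> (fst w))) z X =
        chart_deriv A \<phi> f (fst z) (chart_deriv ?D ?\<Phi> (\<lambda>w. \<phi> (fst w)) z X)"
      by (rule chart_deriv_compose[OF P J c(5) sm_at_jet_proj[OF z sm_at_chart[OF M c(1,2)]] chart_deriv_has[OF M c(1,2) f]])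
    show ?thesis unfolding 2 3 1 ..
  qed
  obtain X c0 where X: "\<Lambda> = der_frame (jet_line_bundle L) ?D ?\<Phi> (\<lambda>w. h (fst w)) z (X, c0)"
    by (rule der_fibreE[OF LJ J' c(5) T zT \<Lambda>])
  obtain ey eg e\<gamma> where Xe: "X = (ey, eg, e\<gamma>)" by (cases X)
  note frame = der_frame_triv[OF LJ J' c(5) T zT, of _ X c0, folded X]
  have h0: "h (fst z) 0 = 0" by (rule triv_zero[OF L c(3,4)])
  \<comment> \<open>A basic section is constant along the fibres, so on it \<open>\<Lambda>\<close>
    acts as the frame element \<open>(ey, c0)\<close> of \<open>L\<close>. Vanishing on all of them
    forces both to be zero.\<close>
  have "der_frame L A \<phi> h (fst z) (ey, c0) = der_frame L A \<phi> h (fst z) (0, 0)"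
    unfolding der_frame_zero[OF L c(1-4)]
  proof (rule sym, rule der_frame_eqI[OF L c(1-4)])
    fix s assume s: "s \<in> sections L"
    show "0 \<in> fib L (fst z)" using subspace_0[OF fib_subspace[OF L jet_ptsD(1)[OF z]]] .
    have sf: "sm_at (base L) (\<lambda>y. h y (s y)) (fst z)" by (rule sm_at_section[OF L s c(3,4)])
    have "chart_deriv ?D ?\<Phi> (\<lambda>w. h (fst w) (s (fst w))) z = chart_deriv ?D ?\<Phi> (\<lambda>w. h (fst w) (basic_section L s w)) z"
      by (rule chart_deriv_cong[OF P J c(5) openin_pts[OF P] z])
         (use basic_section_apply[OF s] sm_at_jet_proj[OF z sf] in auto)
    then show "h (fst z) 0 = chart_deriv A \<phi> (\<lambda>y. h y (s y)) (fst z) ey + c0 * h (fst z) (s (fst z))"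
      using frame[OF basic_section_section[OF s]] basic[OF s] dproj[OF sf, of X] basic_section_apply[OF s, of z] z
      by (simp add: Xe)
  qed (simp add: zero_off_def)
  from der_frame_inj[OF L c(1-4) this] have 0: "ey = 0" "c0 = 0" by blast+
  \<comment> \<open>With \<open>ey\<close> and \<open>c0\<close> zero, only the derivative along the
    jet fibre remains. On a linear section it pairs \<open>(eg, e\<gamma>)\<close> with the
    coefficients of the derivation at the base point, and these can be prescribed.\<close>
  have "inner eg e + e\<gamma> * k = 0" for e k
  proof -
    obtain a S E C where a: "smooth_der L a" "der_coords L a A \<phi> U h S E C" "fst z \<in> S" "E (fst z) = e" "C (fst z) = k"
      by (rule smooth_der_exists[OF c(1-4)])
    note D = der_coordsD[OF a(2)]
    have sE: "sm_at (jet_bundle L) (\<lambda>w. E (fst w)) z" "sm_at (jet_bundle L) (\<lambda>w. C (fst w)) z"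
      by (rule sm_at_jet_proj[OF z D(6)[OF a(3)]], rule sm_at_jet_proj[OF z D(7)[OF a(3)]])
    have s1: "sm_at (jet_bundle L) (\<lambda>w. fst (snd (?\<Phi> w))) z" "sm_at (jet_bundle L) (\<lambda>w. snd (snd (?\<Phi> w))) z"
      by (rule sm_at_fst[OF P sm_at_snd[OF P cs]], rule sm_at_snd[OF P sm_at_snd[OF P cs]])
    have d1: "chart_deriv ?D ?\<Phi> (\<lambda>w. fst (snd (?\<Phi> w))) z X = eg" "chart_deriv ?D ?\<Phi> (\<lambda>w. snd (snd (?\<Phi> w))) z X = e\<gamma>"
      using dch[OF bounded_linear_compose[OF bounded_linear_fst bounded_linear_snd], of X]
        dch[OF bounded_linear_compose[OF bounded_linear_snd bounded_linear_snd], of X] by (simp_all add: Xe)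
    have d2: "chart_deriv ?D ?\<Phi> (\<lambda>w. E (fst w)) z X = 0" "chart_deriv ?D ?\<Phi> (\<lambda>w. C (fst w)) z X = 0"
      using dproj[OF D(6)[OF a(3)], of X] dproj[OF D(7)[OF a(3)], of X]
        linear_0[OF chart_deriv_linear[OF M c(1,2) D(6)[OF a(3)]]] linear_0[OF chart_deriv_linear[OF M c(1,2) D(7)[OF a(3)]]]
      by (simp_all add: Xe 0)
    have "chart_deriv ?D ?\<Phi> (\<lambda>w. inner (fst (snd (?\<Phi> w))) (E (fst w)) + snd (snd (?\<Phi> w)) * C (fst w)) z X = inner eg e + e\<gamma> * k"
      unfolding chart_deriv_add[OF P J c(5) sm_at_inner[OF P s1(1) sE(1)] sm_at_mult[OF P s1(2) sE(2)]]
        chart_deriv_bilinear[OF P J c(5) bounded_bilinear_inner s1(1) sE(1)] chart_deriv_mult[OF P J c(5) s1(2) sE(2)] d1 d2 a(4,5)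
      by simp
    moreover have "chart_deriv ?D ?\<Phi> (\<lambda>w. h (fst w) (linear_section L a w)) z =
        chart_deriv ?D ?\<Phi> (\<lambda>w. inner (fst (snd (?\<Phi> w))) (E (fst w)) + snd (snd (?\<Phi> w)) * C (fst w)) z"
      by (rule chart_deriv_cong[OF P J c(5) openin_jet_proj[OF D(3)] _ _ sm_at_linear_section[OF a(2) z a(3)]])
         (use z a(3) linear_section_coords[OF a(2)] in auto)
    ultimately show ?thesis
      using frame[OF linear_section_section[OF a(1)]] lin[OF a(1)] h0 0(2) by simp
  qed
  then have "inner eg eg = 0" "e\<gamma> = 0" by (metis mult_zero_right add.right_neutral, metis add.left_neutral inner_zero_right mult.right_neutral)
  then have "X = (0, 0, 0)" using 0 by (simp add: Xe)
  then have "X = 0" by (simp add: zero_prod_def)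
  then show ?thesis using X 0(2) der_frame_zero[OF LJ J' c(5) T zT] by simp
qed

section \<open>Commutators of derivations\<close>

lemma derivationsD:
  assumes "a \<in> derivations L"
  shows "s \<in> sections L \<Longrightarrow> a s \<in> sections L" "s \<notin> sections L \<Longrightarrow> a s = (\<lambda>x. 0)"
    "s \<in> sections L \<Longrightarrow> r \<in> sections L \<Longrightarrow> a (\<lambda>y. s y + r y) = (\<lambda>y. a s y + a r y)"
    "s \<in> sections L \<Longrightarrow> a (\<lambda>y. c *\<^sub>R s y) = (\<lambda>y. c *\<^sub>R a s y)"
    "a (\<lambda>y. 0) = (\<lambda>y. 0)"
    "x \<in> pts (base L) \<Longrightarrow> \<exists>\<delta>. \<forall>f\<in>smooth_funs (base L). \<forall>s\<in>sections L. a (\<lambda>y. f y *\<^sub>R s y) x = f x *\<^sub>R a s x + \<delta> f *\<^sub>R s x"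
proof -
  show sec: "s \<in> sections L \<Longrightarrow> a s \<in> sections L" and "s \<notin> sections L \<Longrightarrow> a s = (\<lambda>x. 0)" for s
    using assms unfolding derivations_def by blast+
  have df: "der_at a x \<in> der_fibre L x" if "x \<in> pts (base L)" for x using assms that unfolding derivations_def by blast
  show add: "a (\<lambda>y. s y + r y) = (\<lambda>y. a s y + a r y)" if "s \<in> sections L" "r \<in> sections L" for s r
  proof
    fix x show "a (\<lambda>y. s y + r y) x = a s x + a r x"
    proof (cases "x \<in> pts (base L)")
      case True then show ?thesis using df[OF True] that unfolding der_fibre_def der_at_def by blast
    next
      case False then show ?thesis using section_off[OF L sec] that section_add[OF L that] by simp
    qed
  qed
  show scale: "a (\<lambda>y. c *\<^sub>R s y) = (\<lambda>y. c *\<^sub>R a s y)" if "s \<in> sections L" for s c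
  proof
    fix x show "a (\<lambda>y. c *\<^sub>R s y) x = c *\<^sub>R a s x"
    proof (cases "x \<in> pts (base L)")
      case True then show ?thesis using df[OF True] that unfolding der_fibre_def der_at_def by blast
    next
      case False then show ?thesis using section_off[OF L sec] that section_scale[OF L that] by simp
    qed
  qed
  show "a (\<lambda>y. 0) = (\<lambda>y. 0)" using scale[OF section_zero[OF L], of 0] by simp
  show "\<exists>\<delta>. \<forall>f\<in>smooth_funs (base L). \<forall>s\<in>sections L. a (\<lambda>y. f y *\<^sub>R s y) x = f x *\<^sub>R a s x + \<delta> f *\<^sub>R s x"
    if "x \<in> pts (base L)"
    using df[OF that] unfolding der_fibre_def der_at_def by blast
qed

text \<open>
  The smoothness of the symbol of a derivation is avoided by working with the sections
  \<open>b (f s) - f b(s)\<close> instead of the functions \<open>\<delta>(b)[f]\<close>.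
\<close>

lemma commutator_der_fibre:
  assumes a: "a \<in> derivations L" and b: "b \<in> derivations L" and x: "x \<in> pts (base L)"
  shows "der_at (commutator a b) x \<in> der_fibre L x"
proof -
  note M = base_premanifold[OF L]
  \<comment> \<open>The Leibniz rule with the symbol eliminated: the symbol of \<open>f\<close>
    times \<open>s\<close> is \<open>a (f s) - f a(s)\<close>, a difference of genuine sections to
    which another derivation may be applied.\<close>
  have aL: "a (\<lambda>y. (f y * g y) *\<^sub>R s y) = (\<lambda>y. f y *\<^sub>R a (\<lambda>y. g y *\<^sub>R s y) y + g y *\<^sub>R (a (\<lambda>y. f y *\<^sub>R s y) y + (-1) *\<^sub>R (f y *\<^sub>R a s y)))"
    if a: "a \<in> derivations L" and f: "f \<in> smooth_funs (base L)" and g: "g \<in> smooth_funs (base L)" and s: "s \<in> sections L" for a f g s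
  proof
    fix y
    show "a (\<lambda>y. (f y * g y) *\<^sub>R s y) y = f y *\<^sub>R a (\<lambda>y. g y *\<^sub>R s y) y + g y *\<^sub>R (a (\<lambda>y. f y *\<^sub>R s y) y + (-1) *\<^sub>R (f y *\<^sub>R a s y))"
    proof (cases "y \<in> pts (base L)")
      case True
      obtain \<delta> where d: "\<And>f s. f \<in> smooth_funs (base L) \<Longrightarrow> s \<in> sections L \<Longrightarrow> a (\<lambda>y. f y *\<^sub>R s y) y = f y *\<^sub>R a s y + \<delta> f *\<^sub>R s y"
        using derivationsD(6)[OF a True] by blast
      have "a (\<lambda>y. f y *\<^sub>R (g y *\<^sub>R s y)) y = f y *\<^sub>R a (\<lambda>y. g y *\<^sub>R s y) y + \<delta> f *\<^sub>R (g y *\<^sub>R s y)"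
        by (rule d[OF f section_fun_mult[OF L g s]])
      moreover have "a (\<lambda>y. f y *\<^sub>R s y) y = f y *\<^sub>R a s y + \<delta> f *\<^sub>R s y" by (rule d[OF f s])
      ultimately show ?thesis by (simp add: mult.commute)
    next
      case False
      note off = section_off[OF L derivationsD(1)[OF a] False]
      show ?thesis
        using off[OF s] off[OF section_fun_mult[OF L f s]] off[OF section_fun_mult[OF L g s]]
          off[OF section_fun_mult[OF L smooth_funs_mult[OF M f g] s]] by simp
    qed
  qed
  \<comment> \<open>At a common zero of \<open>f\<close> and \<open>g\<close> the second-order
    expression depends only on the two symbols, and it is symmetric under exchange of
    \<open>a\<close> and \<open>b\<close>. The commutator therefore annihilates such
    products.\<close>
  have ord: "a (b (\<lambda>y. (f y * g y) *\<^sub>R s y)) x = (\<delta>a f * \<delta>b g + \<delta>a g * \<delta>b f) *\<^sub>R s x"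
    if a: "a \<in> derivations L" and b: "b \<in> derivations L"
      and fg: "f \<in> smooth_funs (base L)" "g \<in> smooth_funs (base L)" "f x = 0" "g x = 0" and s: "s \<in> sections L"
      and da: "\<And>f s. f \<in> smooth_funs (base L) \<Longrightarrow> s \<in> sections L \<Longrightarrow> a (\<lambda>y. f y *\<^sub>R s y) x = f x *\<^sub>R a s x + \<delta>a f *\<^sub>R s x"
      and db: "\<And>f s. f \<in> smooth_funs (base L) \<Longrightarrow> s \<in> sections L \<Longrightarrow> b (\<lambda>y. f y *\<^sub>R s y) x = f x *\<^sub>R b s x + \<delta>b f *\<^sub>R s x"
    for a b f g s \<delta>a \<delta>b
  proof -
    note fs = section_fun_mult[OF L fg(1) s] and gs = section_fun_mult[OF L fg(2) s]
    let ?u = "\<lambda>y. b (\<lambda>y. g y *\<^sub>R s y) y" and ?v = "\<lambda>y. b (\<lambda>y. f y *\<^sub>R s y) y + (-1) *\<^sub>R (f y *\<^sub>R b s y)"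
    have u: "?u \<in> sections L" by (rule derivationsD(1)[OF b gs])
    have v: "?v \<in> sections L"
      by (intro section_add[OF L] section_scale[OF L] section_fun_mult[OF L fg(1)] derivationsD(1)[OF b] fs s)
    have "a (b (\<lambda>y. (f y * g y) *\<^sub>R s y)) x = a (\<lambda>y. f y *\<^sub>R ?u y) x + a (\<lambda>y. g y *\<^sub>R ?v y) x"
      unfolding aL[OF b fg(1,2) s] derivationsD(3)[OF a section_fun_mult[OF L fg(1) u] section_fun_mult[OF L fg(2) v]] ..
    also have "\<dots> = \<delta>a f *\<^sub>R ?u x + \<delta>a g *\<^sub>R ?v x"
      using da[OF fg(1) u] da[OF fg(2) v] fg(3,4) by simp
    also have "\<dots> = (\<delta>a f * \<delta>b g + \<delta>a g * \<delta>b f) *\<^sub>R s x"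
      using db[OF fg(1) s] db[OF fg(2) s] fg(3,4) by (simp add: scaleR_add_left)
    finally show ?thesis .
  qed
  have "order_one_at L x (der_at (commutator a b) x)"
    unfolding order_one_at_def
  proof (intro conjI ballI allI impI)
    fix s assume s: "s \<in> sections L"
    note ab = derivationsD(1)[OF a derivationsD(1)[OF b s]] and ba = derivationsD(1)[OF b derivationsD(1)[OF a s]]
    show "der_at (commutator a b) x s \<in> fib L x"
      unfolding der_at_def commutator_def
      by (rule subspace_diff[OF fib_subspace[OF L x] section_in_fib[OF L ab x] section_in_fib[OF L ba x]])
    show "der_at (commutator a b) x (\<lambda>y. c *\<^sub>R s y) = c *\<^sub>R der_at (commutator a b) x s" for c
      using derivationsD(4)[OF a] derivationsD(4)[OF b] derivationsD(1)[OF a s] derivationsD(1)[OF b s] s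
      by (simp add: der_at_def commutator_def scaleR_diff_right)
    show "der_at (commutator a b) x (\<lambda>y. s y + r y) = der_at (commutator a b) x s + der_at (commutator a b) x r"
      if r: "r \<in> sections L" for r
      using derivationsD(3)[OF a] derivationsD(3)[OF b] derivationsD(1)[OF a] derivationsD(1)[OF b] s r
      by (simp add: der_at_def commutator_def)
    fix f g assume fg: "f \<in> smooth_funs (base L)" "g \<in> smooth_funs (base L)" "f x = 0" "g x = 0"
    obtain \<delta>a where da: "\<And>f s. f \<in> smooth_funs (base L) \<Longrightarrow> s \<in> sections L \<Longrightarrow> a (\<lambda>y. f y *\<^sub>R s y) x = f x *\<^sub>R a s x + \<delta>a f *\<^sub>R s x"
      using derivationsD(6)[OF a x] by blast
    obtain \<delta>b where db: "\<And>f s. f \<in> smooth_funs (base L) \<Longrightarrow> s \<in> sections L \<Longrightarrow> b (\<lambda>y. f y *\<^sub>R s y) x = f x *\<^sub>R b s x + \<delta>b f *\<^sub>R s x"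
      using derivationsD(6)[OF b x] by blast
    have "a (b (\<lambda>y. (f y * g y) *\<^sub>R s y)) x = (\<delta>a f * \<delta>b g + \<delta>a g * \<delta>b f) *\<^sub>R s x"
      by (rule ord[OF a b fg s da db])
    moreover have "b (a (\<lambda>y. (f y * g y) *\<^sub>R s y)) x = (\<delta>b f * \<delta>a g + \<delta>b g * \<delta>a f) *\<^sub>R s x"
      by (rule ord[OF b a fg s db da])
    ultimately show "der_at (commutator a b) x (\<lambda>y. (f y * g y) *\<^sub>R s y) = 0"
      unfolding der_at_def commutator_def by (simp add: mult.commute add.commute)
  qed
  moreover have "zero_off (sections L) (der_at (commutator a b) x)"
    using derivationsD(2)[OF a] derivationsD(2)[OF b] derivationsD(5)[OF a] derivationsD(5)[OF b]
    by (simp add: zero_off_def der_at_def commutator_def)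
  ultimately show ?thesis using der_fibre_iff[OF L x] by blast
qed

end


section \<open>Comparison of the Jacobi structures\<close>

context
  fixes L :: "('q, 'v::real_vector, 'e::real_inner) line_bundle" and K
  assumes L: "line_bundle L" and K: "jacobi_structure L K"
begin

lemma jacobi_first_order:
  "s \<in> sections L \<Longrightarrow> first_order_operator L (\<lambda>r. K s r)" "s \<in> sections L \<Longrightarrow> first_order_operator L (\<lambda>r. K r s)"
  and jacobi_alt: "s \<in> sections L \<Longrightarrow> K s s = (\<lambda>x. 0)"
  by (use K in \<open>simp_all add: jacobi_structure_def\<close>)

lemma jacobi_section: "s \<in> sections L \<Longrightarrow> r \<in> sections L \<Longrightarrow> K s r \<in> sections L"
  and jacobi_add: "s \<in> sections L \<Longrightarrow> r \<in> sections L \<Longrightarrow> t \<in> sections L \<Longrightarrow>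
    K s (\<lambda>y. r y + t y) = (\<lambda>y. K s r y + K s t y)"
  and jacobi_scale: "s \<in> sections L \<Longrightarrow> r \<in> sections L \<Longrightarrow> K s (\<lambda>y. c *\<^sub>R r y) = (\<lambda>y. c *\<^sub>R K s r y)"
  using jacobi_first_order(1)[of s] by (simp_all add: first_order_operator_def)

lemma jacobi_prod:
  assumes "s \<in> sections L" "r \<in> sections L" "f \<in> smooth_funs (base L)" "g \<in> smooth_funs (base L)" "f x = 0" "g x = 0"
  shows "K s (\<lambda>y. (f y * g y) *\<^sub>R r y) x = 0"
proof -
  have "K s (\<lambda>y. (f y * g y) *\<^sub>R r y) x - f x *\<^sub>R K s (\<lambda>y. g y *\<^sub>R r y) x - g x *\<^sub>R K s (\<lambda>y. f y *\<^sub>R r y) x +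
      (f x * g x) *\<^sub>R K s r x = 0"
    using jacobi_first_order(1)[OF assms(1)] assms(2-4) unfolding first_order_operator_def by blast
  then show ?thesis using assms(5,6) by simp
qed

text \<open>Polarisation of the vanishing on the diagonal.\<close>

lemma jacobi_antisym:
  assumes s: "s \<in> sections L" and r: "r \<in> sections L"
  shows "K r s x = - K s r x"
proof -
  have left: "K (\<lambda>y. s y + r y) t = (\<lambda>y. K s t y + K r t y)" if "t \<in> sections L" for t
    using jacobi_first_order(2)[OF that] s r unfolding first_order_operator_def by blast
  have "K (\<lambda>y. s y + r y) (\<lambda>y. s y + r y) x = K s s x + K s r x + (K r s x + K r r x)"
    unfolding left[OF section_add[OF L s r]] jacobi_add[OF s s r] jacobi_add[OF r s r] by simp
  then have "K s r x + K r s x = 0" using jacobi_alt[OF s] jacobi_alt[OF r] jacobi_alt[OF section_add[OF L s r]] by simp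
  then show ?thesis by (metis add_eq_0_iff)
qed

end

text \<open>Chosen so that linear sections correspond: the linear section of the lift is the
  pull-back, along the canonical factor, of the linear section of \<open>a\<close>.\<close>

definition lift1 where
  "lift1 L1 L2 a s z = (if s \<in> sections (line_product L1 L2) \<and> z \<in> pts (base_product L1 L2)
     then der_pair L1 L2 z (der_at a (fst z)) (\<lambda>s. 0) s else 0)"

definition lift2 where
  "lift2 L1 L2 a s z = (if s \<in> sections (line_product L1 L2) \<and> z \<in> pts (base_product L1 L2)
     then der_pair L1 L2 z (\<lambda>s. 0) (der_at a (fst (snd z))) s else 0)"

abbreviation jet_pull where
  "jet_pull L1 L2 \<equiv> pull_section (jet_line_bundle (line_product L1 L2)) (jet_product_map L1 L2) (jet_product_factor L1 L2)"

section \<open>Lifts of derivations and pull-backs along the canonical factor\<close>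

context
  fixes L1 :: "('p, 'v::real_vector, 'e::real_inner) line_bundle"
    and L2 :: "('q, 'w::real_vector, 'f::real_inner) line_bundle"
  assumes L1: "line_bundle L1" and L2: "line_bundle L2"
begin

lemma jet_pull_apply:
  assumes "s \<in> sections (line_product (jet_line_bundle L1) (jet_line_bundle L2))"
  shows "jet_pull L1 L2 s = (\<lambda>z. if z \<in> pts (jet_bundle (line_product L1 L2)) then s (jet_product_map L1 L2 z) else 0)"
    "jet_pull L1 L2 s \<in> sections (jet_line_bundle (line_product L1 L2))"
  by (rule jet_product_factor_diffeomorphic[OF L1 L2], use assms in blast)+

lemma zero_der1: "z \<in> pts (base_product L1 L2) \<Longrightarrow> (\<lambda>s. 0) \<in> der_fibre L1 (fst z)"
  and zero_der2: "z \<in> pts (base_product L1 L2) \<Longrightarrow> (\<lambda>s. 0) \<in> der_fibre L2 (fst (snd z))"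
  using zero_der_fibre[OF L1 L2 L1 base_product_pts(1)[OF L1 L2]] zero_der_fibre[OF L1 L2 L2 base_product_pts(2)[OF L1 L2]] by blast+

text \<open>The second der map records the value only after the fibre isomorphism, whose injectivity
  recovers it.\<close>

lemma der2_apply_eq_0:
  assumes z: "z \<in> pts (base_product L1 L2)" and a: "a \<in> der_fibre (line_product L1 L2) z"
    and s: "s \<in> sections L2" and eq: "der2 L1 L2 z a s = snd (snd z) v" and v: "v \<in> fib L1 (fst z)"
  shows "a (pull2 L1 L2 s) = v"
proof -
  have "a (pull2 L1 L2 s) \<in> fib L1 (fst z)"
    using a pull2_section[OF L1 L2 s] unfolding der_fibre_def by (simp add: line_product_simps)
  moreover have "snd (snd z) (a (pull2 L1 L2 s)) = snd (snd z) v"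
    using eq s by (simp add: der_map_def fibre_map_proj)
  ultimately show ?thesis using linear_iso_betwD(5)[OF base_product_pts(4)[OF L1 L2 z]] v by (meson inj_onD)
qed

lemma proj2_zero: "z \<in> pts (base_product L1 L2) \<Longrightarrow> snd (snd z) 0 = 0"
  using linear_iso_betwD(3)[OF base_product_pts(4)[OF L1 L2], of z 0 0]
    subspace_0[OF fib_subspace[OF L1 base_product_pts(1)[OF L1 L2]], of z] by simp

lemma der_at_lift1:
  assumes z: "z \<in> pts (base_product L1 L2)" and a: "der_at a (fst z) \<in> der_fibre L1 (fst z)"
  shows "der_at (lift1 L1 L2 a) z = der_pair L1 L2 z (der_at a (fst z)) (\<lambda>s. 0)"
    "der_at (lift1 L1 L2 a) z \<in> der_fibre (line_product L1 L2) z"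
    "der1 L1 L2 z (der_at (lift1 L1 L2 a) z) = der_at a (fst z)" "der2 L1 L2 z (der_at (lift1 L1 L2 a) z) = (\<lambda>s. 0)"
proof -
  note sp = der_pair_spec[OF L1 L2 z a zero_der2[OF z]]
  have "zero_off (sections (line_product L1 L2)) (der_pair L1 L2 z (der_at a (fst z)) (\<lambda>s. 0))"
    using sp(1) unfolding der_fibre_def by blast
  then show eq: "der_at (lift1 L1 L2 a) z = der_pair L1 L2 z (der_at a (fst z)) (\<lambda>s. 0)"
    using z by (auto simp: der_at_def lift1_def zero_off_def)
  show "der_at (lift1 L1 L2 a) z \<in> der_fibre (line_product L1 L2) z"
    "der1 L1 L2 z (der_at (lift1 L1 L2 a) z) = der_at a (fst z)" "der2 L1 L2 z (der_at (lift1 L1 L2 a) z) = (\<lambda>s. 0)"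
    unfolding eq by (fact sp)+
qed

lemma smooth_der_lift1:
  assumes a: "smooth_der L1 a"
  shows "smooth_der (line_product L1 L2) (lift1 L1 L2 a)"
  unfolding smooth_der_def
proof (intro conjI allI impI ballI, unfold line_product_simps)
  show "lift1 L1 L2 a s = (\<lambda>x. 0)" if "s \<notin> sections (line_product L1 L2)" for s using that by (auto simp: lift1_def)
  show "lift1 L1 L2 a s z = 0" if "z \<notin> pts (base_product L1 L2)" for s z using that by (simp add: lift1_def)
  fix z assume z: "z \<in> pts (base_product L1 L2)"
  note P = premanifold_base_product[OF L1 L2] and pt = base_product_pts[OF L1 L2 z]
  obtain A1 \<phi>1 U1 h1 S E C where c: "der_coords L1 a A1 \<phi>1 U1 h1 S E C" "fst z \<in> S"
    using a pt(1) unfolding smooth_der_def by blast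
  note d = der_coordsD[OF c(1)]
  obtain A2 \<phi>2 where A2: "(A2, \<phi>2) \<in> atlas (base L2)" "fst (snd z) \<in> A2" using chart_cover[OF base_premanifold[OF L2] pt(2)] by blast
  obtain U2 h2 where U2: "(U2, h2) \<in> trivs L2" "fst (snd z) \<in> U2" using triv_cover[OF L2 pt(2)] by blast
  have A1: "(A1, \<phi>1) \<in> atlas (base L1)" "fst z \<in> A1" and U1: "(U1, h1) \<in> trivs L1" "fst z \<in> U1"
    using d c(2) by blast+
  let ?D = "fibre_isos L1 L2 (A1 \<inter> U1) (A2 \<inter> U2)" and ?t = "fibre_coord L1 h1 h2"
  let ?S = "?D \<inter> {y \<in> pts (base_product L1 L2). fst y \<in> S}"
  note D = base_product_atlasI[OF L1 L2 A1(1) U1(1) A2(1) U2(1)]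
  have oS: "openin (mfd_topology (base_product L1 L2)) ?S"
    using openin_chart[OF P D] openin_proj1[OF L1 L2 d(3)] by blast
  have zS: "z \<in> ?S" using z c(2) pt A1 A2 U1 U2 by (auto intro!: fibre_isosI)
  note pp = product_point[OF L1 L2 A1(1) U1(1) A2(1) U2(1)]
  \<comment> \<open>The coefficients are those of \<open>der_pair_frame\<close> with
    \<open>e2 = 0\<close> and \<open>c2 = 0\<close>, so the component along the fibre coordinate is
    \<open>t * C\<close>.\<close>
  have "der_coords (line_product L1 L2) (lift1 L1 L2 a) ?D (product_chart L1 \<phi>1 h1 \<phi>2 h2)
      {z \<in> pts (base_product L1 L2). fst z \<in> U1} (\<lambda>z. h1 (fst z)) ?S (\<lambda>z. (E (fst z), 0, fibre_coord L1 h1 h2 z * C (fst z))) (\<lambda>z. C (fst z))"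
    unfolding der_coords_def line_product_simps
  proof (intro conjI ballI D line_product_trivI[OF L1 L2 U1(1)] oS)
    show "?S \<subseteq> ?D \<inter> {z \<in> pts (base_product L1 L2). fst z \<in> U1}" using pp(7) by blast
    fix y assume y: "y \<in> ?S"
    then have yD: "y \<in> ?D" and yS: "fst y \<in> S" and yp: "y \<in> pts (base_product L1 L2)" by blast+
    note E = sm_at_proj1[OF L1 L2 yp d(6)[OF yS]] and C = sm_at_proj1[OF L1 L2 yp d(7)[OF yS]]
    note t = sm_at_fibre_coord[OF L1 L2 yp U1(1) U2(1) pp(3)[OF yD] pp(5)[OF yD]]
    show "sm_at (base_product L1 L2) (\<lambda>z. (E (fst z), 0, fibre_coord L1 h1 h2 z * C (fst z))) y" "sm_at (base_product L1 L2) (\<lambda>z. C (fst z)) y"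
      by (intro sm_at_Pair[OF P] sm_at_mult[OF P] sm_at_uminus[OF P] sm_at_const[OF P yp] E C t)+
    have fr: "der_at a (fst y) = der_frame L1 A1 \<phi>1 h1 (fst y) (E (fst y), C (fst y))" by (rule d(8)[OF yS])
    have zf: "(\<lambda>s. 0) = der_frame L2 A2 \<phi>2 h2 (fst (snd y)) (0, 0)"
      using der_frame_zero[OF L2 A2(1) _ U2(1), of "fst (snd y)"] pp(4)[OF yD] pp(5)[OF yD] by simp
    show "der_at (lift1 L1 L2 a) y = product_frame L1 L2 A1 \<phi>1 U1 h1 A2 \<phi>2 U2 h2 y ((\<lambda>z. (E (fst z), 0, fibre_coord L1 h1 h2 z * C (fst z))) y, (\<lambda>z. C (fst z)) y)"
      unfolding der_at_lift1(1)[OF yp smooth_der_fibre[OF L1 a base_product_pts(1)[OF L1 L2 yp]]] fr zf der_pair_frame[OF L1 L2 A1(1) U1(1) A2(1) U2(1) yD]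
      by simp
  qed
  then show "\<exists>A \<phi> U h S E C. der_coords (line_product L1 L2) (lift1 L1 L2 a) A \<phi> U h S E C \<and> z \<in> S" using zS by blast
qed

lemma jet_pull_basic1:
  assumes s: "s \<in> sections L1"
  shows "jet_pull L1 L2 (pull1 (jet_line_bundle L1) (jet_line_bundle L2) (basic_section L1 s)) =
    basic_section (line_product L1 L2) (pull1 L1 L2 s)"
proof
  fix z
  note LJ1 = line_bundle_jet[OF L1] and LJ2 = line_bundle_jet[OF L2] and LP = line_bundle_line_product[OF L1 L2]
  note sec = pull1_section[OF LJ1 LJ2 basic_section_section[OF L1 s]]
  show "jet_pull L1 L2 (pull1 (jet_line_bundle L1) (jet_line_bundle L2) (basic_section L1 s)) z =
      basic_section (line_product L1 L2) (pull1 L1 L2 s) z"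
  proof (cases "z \<in> pts (jet_bundle (line_product L1 L2))")
    case True
    note w = jet_product_map_pts[OF L1 L2 True]
    have p: "fst z \<in> pts (base_product L1 L2)" using jet_ptsD(1)[OF LP True] by (simp add: line_product_simps)
    note wp = base_product_pts[OF LJ1 LJ2 w, unfolded jet_line_bundle_simps]
    note bf = section_in_fib[OF LJ1 basic_section_section[OF L1 s] wp(1)[folded jet_line_bundle_simps(1)]]
    have "pull1 (jet_line_bundle L1) (jet_line_bundle L2) (basic_section L1 s) (jet_product_map L1 L2 z) = pull1 L1 L2 s (fst z)"
      using pull1_apply[of _ _ "jet_product_map L1 L2 z" "basic_section L1 s", OF LJ1 LJ2 w bf] pull1_apply[of _ _ "fst z" s, OF L1 L2 p section_in_fib[OF L1 s base_product_pts(1)[OF L1 L2 p]]]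
        wp(1) by (simp add: basic_section_apply[OF L1 s] jet_product_map_apply[OF L1 L2] cong: if_cong)
    then show ?thesis using True by (simp add: jet_pull_apply(1)[OF sec] basic_section_apply[OF LP pull1_section[OF L1 L2 s]])
  qed (simp add: jet_pull_apply(1)[OF sec] basic_section_apply[OF LP pull1_section[OF L1 L2 s]])
qed

text \<open>The first jet of \<open>jet_product_map\<close> is, by construction, evaluation on pairs
  with zero second entry. The derivation \<open>c\<close> is any one with the right values, not only
  \<open>lift1\<close>, because the result is applied to commutators of lifts as well.\<close>

lemma jet_pull_linear1:
  assumes sec: "linear_section L1 a \<in> sections (jet_line_bundle L1)"
    and a: "\<And>x. x \<in> pts (base L1) \<Longrightarrow> der_at a x \<in> der_fibre L1 x"
    and c: "\<And>z. z \<in> pts (base_product L1 L2) \<Longrightarrow> der_at c z = der_pair L1 L2 z (der_at a (fst z)) (\<lambda>s. 0)"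
  shows "jet_pull L1 L2 (pull1 (jet_line_bundle L1) (jet_line_bundle L2) (linear_section L1 a)) =
    linear_section (line_product L1 L2) c"
proof
  fix z
  note LJ1 = line_bundle_jet[OF L1] and LJ2 = line_bundle_jet[OF L2] and LP = line_bundle_line_product[OF L1 L2]
  note sec2 = pull1_section[OF LJ1 LJ2 sec]
  show "jet_pull L1 L2 (pull1 (jet_line_bundle L1) (jet_line_bundle L2) (linear_section L1 a)) z =
      linear_section (line_product L1 L2) c z"
  proof (cases "z \<in> pts (jet_bundle (line_product L1 L2))")
    case True
    note w = jet_product_map_pts[OF L1 L2 True]
    have p: "fst z \<in> pts (base_product L1 L2)" using jet_ptsD(1)[OF LP True] by (simp add: line_product_simps)
    note wp = base_product_pts[OF LJ1 LJ2 w, unfolded jet_line_bundle_simps]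
    note lf = section_in_fib[OF LJ1 sec wp(1)[folded jet_line_bundle_simps(1)]]
    have ap: "pull1 (jet_line_bundle L1) (jet_line_bundle L2) (linear_section L1 a) (jet_product_map L1 L2 z) =
        snd z (der_at c (fst z))"
      using pull1_apply[of _ _ "jet_product_map L1 L2 z" "linear_section L1 a", OF LJ1 LJ2 w lf] wp(1) a[OF base_product_pts(1)[OF L1 L2 p]] c[OF p]
      by (simp add: linear_section_apply[OF L1] jet_product_map_apply[OF L1 L2] cong: if_cong)
    then show ?thesis using True by (simp add: jet_pull_apply(1)[OF sec2] linear_section_apply[OF LP])
  qed (simp add: jet_pull_apply(1)[OF sec2] linear_section_apply[OF LP])
qed

lemma der_at_lift2:
  assumes z: "z \<in> pts (base_product L1 L2)" and a: "der_at a (fst (snd z)) \<in> der_fibre L2 (fst (snd z))"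
  shows "der_at (lift2 L1 L2 a) z = der_pair L1 L2 z (\<lambda>s. 0) (der_at a (fst (snd z)))"
    "der_at (lift2 L1 L2 a) z \<in> der_fibre (line_product L1 L2) z"
    "der1 L1 L2 z (der_at (lift2 L1 L2 a) z) = (\<lambda>s. 0)" "der2 L1 L2 z (der_at (lift2 L1 L2 a) z) = der_at a (fst (snd z))"
proof -
  note sp = der_pair_spec[OF L1 L2 z zero_der1[OF z] a]
  have "zero_off (sections (line_product L1 L2)) (der_pair L1 L2 z (\<lambda>s. 0) (der_at a (fst (snd z))))"
    using sp(1) unfolding der_fibre_def by blast
  then show eq: "der_at (lift2 L1 L2 a) z = der_pair L1 L2 z (\<lambda>s. 0) (der_at a (fst (snd z)))"
    using z by (auto simp: der_at_def lift2_def zero_off_def)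
  show "der_at (lift2 L1 L2 a) z \<in> der_fibre (line_product L1 L2) z"
    "der1 L1 L2 z (der_at (lift2 L1 L2 a) z) = (\<lambda>s. 0)" "der2 L1 L2 z (der_at (lift2 L1 L2 a) z) = der_at a (fst (snd z))"
    unfolding eq by (fact sp)+
qed

lemma smooth_der_lift2:
  assumes a: "smooth_der L2 a"
  shows "smooth_der (line_product L1 L2) (lift2 L1 L2 a)"
  unfolding smooth_der_def
proof (intro conjI allI impI ballI, unfold line_product_simps)
  show "lift2 L1 L2 a s = (\<lambda>x. 0)" if "s \<notin> sections (line_product L1 L2)" for s using that by (auto simp: lift2_def)
  show "lift2 L1 L2 a s z = 0" if "z \<notin> pts (base_product L1 L2)" for s z using that by (simp add: lift2_def)
  fix z assume z: "z \<in> pts (base_product L1 L2)"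
  note P = premanifold_base_product[OF L1 L2] and pt = base_product_pts[OF L1 L2 z]
  obtain A2 \<phi>2 U2 h2 S E C where c: "der_coords L2 a A2 \<phi>2 U2 h2 S E C" "fst (snd z) \<in> S"
    using a pt(2) unfolding smooth_der_def by blast
  note d = der_coordsD[OF c(1)]
  obtain A1 \<phi>1 where A1: "(A1, \<phi>1) \<in> atlas (base L1)" "fst z \<in> A1" using chart_cover[OF base_premanifold[OF L1] pt(1)] by blast
  obtain U1 h1 where U1: "(U1, h1) \<in> trivs L1" "fst z \<in> U1" using triv_cover[OF L1 pt(1)] by blast
  have A2: "(A2, \<phi>2) \<in> atlas (base L2)" "fst (snd z) \<in> A2" and U2: "(U2, h2) \<in> trivs L2" "fst (snd z) \<in> U2"
    using d c(2) by blast+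
  let ?D = "fibre_isos L1 L2 (A1 \<inter> U1) (A2 \<inter> U2)" and ?t = "fibre_coord L1 h1 h2"
  let ?S = "?D \<inter> {y \<in> pts (base_product L1 L2). fst (snd y) \<in> S}"
  note D = base_product_atlasI[OF L1 L2 A1(1) U1(1) A2(1) U2(1)]
  have oS: "openin (mfd_topology (base_product L1 L2)) ?S"
    using openin_chart[OF P D] openin_proj2[OF L1 L2 d(3)] by blast
  have zS: "z \<in> ?S" using z c(2) pt A1 A2 U1 U2 by (auto intro!: fibre_isosI)
  note pp = product_point[OF L1 L2 A1(1) U1(1) A2(1) U2(1)]
  \<comment> \<open>Here \<open>der_pair_frame\<close> is used with \<open>e1 = 0\<close> and
    \<open>c1 = 0\<close>: the zeroth-order part vanishes and the component along the fibre
    coordinate is \<open>- t * C\<close>.\<close>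
  have "der_coords (line_product L1 L2) (lift2 L1 L2 a) ?D (product_chart L1 \<phi>1 h1 \<phi>2 h2)
      {z \<in> pts (base_product L1 L2). fst z \<in> U1} (\<lambda>z. h1 (fst z)) ?S (\<lambda>z. (0, E (fst (snd z)), - (fibre_coord L1 h1 h2 z * C (fst (snd z))))) (\<lambda>z. 0)"
    unfolding der_coords_def line_product_simps
  proof (intro conjI ballI D line_product_trivI[OF L1 L2 U1(1)] oS)
    show "?S \<subseteq> ?D \<inter> {z \<in> pts (base_product L1 L2). fst z \<in> U1}" using pp(7) by blast
    fix y assume y: "y \<in> ?S"
    then have yD: "y \<in> ?D" and yS: "fst (snd y) \<in> S" and yp: "y \<in> pts (base_product L1 L2)" by blast+
    note E = sm_at_proj2[OF L1 L2 yp d(6)[OF yS]] and C = sm_at_proj2[OF L1 L2 yp d(7)[OF yS]]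
    note t = sm_at_fibre_coord[OF L1 L2 yp U1(1) U2(1) pp(3)[OF yD] pp(5)[OF yD]]
    show "sm_at (base_product L1 L2) (\<lambda>z. (0, E (fst (snd z)), - (fibre_coord L1 h1 h2 z * C (fst (snd z))))) y" "sm_at (base_product L1 L2) (\<lambda>z. 0) y"
      by (intro sm_at_Pair[OF P] sm_at_mult[OF P] sm_at_uminus[OF P] sm_at_const[OF P yp] E C t)+
    have fr: "der_at a (fst (snd y)) = der_frame L2 A2 \<phi>2 h2 (fst (snd y)) (E (fst (snd y)), C (fst (snd y)))" by (rule d(8)[OF yS])
    have zf: "(\<lambda>s. 0) = der_frame L1 A1 \<phi>1 h1 (fst y) (0, 0)"
      using der_frame_zero[OF L1 A1(1) _ U1(1), of "fst y"] pp(2)[OF yD] pp(3)[OF yD] by simp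
    show "der_at (lift2 L1 L2 a) y = product_frame L1 L2 A1 \<phi>1 U1 h1 A2 \<phi>2 U2 h2 y ((\<lambda>z. (0, E (fst (snd z)), - (fibre_coord L1 h1 h2 z * C (fst (snd z))))) y, (\<lambda>z. 0) y)"
      unfolding der_at_lift2(1)[OF yp smooth_der_fibre[OF L2 a base_product_pts(2)[OF L1 L2 yp]]] fr zf der_pair_frame[OF L1 L2 A1(1) U1(1) A2(1) U2(1) yD]
      by simp
  qed
  then show "\<exists>A \<phi> U h S E C. der_coords (line_product L1 L2) (lift2 L1 L2 a) A \<phi> U h S E C \<and> z \<in> S" using zS by blast
qed

lemma jet_pull_basic2:
  assumes s: "s \<in> sections L2"
  shows "jet_pull L1 L2 (pull2 (jet_line_bundle L1) (jet_line_bundle L2) (basic_section L2 s)) =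
    basic_section (line_product L1 L2) (pull2 L1 L2 s)"
proof
  fix z
  note LJ1 = line_bundle_jet[OF L1] and LJ2 = line_bundle_jet[OF L2] and LP = line_bundle_line_product[OF L1 L2]
  note sec = pull2_section[OF LJ1 LJ2 basic_section_section[OF L2 s]]
  show "jet_pull L1 L2 (pull2 (jet_line_bundle L1) (jet_line_bundle L2) (basic_section L2 s)) z =
      basic_section (line_product L1 L2) (pull2 L1 L2 s) z"
  proof (cases "z \<in> pts (jet_bundle (line_product L1 L2))")
    case True
    note w = jet_product_map_pts[OF L1 L2 True]
    have p: "fst z \<in> pts (base_product L1 L2)" using jet_ptsD(1)[OF LP True] by (simp add: line_product_simps)
    note wp = base_product_pts[OF LJ1 LJ2 w, unfolded jet_line_bundle_simps]
    note bf = section_in_fib[OF LJ2 basic_section_section[OF L2 s] wp(2)[folded jet_line_bundle_simps(1)]]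
    have "pull2 (jet_line_bundle L1) (jet_line_bundle L2) (basic_section L2 s) (jet_product_map L1 L2 z) = pull2 L1 L2 s (fst z)"
      (is "?u = ?v")
    proof (rule inj_onD[OF linear_iso_betwD(5)[OF base_product_pts(4)[OF L1 L2 p]]])
      note q = pull2_apply[of _ _ "jet_product_map L1 L2 z" "basic_section L2 s", OF LJ1 LJ2 w bf]
      note q' = pull2_apply[of _ _ "fst z" s, OF L1 L2 p section_in_fib[OF L2 s base_product_pts(2)[OF L1 L2 p]]]
      show "?u \<in> fib L1 (fst (fst z))" using q(1) by (simp add: jet_line_bundle_simps jet_product_map_apply[OF L1 L2])
      show "?v \<in> fib L1 (fst (fst z))" by (rule q'(1))
      have "snd (snd (jet_product_map L1 L2 z)) = snd (snd (fst z))" "fst (fst (snd (jet_product_map L1 L2 z))) = fst (snd (fst z))"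
        by (simp_all add: jet_product_map_apply[OF L1 L2])
      then show "snd (snd (fst z)) ?u = snd (snd (fst z)) ?v"
        using q(2) q'(2) wp(2) by (simp add: basic_section_apply[OF L2 s])
    qed
    then show ?thesis using True by (simp add: jet_pull_apply(1)[OF sec] basic_section_apply[OF LP pull2_section[OF L1 L2 s]])
  qed (simp add: jet_pull_apply(1)[OF sec] basic_section_apply[OF LP pull2_section[OF L1 L2 s]])
qed

text \<open>As for the first factor, except that the second jet takes values in the fibre of
  \<open>L2\<close>; the two sides are compared after applying the fibre isomorphism.\<close>

lemma jet_pull_linear2:
  assumes sec: "linear_section L2 a \<in> sections (jet_line_bundle L2)"
    and a: "\<And>x. x \<in> pts (base L2) \<Longrightarrow> der_at a x \<in> der_fibre L2 x"
    and c: "\<And>z. z \<in> pts (base_product L1 L2) \<Longrightarrow> der_at c z = der_pair L1 L2 z (\<lambda>s. 0) (der_at a (fst (snd z)))"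
  shows "jet_pull L1 L2 (pull2 (jet_line_bundle L1) (jet_line_bundle L2) (linear_section L2 a)) =
    linear_section (line_product L1 L2) c"
proof
  fix z
  note LJ1 = line_bundle_jet[OF L1] and LJ2 = line_bundle_jet[OF L2] and LP = line_bundle_line_product[OF L1 L2]
  note sec2 = pull2_section[OF LJ1 LJ2 sec]
  show "jet_pull L1 L2 (pull2 (jet_line_bundle L1) (jet_line_bundle L2) (linear_section L2 a)) z =
      linear_section (line_product L1 L2) c z"
  proof (cases "z \<in> pts (jet_bundle (line_product L1 L2))")
    case True
    note w = jet_product_map_pts[OF L1 L2 True]
    have p: "fst z \<in> pts (base_product L1 L2)" using jet_ptsD(1)[OF LP True] by (simp add: line_product_simps)
    note wp = base_product_pts[OF LJ1 LJ2 w, unfolded jet_line_bundle_simps]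
    note lf = section_in_fib[OF LJ2 sec wp(2)[folded jet_line_bundle_simps(1)]]
    have ap: "pull2 (jet_line_bundle L1) (jet_line_bundle L2) (linear_section L2 a) (jet_product_map L1 L2 z) =
        snd z (der_at c (fst z))"
      (is "?u = ?v")
    proof (rule inj_onD[OF linear_iso_betwD(5)[OF base_product_pts(4)[OF L1 L2 p]]])
      note q = pull2_apply[of _ _ "jet_product_map L1 L2 z" "linear_section L2 a", OF LJ1 LJ2 w lf]
      note ad = a[OF base_product_pts(2)[OF L1 L2 p]]
      show "?u \<in> fib L1 (fst (fst z))" using q(1) by (simp add: jet_line_bundle_simps jet_product_map_apply[OF L1 L2])
      have "der_at c (fst z) \<in> der_fibre (line_product L1 L2) (fst z)"
        unfolding c[OF p] by (rule der_pair_spec(1)[OF L1 L2 p zero_der1[OF p] ad])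
      then show "?v \<in> fib L1 (fst (fst z))"
        using jet_fibre_fib[OF jet_ptsD(2)[OF LP True]] by (simp add: line_product_simps)
      have "snd (snd (jet_product_map L1 L2 z)) = snd (snd (fst z))" by (simp add: jet_product_map_apply[OF L1 L2])
      moreover have "linear_section L2 a (fst (snd (jet_product_map L1 L2 z))) = snd (snd (fst z)) (snd z (der_at c (fst z)))"
        using wp(2) ad unfolding c[OF p] by (simp add: linear_section_apply[OF L2] jet_product_map_apply[OF L1 L2] cong: if_cong)
      ultimately show "snd (snd (fst z)) ?u = snd (snd (fst z)) ?v" using q(2) by simp
    qed
    then show ?thesis using True by (simp add: jet_pull_apply(1)[OF sec2] linear_section_apply[OF LP])
  qed (simp add: jet_pull_apply(1)[OF sec2] linear_section_apply[OF LP])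
qed

text \<open>Both equations restate the two der images of the lift, which are \<open>a\<close> and
  zero, as actions on pulled-back sections.\<close>

lemma lift1_pull:
  assumes a: "smooth_der L1 a"
  shows "s \<in> sections L1 \<Longrightarrow> lift1 L1 L2 a (pull1 L1 L2 s) = pull1 L1 L2 (a s)"
    "s' \<in> sections L2 \<Longrightarrow> lift1 L1 L2 a (pull2 L1 L2 s') = (\<lambda>z. 0)"
proof -
  have off: "lift1 L1 L2 a r z = 0" if "z \<notin> pts (base_product L1 L2)" for r z using that by (simp add: lift1_def)
  show "lift1 L1 L2 a (pull1 L1 L2 s) = pull1 L1 L2 (a s)" if s: "s \<in> sections L1"
  proof
    fix z
    show "lift1 L1 L2 a (pull1 L1 L2 s) z = pull1 L1 L2 (a s) z"
    proof (cases "z \<in> pts (base_product L1 L2)")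
      case True
      note dl = der_at_lift1[OF True smooth_der_fibre[OF L1 a base_product_pts(1)[OF L1 L2 True]]]
      have "der1 L1 L2 z (der_at (lift1 L1 L2 a) z) s = der_at a (fst z) s" by (simp add: dl(3))
      then have "lift1 L1 L2 a (pull1 L1 L2 s) z = a s (fst z)" using s by (simp add: der_map_def fibre_map_proj der_at_def)
      then show ?thesis
        using pull1_apply[of _ _ z "a s", OF L1 L2 True section_in_fib[OF L1 derivationsD(1)[OF L1 smooth_der_derivation[OF L1 a] s] base_product_pts(1)[OF L1 L2 True]]]
        by simp
    qed (simp add: off pull_section_off line_product_simps)
  qed
  show "lift1 L1 L2 a (pull2 L1 L2 s') = (\<lambda>z. 0)" if s: "s' \<in> sections L2"
  proof
    fix z
    show "lift1 L1 L2 a (pull2 L1 L2 s') z = 0"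
    proof (cases "z \<in> pts (base_product L1 L2)")
      case True
      note dl = der_at_lift1[OF True smooth_der_fibre[OF L1 a base_product_pts(1)[OF L1 L2 True]]]
      have "der_at (lift1 L1 L2 a) z (pull2 L1 L2 s') = 0"
        by (rule der2_apply_eq_0[OF True dl(2) s])
           (simp_all add: dl(4) proj2_zero[OF True] subspace_0[OF fib_subspace[OF L1 base_product_pts(1)[OF L1 L2 True]]])
      then show ?thesis by (simp add: der_at_def)
    qed (simp add: off)
  qed
qed

lemma lift2_pull:
  assumes a: "smooth_der L2 a"
  shows "s \<in> sections L1 \<Longrightarrow> lift2 L1 L2 a (pull1 L1 L2 s) = (\<lambda>z. 0)"
    "s' \<in> sections L2 \<Longrightarrow> lift2 L1 L2 a (pull2 L1 L2 s') = pull2 L1 L2 (a s')"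
proof -
  have off: "lift2 L1 L2 a r z = 0" if "z \<notin> pts (base_product L1 L2)" for r z using that by (simp add: lift2_def)
  show "lift2 L1 L2 a (pull1 L1 L2 s) = (\<lambda>z. 0)" if s: "s \<in> sections L1"
  proof
    fix z
    show "lift2 L1 L2 a (pull1 L1 L2 s) z = 0"
    proof (cases "z \<in> pts (base_product L1 L2)")
      case True
      note dl = der_at_lift2[OF True smooth_der_fibre[OF L2 a base_product_pts(2)[OF L1 L2 True]]]
      have "der1 L1 L2 z (der_at (lift2 L1 L2 a) z) s = 0" by (simp add: dl(3))
      then show ?thesis using s by (simp add: der_map_def fibre_map_proj der_at_def)
    qed (simp add: off)
  qed
  show "lift2 L1 L2 a (pull2 L1 L2 s') = pull2 L1 L2 (a s')" if s: "s' \<in> sections L2"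
  proof
    fix z
    show "lift2 L1 L2 a (pull2 L1 L2 s') z = pull2 L1 L2 (a s') z"
    proof (cases "z \<in> pts (base_product L1 L2)")
      case True
      note dl = der_at_lift2[OF True smooth_der_fibre[OF L2 a base_product_pts(2)[OF L1 L2 True]]]
      note p = pull2_apply[of _ _ z "a s'", OF L1 L2 True section_in_fib[OF L2 derivationsD(1)[OF L2 smooth_der_derivation[OF L2 a] s] base_product_pts(2)[OF L1 L2 True]]]
      have "der_at (lift2 L1 L2 a) z (pull2 L1 L2 s') = pull2 L1 L2 (a s') z"
        by (rule der2_apply_eq_0[OF True dl(2) s _ p(1)]) (simp only: dl(4) p(2), simp add: der_at_def)
      then show ?thesis by (simp add: der_at_def)
    qed (simp add: off pull_section_off line_product_simps)
  qed
qed

text \<open>An element of the der fibre of the line product is known from its action on pull-backs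
  from the two factors. There a lift acts as the given derivation or as zero, so the commutators can
  be computed in the factors.\<close>

lemma lift_commutator:
  assumes z: "z \<in> pts (base_product L1 L2)"
  shows "smooth_der L1 a \<Longrightarrow> smooth_der L1 b \<Longrightarrow>
      der_at (commutator (lift1 L1 L2 a) (lift1 L1 L2 b)) z = der_pair L1 L2 z (der_at (commutator a b) (fst z)) (\<lambda>s. 0)"
    "smooth_der L2 a' \<Longrightarrow> smooth_der L2 b' \<Longrightarrow>
      der_at (commutator (lift2 L1 L2 a') (lift2 L1 L2 b')) z = der_pair L1 L2 z (\<lambda>s. 0) (der_at (commutator a' b') (fst (snd z)))"
    "smooth_der L1 a \<Longrightarrow> smooth_der L2 b' \<Longrightarrow>
      der_at (commutator (lift1 L1 L2 a) (lift2 L1 L2 b')) z = (\<lambda>s. 0)"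
proof -
  note LP = line_bundle_line_product[OF L1 L2]
  have zp: "z \<in> pts (base (line_product L1 L2))" using z by (simp add: line_product_simps)
  note cf = commutator_der_fibre[OF LP _ _ zp]
  note der = smooth_der_derivation[OF LP]
  have zero_sec: "a (\<lambda>z. 0) = (\<lambda>z. 0)" if "smooth_der (line_product L1 L2) a" for a
    by (rule derivationsD(5)[OF LP der[OF that]])
  have p1: "pull1 L1 L2 r z = r (fst z)" if "r \<in> sections L1" for r
    by (rule pull1_apply[of _ _ z r, OF L1 L2 z section_in_fib[OF L1 that base_product_pts(1)[OF L1 L2 z]]])
  have p2: "snd (snd z) (pull2 L1 L2 r z) = r (fst (snd z))" "pull2 L1 L2 r z \<in> fib L1 (fst z)" if "r \<in> sections L2" for r
    using pull2_apply[of _ _ z r, OF L1 L2 z section_in_fib[OF L2 that base_product_pts(2)[OF L1 L2 z]]] by blast+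
  note iso = linear_iso_betwD[OF base_product_pts(4)[OF L1 L2 z]]
  have diff: "snd (snd z) (u - v) = snd (snd z) u - snd (snd z) v" if "u \<in> fib L1 (fst z)" "v \<in> fib L1 (fst z)" for u v
    using iso(2)[OF that(1) subspace_scale[OF fib_subspace[OF L1 base_product_pts(1)[OF L1 L2 z]] that(2), of "-1"]] iso(3)[OF that(2), of "-1"]
    by simp
  show "der_at (commutator (lift1 L1 L2 a) (lift1 L1 L2 b)) z = der_pair L1 L2 z (der_at (commutator a b) (fst z)) (\<lambda>s. 0)"
    if a: "smooth_der L1 a" and b: "smooth_der L1 b"
  proof -
    note da = derivationsD[OF L1 smooth_der_derivation[OF L1 a]] and db = derivationsD[OF L1 smooth_der_derivation[OF L1 b]]
    note la = smooth_der_lift1[OF a] and lb = smooth_der_lift1[OF b]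
    let ?c = "der_at (commutator (lift1 L1 L2 a) (lift1 L1 L2 b)) z"
    have "der1 L1 L2 z ?c = der_at (commutator a b) (fst z)"
      by (rule ext) (simp add: der_map_def fibre_map_proj der_at_def commutator_def lift1_pull(1)[OF a] lift1_pull(1)[OF b] p1 da db)
    moreover have "der2 L1 L2 z ?c = (\<lambda>s. 0)"
      by (rule ext) (simp add: der_map_def fibre_map_proj der_at_def commutator_def lift1_pull(2)[OF a] lift1_pull(2)[OF b]
          zero_sec[OF la] zero_sec[OF lb] proj2_zero[OF z])
    ultimately show ?thesis using der_pair_der_map[OF L1 L2 z cf[OF der[OF la] der[OF lb]]] by simp
  qed
  show "der_at (commutator (lift2 L1 L2 a') (lift2 L1 L2 b')) z = der_pair L1 L2 z (\<lambda>s. 0) (der_at (commutator a' b') (fst (snd z)))"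
    if a: "smooth_der L2 a'" and b: "smooth_der L2 b'"
  proof -
    note da = derivationsD[OF L2 smooth_der_derivation[OF L2 a]] and db = derivationsD[OF L2 smooth_der_derivation[OF L2 b]]
    note la = smooth_der_lift2[OF a] and lb = smooth_der_lift2[OF b]
    let ?c = "der_at (commutator (lift2 L1 L2 a') (lift2 L1 L2 b')) z"
    have "der1 L1 L2 z ?c = (\<lambda>s. 0)"
      by (rule ext) (simp add: der_map_def fibre_map_proj der_at_def commutator_def lift2_pull(1)[OF a] lift2_pull(1)[OF b]
          zero_sec[OF la] zero_sec[OF lb])
    moreover have "der2 L1 L2 z ?c = der_at (commutator a' b') (fst (snd z))"
      by (rule ext) (simp add: der_map_def fibre_map_proj der_at_def commutator_def lift2_pull(2)[OF a] lift2_pull(2)[OF b] p2 diff da db)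
    ultimately show ?thesis using der_pair_der_map[OF L1 L2 z cf[OF der[OF la] der[OF lb]]] by simp
  qed
  show "der_at (commutator (lift1 L1 L2 a) (lift2 L1 L2 b')) z = (\<lambda>s. 0)"
    if a: "smooth_der L1 a" and b: "smooth_der L2 b'"
  proof -
    note da = derivationsD[OF L1 smooth_der_derivation[OF L1 a]] and db = derivationsD[OF L2 smooth_der_derivation[OF L2 b]]
    note la = smooth_der_lift1[OF a] and lb = smooth_der_lift2[OF b]
    let ?c = "der_at (commutator (lift1 L1 L2 a) (lift2 L1 L2 b')) z"
    have "der1 L1 L2 z ?c = der1 L1 L2 z (\<lambda>s. 0)"
      by (rule ext) (simp add: der_map_def fibre_map_proj der_at_def commutator_def lift1_pull(1)[OF a] lift2_pull(1)[OF b]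
          zero_sec[OF la] zero_sec[OF lb] da)
    moreover have "der2 L1 L2 z ?c = der2 L1 L2 z (\<lambda>s. 0)"
      by (rule ext) (simp add: der_map_def fibre_map_proj der_at_def commutator_def lift1_pull(2)[OF a] lift2_pull(2)[OF b]
          zero_sec[OF la] zero_sec[OF lb] db)
    ultimately show ?thesis
      by (rule der_product_eqI[OF L1 L2 z cf[OF der[OF la] der[OF lb]] zero_der_fibre[OF L1 L2 LP zp]])
  qed
qed

text \<open>The two der maps carry \<open>\<Lambda>\<close> to the der fibres over the two jet
  bundles, where vanishing on basic and linear sections is decisive; a der element with both images
  zero is zero.\<close>

lemma jet_product_der_fibre_eq_0:
  assumes y: "y \<in> pts (base_product (jet_line_bundle L1) (jet_line_bundle L2))"
    and \<Lambda>: "\<Lambda> \<in> der_fibre (line_product (jet_line_bundle L1) (jet_line_bundle L2)) y"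
    and 1: "\<And>s. s \<in> sections L1 \<Longrightarrow> \<Lambda> (pull1 (jet_line_bundle L1) (jet_line_bundle L2) (basic_section L1 s)) = 0"
      "\<And>a. smooth_der L1 a \<Longrightarrow> \<Lambda> (pull1 (jet_line_bundle L1) (jet_line_bundle L2) (linear_section L1 a)) = 0"
    and 2: "\<And>s. s \<in> sections L2 \<Longrightarrow> \<Lambda> (pull2 (jet_line_bundle L1) (jet_line_bundle L2) (basic_section L2 s)) = 0"
      "\<And>a. smooth_der L2 a \<Longrightarrow> \<Lambda> (pull2 (jet_line_bundle L1) (jet_line_bundle L2) (linear_section L2 a)) = 0"
  shows "\<Lambda> = (\<lambda>s. 0)"
proof -
  let ?J1 = "jet_line_bundle L1" and ?J2 = "jet_line_bundle L2"
  note LJ1 = line_bundle_jet[OF L1] and LJ2 = line_bundle_jet[OF L2]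
  note LT = line_bundle_line_product[OF LJ1 LJ2]
  note yp = base_product_pts[OF LJ1 LJ2 y]
  have yT: "y \<in> pts (base (line_product ?J1 ?J2))" using y by (simp add: line_product_simps)
  have b0: "snd (snd y) 0 = 0"
    using linear_iso_betwD(3)[OF yp(4), of 0 0] subspace_0[OF fib_subspace[OF LJ1 yp(1)]] by simp
  have "der1 ?J1 ?J2 y \<Lambda> = (\<lambda>s. 0)"
  proof (rule jet_der_fibre_eq_0[OF L1 _ der1_der_fibre[OF LJ1 LJ2 y \<Lambda>]])
    show "fst y \<in> pts (jet_bundle L1)" using yp(1) by (simp add: jet_line_bundle_simps)
  qed (use 1 basic_section_section[OF L1] linear_section_section[OF L1] in \<open>simp_all add: der_map_def fibre_map_proj\<close>)
  moreover have "der2 ?J1 ?J2 y \<Lambda> = (\<lambda>s. 0)"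
  proof (rule jet_der_fibre_eq_0[OF L2 _ der2_der_fibre[OF LJ1 LJ2 y \<Lambda>]])
    show "fst (snd y) \<in> pts (jet_bundle L2)" using yp(2) by (simp add: jet_line_bundle_simps)
  qed (use 2 basic_section_section[OF L2] linear_section_section[OF L2] b0 in \<open>simp_all add: der_map_def fibre_map_proj\<close>)
  moreover have "der1 ?J1 ?J2 y (\<lambda>s. 0) = (\<lambda>s. 0)" "der2 ?J1 ?J2 y (\<lambda>s. 0) = (\<lambda>s. 0)"
    by (auto simp: der_map_def fibre_map_proj b0)
  ultimately show ?thesis
    by (intro der_product_eqI[OF LJ1 LJ2 y \<Lambda> zero_der_fibre[OF LJ1 LJ2 LT yT]]) simp_all
qed

text \<open>Pull-back turns linear and basic sections of the factors into linear sections of lifts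
  and basic sections of pull-backs, and lifting respects commutators, so the brackets match on
  these. The general case is an extension by order one in each argument.\<close>

lemma jet_pull_bracket:
  assumes K: "canonical_jacobi (line_product L1 L2) K" and K1: "canonical_jacobi L1 K1" and K2: "canonical_jacobi L2 K2"
    and K12: "product_jacobi (jet_line_bundle L1) K1 (jet_line_bundle L2) K2 K12"
    and s: "s \<in> sections (line_product (jet_line_bundle L1) (jet_line_bundle L2))"
    and r: "r \<in> sections (line_product (jet_line_bundle L1) (jet_line_bundle L2))"
  shows "jet_pull L1 L2 (K12 s r) = K (jet_pull L1 L2 s) (jet_pull L1 L2 r)"
proof -
  let ?L = "line_product L1 L2" and ?J1 = "jet_line_bundle L1" and ?J2 = "jet_line_bundle L2"
  let ?J = "jet_line_bundle ?L" and ?T = "line_product ?J1 ?J2"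
  let ?w = "jet_product_map L1 L2" and ?P = "jet_pull L1 L2"
  note LP = line_bundle_line_product[OF L1 L2] and LJ1 = line_bundle_jet[OF L1] and LJ2 = line_bundle_jet[OF L2]
  note LJ = line_bundle_jet[OF LP] and LT = line_bundle_line_product[OF LJ1 LJ2]
  note MJ = premanifold_jet_bundle[OF LP] and MT = premanifold_base_product[OF LJ1 LJ2]
  have JK: "jacobi_structure ?J K" using K unfolding canonical_jacobi_def by blast
  have JT: "jacobi_structure ?T K12" using K12 unfolding product_jacobi_def Let_def by blast
  have T11: "K12 (pull1 ?J1 ?J2 f) (pull1 ?J1 ?J2 f') = pull1 ?J1 ?J2 (K1 f f')" if "f \<in> sections ?J1" "f' \<in> sections ?J1" for f f'
    using K12 that unfolding product_jacobi_def Let_def by blast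
  have T22: "K12 (pull2 ?J1 ?J2 f) (pull2 ?J1 ?J2 f') = pull2 ?J1 ?J2 (K2 f f')" if "f \<in> sections ?J2" "f' \<in> sections ?J2" for f f'
    using K12 that unfolding product_jacobi_def Let_def by blast
  have T12: "K12 (pull1 ?J1 ?J2 f) (pull2 ?J1 ?J2 f') = (\<lambda>z. 0)" if "f \<in> sections ?J1" "f' \<in> sections ?J2" for f f'
    using K12 that unfolding product_jacobi_def Let_def by blast
  have can: "K' (linear_section M a) (linear_section M b) = linear_section M (commutator a b)"
      "K' (linear_section M a) (basic_section M s) = basic_section M (a s)"
      "K' (basic_section M s) (basic_section M r) = (\<lambda>z. 0)"
    if "canonical_jacobi M K'" "a \<in> derivations M" "b \<in> derivations M" "s \<in> sections M" "r \<in> sections M"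
    for M :: "('x, 'y::real_vector, 'z::real_inner) line_bundle" and K' a b s r
    using that unfolding canonical_jacobi_def by blast+
  note sd1 = smooth_der_derivation[OF L1] and sd2 = smooth_der_derivation[OF L2] and sd = smooth_der_derivation[OF LP]
  note l1 = smooth_der_lift1 and l2 = smooth_der_lift2
  note bs1 = basic_section_section[OF L1] and bs2 = basic_section_section[OF L2] and bs = basic_section_section[OF LP]
  note ls1 = linear_section_section[OF L1] and ls2 = linear_section_section[OF L2] and ls = linear_section_section[OF LP]
  note P1 = pull1_section[OF LJ1 LJ2] and P2 = pull2_section[OF LJ1 LJ2]
  note pl1 = pull1_section[OF L1 L2] and pl2 = pull2_section[OF L1 L2]
  have PL1: "?P (pull1 ?J1 ?J2 (linear_section L1 a)) = linear_section ?L (lift1 L1 L2 a)" if a: "smooth_der L1 a" for a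
    by (rule jet_pull_linear1[OF ls1[OF a]])
       (assumption | rule der_at_lift1(1) smooth_der_fibre[OF L1 a] base_product_pts(1)[OF L1 L2])+
  have PL2: "?P (pull2 ?J1 ?J2 (linear_section L2 a)) = linear_section ?L (lift2 L1 L2 a)" if a: "smooth_der L2 a" for a
    by (rule jet_pull_linear2[OF ls2[OF a]])
       (assumption | rule der_at_lift2(1) smooth_der_fibre[OF L2 a] base_product_pts(2)[OF L1 L2])+
  note PB1 = jet_pull_basic1 and PB2 = jet_pull_basic2
  have P0: "?P (\<lambda>z. 0) = (\<lambda>z. 0)" using jet_pull_apply(1)[OF section_zero[OF LT]] by auto
  have lin0: "linear_section ?L c = (\<lambda>z. 0)" if "\<And>p. p \<in> pts (base_product L1 L2) \<Longrightarrow> der_at c p = (\<lambda>s. 0)" for c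
  proof
    fix z
    show "linear_section ?L c z = 0"
    proof (cases "z \<in> pts (jet_bundle ?L)")
      case True
      then have p: "fst z \<in> pts (base_product L1 L2)" using jet_ptsD(1)[OF LP True] by (simp add: line_product_simps)
      obtain A \<phi> U h where c: "(A, \<phi>) \<in> atlas (base ?L)" "fst z \<in> A" "(U, h) \<in> trivs ?L" "fst z \<in> U"
        "z \<in> Sigma (A \<inter> U) (jet_fibre ?L)" by (rule jet_atlas_cover[OF LP True])
      have z0: "(\<lambda>s. 0) \<in> der_fibre ?L (fst z)" using zero_der_fibre[OF L1 L2 LP jet_ptsD(1)[OF LP True]] .
      have "\<forall>k. \<forall>a\<in>der_fibre ?L (fst z). snd z (\<lambda>s. k *\<^sub>R a s) = k *\<^sub>R snd z a"
        using jet_ptsD(2)[OF LP True] unfolding jet_fibre_def by blast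
      from bspec[OF spec[OF this, of 0] z0] have "snd z (\<lambda>s. 0) = 0" by simp
      then show ?thesis using that[OF p] by (simp add: linear_section_apply[OF LP])
    qed (simp add: linear_section_apply[OF LP])
  qed
  have bas0: "basic_section ?L (\<lambda>z. 0) = (\<lambda>z. 0)" using basic_section_apply[OF LP section_zero[OF LP]] by auto
  have pull10: "pull1 ?J1 ?J2 (\<lambda>z. 0) = (\<lambda>z. 0)"
  proof
    show "pull1 ?J1 ?J2 (\<lambda>z. 0) y = 0" for y
      using pull1_apply[of _ _ y "\<lambda>z. 0", OF LJ1 LJ2] subspace_0[OF fib_subspace[OF LJ1 base_product_pts(1)[OF LJ1 LJ2]]]
        pull_section_off[of y ?T] by (cases "y \<in> pts (base_product ?J1 ?J2)") (auto simp: line_product_simps)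
  qed
  have pull20: "pull2 ?J1 ?J2 (\<lambda>z. 0) = (\<lambda>z. 0)"
  proof
    fix y show "pull2 ?J1 ?J2 (\<lambda>z. 0) y = 0"
    proof (cases "y \<in> pts (base_product ?J1 ?J2)")
      case True
      note q = base_product_pts[OF LJ1 LJ2 True]
      note z0 = subspace_0[OF fib_subspace[OF LJ1 q(1)]] subspace_0[OF fib_subspace[OF LJ2 q(2)]]
      note p = pull2_apply[of _ _ y "\<lambda>z. 0", OF LJ1 LJ2 True z0(2)]
      have "snd (snd y) 0 = 0" using linear_iso_betwD(3)[OF q(4) z0(1), of 0] by simp
      then show ?thesis using inj_onD[OF linear_iso_betwD(5)[OF q(4)], of "pull2 ?J1 ?J2 (\<lambda>z. 0) y" 0] p z0(1) by simp
    qed (simp add: pull_section_off line_product_simps)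
  qed
  text \<open>The defect of the claim; it vanishes on the generating sections and is of order one in each argument.\<close>
  define D where "D s r z = K12 s r (?w z) - K (?P s) (?P r) z" for s r z
  have D0: "D s r z = 0" if "?P (K12 s r) = K (?P s) (?P r)" "s \<in> sections ?T" "r \<in> sections ?T" "z \<in> pts (jet_bundle ?L)" for s r z
    using fun_cong[OF that(1), of z] jet_pull_apply(1)[OF jacobi_section[OF LT JT that(2,3)]] that(4) by (simp add: D_def)
  have Danti: "D r s z = - D s r z" if "s \<in> sections ?T" "r \<in> sections ?T" for s r z
    using jacobi_antisym[OF LT JT that] jacobi_antisym[OF LJ JK jet_pull_apply(2)[OF that(1)] jet_pull_apply(2)[OF that(2)]]
    by (simp add: D_def)
  \<comment> \<open>On pairs of these sections the canonical structures and the product rule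
    determine \<open>K12\<close>; on their pull-backs the canonical rules determine
    \<open>K\<close>.\<close>
  define G where "G = {pull1 ?J1 ?J2 (linear_section L1 a) | a. smooth_der L1 a} \<union> {pull1 ?J1 ?J2 (basic_section L1 s) | s. s \<in> sections L1} \<union>
    ({pull2 ?J1 ?J2 (linear_section L2 a) | a. smooth_der L2 a} \<union> {pull2 ?J1 ?J2 (basic_section L2 s) | s. s \<in> sections L2})"
  have GT: "f \<in> sections ?T" if "f \<in> G" for f
    using that P1 P2 bs1 bs2 ls1 ls2 unfolding G_def by blast
  have ll1: "?P (K12 (pull1 ?J1 ?J2 (linear_section L1 a)) (pull1 ?J1 ?J2 (linear_section L1 b))) =
      K (?P (pull1 ?J1 ?J2 (linear_section L1 a))) (?P (pull1 ?J1 ?J2 (linear_section L1 b)))"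
    if a: "smooth_der L1 a" and b: "smooth_der L1 b" for a b
  proof -
    have e: "K1 (linear_section L1 a) (linear_section L1 b) = linear_section L1 (commutator a b)"
      by (rule can(1)[OF K1 sd1[OF a] sd1[OF b] section_zero[OF L1] section_zero[OF L1]])
    \<comment> \<open>The commutator has not been shown to be a \<open>smooth_der\<close>. Its
      linear section is nevertheless smooth, being a value of the bracket \<open>K1\<close>.\<close>
    have "linear_section L1 (commutator a b) \<in> sections ?J1"
      using jacobi_section[OF LJ1 _ ls1[OF a] ls1[OF b]] K1 e unfolding canonical_jacobi_def by metis
    then have "?P (pull1 ?J1 ?J2 (linear_section L1 (commutator a b))) =
        linear_section ?L (commutator (lift1 L1 L2 a) (lift1 L1 L2 b))"
      by (rule jet_pull_linear1) (assumption | rule commutator_der_fibre[OF L1 sd1[OF a] sd1[OF b]] lift_commutator(1)[OF _ a b])+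
    then show ?thesis
      unfolding T11[OF ls1[OF a] ls1[OF b]] e PL1[OF a] PL1[OF b]
      using can(1)[OF K sd[OF l1[OF a]] sd[OF l1[OF b]] section_zero[OF LP] section_zero[OF LP]] by simp
  qed
  have ll2: "?P (K12 (pull2 ?J1 ?J2 (linear_section L2 a)) (pull2 ?J1 ?J2 (linear_section L2 b))) =
      K (?P (pull2 ?J1 ?J2 (linear_section L2 a))) (?P (pull2 ?J1 ?J2 (linear_section L2 b)))"
    if a: "smooth_der L2 a" and b: "smooth_der L2 b" for a b
  proof -
    have e: "K2 (linear_section L2 a) (linear_section L2 b) = linear_section L2 (commutator a b)"
      by (rule can(1)[OF K2 sd2[OF a] sd2[OF b] section_zero[OF L2] section_zero[OF L2]])
    have "linear_section L2 (commutator a b) \<in> sections ?J2"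
      using jacobi_section[OF LJ2 _ ls2[OF a] ls2[OF b]] K2 e unfolding canonical_jacobi_def by metis
    then have "?P (pull2 ?J1 ?J2 (linear_section L2 (commutator a b))) =
        linear_section ?L (commutator (lift2 L1 L2 a) (lift2 L1 L2 b))"
      by (rule jet_pull_linear2) (assumption | rule commutator_der_fibre[OF L2 sd2[OF a] sd2[OF b]] lift_commutator(2)[OF _ a b])+
    then show ?thesis
      unfolding T22[OF ls2[OF a] ls2[OF b]] e PL2[OF a] PL2[OF b]
      using can(1)[OF K sd[OF l2[OF a]] sd[OF l2[OF b]] section_zero[OF LP] section_zero[OF LP]] by simp
  qed
  have lb1: "?P (K12 (pull1 ?J1 ?J2 (linear_section L1 a)) (pull1 ?J1 ?J2 (basic_section L1 s))) =
      K (?P (pull1 ?J1 ?J2 (linear_section L1 a))) (?P (pull1 ?J1 ?J2 (basic_section L1 s)))"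
    if a: "smooth_der L1 a" and s: "s \<in> sections L1" for a s
    unfolding T11[OF ls1[OF a] bs1[OF s]] can(2)[OF K1 sd1[OF a] sd1[OF a] s s] PL1[OF a] PB1[OF s]
      PB1[OF derivationsD(1)[OF L1 sd1[OF a] s]] can(2)[OF K sd[OF l1[OF a]] sd[OF l1[OF a]] pl1[OF s] pl1[OF s]] lift1_pull(1)[OF a s] ..
  have lb2: "?P (K12 (pull2 ?J1 ?J2 (linear_section L2 a)) (pull2 ?J1 ?J2 (basic_section L2 s))) =
      K (?P (pull2 ?J1 ?J2 (linear_section L2 a))) (?P (pull2 ?J1 ?J2 (basic_section L2 s)))"
    if a: "smooth_der L2 a" and s: "s \<in> sections L2" for a s
    unfolding T22[OF ls2[OF a] bs2[OF s]] can(2)[OF K2 sd2[OF a] sd2[OF a] s s] PL2[OF a] PB2[OF s]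
      PB2[OF derivationsD(1)[OF L2 sd2[OF a] s]] can(2)[OF K sd[OF l2[OF a]] sd[OF l2[OF a]] pl2[OF s] pl2[OF s]] lift2_pull(2)[OF a s] ..
  \<comment> \<open>The zero derivation fills the derivation arguments of \<open>can\<close> where
    only basic sections are involved.\<close>
  have z1: "(\<lambda>s x. 0) \<in> derivations M" if "line_bundle M" for M :: "('x, 'y::real_vector, 'z::real_inner) line_bundle"
  proof -
    have "(\<lambda>s. 0) \<in> der_fibre M x" if "x \<in> pts (base M)" for x
      using zero_der_fibre[OF L1 L2 \<open>line_bundle M\<close> that] .
    then show ?thesis using section_zero[OF that] by (simp add: derivations_def der_at_def)
  qed
  have bb1: "?P (K12 (pull1 ?J1 ?J2 (basic_section L1 s)) (pull1 ?J1 ?J2 (basic_section L1 r))) =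
      K (?P (pull1 ?J1 ?J2 (basic_section L1 s))) (?P (pull1 ?J1 ?J2 (basic_section L1 r)))"
    if s: "s \<in> sections L1" and r: "r \<in> sections L1" for s r
    unfolding T11[OF bs1[OF s] bs1[OF r]] can(3)[OF K1 z1[OF L1] z1[OF L1] s r] PB1[OF s] PB1[OF r] pull10 P0
      can(3)[OF K z1[OF LP] z1[OF LP] pl1[OF s] pl1[OF r]] ..
  have bb2: "?P (K12 (pull2 ?J1 ?J2 (basic_section L2 s)) (pull2 ?J1 ?J2 (basic_section L2 r))) =
      K (?P (pull2 ?J1 ?J2 (basic_section L2 s))) (?P (pull2 ?J1 ?J2 (basic_section L2 r)))"
    if s: "s \<in> sections L2" and r: "r \<in> sections L2" for s r
    unfolding T22[OF bs2[OF s] bs2[OF r]] can(3)[OF K2 z1[OF L2] z1[OF L2] s r] PB2[OF s] PB2[OF r] pull20 P0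
      can(3)[OF K z1[OF LP] z1[OF LP] pl2[OF s] pl2[OF r]] ..
  have ll12: "?P (K12 (pull1 ?J1 ?J2 (linear_section L1 a)) (pull2 ?J1 ?J2 (linear_section L2 b))) =
      K (?P (pull1 ?J1 ?J2 (linear_section L1 a))) (?P (pull2 ?J1 ?J2 (linear_section L2 b)))"
    if a: "smooth_der L1 a" and b: "smooth_der L2 b" for a b
    unfolding T12[OF ls1[OF a] ls2[OF b]] PL1[OF a] PL2[OF b] P0
      can(1)[OF K sd[OF l1[OF a]] sd[OF l2[OF b]] section_zero[OF LP] section_zero[OF LP]]
    by (rule sym, rule lin0) (rule lift_commutator(3)[OF _ a b])
  have lb12: "?P (K12 (pull1 ?J1 ?J2 (linear_section L1 a)) (pull2 ?J1 ?J2 (basic_section L2 s))) =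
      K (?P (pull1 ?J1 ?J2 (linear_section L1 a))) (?P (pull2 ?J1 ?J2 (basic_section L2 s)))"
    if a: "smooth_der L1 a" and s: "s \<in> sections L2" for a s
    unfolding T12[OF ls1[OF a] bs2[OF s]] PL1[OF a] PB2[OF s] P0
      can(2)[OF K sd[OF l1[OF a]] sd[OF l1[OF a]] pl2[OF s] pl2[OF s]] lift1_pull(2)[OF a s] bas0 ..
  \<comment> \<open>Stated for the defect, as neither this order nor the opposite one is given
    directly on both sides: the product rule is known with the first factor on the left, the
    canonical rule with the linear section on the left. Antisymmetry of \<open>K12\<close> bridges
    the two.\<close>
  have lb21: "D (pull2 ?J1 ?J2 (linear_section L2 a)) (pull1 ?J1 ?J2 (basic_section L1 s)) z = 0"
    if a: "smooth_der L2 a" and s: "s \<in> sections L1" for a s z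
  proof -
    have "K12 (pull2 ?J1 ?J2 (linear_section L2 a)) (pull1 ?J1 ?J2 (basic_section L1 s)) (?w z) = 0"
      using jacobi_antisym[OF LT JT P1[OF bs1[OF s]] P2[OF ls2[OF a]]] T12[OF bs1[OF s] ls2[OF a]] by simp
    then show ?thesis
      unfolding D_def PL2[OF a] PB1[OF s] can(2)[OF K sd[OF l2[OF a]] sd[OF l2[OF a]] pl1[OF s] pl1[OF s]] lift2_pull(1)[OF a s] bas0
      by simp
  qed
  have bb12: "?P (K12 (pull1 ?J1 ?J2 (basic_section L1 s)) (pull2 ?J1 ?J2 (basic_section L2 r))) =
      K (?P (pull1 ?J1 ?J2 (basic_section L1 s))) (?P (pull2 ?J1 ?J2 (basic_section L2 r)))"
    if s: "s \<in> sections L1" and r: "r \<in> sections L2" for s r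
    unfolding T12[OF bs1[OF s] bs2[OF r]] PB1[OF s] PB2[OF r] P0 can(3)[OF K z1[OF LP] z1[OF LP] pl1[OF s] pl2[OF r]] ..
  have GE: thesis if "f \<in> G" "\<And>a. smooth_der L1 a \<Longrightarrow> f = pull1 ?J1 ?J2 (linear_section L1 a) \<Longrightarrow> thesis"
    "\<And>s. s \<in> sections L1 \<Longrightarrow> f = pull1 ?J1 ?J2 (basic_section L1 s) \<Longrightarrow> thesis"
    "\<And>a. smooth_der L2 a \<Longrightarrow> f = pull2 ?J1 ?J2 (linear_section L2 a) \<Longrightarrow> thesis"
    "\<And>s. s \<in> sections L2 \<Longrightarrow> f = pull2 ?J1 ?J2 (basic_section L2 s) \<Longrightarrow> thesis" for f thesis
    using that unfolding G_def by blast
  \<comment> \<open>Each pair of generators has been computed in one order only, so the defect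
    vanishes for that order; its antisymmetry then gives the other.\<close>
  have half: "D f g z = 0 \<or> D g f z = 0" if f: "f \<in> G" and g: "g \<in> G" and z: "z \<in> pts (jet_bundle ?L)" for f g z
  proof (rule GE[OF f])
    note d = D0[OF _ GT[OF f] GT[OF g] z] D0[OF _ GT[OF g] GT[OF f] z]
    show ?thesis if 1: "smooth_der L1 a" "f = pull1 ?J1 ?J2 (linear_section L1 a)" for a
      by (rule GE[OF g]) (use 1 ll1 lb1 ll12 lb12 d in simp_all)
    show ?thesis if 1: "s \<in> sections L1" "f = pull1 ?J1 ?J2 (basic_section L1 s)" for s
      by (rule GE[OF g]) (use 1 lb1 bb1 lb21 bb12 d in simp_all)
    show ?thesis if 1: "smooth_der L2 a" "f = pull2 ?J1 ?J2 (linear_section L2 a)" for a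
      by (rule GE[OF g]) (use 1 ll12 lb21 ll2 lb2 d in simp_all)
    show ?thesis if 1: "s \<in> sections L2" "f = pull2 ?J1 ?J2 (basic_section L2 s)" for s
      by (rule GE[OF g]) (use 1 lb12 bb12 lb2 bb2 d in simp_all)
  qed
  have DG: "D f g z = 0" if "f \<in> G" "g \<in> G" "z \<in> pts (jet_bundle ?L)" for f g z
    using half[OF that] Danti[OF GT[OF that(1)] GT[OF that(2)], of z] by auto
  have sw: "smooth_map (jet_bundle ?L) (base_product ?J1 ?J2) ?w"
    by (rule jet_product_map_diffeo[OF L1 L2])
  \<comment> \<open>For fixed \<open>s\<close> and \<open>z\<close>, the defect as a function of
    \<open>r\<close> is an element of the der fibre at \<open>?w z\<close>: both brackets have order
    one there, and functions vanishing at \<open>?w z\<close> pull back to functions vanishing at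
    \<open>z\<close>.\<close>
  have ext: "D s r z = 0" if s: "s \<in> sections ?T" and r: "r \<in> sections ?T" and z: "z \<in> pts (jet_bundle ?L)"
    and g: "\<And>f. f \<in> G \<Longrightarrow> D s f z = 0" for s r z
  proof -
    note wz = jet_product_map_pts[OF L1 L2 z]
    have wT: "?w z \<in> pts (base ?T)" using wz by (simp add: line_product_simps)
    have zJ: "z \<in> pts (base ?J)" using z by (simp add: jet_line_bundle_simps)
    note Ps = jet_pull_apply(2)[OF s]
    define \<Lambda> where "\<Lambda> r = (if r \<in> sections ?T then D s r z else 0)" for r
    have Padd: "?P (\<lambda>y. r y + t y) = (\<lambda>y. ?P r y + ?P t y)" if "r \<in> sections ?T" "t \<in> sections ?T" for r t
      using jet_pull_apply(1)[OF that(1)] jet_pull_apply(1)[OF that(2)] jet_pull_apply(1)[OF section_add[OF LT that]] by auto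
    have Pscale: "?P (\<lambda>y. c *\<^sub>R r y) = (\<lambda>y. c *\<^sub>R ?P r y)" if "r \<in> sections ?T" for r c
      using jet_pull_apply(1)[OF that] jet_pull_apply(1)[OF section_scale[OF LT that]] by auto
    have "order_one_at ?T (?w z) \<Lambda>"
      unfolding order_one_at_def
    proof (intro conjI ballI allI impI)
      fix r assume r: "r \<in> sections ?T"
      note Pr = jet_pull_apply(2)[OF r]
      have "K12 s r (?w z) \<in> fib ?T (?w z)" by (rule section_in_fib[OF LT jacobi_section[OF LT JT s r] wT])
      moreover have "K (?P s) (?P r) z \<in> fib ?T (?w z)"
        using section_in_fib[OF LJ jacobi_section[OF LJ JK Ps Pr] zJ] by (simp add: fib_jet_product[OF L1 L2])
      ultimately show "\<Lambda> r \<in> fib ?T (?w z)"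
        using r subspace_diff[OF fib_subspace[OF LT wT]] by (simp add: \<Lambda>_def D_def)
      show "\<Lambda> (\<lambda>y. c *\<^sub>R r y) = c *\<^sub>R \<Lambda> r" for c
        using r section_scale[OF LT r, of c]
        by (simp add: \<Lambda>_def D_def Pscale[OF r] jacobi_scale[OF LT JT s r] jacobi_scale[OF LJ JK Ps Pr] scaleR_diff_right)
      show "\<Lambda> (\<lambda>y. r y + t y) = \<Lambda> r + \<Lambda> t" if t: "t \<in> sections ?T" for t
        using r t section_add[OF LT r t]
        by (simp add: \<Lambda>_def D_def Padd[OF r t] jacobi_add[OF LT JT s r t] jacobi_add[OF LJ JK Ps Pr jet_pull_apply(2)[OF t]])
      fix f g assume fg: "f \<in> smooth_funs (base ?T)" "g \<in> smooth_funs (base ?T)" "f (?w z) = 0" "g (?w z) = 0"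
      define F where "F f y = (if y \<in> pts (jet_bundle ?L) then f (?w y) else 0)"
        for f :: "_ \<Rightarrow> real" and y
      have F: "F f \<in> smooth_funs (base ?J)" if f: "f \<in> smooth_funs (base ?T)" for f
        unfolding jet_line_bundle_simps smooth_funs_iff[OF MJ]
      proof (intro conjI ballI)
        show "zero_off (pts (jet_bundle ?L)) (F f)" by (simp add: zero_off_def F_def)
        fix p assume p: "p \<in> pts (jet_bundle ?L)"
        have "sm_at (base_product ?J1 ?J2) f (?w p)"
          using f jet_product_map_pts[OF L1 L2 p] smooth_funs_iff[OF MT] unfolding line_product_simps by blast
        from sm_at_pullback[OF MJ MT sw p this] show "sm_at (jet_bundle ?L) (F f) p"
          by (rule sm_at_cong[OF MJ _ openin_pts[OF MJ] p]) (simp add: F_def)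
      qed
      note fgr = section_fun_mult[OF LT smooth_funs_mult[OF base_premanifold[OF LT] fg(1,2)] r]
      have "?P (\<lambda>y. (f y * g y) *\<^sub>R r y) = (\<lambda>y. (F f y * F g y) *\<^sub>R ?P r y)"
        using jet_pull_apply(1)[OF r] jet_pull_apply(1)[OF fgr] by (auto simp: F_def)
      moreover have "K (?P s) (\<lambda>y. (F f y * F g y) *\<^sub>R ?P r y) z = 0"
        by (rule jacobi_prod[OF LJ JK Ps Pr F[OF fg(1)] F[OF fg(2)]]) (simp_all add: F_def fg(3,4))
      ultimately show "\<Lambda> (\<lambda>y. (f y * g y) *\<^sub>R r y) = 0"
        using jacobi_prod[OF LT JT s r fg] by (simp add: \<Lambda>_def D_def)
    qed
    moreover have "zero_off (sections ?T) \<Lambda>" by (simp add: zero_off_def \<Lambda>_def)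
    ultimately have fibre: "\<Lambda> \<in> der_fibre ?T (?w z)" using der_fibre_iff[OF LT wT] by blast
    have van: "\<Lambda> f = 0" if "f \<in> G" for f using g[OF that] GT[OF that] by (simp add: \<Lambda>_def)
    have "\<Lambda> = (\<lambda>s. 0)"
      by (rule jet_product_der_fibre_eq_0[OF wz fibre]; rule van, unfold G_def, blast)
    then show ?thesis using r by (simp add: \<Lambda>_def fun_eq_iff) metis
  qed
  \<comment> \<open>With a generator fixed in the first slot, \<open>ext\<close> frees the second.
    Antisymmetry puts the generator into the second slot, and one more use of \<open>ext\<close>
    frees that slot too, now with \<open>s\<close> arbitrary.\<close>
  have "D s f z = 0" if "f \<in> G" "z \<in> pts (jet_bundle ?L)" for f z
    using ext[OF GT[OF that(1)] s that(2) DG[OF that(1) _ that(2)]] Danti[OF s GT[OF that(1)], of z] by simp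
  then have D: "D s r z = 0" if "z \<in> pts (jet_bundle ?L)" for z using ext[OF s r that] that by blast
  show ?thesis
  proof
    fix z
    show "?P (K12 s r) z = K (?P s) (?P r) z"
    proof (cases "z \<in> pts (jet_bundle ?L)")
      case True
      then show ?thesis using D[OF True] jet_pull_apply(1)[OF jacobi_section[OF LT JT s r]] by (simp add: D_def)
    next
      case False
      then show ?thesis
        using section_off[OF LJ jacobi_section[OF LJ JK jet_pull_apply(2)[OF s] jet_pull_apply(2)[OF r]], of z]
          pull_section_off[of z ?J] by (simp add: jet_line_bundle_simps)
    qed
  qed
qed

end

theorem proposition4p3p2:
  fixes L1 :: "('q1, 'v1::real_vector, 'e1::real_inner) line_bundle"
    and L2 :: "('q2, 'v2::real_vector, 'e2::real_inner) line_bundle"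
  assumes "line_bundle L1" and "line_bundle L2"
  shows "diffeomorphic_factor
           (jet_line_bundle (line_product L1 L2))
           (line_product (jet_line_bundle L1) (jet_line_bundle L2))
           (jet_product_map L1 L2) (jet_product_factor L1 L2) \<and>
         (\<forall>K K1 K2 K12.
            canonical_jacobi (line_product L1 L2) K \<and>
            canonical_jacobi L1 K1 \<and> canonical_jacobi L2 K2 \<and>
            product_jacobi (jet_line_bundle L1) K1 (jet_line_bundle L2) K2 K12 \<longrightarrow>
            jacobi_isomorphism
              (jet_line_bundle (line_product L1 L2)) K
              (line_product (jet_line_bundle L1) (jet_line_bundle L2)) K12
              (jet_product_map L1 L2) (jet_product_factor L1 L2))"
proof (rule jet_product_factor_diffeomorphic[OF assms], intro conjI allI impI)
  let ?L = "line_product L1 L2" and ?J1 = "jet_line_bundle L1" and ?J2 = "jet_line_bundle L2"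
  let ?J = "jet_line_bundle ?L" and ?T = "line_product ?J1 ?J2"
  let ?w = "jet_product_map L1 L2" and ?W = "jet_product_factor L1 L2"
  fix g
  assume diff: "diffeomorphic_factor ?J ?T ?w ?W" and fac: "factor ?T ?J g (\<lambda>(y, v). (g y, v))"
    and gw: "\<And>z. z \<in> pts (jet_bundle ?L) \<Longrightarrow> g (?w z) = z"
    and wg: "\<And>y. y \<in> pts (base_product ?J1 ?J2) \<Longrightarrow> ?w (g y) = y"
    and gp: "\<And>y. y \<in> pts (base_product ?J1 ?J2) \<Longrightarrow> g y \<in> pts (jet_bundle ?L)"
    and Pw: "\<And>s. s \<in> sections ?T \<Longrightarrow> pull_section ?J ?w ?W s = (\<lambda>z. if z \<in> pts (jet_bundle ?L) then s (?w z) else 0)"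
      "\<And>s. s \<in> sections ?T \<Longrightarrow> pull_section ?J ?w ?W s \<in> sections ?J"
    and Pg: "\<And>s. s \<in> sections ?J \<Longrightarrow> pull_section ?T g (\<lambda>(y, v). (g y, v)) s =
        (\<lambda>y. if y \<in> pts (base_product ?J1 ?J2) then s (g y) else 0)"
      "\<And>s. s \<in> sections ?J \<Longrightarrow> pull_section ?T g (\<lambda>(y, v). (g y, v)) s \<in> sections ?T"
  show "diffeomorphic_factor ?J ?T ?w ?W" by (rule diff)
  fix K K1 K2 K12
  assume KK: "canonical_jacobi ?L K \<and> canonical_jacobi L1 K1 \<and> canonical_jacobi L2 K2 \<and> product_jacobi ?J1 K1 ?J2 K2 K12"
  note LP = line_bundle_line_product[OF assms]
  note LJ = line_bundle_jet[OF LP] and LT = line_bundle_line_product[OF line_bundle_jet[OF assms(1)] line_bundle_jet[OF assms(2)]]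
  note br = jet_pull_bracket[OF assms, of K K1 K2 K12]
  have JK: "jacobi_structure ?J K" using KK unfolding canonical_jacobi_def by blast
  have JT: "jacobi_structure ?T K12" using KK unfolding product_jacobi_def Let_def by blast
  have "factor ?J ?T ?w ?W" using diff unfolding diffeomorphic_factor_def by blast
  then have 1: "jacobi_map ?J K ?T K12 ?w ?W"
    unfolding jacobi_map_def using JK JT br KK by blast
  have wp: "?w z \<in> pts (base_product ?J1 ?J2)" if "z \<in> pts (jet_bundle ?L)" for z by (rule jet_product_map_pts[OF assms that])
  let ?Pg = "pull_section ?T g (\<lambda>(y, v). (g y, v))" and ?Pw = "pull_section ?J ?w ?W"
  have PgPw: "?Pg (?Pw s) = s" if s: "s \<in> sections ?T" for s
    unfolding Pg(1)[OF Pw(2)[OF s]] unfolding Pw(1)[OF s] using gp wg section_off[OF LT s] by (auto simp: line_product_simps)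
  have PwPg: "?Pw (?Pg s) = s" if s: "s \<in> sections ?J" for s
    unfolding Pw(1)[OF Pg(2)[OF s]] unfolding Pg(1)[OF s] using wp gw section_off[OF LJ s] by (auto simp: jet_line_bundle_simps)
  \<comment> \<open>The two pull-backs are mutually inverse on sections, so compatibility of the
    inverse with the brackets follows by applying that of \<open>W\<close> to \<open>?Pg s\<close>
    and \<open>?Pg r\<close>.\<close>
  have "?Pg (K s r) = K12 (?Pg s) (?Pg r)" if s: "s \<in> sections ?J" and r: "r \<in> sections ?J" for s r
  proof -
    have "?Pw (K12 (?Pg s) (?Pg r)) = K s r"
      using br[OF _ _ _ _ Pg(2)[OF s] Pg(2)[OF r]] KK PwPg[OF s] PwPg[OF r] by simp
    then show ?thesis using PgPw[OF jacobi_section[OF LT JT Pg(2)[OF s] Pg(2)[OF r]]] by simp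
  qed
  then have 2: "jacobi_map ?T K12 ?J K g (\<lambda>(y, v). (g y, v))"
    unfolding jacobi_map_def using JK JT fac by blast
  show "jacobi_isomorphism ?J K ?T K12 ?w ?W"
    unfolding jacobi_isomorphism_def
  proof (intro conjI exI[of _ g] exI[of _ "\<lambda>(y, v). (g y, v)"] ballI)
    show "g (?w x) = x" if "x \<in> pts (base ?J)" for x using that gw by (simp add: jet_line_bundle_simps)
    show "?w (g y) = y" if "y \<in> pts (base ?T)" for y using that wg by (simp add: line_product_simps)
    show "(\<lambda>(y, v). (g y, v)) (?W z) = z" if "z \<in> pts (total_space ?J)" for z
      using that gw by (auto simp: total_space_def jet_product_factor_def jet_line_bundle_simps)
    show "?W ((\<lambda>(y, v). (g y, v)) z) = z" if "z \<in> pts (total_space ?T)" for z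
      using that wg by (auto simp: total_space_def jet_product_factor_def line_product_simps)
  qed (fact 1 2)+
qed

end
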